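(* Let $n,m\in\mathbb{N}$, $1<p<\infty$, $s>0$ with $s\notin 2\mathbb{N}$, and $A\in\mathbb{S}_+^m$. Assume that $\Omega\subset\mathbb{R}^n$ is a nonempty open set, let $u_1,u_2\in H^{s,p}(\mathbb{R}^n;\mathbb{R}^m)$ and define the functions $v_i\in L^{p'}(\mathbb{R}^n;\mathbb{R}^m)$ by $$v_i:=|A^{1/2}(-\Delta)^{s/2}u_i|^{p-2}A(-\Delta)^{s/2}u_i,\qquad i=1,2.$$ If $$(-\Delta)^s_{p,A}u_1=(-\Delta)^s_{p,A}u_2\quad\text{and}\quad v_1=v_2\quad\text{in }\Omega,$$ then $u_1\equiv u_2$ in $\mathbb{R}^n$.
   Context: Here $1/p+1/p'=1$. The Bessel potential space is $H^{s,p}(\mathbb{R}^n)=\{u\in\mathscr{S}'(\mathbb{R}^n): \mathcal{F}^{-1}(\langle\xi\rangle^s\hat u)\in L^p(\mathbb{R}^n)\}$, $\langle\xi\rangle=(1+|\xi|^2)^{1/2}$, with norm $\|\mathcal{F}^{-1}(\langle\xi\rangle^s\hat u)\|_{L^p}$; $H^{s,p}(\mathbb{R}^n;\mathbb{R}^m)$ is its (real) vector-valued version. The fractional Laplacian $(-\Delta)^{a}u=\mathcal{F}^{-1}(|\xi|^{2a}\hat u)$, $a\ge0$, acts componentwise, and $(-\Delta)^{s/2}\colon H^{s,p}(\mathbb{R}^n;\mathbb{R}^m)\to L^p(\mathbb{R}^n;\mathbb{R}^m)$ is bounded. $\mathbb{S}_+^m$ denotes the class of functions $A\in L^\infty(\mathbb{R}^n;\mathbb{R}^{m\times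 m})$ taking values in the symmetric positive definite matrices for which there are $0<\lambda<\Lambda$ with $\lambda^2|v|^2\le\langle Av,v\rangle\le\Lambda^2|v|^2$ a.e. in $\mathbb{R}^n$ for all $v\in\mathbb{R}^m$; $A^{1/2}$ is the unique positive definite square root. The anisotropic fractional $p$-biharmonic operator $(-\Delta)^s_{p,A}\colon H^{s,p}(\mathbb{R}^n;\mathbb{R}^m)\to (H^{s,p}(\mathbb{R}^n;\mathbb{R}^m))^*$ is $$\langle(-\Delta)^s_{p,A}u,v\rangle=\int_{\mathbb{R}^n}|A^{1/2}(-\Delta)^{s/2}u|^{p-2}A(-\Delta)^{s/2}u\cdot(-\Delta)^{s/2}v\,dx.$$ Equality of $(-\Delta)^s_{p,A}u_1$ and $(-\Delta)^s_{p,A}u_2$ in $\Omega$ means equality when tested against all $\varphi\in C_c^\infty(\Omega;\mathbb{R}^m)$; $v_1=v_2$ in $\Omega$ is meant a.e. The expression $|A^{1/2}w|^{p-2}Aw$ is read as $0$ when $w=0$. *)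

theory Defs
  imports "HOL-Analysis.Analysis"
begin

section \<open>Lebesgue spaces\<close>

definition Lp_space :: "real \<Rightarrow> ('a::euclidean_space \<Rightarrow> 'b::euclidean_space) set" where
  "Lp_space p = {f. f \<in> borel_measurable lebesgue \<and>
                    integrable lebesgue (\<lambda>x. norm (f x) powr p)}"

definition Lp_norm :: "real \<Rightarrow> ('a::euclidean_space \<Rightarrow> 'b::euclidean_space) \<Rightarrow> real" where
  "Lp_norm p f = (LINT x|lebesgue. norm (f x) powr p) powr (1 / p)"

section \<open>Smooth functions, Schwartz functions and test functions\<close>

text \<open>Iterated partial derivatives, along a list of coordinate directions.\<close>

fun partial_derivs ::
  "'a list \<Rightarrow> ('a::euclidean_space \<Rightarrow> 'b::real_normed_vector) \<Rightarrow> 'a \<Rightarrow> 'b" where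
  "partial_derivs [] f = f"
| "partial_derivs (b # bs) f = (\<lambda>x. frechet_derivative (partial_derivs bs f) (at x) b)"

definition smooth :: "('a::euclidean_space \<Rightarrow> 'b::real_normed_vector) \<Rightarrow> bool" where
  "smooth f \<longleftrightarrow> (\<forall>bs\<in>lists Basis. \<forall>x. partial_derivs bs f differentiable (at x))"

definition schwartz :: "('a::euclidean_space \<Rightarrow> complex) set" where
  "schwartz = {\<phi>. smooth \<phi> \<and>
     (\<forall>bs\<in>lists Basis. \<forall>k::nat.
        bounded (range (\<lambda>x. (1 + norm x) ^ k *\<^sub>R partial_derivs bs \<phi> x)))}"

definition schwartz_seminorm :: "nat \<Rightarrow> ('a::euclidean_space \<Rightarrow> complex) \<Rightarrow> real" where
  "schwartz_seminorm k \<phi> =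
     (\<Sum>bs | bs \<in> lists Basis \<and> length bs \<le> k.
        SUP x. (1 + norm x) ^ k * norm (partial_derivs bs \<phi> x))"

definition test_functions :: "'a set \<Rightarrow> ('a::euclidean_space \<Rightarrow> 'b::euclidean_space) set" where
  "test_functions \<Omega> = {\<phi>. smooth \<phi> \<and> compact (closure {x. \<phi> x \<noteq> 0}) \<and>
                          closure {x. \<phi> x \<noteq> 0} \<subseteq> \<Omega>}"

section \<open>Fourier transform\<close>

text \<open>
  The normalisation is the one for which \<open>-\<Delta>\<close> has the symbol \<open>\<bar>\<xi>\<bar>\<^sup>2\<close>.
\<close>

definition fourier :: "('a::euclidean_space \<Rightarrow> complex) \<Rightarrow> 'a \<Rightarrow> complex" where
  "fourier \<phi> \<xi> = (LINT x|lebesgue. cis (- (x \<bullet> \<xi>)) * \<phi> x)"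

definition inv_fourier :: "('a::euclidean_space \<Rightarrow> complex) \<Rightarrow> 'a \<Rightarrow> complex" where
  "inv_fourier \<phi> x =
     (LINT \<xi>|lebesgue. cis (x \<bullet> \<xi>) * \<phi> \<xi>) / of_real ((2 * pi) ^ DIM('a))"

section \<open>Tempered distributions\<close>

text \<open>
  A tempered distribution is a continuous complex-linear functional on \<^const>\<open>schwartz\<close>.
  Functionals are \<^const>\<open>extensional\<close> on \<^const>\<open>schwartz\<close>, so that
  HOL equality of distributions is equality of distributions.
\<close>

type_synonym 'a functional = "('a \<Rightarrow> complex) \<Rightarrow> complex"

definition tempered_distributions :: "'a::euclidean_space functional set" where
  "tempered_distributions = {T. T \<in> extensional schwartz \<and>
     (\<forall>\<phi>\<in>schwartz. \<forall>\<psi>\<in>schwartz. T (\<lambda>x. \<phi> x + \<psi> x) = T \<phi> + T \<psi>) \<and>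
     (\<forall>\<phi>\<in>schwartz. \<forall>c. T (\<lambda>x. c * \<phi> x) = c * T \<phi>) \<and>
     (\<exists>C k. \<forall>\<phi>\<in>schwartz. norm (T \<phi>) \<le> C * schwartz_seminorm k \<phi>)}"

definition real_distribution :: "'a::euclidean_space functional \<Rightarrow> bool" where
  "real_distribution T \<longleftrightarrow> (\<forall>\<phi>\<in>schwartz. T (\<lambda>x. cnj (\<phi> x)) = cnj (T \<phi>))"

definition distr_of :: "('a::euclidean_space \<Rightarrow> complex) \<Rightarrow> 'a functional" where
  "distr_of f = (\<lambda>\<phi>\<in>schwartz. LINT x|lebesgue. f x * \<phi> x)"

definition distr_diff ::
  "'a::euclidean_space functional \<Rightarrow> 'a functional \<Rightarrow> 'a functional" where
  "distr_diff S T = (\<lambda>\<phi>\<in>schwartz. S \<phi> - T \<phi>)"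

definition distr_mult ::
  "('a::euclidean_space \<Rightarrow> complex) \<Rightarrow> 'a functional \<Rightarrow> 'a functional" where
  "distr_mult g T = (\<lambda>\<phi>\<in>schwartz. T (\<lambda>\<xi>. g \<xi> * \<phi> \<xi>))"

definition distr_fourier :: "'a::euclidean_space functional \<Rightarrow> 'a functional" where
  "distr_fourier T = (\<lambda>\<phi>\<in>schwartz. T (fourier \<phi>))"

definition distr_inv_fourier :: "'a::euclidean_space functional \<Rightarrow> 'a functional" where
  "distr_inv_fourier T = (\<lambda>\<phi>\<in>schwartz. T (inv_fourier \<phi>))"

section \<open>Bessel potential spaces\<close>

definition bracket :: "'a::euclidean_space \<Rightarrow> real" where
  "bracket \<xi> = sqrt (1 + (norm \<xi>)\<^sup>2)"

definition bessel_operator ::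
  "real \<Rightarrow> 'a::euclidean_space functional \<Rightarrow> 'a functional" where
  "bessel_operator s u =
     distr_inv_fourier (distr_mult (\<lambda>\<xi>. of_real (bracket \<xi> powr s)) (distr_fourier u))"

definition bessel_space :: "real \<Rightarrow> real \<Rightarrow> 'a::euclidean_space functional set" where
  "bessel_space s p = {u \<in> tempered_distributions.
     \<exists>f\<in>Lp_space p. bessel_operator s u = distr_of f}"

definition bessel_norm :: "real \<Rightarrow> real \<Rightarrow> 'a::euclidean_space functional \<Rightarrow> real" where
  "bessel_norm s p u =
     Lp_norm p (SOME f. f \<in> Lp_space p \<and> bessel_operator s u = distr_of f)"

text \<open>
  An \<open>\<real>\<^sup>m\<close>-valued tempered distribution is the vector of its (real) components.
\<close>

definition bessel_space_vec ::
  "real \<Rightarrow> real \<Rightarrow> ('a::euclidean_space functional ^ 'm) set" where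
  "bessel_space_vec s p = {u. \<forall>i. u $ i \<in> bessel_space s p \<and> real_distribution (u $ i)}"

definition distr_of_vec ::
  "('a::euclidean_space \<Rightarrow> real ^ 'm) \<Rightarrow> 'a functional ^ 'm" where
  "distr_of_vec f = (\<chi> i. distr_of (\<lambda>x. of_real (f x $ i)))"

section \<open>Fractional Laplacian\<close>

definition frac_laplacian_schwartz ::
  "real \<Rightarrow> ('a::euclidean_space \<Rightarrow> complex) \<Rightarrow> 'a \<Rightarrow> complex" where
  "frac_laplacian_schwartz a \<phi> =
     inv_fourier (\<lambda>\<xi>. of_real (norm \<xi> powr (2 * a)) * fourier \<phi> \<xi>)"

text \<open>
  The symbol \<open>\<bar>\<xi>\<bar>\<^bsup>2a\<^esup>\<close> is not smooth at the origin, so it does not act by multiplication on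
  all tempered distributions. As usual, \<open>(-\<Delta>)\<^sup>a : H\<^bsup>2a,p\<^esup> \<rightarrow> L\<^sup>p\<close> is the bounded extension,
  along the dense inclusion of the Schwartz functions, of the operator given there
  by the Fourier symbol.
\<close>

definition has_frac_laplacian ::
  "real \<Rightarrow> real \<Rightarrow> 'a::euclidean_space functional \<Rightarrow> ('a \<Rightarrow> complex) \<Rightarrow> bool" where
  "has_frac_laplacian a p u w \<longleftrightarrow>
     u \<in> bessel_space (2 * a) p \<and> w \<in> Lp_space p \<and>
     (\<exists>\<phi>. (\<forall>k::nat. \<phi> k \<in> schwartz \<and>
               distr_diff (distr_of (\<phi> k)) u \<in> bessel_space (2 * a) p \<and>
               (\<lambda>x. frac_laplacian_schwartz a (\<phi> k) x - w x) \<in> Lp_space p) \<and>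
          (\<lambda>k. bessel_norm (2 * a) p (distr_diff (distr_of (\<phi> k)) u)) \<longlonglongrightarrow> 0 \<and>
          (\<lambda>k. Lp_norm p (\<lambda>x. frac_laplacian_schwartz a (\<phi> k) x - w x)) \<longlonglongrightarrow> 0)"

text \<open>
  A representative of \<open>(-\<Delta>)\<^sup>a u\<close>, which is determined up to null sets. It is real-valued
  because the components of \<open>u\<close> are real and the symbol is even.
\<close>

definition frac_laplacian ::
  "real \<Rightarrow> real \<Rightarrow> 'a::euclidean_space functional ^ 'm \<Rightarrow> 'a \<Rightarrow> real ^ 'm" where
  "frac_laplacian a p u =
     (SOME w. \<forall>i. has_frac_laplacian a p (u $ i) (\<lambda>x. of_real (w x $ i)))"

section \<open>The anisotropic fractional p-biharmonic operator\<close>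

definition sym_pos_def :: "real ^ 'm ^ 'm \<Rightarrow> bool" where
  "sym_pos_def M \<longleftrightarrow> transpose M = M \<and> (\<forall>v. v \<noteq> 0 \<longrightarrow> (M *v v) \<bullet> v > 0)"

definition matrix_sqrt :: "real ^ 'm ^ 'm \<Rightarrow> real ^ 'm ^ 'm" where
  "matrix_sqrt M = (THE B. sym_pos_def B \<and> B ** B = M)"

definition S_plus :: "('a::euclidean_space \<Rightarrow> real ^ 'm ^ 'm) set" where
  "S_plus = {A. A \<in> borel_measurable lebesgue \<and>
     (\<exists>C. AE x in lebesgue. norm (A x) \<le> C) \<and>
     (AE x in lebesgue. sym_pos_def (A x)) \<and>
     (\<exists>l L. 0 < l \<and> l < L \<and>
        (AE x in lebesgue. \<forall>v. l\<^sup>2 * (norm v)\<^sup>2 \<le> (A x *v v) \<bullet> v \<and>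
                               (A x *v v) \<bullet> v \<le> L\<^sup>2 * (norm v)\<^sup>2))}"

text \<open>
  Here \<open>\<bar>A\<^bsup>1/2\<^esup> w\<bar>\<^bsup>p-2\<^esup> A w\<close> with \<open>w = (-\<Delta>)\<^bsup>s/2\<^esup> u\<close>. It vanishes where \<open>w = 0\<close>, since
  \<open>0 powr (p - 2) = 0\<close>.
\<close>

definition p_flux ::
  "real \<Rightarrow> real \<Rightarrow> ('a::euclidean_space \<Rightarrow> real ^ 'm ^ 'm) \<Rightarrow>
   'a functional ^ 'm \<Rightarrow> 'a \<Rightarrow> real ^ 'm" where
  "p_flux s p A u x =
     (let w = frac_laplacian (s / 2) p u x
      in norm (matrix_sqrt (A x) *v w) powr (p - 2) *\<^sub>R (A x *v w))"

text \<open>\<open>p_biharmonic s p A u v\<close> is the dual pairing of \<open>(-\<Delta>)\<^sup>s\<^sub>p\<^sub>,\<^sub>A u\<close> with \<open>v\<close>.\<close>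

definition p_biharmonic ::
  "real \<Rightarrow> real \<Rightarrow> ('a::euclidean_space \<Rightarrow> real ^ 'm ^ 'm) \<Rightarrow>
   'a functional ^ 'm \<Rightarrow> 'a functional ^ 'm \<Rightarrow> real" where
  "p_biharmonic s p A u v =
     (LINT x|lebesgue. p_flux s p A u x \<bullet> frac_laplacian (s / 2) p v x)"

end

theory Submission
  imports Defs "HOL-Probability.Probability" "HOL-Real_Asymp.Real_Asymp" "HOL-Complex_Analysis.Cauchy_Integral_Formula"
begin

text \<open>
  Every \<open>u\<close> in the Bessel space is \<open>\<langle>D\<rangle>\<^bsup>-s\<^esup> f\<close> with \<open>f\<close> in \<open>L\<^sup>p\<close>, and \<open>(-\<Delta>)\<^bsup>s/2\<^esup> u = T f\<close>
  where \<open>T\<close> has the symbol \<open>(|\<xi>|\<^sup>2 / (1 + |\<xi>|\<^sup>2))\<^bsup>s/2\<^esup>\<close>; the binomial series shows that \<open>T\<close> is the identity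
  plus convolution with an \<open>L\<^sup>1\<close> function, and \<open>T\<close> is injective on \<open>L\<^sup>p\<close>. Since \<open>w \<mapsto> |A\<^bsup>1/2\<^esup> w|\<^bsup>p-2\<^esup> A w\<close>
  is injective too, it suffices that \<open>v = v\<^sub>1 - v\<^sub>2\<close> vanishes almost everywhere.

  Each component of \<open>v\<close> vanishes on \<open>\<Omega>\<close> and is orthogonal to \<open>(-\<Delta>)\<^bsup>s/2\<^esup> \<phi>\<close> for all test functions
  \<open>\<phi>\<close> on \<open>\<Omega>\<close>. Away from its support, \<open>(-\<Delta>)\<^sup>\<gamma> \<phi>\<close> is a nonzero multiple of the potential of \<open>\<phi>\<close> with kernel
  \<open>|x - y|\<^bsup>-n-2\<gamma>\<^esup>\<close> when \<open>\<gamma>\<close> is not an integer. Using \<open>(-\<Delta>)\<^sup>k \<phi>\<close> as test functions, \<open>v\<close> integrates to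
  zero against these potentials with \<open>\<gamma> = s/2 + k\<close> for all \<open>k\<close>, hence, by Weierstrass approximation in
  \<open>|x - y|\<^bsup>-2\<^esup>\<close>, against \<open>\<phi>(y) exp (-\<tau> |x - y|\<^sup>2)\<close>. So the Gaussian averages of \<open>v\<close> vanish on \<open>\<Omega>\<close>, by
  analyticity they vanish everywhere, and letting the Gaussians concentrate gives \<open>v = 0\<close>.
\<close>

section \<open>Smooth and Schwartz functions\<close>

text \<open>The fluxes lie only in L^q with q = p / (p - 1): they carry no derivatives, and for q >
  2 their Fourier transforms need not be functions. Singular symbols therefore act on Schwartz
  functions, and the information reaches \<open>v\<close> through integrals against it. The one
  multiplier that must act on L^p itself is built from heat kernels: an L^1 average of the Gaussians
  exp(-t|\<xi>|^2) has an integrable kernel, hence is bounded on every L^p without a multiplier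
  theorem. The same averaging, with weight t^(-\<gamma>-1) and the exponential replaced by a Taylor
  remainder, produces |\<xi>|^(2\<gamma>).

  The condition on s means nonlocality: for an integer \<gamma> the operator is differential and
  gives zero off the support of \<phi>. Iterated Laplacians of \<phi> keep its support, so one test
  function yields a whole sequence of moments. They determine the Gaussian average because |x -
  y|^(-2) stays bounded: \<phi> lives on a ball of radius r, and \<open>v\<close> vanishes on the
  concentric ball of radius 2r.\<close>

abbreviation dd :: "'a \<Rightarrow> ('a::euclidean_space \<Rightarrow> 'b::real_normed_vector) \<Rightarrow> 'a \<Rightarrow> 'b" where
  "dd b f \<equiv> (\<lambda>x. frechet_derivative f (at x) b)"

lemma dd_eqI:
  assumes "\<And>x. (f has_derivative f' x) (at x)"
  shows "dd b f = (\<lambda>x. f' x b)"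
  using frechet_derivative_at[OF assms] by (simp add: fun_eq_iff)

lemma partial_derivs_append: "partial_derivs (bs @ cs) f = partial_derivs bs (partial_derivs cs f)"
  by (induction bs) auto

text \<open>Smoothness and decay quantify over all iterated partial derivatives. Leibniz formulas of
  higher order are avoided by exhibiting a class \<open>P\<close> closed under one coordinate
  derivative; estimates are then made for the members of \<open>P\<close> only.\<close>

lemma partial_derivs_closed:
  assumes "\<And>g b. g \<in> P \<Longrightarrow> b \<in> Basis \<Longrightarrow> dd b g \<in> P" "f \<in> P" "bs \<in> lists Basis"
  shows "partial_derivs bs f \<in> P"
  using assms(3) by (induction bs) (auto intro: assms)

lemma smoothI:
  assumes "\<And>g b. g \<in> P \<Longrightarrow> b \<in> Basis \<Longrightarrow> dd b g \<in> P"
    and "\<And>g x. g \<in> P \<Longrightarrow> g differentiable (at x)" "f \<in> P"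
  shows "smooth f"
  using partial_derivs_closed[of P f] assms unfolding smooth_def by blast

lemma smooth_differentiable: "smooth f \<Longrightarrow> f differentiable (at x)"
  unfolding smooth_def by (metis lists.Nil partial_derivs.simps(1))

lemma smooth_has_derivative: "smooth f \<Longrightarrow> (f has_derivative frechet_derivative f (at x)) (at x)"
  using smooth_differentiable frechet_derivative_works by blast

lemma smooth_partial_derivs: "smooth f \<Longrightarrow> bs \<in> lists Basis \<Longrightarrow> smooth (partial_derivs bs f)"
  unfolding smooth_def by (metis append_in_lists_conv partial_derivs_append)

lemma smooth_dd: "smooth f \<Longrightarrow> b \<in> Basis \<Longrightarrow> smooth (dd b f)"
  using smooth_partial_derivs[of f "[b]"] by simp

lemma smooth_continuous_on: "smooth f \<Longrightarrow> continuous_on S f"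
  using smooth_differentiable
  by (metis continuous_at_imp_continuous_on differentiable_imp_continuous_within)

text \<open>The multiplier algebra of the Schwartz space, often written O_M. The exponent
  \<open>k\<close> may depend on the derivative.\<close>

definition slowly_increasing :: "('a::euclidean_space \<Rightarrow> complex) set" where
  "slowly_increasing = {m. smooth m \<and> (\<forall>bs\<in>lists Basis. \<exists>C k. \<forall>x. norm (partial_derivs bs m x) \<le> C * (1 + norm x) ^ k)}"

lemma slowly_increasing_dd:
  assumes "m \<in> slowly_increasing" "b \<in> Basis" shows "dd b m \<in> slowly_increasing"
proof -
  have "smooth (dd b m)" using assms smooth_dd unfolding slowly_increasing_def by blast
  moreover have "\<exists>C k. \<forall>x. norm (partial_derivs bs (dd b m) x) \<le> C * (1 + norm x) ^ k" if "bs \<in> lists Basis" for bs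
  proof -
    have "bs @ [b] \<in> lists Basis" using that assms by simp
    from assms(1) this have "\<exists>C k. \<forall>x. norm (partial_derivs (bs @ [b]) m x) \<le> C * (1 + norm x) ^ k"
      unfolding slowly_increasing_def by blast
    then show ?thesis by (simp add: partial_derivs_append)
  qed
  ultimately show ?thesis unfolding slowly_increasing_def by blast
qed

lemma slowly_increasing_growth:
  assumes "m \<in> slowly_increasing" obtains C k where "C \<ge> 0" "\<And>x. norm (m x) \<le> C * (1 + norm x) ^ k"
proof -
  have "[] \<in> lists (Basis :: 'a set)" by simp
  with assms obtain C k where *: "\<forall>x. norm (partial_derivs [] m x) \<le> C * (1 + norm x) ^ k"
    unfolding slowly_increasing_def by blast
  have "norm (m 0) \<le> C" using *[rule_format, of 0] by simp
  then have "0 \<le> C" by (rule order_trans[OF norm_ge_zero])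
  with * that show ?thesis by auto
qed

lemma slowly_increasingI:
  assumes "\<And>g b. g \<in> P \<Longrightarrow> b \<in> Basis \<Longrightarrow> dd b g \<in> P"
    and "\<And>g x. g \<in> P \<Longrightarrow> g differentiable (at x)"
    and "\<And>g. g \<in> P \<Longrightarrow> \<exists>C k. \<forall>x. norm (g x) \<le> C * (1 + norm x) ^ k" and "f \<in> P"
  shows "f \<in> slowly_increasing"
  using smoothI[of P f] partial_derivs_closed[of P f] assms unfolding slowly_increasing_def by blast

lemma schwartz_dd:
  assumes "f \<in> schwartz" "b \<in> Basis" shows "dd b f \<in> schwartz"
proof -
  have "smooth (dd b f)" using assms smooth_dd unfolding schwartz_def by blast
  moreover have "bounded (range (\<lambda>x. (1 + norm x) ^ k *\<^sub>R partial_derivs bs (dd b f) x))" if "bs \<in> lists Basis" for bs k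
  proof -
    have "bs @ [b] \<in> lists Basis" using that assms by simp
    from assms(1) this have "bounded (range (\<lambda>x. (1 + norm x) ^ k *\<^sub>R partial_derivs (bs @ [b]) f x))"
      unfolding schwartz_def by blast
    then show ?thesis by (simp add: partial_derivs_append)
  qed
  ultimately show ?thesis unfolding schwartz_def by blast
qed

lemma schwartz_decay:
  assumes "f \<in> schwartz" obtains C where "C \<ge> 0" "\<And>x. (1 + norm x) ^ k * norm (f x) \<le> C"
proof -
  have "[] \<in> lists (Basis :: 'a set)" by simp
  with assms have "bounded (range (\<lambda>x. (1 + norm x) ^ k *\<^sub>R partial_derivs [] f x))"
    unfolding schwartz_def by blast
  then obtain C where *: "\<And>x. norm ((1 + norm x) ^ k *\<^sub>R f x) \<le> C" unfolding bounded_iff by auto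
  have "0 \<le> C" using *[of 0] norm_ge_zero order_trans by blast
  with * that show ?thesis by auto
qed

lemma schwartzI:
  assumes "\<And>g b. g \<in> P \<Longrightarrow> b \<in> Basis \<Longrightarrow> dd b g \<in> P"
    and "\<And>g x. g \<in> P \<Longrightarrow> g differentiable (at x)"
    and "\<And>g k. g \<in> P \<Longrightarrow> \<exists>C. \<forall>x. (1 + norm x) ^ k * norm (g x) \<le> C" and "f \<in> P"
  shows "f \<in> schwartz"
proof -
  have "bounded (range (\<lambda>x. (1 + norm x) ^ k *\<^sub>R partial_derivs bs f x))" if "bs \<in> lists Basis" for bs k
  proof -
    have "partial_derivs bs f \<in> P" using partial_derivs_closed assms that by blast
    then obtain C where "\<forall>x. (1 + norm x) ^ k * norm (partial_derivs bs f x) \<le> C" using assms(3) by blast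
    then show ?thesis unfolding bounded_iff by (intro exI[of _ C]) auto
  qed
  then show ?thesis using smoothI[of P f] assms unfolding schwartz_def by blast
qed

lemma schwartz_smooth: "f \<in> schwartz \<Longrightarrow> smooth f"
  unfolding schwartz_def by blast

lemma schwartz_has_derivative:
  "f \<in> schwartz \<Longrightarrow> (f has_derivative frechet_derivative f (at x)) (at x)"
  using schwartz_smooth smooth_has_derivative by blast

lemma schwartz_continuous_on: "f \<in> schwartz \<Longrightarrow> continuous_on S f"
  using schwartz_smooth smooth_continuous_on by blast

lemma schwartz_measurable: "f \<in> schwartz \<Longrightarrow> f \<in> borel_measurable borel"
  using schwartz_continuous_on by (rule borel_measurable_continuous_onI)

text \<open>A derivative of a product m * f is a sum of two such products, so finite sums of
  products form a class closed under differentiation. With constant m the same class also shows that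
  sums of Schwartz functions are Schwartz functions.\<close>

inductive_set prod_span :: "('a::euclidean_space \<Rightarrow> complex) set" where
  prod: "f \<in> schwartz \<Longrightarrow> m \<in> slowly_increasing \<Longrightarrow> (\<lambda>x. m x * f x) \<in> prod_span"
| add: "f \<in> prod_span \<Longrightarrow> g \<in> prod_span \<Longrightarrow> (\<lambda>x. f x + g x) \<in> prod_span"

lemma slowly_increasing_has_derivative:
  "m \<in> slowly_increasing \<Longrightarrow> (m has_derivative frechet_derivative m (at x)) (at x)"
  unfolding slowly_increasing_def using smooth_has_derivative by blast

lemma prod_span_schwartz: "f \<in> prod_span \<Longrightarrow> f \<in> schwartz"
proof (rule schwartzI[of prod_span])
  have diff: "g differentiable (at x)" if "g \<in> prod_span" for g :: "'a \<Rightarrow> complex" and x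
    using that
    by (induction) (auto intro!: derivative_intros
        simp: differentiableI[OF schwartz_has_derivative] differentiableI[OF slowly_increasing_has_derivative])
  then show "\<And>(g :: 'a \<Rightarrow> complex) x. g \<in> prod_span \<Longrightarrow> g differentiable (at x)" by blast
  show "dd b g \<in> prod_span" if "g \<in> prod_span" "b \<in> Basis" for g :: "'a \<Rightarrow> complex" and b
    using that
  proof (induction)
    case (prod f m)
    have "((\<lambda>x. m x * f x) has_derivative (\<lambda>h. m x * frechet_derivative f (at x) h + frechet_derivative m (at x) h * f x)) (at x)" for x
      using prod by (intro has_derivative_mult schwartz_has_derivative slowly_increasing_has_derivative)
    from dd_eqI[OF this, of b]
    show ?case using prod by (auto intro!: prod_span.intros schwartz_dd slowly_increasing_dd)
  next
    case (add f g)
    have "((\<lambda>x. f x + g x) has_derivative (\<lambda>h. frechet_derivative f (at x) h + frechet_derivative g (at x) h)) (at x)" for x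
      using add diff by (intro has_derivative_add) (auto simp: frechet_derivative_works[symmetric])
    from dd_eqI[OF this, of b]
    show ?case using add by (auto intro!: prod_span.intros)
  qed
  show "\<exists>C. \<forall>x. (1 + norm x) ^ k * norm (g x) \<le> C" if "g \<in> prod_span" for g :: "'a \<Rightarrow> complex" and k
    using that
  proof (induction)
    case (prod f m)
    obtain C j where C: "C \<ge> 0" "\<And>x. norm (m x) \<le> C * (1 + norm x) ^ j"
      using slowly_increasing_growth prod by blast
    obtain D where D: "\<And>x. (1 + norm x) ^ (k + j) * norm (f x) \<le> D" using schwartz_decay prod by blast
    have "(1 + norm x) ^ k * norm (m x * f x) \<le> C * D" for x
    proof -
      have "(1 + norm x) ^ k * norm (m x * f x) \<le> (1 + norm x) ^ k * ((C * (1 + norm x) ^ j) * norm (f x))"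
        unfolding norm_mult using C by (intro mult_left_mono mult_right_mono) auto
      also have "\<dots> = C * ((1 + norm x) ^ (k + j) * norm (f x))" by (simp add: power_add)
      also have "\<dots> \<le> C * D" using C D by (intro mult_left_mono) auto
      finally show ?thesis .
    qed
    then show ?case by blast
  next
    case (add f g)
    then obtain C D where "\<forall>x. (1 + norm x) ^ k * norm (f x) \<le> C" "\<forall>x. (1 + norm x) ^ k * norm (g x) \<le> D" by blast
    then have "(1 + norm x) ^ k * norm (f x + g x) \<le> C + D" for x
      using mult_left_mono[OF norm_triangle_ineq[of "f x" "g x"], of "(1 + norm x) ^ k"]
      by (smt (verit) distrib_left norm_ge_zero zero_le_power)
    then show ?case by blast
  qed
qed

lemma schwartz_mult: "m \<in> slowly_increasing \<Longrightarrow> f \<in> schwartz \<Longrightarrow> (\<lambda>x. m x * f x) \<in> schwartz"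
  by (rule prod_span_schwartz[OF prod_span.prod])

lemma dd_const: "dd b (\<lambda>x. c) = (\<lambda>x. 0)"
  by (rule dd_eqI[where f' = "\<lambda>x h. 0"]) simp

lemma slowly_increasing_const: "(\<lambda>x. c) \<in> slowly_increasing"
proof (rule slowly_increasingI[where P = "range (\<lambda>c x. c)"])
  fix g :: "'a \<Rightarrow> complex" and b :: 'a assume "g \<in> range (\<lambda>c x. c)"
  then obtain c where g: "g = (\<lambda>x. c)" by blast
  show "dd b g \<in> range (\<lambda>c x. c)" "\<And>x. g differentiable (at x)" by (auto simp: g dd_const)
  have "\<forall>x. norm (g x) \<le> norm c * (1 + norm x) ^ 0" by (simp add: g)
  then show "\<exists>C k. \<forall>x. norm (g x) \<le> C * (1 + norm x) ^ k" by blast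
qed auto

lemma schwartz_add: "f \<in> schwartz \<Longrightarrow> g \<in> schwartz \<Longrightarrow> (\<lambda>x. f x + g x) \<in> schwartz"
  using prod_span_schwartz[OF prod_span.add[OF prod_span.prod[OF _ slowly_increasing_const[of 1]] prod_span.prod[OF _ slowly_increasing_const[of 1]]]]
  by simp

lemma schwartz_cmult: "f \<in> schwartz \<Longrightarrow> (\<lambda>x. c * f x) \<in> schwartz"
  by (rule schwartz_mult[OF slowly_increasing_const])

lemma schwartz_diff: "f \<in> schwartz \<Longrightarrow> g \<in> schwartz \<Longrightarrow> (\<lambda>x. f x - g x) \<in> schwartz"
  using schwartz_add[of f "\<lambda>x. -1 * g x"] schwartz_cmult[of g "-1"] by simp

text \<open>Reflection (c = -1) and complex conjugation (L = \<open>cnj\<close>) in one statement.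
  The scalar \<open>d\<close> in the class of functions collects the factors \<open>c\<close>
  produced by the chain rule.\<close>

lemma schwartz_linear_image:
  fixes L :: "complex \<Rightarrow> complex"
  assumes L: "bounded_linear L" and f: "f \<in> schwartz" and c: "\<bar>c\<bar> = 1"
  shows "(\<lambda>x. L (f (c *\<^sub>R x))) \<in> schwartz"
proof (rule schwartzI[where P = "{\<lambda>x. d *\<^sub>R L (f (c *\<^sub>R x)) |d f. f \<in> schwartz}"])
  fix g :: "'a \<Rightarrow> complex" assume "g \<in> {\<lambda>x. d *\<^sub>R L (f (c *\<^sub>R x)) |d f. f \<in> schwartz}"
  then obtain d f where g: "g = (\<lambda>x. d *\<^sub>R L (f (c *\<^sub>R x)))" and f: "f \<in> schwartz" by blast
  have D: "(g has_derivative (\<lambda>h. d *\<^sub>R L (frechet_derivative f (at (c *\<^sub>R x)) (c *\<^sub>R h)))) (at x)" for x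
    unfolding g
    by (intro has_derivative_scaleR_right bounded_linear.has_derivative[OF L]
         has_derivative_compose[of "\<lambda>x. c *\<^sub>R x", OF _ schwartz_has_derivative[OF f]] has_derivative_ident)
  then show "\<And>x. g differentiable (at x)" unfolding differentiable_def by blast
  show "dd b g \<in> {\<lambda>x. d *\<^sub>R L (f (c *\<^sub>R x)) |d f. f \<in> schwartz}" if "b \<in> Basis" for b
  proof -
    have "linear (frechet_derivative f (at (c *\<^sub>R x)))" for x
      using schwartz_has_derivative[OF f] has_derivative_linear by blast
    then have "dd b g = (\<lambda>x. (d * c) *\<^sub>R L (dd b f (c *\<^sub>R x)))"
      unfolding dd_eqI[OF D] by (simp add: linear_scale linear_scale[OF bounded_linear.linear[OF L]])
    then show ?thesis using schwartz_dd[OF f that] by (intro CollectI exI[of _ "d * c"] exI[of _ "dd b f"] conjI)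
  qed
  show "\<exists>C. \<forall>x. (1 + norm x) ^ k * norm (g x) \<le> C" for k
  proof -
    obtain C where C: "\<And>x. (1 + norm x) ^ k * norm (f x) \<le> C" using schwartz_decay f by blast
    obtain K where K: "K > 0" "\<And>x. norm (L x) \<le> norm x * K" using L bounded_linear.pos_bounded by blast
    have "(1 + norm x) ^ k * norm (g x) \<le> \<bar>d\<bar> * K * C" for x
    proof -
      have "(1 + norm x) ^ k * norm (g x) \<le> (1 + norm x) ^ k * (\<bar>d\<bar> * (norm (f (c *\<^sub>R x)) * K))"
        unfolding g norm_scaleR by (intro mult_left_mono K) auto
      also have "\<dots> = \<bar>d\<bar> * K * ((1 + norm (c *\<^sub>R x)) ^ k * norm (f (c *\<^sub>R x)))"
        using c by simp
      also have "\<dots> \<le> \<bar>d\<bar> * K * C" using K by (intro mult_left_mono C) auto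
      finally show ?thesis .
    qed
    then show ?thesis by blast
  qed
next
  show "(\<lambda>x. L (f (c *\<^sub>R x))) \<in> {\<lambda>x. d *\<^sub>R L (f (c *\<^sub>R x)) |d f. f \<in> schwartz}"
    using f by (intro CollectI exI[of _ 1] exI[of _ f]) auto
qed

lemma schwartz_reflect: "f \<in> schwartz \<Longrightarrow> (\<lambda>x. f (- x)) \<in> schwartz"
  using schwartz_linear_image[of "\<lambda>x. x" f "-1"] by (simp add: bounded_linear_ident)

lemma schwartz_cnj: "f \<in> schwartz \<Longrightarrow> (\<lambda>x. cnj (f x)) \<in> schwartz"
  using schwartz_linear_image[of cnj f 1] by (simp add: bounded_linear_cnj)

text \<open>Coordinate polynomials times \<open>\<psi>\<close>, where the differential of \<open>\<psi>\<close> is a coordinate times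
  another member of the family \<open>\<Psi>\<close>.\<close>

inductive_set poly_span :: "('a::euclidean_space \<Rightarrow> complex) set \<Rightarrow> ('a \<Rightarrow> complex) set" for \<Psi> where
  base: "f \<in> \<Psi> \<Longrightarrow> f \<in> poly_span \<Psi>"
| coord: "f \<in> poly_span \<Psi> \<Longrightarrow> b \<in> Basis \<Longrightarrow> (\<lambda>x. of_real (x \<bullet> b) * f x) \<in> poly_span \<Psi>"
| scale: "f \<in> poly_span \<Psi> \<Longrightarrow> (\<lambda>x. c * f x) \<in> poly_span \<Psi>"
| add: "f \<in> poly_span \<Psi> \<Longrightarrow> g \<in> poly_span \<Psi> \<Longrightarrow> (\<lambda>x. f x + g x) \<in> poly_span \<Psi>"

lemma poly_span_derivative:
  assumes "\<And>f x. f \<in> \<Psi> \<Longrightarrow> f differentiable (at x)"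
    and "\<And>f b. f \<in> \<Psi> \<Longrightarrow> b \<in> Basis \<Longrightarrow> dd b f \<in> poly_span \<Psi>" and "f \<in> poly_span \<Psi>"
  shows "f differentiable (at x)" "b \<in> Basis \<Longrightarrow> dd b f \<in> poly_span \<Psi>"
proof -
  have d: "f differentiable (at x)" if "f \<in> poly_span \<Psi>" for f x
    using that by (induction) (auto intro!: assms derivative_intros simp: bounded_linear_imp_differentiable bounded_linear_compose[OF bounded_linear_of_real bounded_linear_inner_left])
  then show "f differentiable (at x)" using assms by blast
  note d' = d[unfolded frechet_derivative_works]
  show "dd b f \<in> poly_span \<Psi>" if b: "b \<in> Basis"
    using assms(3)
  proof (induction)
    case (coord f c)
    have "((\<lambda>x. of_real (x \<bullet> c) * f x) has_derivative
      (\<lambda>h. of_real (x \<bullet> c) * frechet_derivative f (at x) h + of_real (h \<bullet> c) * f x)) (at x)" for x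
      by (intro has_derivative_mult d' coord bounded_linear.has_derivative[OF bounded_linear_of_real]
           has_derivative_inner_left has_derivative_ident)
    from dd_eqI[OF this, of b] show ?case using coord
      by (simp only:) (rule poly_span.add[OF poly_span.coord poly_span.scale])
  next
    case (scale f c)
    have "((\<lambda>x. c * f x) has_derivative (\<lambda>h. c * frechet_derivative f (at x) h)) (at x)" for x
      by (intro has_derivative_mult_right d' scale)
    from dd_eqI[OF this, of b] show ?case using scale by (simp only:) (rule poly_span.scale)
  next
    case (add f g)
    have "((\<lambda>x. f x + g x) has_derivative (\<lambda>h. frechet_derivative f (at x) h + frechet_derivative g (at x) h)) (at x)" for x
      by (intro has_derivative_add d' add)
    from dd_eqI[OF this, of b] show ?case using add by (simp only:) (rule poly_span.add)
  qed (use assms b in auto)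
qed

lemma poly_span_slowly_increasing:
  assumes "\<And>f x. f \<in> \<Psi> \<Longrightarrow> f differentiable (at x)"
    and "\<And>f b. f \<in> \<Psi> \<Longrightarrow> b \<in> Basis \<Longrightarrow> dd b f \<in> poly_span \<Psi>"
    and gr: "\<And>f. f \<in> \<Psi> \<Longrightarrow> \<exists>C k. \<forall>x. norm (f x) \<le> C * (1 + norm x) ^ k" and "f \<in> \<Psi>"
  shows "f \<in> slowly_increasing"
proof (rule slowly_increasingI[of "poly_span \<Psi>"])
  show "\<exists>C k. \<forall>x. norm (g x) \<le> C * (1 + norm x) ^ k" if "g \<in> poly_span \<Psi>" for g
    using that
  proof (induction)
    case (coord f b)
    then obtain C k where C: "\<And>x. norm (f x) \<le> C * (1 + norm x) ^ k" by blast
    have "norm (of_real (x \<bullet> b) * f x) \<le> C * (1 + norm x) ^ Suc k" for x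
    proof -
      have "norm (of_real (x \<bullet> b) * f x) \<le> (1 + norm x) * (C * (1 + norm x) ^ k)"
        unfolding norm_mult norm_of_real using Basis_le_norm[OF coord(2), of x] norm_ge_zero[of x]
        by (intro mult_mono C) auto
      then show ?thesis by (simp add: mult_ac)
    qed
    then show ?case by blast
  next
    case (scale f c)
    then obtain C k where C: "\<And>x. norm (f x) \<le> C * (1 + norm x) ^ k" by blast
    then have "norm (c * f x) \<le> (norm c * C) * (1 + norm x) ^ k" for x
      using mult_left_mono[OF C[of x], of "norm c"] by (simp add: norm_mult mult_ac)
    then show ?case by blast
  next
    case (add f g)
    then obtain C k D l where C: "\<And>x. norm (f x) \<le> C * (1 + norm x) ^ k" and D: "\<And>x. norm (g x) \<le> D * (1 + norm x) ^ l" by blast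
    have "norm (f x + g x) \<le> (\<bar>C\<bar> + \<bar>D\<bar>) * (1 + norm x) ^ (k + l)" for x
    proof -
      have "norm (f x) \<le> \<bar>C\<bar> * (1 + norm x) ^ (k + l)"
        by (rule order_trans[OF C]) (intro mult_mono power_increasing, auto)
      moreover have "norm (g x) \<le> \<bar>D\<bar> * (1 + norm x) ^ (k + l)"
        by (rule order_trans[OF D]) (intro mult_mono power_increasing, auto)
      ultimately show ?thesis using norm_triangle_ineq[of "f x" "g x"] by (simp add: distrib_right)
    qed
    then show ?case by blast
  qed (use gr in auto)
qed (use poly_span_derivative[OF assms(1,2)] poly_span.base[OF assms(4)] in blast)+

text \<open>Differentiation lowers the exponent by one and brings down a coordinate, hence the
  family over all exponents \<open>r\<close>. The shift \<open>c\<close> is arbitrary because the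
  regularised inverse of the symbol of \<open>frac_op\<close> has a small \<epsilon> in place of
  1.\<close>

lemma slowly_increasing_bracket_powr:
  assumes c: "c > 0"
  shows "(\<lambda>x. complex_of_real ((c + (norm x)\<^sup>2) powr r)) \<in> slowly_increasing"
proof (rule poly_span_slowly_increasing[where \<Psi> = "range (\<lambda>r x. complex_of_real ((c + (norm x)\<^sup>2) powr r))"])
  fix f :: "'a \<Rightarrow> complex" assume "f \<in> range (\<lambda>r x. complex_of_real ((c + (norm x)\<^sup>2) powr r))"
  then obtain r where f: "f = (\<lambda>x. complex_of_real ((c + (norm x)\<^sup>2) powr r))" by blast
  have pos: "c + (norm x)\<^sup>2 > 0" for x :: 'a using c by (simp add: add_pos_nonneg)
  have D: "(f has_derivative (\<lambda>h. of_real (r * (c + (norm x)\<^sup>2) powr (r - 1) * (2 * (x \<bullet> h))))) (at x)" for x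
  proof -
    have "((\<lambda>x. c + x \<bullet> x) has_derivative (\<lambda>h. 2 * (x \<bullet> h))) (at x)"
      by (auto intro!: derivative_eq_intros simp: inner_commute)
    moreover have "((\<lambda>y. y powr r) has_derivative (\<lambda>h. h * (r * (c + (norm x)\<^sup>2) powr (r - 1)))) (at (c + x \<bullet> x))"
      using has_real_derivative_powr[of "c + x \<bullet> x" r] pos[of x]
      unfolding has_field_derivative_def power2_norm_eq_inner mult_commute_abs by simp
    ultimately have "((\<lambda>x. (c + x \<bullet> x) powr r) has_derivative (\<lambda>h. (2 * (x \<bullet> h)) * (r * (c + (norm x)\<^sup>2) powr (r - 1)))) (at x)"
      by (rule has_derivative_compose)
    from bounded_linear.has_derivative[OF bounded_linear_of_real[where 'a = complex] this]
    show ?thesis unfolding f power2_norm_eq_inner by (simp add: mult_ac)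
  qed
  then show "\<And>x. f differentiable (at x)" unfolding differentiable_def by blast
  show "dd b f \<in> poly_span (range (\<lambda>r x. complex_of_real ((c + (norm x)\<^sup>2) powr r)))" if "b \<in> Basis" for b
  proof -
    have "dd b f = (\<lambda>x. complex_of_real (2 * r) * (of_real (x \<bullet> b) * complex_of_real ((c + (norm x)\<^sup>2) powr (r - 1))))"
      unfolding dd_eqI[OF D] by (simp add: mult_ac)
    then show ?thesis using that by (simp only:) (rule poly_span.scale[OF poly_span.coord[OF poly_span.base[OF rangeI]]])
  qed
  show "\<exists>C k. \<forall>x. norm (f x) \<le> C * (1 + norm x) ^ k"
  proof (cases "r \<ge> 0")
    case True
    define k where "k = nat \<lceil>r\<rceil>"
    have k: "r \<le> real k" unfolding k_def by linarith
    have "norm (f x) \<le> ((1 + c) powr r) * (1 + norm x) ^ (2 * k)" for x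
    proof -
      have "c + (norm x)\<^sup>2 \<le> (1 + c) * (1 + norm x)\<^sup>2"
        using c by (simp add: power2_eq_square algebra_simps add_nonneg_nonneg)
      then have "(c + (norm x)\<^sup>2) powr r \<le> ((1 + c) * (1 + norm x)\<^sup>2) powr r"
        using True pos[of x] by (intro powr_mono2) auto
      also have "\<dots> = (1 + c) powr r * ((1 + norm x)\<^sup>2) powr r" using c by (simp add: powr_mult)
      also have "((1 + norm x)\<^sup>2) powr r \<le> ((1 + norm x)\<^sup>2) powr real k"
        using k by (intro powr_mono) (auto simp: one_le_power)
      also have "\<dots> = (1 + norm x) ^ (2 * k)"
        using add_pos_nonneg[of 1 "norm x"] by (subst powr_realpow) (auto simp: power_mult)
      finally show ?thesis by (simp add: f mult_left_mono)
    qed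
    then show ?thesis by blast
  next
    case False
    have "norm (f x) \<le> c powr r * (1 + norm x) ^ 0" for x
      using False c by (simp add: f) (rule powr_mono2', auto)
    then show ?thesis by blast
  qed
qed auto

lemma slowly_increasing_coord:
  assumes "b \<in> Basis" shows "(\<lambda>x. of_real (x \<bullet> b)) \<in> slowly_increasing"
proof (rule poly_span_slowly_increasing[where \<Psi> = "insert (\<lambda>x. of_real (x \<bullet> b)) (range (\<lambda>c x. c))"])
  fix f :: "'a \<Rightarrow> complex" assume f: "f \<in> insert (\<lambda>x. of_real (x \<bullet> b)) (range (\<lambda>c x. c))"
  have D: "((\<lambda>x. complex_of_real (x \<bullet> b)) has_derivative (\<lambda>h. of_real (h \<bullet> b))) (at x)" for x
    by (intro bounded_linear.has_derivative[OF bounded_linear_of_real] has_derivative_inner_left has_derivative_ident)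
  show "f differentiable (at x)" for x using f differentiableI[OF D] by auto
  show "dd b' f \<in> poly_span (insert (\<lambda>x. of_real (x \<bullet> b)) (range (\<lambda>c x. c)))" for b'
    using f dd_eqI[OF D, of b'] by (auto simp: dd_const intro!: poly_span.base)
  show "\<exists>C k. \<forall>x. norm (f x) \<le> C * (1 + norm x) ^ k"
  proof -
    have "norm (complex_of_real (x \<bullet> b)) \<le> 1 * (1 + norm x) ^ 1" for x
      using Basis_le_norm[OF assms, of x] by simp
    moreover have "norm c \<le> norm c * (1 + norm x) ^ 0" for c :: complex and x :: 'a by simp
    ultimately show ?thesis using f by blast
  qed
qed auto

lemma schwartz_coord: "f \<in> schwartz \<Longrightarrow> b \<in> Basis \<Longrightarrow> (\<lambda>x. of_real (x \<bullet> b) * f x) \<in> schwartz"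
  by (intro schwartz_mult slowly_increasing_coord)

lemma powr_exp_bound:
  fixes t :: real assumes "t > 0" shows "\<exists>C. \<forall>y\<ge>0. (1 + y) ^ k * exp (- (t * y\<^sup>2)) \<le> C"
proof -
  have "((\<lambda>y::real. (1 + y) ^ k * exp (- (t * y\<^sup>2))) \<longlongrightarrow> 0) at_top"
    using assms by real_asymp
  then have "eventually (\<lambda>y::real. (1 + y) ^ k * exp (- (t * y\<^sup>2)) < 1) at_top"
    by (rule order_tendstoD) simp
  then obtain N where N: "\<And>y. y \<ge> N \<Longrightarrow> (1 + y) ^ k * exp (- (t * y\<^sup>2)) < 1"
    unfolding eventually_at_top_linorder by blast
  have "compact ((\<lambda>y::real. (1 + y) ^ k * exp (- (t * y\<^sup>2))) ` {0..N})"
    by (intro compact_continuous_image continuous_intros compact_Icc)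
  then have "bounded ((\<lambda>y::real. (1 + y) ^ k * exp (- (t * y\<^sup>2))) ` {0..N})" by (rule compact_imp_bounded)
  then obtain C where C: "\<And>y. y \<in> {0..N} \<Longrightarrow> norm ((1 + y) ^ k * exp (- (t * y\<^sup>2))) \<le> C"
    unfolding bounded_iff by blast
  have "(1 + y) ^ k * exp (- (t * y\<^sup>2)) \<le> max C 1" if "y \<ge> 0" for y
    using N[of y] C[of y] that by (cases "y \<ge> N") (auto simp: max_def)
  then show ?thesis by blast
qed

lemma schwartz_gaussian:
  assumes t: "t > 0" shows "(\<lambda>x. complex_of_real (exp (- (t * (norm x)\<^sup>2)))) \<in> schwartz"
proof (rule schwartzI[where P = "poly_span {\<lambda>x. complex_of_real (exp (- (t * (norm x)\<^sup>2)))}"])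
  define G where "G = (\<lambda>x::'a. complex_of_real (exp (- (t * (norm x)\<^sup>2))))"
  have D: "(G has_derivative (\<lambda>h. of_real (exp (- (t * (norm x)\<^sup>2)) * (- (2 * t * (x \<bullet> h)))))) (at x)" for x
  proof -
    have "((\<lambda>x. exp (- (t * (x \<bullet> x)))) has_derivative (\<lambda>h. exp (- (t * (x \<bullet> x))) * (- (2 * t * (x \<bullet> h))))) (at x)"
      by (auto intro!: derivative_eq_intros simp: inner_commute algebra_simps)
    from bounded_linear.has_derivative[OF bounded_linear_of_real[where 'a = complex] this]
    show ?thesis unfolding G_def power2_norm_eq_inner .
  qed
  have d1: "\<And>f x. f \<in> {G} \<Longrightarrow> f differentiable (at x)" using D unfolding differentiable_def by blast
  have d2: "dd b f \<in> poly_span {G}" if "f \<in> {G}" "b \<in> Basis" for f b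
  proof -
    have "dd b f = (\<lambda>x. (- (2 * t)) * (of_real (x \<bullet> b) * G x))"
      using that by (simp only: singleton_iff dd_eqI[OF D]) (simp add: G_def mult_ac)
    then show ?thesis using that by (simp only:) (rule poly_span.scale[OF poly_span.coord[OF poly_span.base[OF singletonI]]])
  qed
  show "\<And>g b. g \<in> poly_span {G} \<Longrightarrow> b \<in> Basis \<Longrightarrow> dd b g \<in> poly_span {G}"
    "\<And>g x. g \<in> poly_span {G} \<Longrightarrow> g differentiable (at x)"
    using poly_span_derivative[OF d1 d2] by blast+
  \<comment> \<open>All \<open>k\<close> at once, because multiplication by a coordinate consumes
    the bound for \<open>Suc k\<close>.\<close>
  have "\<forall>k. \<exists>C. \<forall>x. (1 + norm x) ^ k * norm (g x) \<le> C" if "g \<in> poly_span {G}" for g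
    using that
  proof (induction)
    case (base f)
    show ?case
    proof
      fix k
      obtain C where C: "\<forall>y\<ge>0. (1 + y) ^ k * exp (- (t * y\<^sup>2)) \<le> C" using powr_exp_bound[OF t] by blast
      have "(1 + norm x) ^ k * norm (f x) \<le> C" for x
        using C[rule_format, of "norm x"] base by (simp add: G_def)
      then show "\<exists>C. \<forall>x. (1 + norm x) ^ k * norm (f x) \<le> C" by blast
    qed
  next
    case (coord f b)
    show ?case
    proof
      fix k
      obtain C where C: "\<And>x. (1 + norm x) ^ Suc k * norm (f x) \<le> C" using coord by blast
      have "(1 + norm x) ^ k * norm (of_real (x \<bullet> b) * f x) \<le> C" for x
      proof -
        have "(1 + norm x) ^ k * norm (of_real (x \<bullet> b) * f x) \<le> (1 + norm x) ^ k * ((1 + norm x) * norm (f x))"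
          unfolding norm_mult using Basis_le_norm[OF coord(2), of x] by (intro mult_mono) auto
        then show ?thesis using C[of x] by (simp add: mult_ac)
      qed
      then show "\<exists>C. \<forall>x. (1 + norm x) ^ k * norm (of_real (x \<bullet> b) * f x) \<le> C" by blast
    qed
  next
    case (scale f c)
    show ?case
    proof
      fix k
      obtain C where C: "\<And>x. (1 + norm x) ^ k * norm (f x) \<le> C" using scale by blast
      have "(1 + norm x) ^ k * norm (c * f x) \<le> norm c * C" for x
        using mult_left_mono[OF C[of x], of "norm c"] by (simp add: norm_mult mult_ac)
      then show "\<exists>C. \<forall>x. (1 + norm x) ^ k * norm (c * f x) \<le> C" by blast
    qed
  next
    case (add f g)
    show ?case
    proof
      fix k
      obtain C D where "\<forall>x. (1 + norm x) ^ k * norm (f x) \<le> C" "\<forall>x. (1 + norm x) ^ k * norm (g x) \<le> D" using add by meson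
      then have "(1 + norm x) ^ k * norm (f x + g x) \<le> C + D" for x
        using mult_left_mono[OF norm_triangle_ineq[of "f x" "g x"], of "(1 + norm x) ^ k"]
        by (smt (verit) distrib_left norm_ge_zero zero_le_power)
      then show "\<exists>C. \<forall>x. (1 + norm x) ^ k * norm (f x + g x) \<le> C" by blast
    qed
  qed
  then show "\<And>g k. g \<in> poly_span {G} \<Longrightarrow> \<exists>C. \<forall>x. (1 + norm x) ^ k * norm (g x) \<le> C" by blast
  show "G \<in> poly_span {G}" by (auto intro: poly_span.base)
qed

section \<open>Integration over Euclidean space: substitution, product structure, domination\<close>

lemma integrable_lebesgue_iff:
  fixes f :: "'a::euclidean_space \<Rightarrow> 'b::{banach, second_countable_topology}"
  shows "f \<in> borel_measurable borel \<Longrightarrow> integrable lebesgue f \<longleftrightarrow> integrable lborel f"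
  by (rule integrable_completion) simp

lemma lebesgue_integral_eq_lborel:
  fixes f :: "'a::euclidean_space \<Rightarrow> 'b::{banach, second_countable_topology}"
  shows "f \<in> borel_measurable borel \<Longrightarrow> integral\<^sup>L lebesgue f = integral\<^sup>L lborel f"
  by (rule integral_completion) simp

lemma integrable_le:
  fixes f :: "'a \<Rightarrow> 'b::{banach, second_countable_topology}"
  assumes "integrable M g" "f \<in> borel_measurable M" "\<And>x. norm (f x) \<le> (g x :: real)"
  shows "integrable M f"
proof (rule Bochner_Integration.integrable_bound[OF assms(1,2)])
  show "AE x in M. norm (f x) \<le> norm (g x)"
    using order_trans[OF assms(3) abs_ge_self] by simp
qed

lemma measurable_cis [measurable]: "cis \<in> borel_measurable borel"
  by (intro borel_measurable_continuous_onI continuous_intros)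

lemma
  fixes f :: "'a::euclidean_space \<Rightarrow> 'b::{banach, second_countable_topology}"
  assumes c: "c \<noteq> 0"
  shows lborel_integrable_affine: "integrable lborel f \<Longrightarrow> integrable lborel (\<lambda>x. f (t + c *\<^sub>R x))"
    and lborel_integral_affine: "f \<in> borel_measurable borel \<Longrightarrow>
      integral\<^sup>L lborel f = (\<bar>c\<bar> ^ DIM('a)) *\<^sub>R (LINT x|lborel. f (t + c *\<^sub>R x))"
proof -
  have T: "(\<lambda>x::'a. t + c *\<^sub>R x) \<in> borel_measurable borel" by measurable
  show "integrable lborel f \<Longrightarrow> integrable lborel (\<lambda>x. f (t + c *\<^sub>R x))"
  proof -
    assume f: "integrable lborel f"
    then have [measurable]: "f \<in> borel_measurable borel" by (simp add: borel_measurable_integrable)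
    from f have "integrable (density (distr lborel borel (\<lambda>x. t + c *\<^sub>R x)) (\<lambda>_. ennreal (\<bar>c\<bar> ^ DIM('a)))) f"
      using lborel_affine[OF c, of t] by simp
    then have "integrable (distr lborel borel (\<lambda>x. t + c *\<^sub>R x)) (\<lambda>x. \<bar>c\<bar> ^ DIM('a) *\<^sub>R f x)"
      by (subst (asm) integrable_density) auto
    then have "integrable lborel (\<lambda>x. \<bar>c\<bar> ^ DIM('a) *\<^sub>R f (t + c *\<^sub>R x))"
      by (subst (asm) integrable_distr_eq) auto
    from integrable_scaleR_right[OF this, of "inverse (\<bar>c\<bar> ^ DIM('a))"]
    show ?thesis using c by simp
  qed
  assume [measurable]: "f \<in> borel_measurable borel"
  have "integral\<^sup>L lborel f = integral\<^sup>L (density (distr lborel borel (\<lambda>x. t + c *\<^sub>R x)) (\<lambda>_. ennreal (\<bar>c\<bar> ^ DIM('a)))) f"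
    using lborel_affine[OF c, of t] by simp
  also have "\<dots> = (LINT x|lborel. \<bar>c\<bar> ^ DIM('a) *\<^sub>R f (t + c *\<^sub>R x))"
    by (subst integral_density) (auto simp: integral_distr)
  finally show "integral\<^sup>L lborel f = (\<bar>c\<bar> ^ DIM('a)) *\<^sub>R (LINT x|lborel. f (t + c *\<^sub>R x))" by simp
qed

lemma
  fixes f :: "'a::euclidean_space \<Rightarrow> 'b::{banach, second_countable_topology}"
  shows lborel_integrable_shift: "integrable lborel f \<Longrightarrow> integrable lborel (\<lambda>x. f (t + x))"
    and lborel_integrable_reflect: "integrable lborel f \<Longrightarrow> integrable lborel (\<lambda>x. f (t - x))"
    and lborel_integral_shift: "f \<in> borel_measurable borel \<Longrightarrow> (LINT x|lborel. f (t + x)) = integral\<^sup>L lborel f"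
    and lborel_integral_reflect: "f \<in> borel_measurable borel \<Longrightarrow> (LINT x|lborel. f (t - x)) = integral\<^sup>L lborel f"
  using lborel_integrable_affine[of 1 f t] lborel_integrable_affine[of "-1" f t]
    lborel_integral_affine[of 1 f t] lborel_integral_affine[of "-1" f t] by simp_all

text \<open>Lebesgue measure is the image of a product of one-dimensional measures under the
  coordinate map. This reduces the comparison function of \<open>integrable_decay\<close> and the
  Gaussian integrals to dimension one.\<close>

lemma
  fixes f :: "'a::euclidean_space \<Rightarrow> real \<Rightarrow> complex"
  assumes f: "\<And>b. b \<in> Basis \<Longrightarrow> integrable lborel (f b)"
  shows integrable_prod_Basis: "integrable lborel (\<lambda>x. \<Prod>b\<in>Basis. f b (x \<bullet> b))"
    and integral_prod_Basis: "(LINT x|lborel. (\<Prod>b\<in>Basis. f b (x \<bullet> b))) = (\<Prod>b\<in>Basis. integral\<^sup>L lborel (f b))"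
proof -
  interpret P: product_sigma_finite "\<lambda>_::'a. lborel :: real measure" ..
  have L: "lborel = distr (\<Pi>\<^sub>M b\<in>(Basis::'a set). lborel) borel (\<lambda>f. \<Sum>b\<in>Basis. f b *\<^sub>R b)" by (rule lborel_eq)
  have m: "(\<lambda>f. \<Sum>b\<in>Basis. f b *\<^sub>R b) \<in> measurable (\<Pi>\<^sub>M b\<in>(Basis::'a set). lborel) borel" by measurable
  have [measurable]: "b \<in> Basis \<Longrightarrow> f b \<in> borel_measurable borel" for b using f[of b] by (simp add: borel_measurable_integrable)
  have m2: "(\<lambda>x. \<Prod>b\<in>Basis. f b (x \<bullet> b)) \<in> borel_measurable borel"
    by (intro borel_measurable_prod) measurable
  have eq: "(\<Prod>b\<in>Basis. f b ((\<Sum>c\<in>Basis. x c *\<^sub>R c) \<bullet> b)) = (\<Prod>b\<in>Basis. f b (x b))" for x :: "'a \<Rightarrow> real"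
    by (intro prod.cong) (auto simp: inner_sum_left inner_Basis if_distrib cong: if_cong)
  show "integrable lborel (\<lambda>x. \<Prod>b\<in>Basis. f b (x \<bullet> b))"
    by (subst L, subst integrable_distr_eq[OF m m2]) (auto simp: eq intro!: P.product_integrable_prod f)
  show "(LINT x|lborel. (\<Prod>b\<in>Basis. f b (x \<bullet> b))) = (\<Prod>b\<in>Basis. integral\<^sup>L lborel (f b))"
    by (subst L, subst integral_distr[OF m m2]) (auto simp: eq intro!: P.product_integral_prod f)
qed

text \<open>Each coordinate satisfies 1 + (x \<bullet> b)^2 \<le> (1 + norm x)^2, so the product of
  the integrable functions 1 / (1 + t^2) dominates. One square per coordinate gives the exponent
  \<open>2 * DIM('a)\<close>, which serves below as the standard rate of decay.\<close>

lemma integrable_decay: "integrable lborel (\<lambda>x::'a::euclidean_space. 1 / (1 + norm x) ^ (2 * DIM('a)))"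
proof -
  have "integrable lborel (\<lambda>x::real. complex_of_real (inverse (1 + x\<^sup>2)))"
    using integrable_inverse_1_plus_square unfolding set_integrable_def
    by (intro integrable_of_real) simp
  then have "integrable lborel (\<lambda>x::'a. \<Prod>b\<in>Basis. complex_of_real (inverse (1 + (x \<bullet> b)\<^sup>2)))"
    by (rule integrable_prod_Basis)
  then show ?thesis
  proof (rule Bochner_Integration.integrable_bound)
    have "norm (1 / (1 + norm x) ^ (2 * DIM('a))) \<le> norm (\<Prod>b\<in>Basis. complex_of_real (inverse (1 + (x \<bullet> b)\<^sup>2)))" for x :: 'a
    proof -
      have "(\<Prod>b\<in>(Basis::'a set). 1 + (x \<bullet> b)\<^sup>2) \<le> (\<Prod>b\<in>(Basis::'a set). (1 + norm x)\<^sup>2)"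
      proof (intro prod_mono conjI)
        fix b :: 'a assume "b \<in> Basis"
        then have "(x \<bullet> b)\<^sup>2 \<le> (norm x)\<^sup>2" using Basis_le_norm[of b x] by (simp add: abs_le_square_iff[symmetric])
        then show "1 + (x \<bullet> b)\<^sup>2 \<le> (1 + norm x)\<^sup>2" using norm_ge_zero[of x] unfolding power2_sum one_power2 by linarith
      qed simp
      then have "(\<Prod>b\<in>(Basis::'a set). 1 + (x \<bullet> b)\<^sup>2) \<le> (1 + norm x) ^ (2 * DIM('a))"
        by (simp add: power_mult[symmetric] mult.commute)
      moreover have "(\<Prod>b\<in>(Basis::'a set). 1 + (x \<bullet> b)\<^sup>2) > 0" by (intro prod_pos) (simp add: add_pos_nonneg)
      ultimately have "inverse ((1 + norm x) ^ (2 * DIM('a))) \<le> inverse (\<Prod>b\<in>(Basis::'a set). 1 + (x \<bullet> b)\<^sup>2)"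
        by (rule le_imp_inverse_le)
      also have "\<dots> = norm (\<Prod>b\<in>Basis. complex_of_real (inverse (1 + (x \<bullet> b)\<^sup>2)))"
        unfolding prod_norm[symmetric] norm_of_real prod_inversef[symmetric]
        by (simp add: add_nonneg_nonneg)
      finally show ?thesis by (simp add: inverse_eq_divide)
    qed
    then show "AE x::'a in lborel. norm (1 / (1 + norm x) ^ (2 * DIM('a))) \<le> norm (\<Prod>b\<in>Basis. complex_of_real (inverse (1 + (x \<bullet> b)\<^sup>2)))"
      by simp
  qed measurable
qed

lemma decay_integrable:
  fixes f :: "'a::euclidean_space \<Rightarrow> 'b::{banach, second_countable_topology}"
  assumes [measurable]: "f \<in> borel_measurable borel" and "\<And>x. (1 + norm x) ^ (2 * DIM('a)) * norm (f x) \<le> C"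
  shows "integrable lborel f"
proof (rule integrable_le)
  show "integrable lborel (\<lambda>x::'a. C * (1 / (1 + norm x) ^ (2 * DIM('a))))"
    by (intro integrable_mult_right integrable_decay)
  have "0 < (1 + norm x) ^ (2 * DIM('a))" for x :: 'a by (simp add: add_pos_nonneg)
  then show "norm (f x) \<le> C * (1 / (1 + norm x) ^ (2 * DIM('a)))" for x
    using assms(2)[of x] by (simp add: pos_le_divide_eq mult.commute)
qed simp

lemma schwartz_integrable: "f \<in> schwartz \<Longrightarrow> integrable lborel f"
  by (metis decay_integrable schwartz_decay schwartz_measurable)

lemma schwartz_bounded: "f \<in> schwartz \<Longrightarrow> \<exists>C. \<forall>x. norm (f x) \<le> C"
  using schwartz_decay[of f 0] by auto

lemma schwartz_powr_integrable:
  assumes f: "f \<in> schwartz" and q: "q \<ge> 1"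
  shows "integrable lborel (\<lambda>x. norm (f x) powr q)"
proof -
  obtain B where B: "\<And>x. norm (f x) \<le> B" using schwartz_bounded[OF f] by blast
  have [measurable]: "f \<in> borel_measurable borel" by (rule schwartz_measurable[OF f])
  show ?thesis
  proof (rule integrable_le)
    show "integrable lborel (\<lambda>x. B powr (q - 1) * norm (f x))"
      by (intro integrable_mult_right integrable_norm schwartz_integrable f)
    have "norm (f x) powr q \<le> B powr (q - 1) * norm (f x)" for x
    proof -
      have "norm (f x) powr q = norm (f x) powr (q - 1) * norm (f x)"
        using powr_add[of "norm (f x)" "q - 1" 1] by (cases "f x = 0") auto
      also have "\<dots> \<le> B powr (q - 1) * norm (f x)"
        using q B by (intro mult_right_mono powr_mono2) auto
      finally show ?thesis .
    qed
    then show "norm (norm (f x) powr q) \<le> B powr (q - 1) * norm (f x)" for x by simp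
  qed measurable
qed

text \<open>A product bound with integrable factors gives absolute convergence of the double
  integral. Interchanges of a spatial and a frequency integral mostly take this form.\<close>

lemma
  fixes F :: "'a::euclidean_space \<Rightarrow> 'b::euclidean_space \<Rightarrow> 'c::{banach, second_countable_topology}"
    and f :: "'a \<Rightarrow> real" and g :: "'b \<Rightarrow> real"
  assumes m: "(\<lambda>(x, y). F x y) \<in> borel_measurable (borel \<Otimes>\<^sub>M borel)"
    and f: "integrable lborel f" and g: "integrable lborel g"
    and b: "\<And>x y. norm (F x y) \<le> f x * g y"
  shows fubini_bounded_integrable: "integrable (lborel \<Otimes>\<^sub>M lborel) (\<lambda>(x, y). F x y)"
    and fubini_bounded_swap: "(LINT x|lborel. LINT y|lborel. F x y) = (LINT y|lborel. LINT x|lborel. F x y)"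
proof -
  have m': "(\<lambda>(x, y). F x y) \<in> borel_measurable (lborel \<Otimes>\<^sub>M lborel)"
    using m by (simp cong: measurable_cong_sets)
  have mx: "(\<lambda>y. F x y) \<in> borel_measurable lborel" for x
    using measurable_compose[OF measurable_Pair1' m', of x] by simp
  have ix: "integrable lborel (\<lambda>y. F x y)" for x
    by (rule integrable_le[OF integrable_mult_right[OF g, of "f x"] mx]) (simp add: b)
  show *: "integrable (lborel \<Otimes>\<^sub>M lborel) (\<lambda>(x, y). F x y)"
  proof (rule lborel_pair.Fubini_integrable[OF m'])
    show "AE x in lborel. integrable lborel (\<lambda>y. case (x, y) of (x, y) \<Rightarrow> F x y)" using ix by simp
    have "(\<lambda>x. LINT y|lborel. norm (F x y)) \<in> borel_measurable lborel"
      using m' by (intro lborel.borel_measurable_lebesgue_integral) (simp add: split_beta')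
    moreover have "(LINT y|lborel. norm (F x y)) \<le> f x * (LINT y|lborel. g y)" for x
      using integral_mono[OF integrable_norm[OF ix] integrable_mult_right[OF g] b, of x] by simp
    ultimately show "integrable lborel (\<lambda>x. LINT y|lborel. norm (case (x, y) of (x, y) \<Rightarrow> F x y))"
      by (intro integrable_le[OF integrable_mult_left[OF f, of "LINT y|lborel. g y"]]) auto
  qed
  show "(LINT x|lborel. LINT y|lborel. F x y) = (LINT y|lborel. LINT x|lborel. F x y)"
    using lborel_pair.Fubini_integral[OF *] by simp
qed

text \<open>By translation invariance every difference quotient has integral zero, and the quotients
  converge to the derivative under a common integrable bound. This is integration by parts without
  boundary terms.\<close>

lemma integral_dd_schwartz:
  assumes f: "f \<in> schwartz" and b: "b \<in> Basis"
  shows "(LINT x|lborel. dd b f x) = 0"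
proof -
  define D where "D = dd b f"
  have D: "D \<in> schwartz" unfolding D_def using f b by (rule schwartz_dd)
  note [measurable] = schwartz_measurable[OF D] schwartz_measurable[OF f]
  obtain C where C: "C \<ge> 0" "\<And>x. (1 + norm x) ^ (2 * DIM('a)) * norm (D x) \<le> C" using schwartz_decay[OF D] by blast
  define h where "h n = 1 / real (Suc n)" for n
  have h: "0 < h n" "h n \<le> 1" for n unfolding h_def by auto
  define Q where "Q n x = (f (h n *\<^sub>R b + x) - f x) /\<^sub>R h n" for n x
  have deriv: "((\<lambda>s. f (s *\<^sub>R b + x)) has_derivative (\<lambda>u. u *\<^sub>R D (s *\<^sub>R b + x))) (at s)" for s x
  proof -
    have "((\<lambda>s. f (s *\<^sub>R b + x)) has_derivative (\<lambda>u. frechet_derivative f (at (s *\<^sub>R b + x)) (u *\<^sub>R b))) (at s)"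
      by (rule has_derivative_compose[OF _ schwartz_has_derivative[OF f]]) (auto intro!: derivative_eq_intros)
    moreover have "linear (frechet_derivative f (at (s *\<^sub>R b + x)))"
      using schwartz_has_derivative[OF f] has_derivative_linear by blast
    ultimately show ?thesis by (simp add: linear_scale D_def)
  qed
  have lim: "(\<lambda>n. Q n x) \<longlonglongrightarrow> D x" for x
  proof -
    have "((\<lambda>s. norm (f (s *\<^sub>R b + x) - f x - s *\<^sub>R D x) / norm s) \<longlongrightarrow> 0) (at 0)"
      using deriv[of x 0] by (simp add: has_derivative_at)
    then have "((\<lambda>s. norm ((f (s *\<^sub>R b + x) - f x) /\<^sub>R s - D x)) \<longlongrightarrow> 0) (at 0)"
    proof (rule Lim_transform_eventually)
      have "norm (f (s *\<^sub>R b + x) - f x - s *\<^sub>R D x) / norm s = norm ((f (s *\<^sub>R b + x) - f x) /\<^sub>R s - D x)" if "s \<noteq> 0" for s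
      proof -
        have "(f (s *\<^sub>R b + x) - f x) /\<^sub>R s - D x = (f (s *\<^sub>R b + x) - f x - s *\<^sub>R D x) /\<^sub>R s"
          using that by (simp add: scaleR_diff_right)
        then show ?thesis by (simp add: divide_inverse mult.commute)
      qed
      then show "\<forall>\<^sub>F s in at 0. norm (f (s *\<^sub>R b + x) - f x - s *\<^sub>R D x) / norm s = norm ((f (s *\<^sub>R b + x) - f x) /\<^sub>R s - D x)"
        by (auto simp: eventually_at_filter)
    qed
    then have "((\<lambda>s. (f (s *\<^sub>R b + x) - f x) /\<^sub>R s) \<longlongrightarrow> D x) (at 0)"
      by (simp add: Lim_null[of _ "D x"] tendsto_norm_zero_iff)
    moreover have "filterlim h (at 0) sequentially" unfolding h_def by real_asymp
    ultimately show ?thesis unfolding Q_def by (rule filterlim_compose)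
  qed
  \<comment> \<open>Mean value theorem on a segment of length at most 1: moving the base point that
    far changes 1 + norm by a factor of at most 2, whence the power of 2.\<close>
  have bd: "norm (Q n x) \<le> (C * 2 ^ (2 * DIM('a))) * (1 / (1 + norm x) ^ (2 * DIM('a)))" for n x
  proof -
    have "\<exists>s\<in>{0<..<h n}. norm (f (h n *\<^sub>R b + x) - f (0 *\<^sub>R b + x)) \<le> norm ((h n - 0) *\<^sub>R D (s *\<^sub>R b + x))"
      using h[of n] deriv by (intro mvt_general)
        (auto intro!: continuous_at_imp_continuous_on has_derivative_continuous)
    then obtain s where s: "0 < s" "s < h n" and "norm (f (h n *\<^sub>R b + x) - f x) \<le> h n * norm (D (s *\<^sub>R b + x))"
      using h[of n] by auto
    then have "norm (Q n x) \<le> norm (D (s *\<^sub>R b + x))" using h[of n] by (simp add: Q_def pos_divide_le_eq mult.commute divide_inverse_commute[symmetric])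
    moreover have "(1 + norm x) ^ (2 * DIM('a)) * norm (D (s *\<^sub>R b + x)) \<le> C * 2 ^ (2 * DIM('a))"
    proof -
      have "norm x \<le> norm (s *\<^sub>R b + x) + norm (s *\<^sub>R b)" by (metis add_diff_cancel_left' norm_triangle_ineq4)
      moreover have "norm (s *\<^sub>R b) \<le> 1" using b s h[of n] by simp
      ultimately have "1 + norm x \<le> 2 * (1 + norm (s *\<^sub>R b + x))"
        using norm_ge_zero[of "s *\<^sub>R b + x"] by argo
      then have "(1 + norm x) ^ (2 * DIM('a)) \<le> (2 * (1 + norm (s *\<^sub>R b + x))) ^ (2 * DIM('a))"
        by (rule power_mono) simp
      then have "(1 + norm x) ^ (2 * DIM('a)) * norm (D (s *\<^sub>R b + x)) \<le> (2 * (1 + norm (s *\<^sub>R b + x))) ^ (2 * DIM('a)) * norm (D (s *\<^sub>R b + x))"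
        by (rule mult_right_mono) simp
      also have "\<dots> = 2 ^ (2 * DIM('a)) * ((1 + norm (s *\<^sub>R b + x)) ^ (2 * DIM('a)) * norm (D (s *\<^sub>R b + x)))"
        by (simp only: power_mult_distrib mult.assoc)
      also have "\<dots> \<le> 2 ^ (2 * DIM('a)) * C" by (intro mult_left_mono C) auto
      finally show ?thesis by (simp add: mult.commute)
    qed
    moreover have P: "0 < (1 + norm x) ^ (2 * DIM('a))" by (simp add: add_pos_nonneg)
    ultimately have "(1 + norm x) ^ (2 * DIM('a)) * norm (Q n x) \<le> C * 2 ^ (2 * DIM('a))"
      by (meson mult_left_mono order_trans less_imp_le)
    then show ?thesis using P by (simp add: pos_le_divide_eq mult.commute)
  qed
  have "(\<lambda>n. LINT x|lborel. Q n x) \<longlonglongrightarrow> (LINT x|lborel. D x)"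
    by (rule integral_dominated_convergence[where w = "\<lambda>x. (C * 2 ^ (2 * DIM('a))) * (1 / (1 + norm x) ^ (2 * DIM('a)))"])
       (use lim bd integrable_mult_right[OF integrable_decay] in \<open>auto simp: Q_def\<close>)
  moreover have "(LINT x|lborel. Q n x) = 0" for n
  proof -
    have "(LINT x|lborel. f (h n *\<^sub>R b + x) - f x) = 0"
      using lborel_integral_shift[of f "h n *\<^sub>R b"] lborel_integrable_shift[OF schwartz_integrable[OF f], of "h n *\<^sub>R b"] schwartz_integrable[OF f]
      by (subst Bochner_Integration.integral_diff) auto
    then show ?thesis unfolding Q_def by simp
  qed
  ultimately show ?thesis unfolding D_def by (simp add: LIMSEQ_const_iff)
qed

section \<open>Fourier transform and heat kernel\<close>

lemma fourier_lborel:
  "\<phi> \<in> borel_measurable borel \<Longrightarrow> fourier \<phi> \<xi> = (LINT x|lborel. cis (- (x \<bullet> \<xi>)) * \<phi> x)"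
  unfolding fourier_def by (rule lebesgue_integral_eq_lborel) measurable

lemma inv_fourier_lborel:
  fixes \<phi> :: "'a::euclidean_space \<Rightarrow> complex"
  shows "\<phi> \<in> borel_measurable borel \<Longrightarrow>
    inv_fourier \<phi> x = (LINT \<xi>|lborel. cis (x \<bullet> \<xi>) * \<phi> \<xi>) / of_real ((2 * pi) ^ DIM('a))"
  unfolding inv_fourier_def by (subst lebesgue_integral_eq_lborel) auto

lemma inv_fourier_eq:
  fixes \<phi> :: "'a::euclidean_space \<Rightarrow> complex"
  assumes [measurable]: "\<phi> \<in> borel_measurable borel"
  shows "inv_fourier \<phi> x = fourier (\<lambda>\<xi>. \<phi> (- \<xi>)) x / of_real ((2 * pi) ^ DIM('a))"
    and "inv_fourier \<phi> x = fourier \<phi> (- x) / of_real ((2 * pi) ^ DIM('a))"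
proof -
  show *: "inv_fourier \<phi> x = fourier \<phi> (- x) / of_real ((2 * pi) ^ DIM('a))"
    by (simp add: inv_fourier_lborel fourier_lborel inner_commute)
  have "fourier \<phi> (- x) = fourier (\<lambda>\<xi>. \<phi> (- \<xi>)) x"
    using lborel_integral_reflect[of "\<lambda>\<xi>. cis (\<xi> \<bullet> x) * \<phi> \<xi>" 0] by (simp add: fourier_lborel)
  with * show "inv_fourier \<phi> x = fourier (\<lambda>\<xi>. \<phi> (- \<xi>)) x / of_real ((2 * pi) ^ DIM('a))" by simp
qed

lemma integrable_cis_mult:
  fixes f :: "'a::euclidean_space \<Rightarrow> complex"
  assumes "integrable lborel f" and [measurable]: "c \<in> borel_measurable borel"
  shows "integrable lborel (\<lambda>x. cis (c x) * f x)"
proof -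
  have [measurable]: "f \<in> borel_measurable borel" using assms by (simp add: borel_measurable_integrable)
  show ?thesis by (rule integrable_le[OF integrable_norm[OF assms(1)]]) (auto simp: norm_mult)
qed

lemma norm_fourier_le:
  assumes "integrable lborel f" shows "norm (fourier f \<xi>) \<le> (LINT x|lborel. norm (f x))"
proof -
  have [measurable]: "f \<in> borel_measurable borel" using assms by (simp add: borel_measurable_integrable)
  show ?thesis unfolding fourier_lborel[OF \<open>f \<in> _\<close>]
    by (rule order_trans[OF integral_norm_bound]) (simp add: norm_mult)
qed

text \<open>Only moments are asked for, no smoothness. That is what makes a Fourier transform
  smooth, and it covers the continuous functions of compact support that are mollified
  later.\<close>

definition rapid :: "('a::euclidean_space \<Rightarrow> complex) set" where
  "rapid = {h \<in> borel_measurable borel. \<forall>k. integrable lborel (\<lambda>x. (1 + norm x) ^ k * norm (h x))}"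

lemma rapid_integrable: "h \<in> rapid \<Longrightarrow> integrable lborel h"
  unfolding rapid_def using integrable_norm_cancel[of lborel h] by (auto dest!: spec[of _ 0])

lemma rapid_coord:
  assumes h: "h \<in> rapid" and b: "b \<in> Basis" shows "(\<lambda>x. c * of_real (x \<bullet> b) * h x) \<in> rapid"
proof -
  have [measurable]: "h \<in> borel_measurable borel" using h unfolding rapid_def by blast
  have "integrable lborel (\<lambda>x. (1 + norm x) ^ k * norm (c * of_real (x \<bullet> b) * h x))" for k
  proof (rule integrable_le)
    show "integrable lborel (\<lambda>x. norm c * ((1 + norm x) ^ Suc k * norm (h x)))"
      by (rule integrable_mult_right) (use h in \<open>simp only: rapid_def mem_Collect_eq\<close>)
    show "norm ((1 + norm x) ^ k * norm (c * of_real (x \<bullet> b) * h x)) \<le> norm c * ((1 + norm x) ^ Suc k * norm (h x))" for x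
    proof -
      have "\<bar>x \<bullet> b\<bar> \<le> 1 + norm x" using Basis_le_norm[OF b, of x] by simp
      then have "(1 + norm x) ^ k * (norm c * (\<bar>x \<bullet> b\<bar> * norm (h x))) \<le> (1 + norm x) ^ k * (norm c * ((1 + norm x) * norm (h x)))"
        by (intro mult_left_mono mult_right_mono) auto
      then show ?thesis by (simp add: norm_mult mult_ac)
    qed
  qed measurable
  then show ?thesis unfolding rapid_def by simp
qed

lemma schwartz_rapid: assumes f: "f \<in> schwartz" shows "f \<in> rapid"
proof -
  have [measurable]: "f \<in> borel_measurable borel" by (rule schwartz_measurable[OF f])
  have "integrable lborel (\<lambda>x. (1 + norm x) ^ k * norm (f x))" for k
  proof -
    obtain C where "\<And>x. (1 + norm x) ^ (2 * DIM('a) + k) * norm (f x) \<le> C" using schwartz_decay[OF f] by blast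
    then show ?thesis by (intro decay_integrable[where C = C]) (auto simp: power_add mult.assoc)
  qed
  then show ?thesis unfolding rapid_def by simp
qed

text \<open>The bound |exp(iu) - 1 - iu| \<le> u^2 / 2 with u = -(x \<bullet> (\<eta> - \<xi>))
  makes the remainder quadratic in \<eta> - \<xi>, with a second moment of \<open>h\<close> as
  constant.\<close>

lemma fourier_has_derivative:
  fixes h :: "'a::euclidean_space \<Rightarrow> complex"
  assumes h: "h \<in> rapid"
  shows "(fourier h has_derivative (\<lambda>d. LINT x|lborel. cis (- (x \<bullet> \<xi>)) * (- \<i> * of_real (x \<bullet> d) * h x))) (at \<xi>)"
proof (rule has_derivativeI_sandwich[where e = 1])
  have [measurable]: "h \<in> borel_measurable borel" using h unfolding rapid_def by blast
  define M where "M = (LINT x|lborel. (1 + norm x) ^ 2 * norm (h x))"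
  have iM: "integrable lborel (\<lambda>x. (1 + norm x) ^ 2 * norm (h x))" using h unfolding rapid_def by blast
  define D where "D d x = cis (- (x \<bullet> \<xi>)) * (- \<i> * of_real (x \<bullet> d) * h x)" for d x
  have bD: "norm (D d x) \<le> norm d * ((1 + norm x) ^ 2 * norm (h x))" for d x
  proof -
    have "\<bar>x \<bullet> d\<bar> \<le> norm d * norm x" using Cauchy_Schwarz_ineq2[of x d] by (simp add: mult.commute)
    also have "\<dots> \<le> norm d * (1 + norm x) ^ 2"
      by (intro mult_left_mono) (auto simp: power2_sum)
    finally have "\<bar>x \<bullet> d\<bar> * norm (h x) \<le> norm d * (1 + norm x) ^ 2 * norm (h x)" by (rule mult_right_mono) simp
    then show ?thesis by (simp add: D_def norm_mult)
  qed
  have iD: "integrable lborel (D d)" for d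
    by (rule integrable_le[OF integrable_mult_right[OF iM] _ bD]) (simp add: D_def)
  show "bounded_linear (\<lambda>d. LINT x|lborel. cis (- (x \<bullet> \<xi>)) * (- \<i> * of_real (x \<bullet> d) * h x))"
    unfolding D_def[symmetric]
  proof (rule bounded_linear_intro)
    show "(LINT x|lborel. D (d + e) x) = (LINT x|lborel. D d x) + (LINT x|lborel. D e x)" for d e
      unfolding Bochner_Integration.integral_add[OF iD iD, symmetric]
      by (simp add: D_def inner_add_right algebra_simps)
    show "(LINT x|lborel. D (r *\<^sub>R d) x) = r *\<^sub>R (LINT x|lborel. D d x)" for r d
      unfolding integral_scaleR_right[symmetric] by (simp add: D_def scaleR_conv_of_real mult_ac)
    show "norm (LINT x|lborel. D d x) \<le> norm d * M" for d
      unfolding M_def integral_mult_right_zero[symmetric]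
      by (rule order_trans[OF integral_norm_bound integral_mono]) (auto intro!: iD iM integrable_norm bD integrable_mult_right)
  qed
  show "norm (fourier h \<eta> - fourier h \<xi> - (LINT x|lborel. cis (- (x \<bullet> \<xi>)) * (- \<i> * of_real (x \<bullet> (\<eta> - \<xi>)) * h x))) / norm (\<eta> - \<xi>) \<le> M * norm (\<eta> - \<xi>)"
    if "\<eta> \<noteq> \<xi>" for \<eta>
  proof -
    have ih: "integrable lborel h" by (rule rapid_integrable[OF h])
    have "fourier h \<eta> - fourier h \<xi> - (LINT x|lborel. D (\<eta> - \<xi>) x) = (LINT x|lborel. cis (- (x \<bullet> \<eta>)) * h x - cis (- (x \<bullet> \<xi>)) * h x - D (\<eta> - \<xi>) x)"
      by (simp add: fourier_lborel integrable_cis_mult ih iD)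
    also have "norm \<dots> \<le> (LINT x|lborel. (norm (\<eta> - \<xi>))\<^sup>2 * ((1 + norm x) ^ 2 * norm (h x)))"
    proof (rule order_trans[OF integral_norm_bound integral_mono])
      fix x
      define u where "u = - (x \<bullet> (\<eta> - \<xi>))"
      have "cis (- (x \<bullet> \<eta>)) = cis (- (x \<bullet> \<xi>)) * cis u" by (simp add: cis_mult u_def inner_diff_right)
      then have "cis (- (x \<bullet> \<eta>)) * h x - cis (- (x \<bullet> \<xi>)) * h x - D (\<eta> - \<xi>) x = cis (- (x \<bullet> \<xi>)) * h x * (cis u - (1 + \<i> * of_real u))"
        by (simp add: D_def u_def algebra_simps)
      then have "norm (cis (- (x \<bullet> \<eta>)) * h x - cis (- (x \<bullet> \<xi>)) * h x - D (\<eta> - \<xi>) x) = norm (h x) * norm (cis u - (1 + \<i> * of_real u))"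
        by (simp add: norm_mult)
      also have "norm (h x) * norm (cis u - (1 + \<i> * of_real u)) \<le> norm (h x) * u\<^sup>2"
      proof (rule mult_left_mono)
        have "norm (cis u - (1 + \<i> * of_real u)) \<le> u\<^sup>2 / 2"
          using iexp_approx1[of u 1] by (simp add: cis_conv_exp power2_eq_square)
        also have "\<dots> \<le> u\<^sup>2" by simp
        finally show "norm (cis u - (1 + \<i> * of_real u)) \<le> u\<^sup>2" .
      qed simp
      also have "norm (h x) * u\<^sup>2 \<le> norm (h x) * ((norm (\<eta> - \<xi>))\<^sup>2 * (1 + norm x) ^ 2)"
      proof (rule mult_left_mono)
        have "\<bar>u\<bar> \<le> norm x * norm (\<eta> - \<xi>)" unfolding u_def using Cauchy_Schwarz_ineq2 by simp
        also have "\<dots> \<le> (1 + norm x) * norm (\<eta> - \<xi>)" by (rule mult_right_mono) auto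
        finally have "\<bar>u\<bar>\<^sup>2 \<le> ((1 + norm x) * norm (\<eta> - \<xi>))\<^sup>2" by (rule power_mono) simp
        then show "u\<^sup>2 \<le> (norm (\<eta> - \<xi>))\<^sup>2 * (1 + norm x) ^ 2" by (simp add: power_mult_distrib mult.commute)
      qed simp
      finally show "norm (cis (- (x \<bullet> \<eta>)) * h x - cis (- (x \<bullet> \<xi>)) * h x - D (\<eta> - \<xi>) x) \<le> (norm (\<eta> - \<xi>))\<^sup>2 * ((1 + norm x) ^ 2 * norm (h x))"
        by (simp add: mult_ac)
    qed (auto intro!: iD iM integrable_cis_mult ih integrable_mult_right integrable_norm Bochner_Integration.integrable_diff)
    also have "\<dots> = (norm (\<eta> - \<xi>))\<^sup>2 * M" by (simp add: M_def)
    finally show ?thesis using that unfolding D_def by (simp add: pos_divide_le_eq power2_eq_square mult_ac)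
  qed
  have "((\<lambda>\<eta>. M * norm (\<eta> - \<xi>)) \<longlongrightarrow> M * norm (\<xi> - \<xi>)) (at \<xi>)" by (intro tendsto_intros)
  then show "((\<lambda>\<eta>. M * norm (\<eta> - \<xi>)) \<longlongrightarrow> 0) (at \<xi>)" by simp
qed simp

lemma dd_fourier:
  assumes "h \<in> rapid" "b \<in> Basis"
  shows "dd b (fourier h) = fourier (\<lambda>x. - \<i> * of_real (x \<bullet> b) * h x)"
proof -
  have [measurable]: "h \<in> borel_measurable borel" using assms unfolding rapid_def by blast
  show ?thesis unfolding dd_eqI[OF fourier_has_derivative[OF assms(1)]] by (rule ext) (simp add: fourier_lborel)
qed

text \<open>The transforms of rapidly decaying functions form a class closed under derivatives,
  since differentiating multiplies \<open>h\<close> by a coordinate, and each of them is bounded by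
  an L^1 norm.\<close>

lemma fourier_slowly_increasing:
  assumes "h \<in> rapid" shows "fourier h \<in> slowly_increasing"
proof (rule slowly_increasingI[where P = "fourier ` rapid"])
  show "dd b g \<in> fourier ` rapid" if "g \<in> fourier ` rapid" "b \<in> Basis" for g :: "'a \<Rightarrow> complex" and b
    using that dd_fourier rapid_coord[of _ b "- \<i>"] by (auto intro!: imageI)
  show "g differentiable (at x)" if "g \<in> fourier ` rapid" for g :: "'a \<Rightarrow> complex" and x
    using that fourier_has_derivative differentiableI by blast
  show "\<exists>C k. \<forall>x. norm (g x) \<le> C * (1 + norm x) ^ k" if g: "g \<in> fourier ` rapid" for g :: "'a \<Rightarrow> complex"
  proof -
    obtain h where h: "h \<in> rapid" "g = fourier h" using g by blast
    then have "\<forall>x. norm (g x) \<le> (LINT x|lborel. norm (h x)) * (1 + norm x) ^ 0"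
      by (simp add: norm_fourier_le rapid_integrable)
    then show ?thesis by blast
  qed
qed (use assms in auto)

lemma cis_inner_has_derivative:
  "((\<lambda>x. cis (- (x \<bullet> \<xi>))) has_derivative (\<lambda>h. - \<i> * of_real (h \<bullet> \<xi>) * cis (- (x \<bullet> \<xi>)))) (at x)"
proof -
  have "((\<lambda>x. - \<i> * complex_of_real (x \<bullet> \<xi>)) has_derivative (\<lambda>h. - \<i> * of_real (h \<bullet> \<xi>))) (at x)"
    by (intro has_derivative_mult_right bounded_linear.has_derivative[OF bounded_linear_of_real]
      has_derivative_inner_left has_derivative_ident)
  from has_derivative_compose[OF this DERIV_exp[THEN has_field_derivative_imp_has_derivative]]
  show ?thesis by (simp add: cis_conv_exp mult.commute)
qed

lemma slowly_increasing_cis: "(\<lambda>x. cis (- (x \<bullet> \<xi>))) \<in> slowly_increasing"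
proof (rule slowly_increasingI[where P = "range (\<lambda>c x. c * cis (- (x \<bullet> \<xi>)))"])
  fix g :: "'a \<Rightarrow> complex" and b :: 'a assume "g \<in> range (\<lambda>c x. c * cis (- (x \<bullet> \<xi>)))"
  then obtain c where g: "g = (\<lambda>x. c * cis (- (x \<bullet> \<xi>)))" by blast
  have D: "(g has_derivative (\<lambda>h. c * (- \<i> * of_real (h \<bullet> \<xi>) * cis (- (x \<bullet> \<xi>))))) (at x)" for x
    unfolding g by (rule has_derivative_mult_right[OF cis_inner_has_derivative])
  show "\<And>x. g differentiable (at x)" using D differentiableI by blast
  have "dd b g = (\<lambda>x. (c * (- \<i> * of_real (b \<bullet> \<xi>))) * cis (- (x \<bullet> \<xi>)))"
    unfolding dd_eqI[OF D] by (simp add: mult_ac)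
  then show "dd b g \<in> range (\<lambda>c x. c * cis (- (x \<bullet> \<xi>)))" by blast
  have "\<forall>x. norm (g x) \<le> norm c * (1 + norm x) ^ 0" by (simp add: g norm_mult)
  then show "\<exists>C k. \<forall>x. norm (g x) \<le> C * (1 + norm x) ^ k" by blast
next
  show "(\<lambda>x. cis (- (x \<bullet> \<xi>))) \<in> range (\<lambda>c x. c * cis (- (x \<bullet> \<xi>)))" by (rule range_eqI[of _ _ 1]) simp
qed

text \<open>The derivative of x -> cis (- (x \<bullet> \<xi>)) * f x is a derivative of a Schwartz
  function and has integral zero; the product rule splits it into the two sides of the
  claim.\<close>

lemma fourier_dd:
  assumes f: "f \<in> schwartz" and b: "b \<in> Basis"
  shows "fourier (dd b f) \<xi> = \<i> * of_real (\<xi> \<bullet> b) * fourier f \<xi>"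
proof -
  note [measurable] = schwartz_measurable[OF f] schwartz_measurable[OF schwartz_dd[OF f b]]
  define e where "e x = cis (- (x \<bullet> \<xi>))" for x :: 'a
  have "(e has_derivative (\<lambda>h. - \<i> * of_real (h \<bullet> \<xi>) * cis (- (x \<bullet> \<xi>)))) (at x)" for x
    unfolding e_def by (rule cis_inner_has_derivative)
  from has_derivative_mult[OF this schwartz_has_derivative[OF f]]
  have "((\<lambda>x. e x * f x) has_derivative (\<lambda>h. e x * frechet_derivative f (at x) h + (- \<i> * of_real (h \<bullet> \<xi>) * cis (- (x \<bullet> \<xi>))) * f x)) (at x)" for x .
  from dd_eqI[OF this, of b]
  have eq: "dd b (\<lambda>x. e x * f x) = (\<lambda>x. e x * dd b f x - (\<i> * of_real (\<xi> \<bullet> b)) * (e x * f x))"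
    by (simp add: fun_eq_iff e_def inner_commute mult_ac)
  have "(\<lambda>x. e x * f x) \<in> schwartz"
    unfolding e_def by (intro schwartz_mult slowly_increasing_cis f)
  from integral_dd_schwartz[OF this b]
  have "(LINT x|lborel. e x * dd b f x - (\<i> * of_real (\<xi> \<bullet> b)) * (e x * f x)) = 0" unfolding eq .
  then have "(LINT x|lborel. e x * dd b f x) - (\<i> * of_real (\<xi> \<bullet> b)) * (LINT x|lborel. e x * f x) = 0"
    using schwartz_integrable[OF f] schwartz_integrable[OF schwartz_dd[OF f b]]
    by (subst (asm) Bochner_Integration.integral_diff) (auto simp: e_def intro!: integrable_cis_mult integrable_mult_right)
  then show ?thesis unfolding e_def by (simp add: fourier_lborel)
qed

lemma schwartz_sum: "finite I \<Longrightarrow> (\<And>i. i \<in> I \<Longrightarrow> f i \<in> schwartz) \<Longrightarrow> (\<lambda>x. \<Sum>i\<in>I. f i x) \<in> schwartz"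
proof (induction rule: finite_induct)
  case empty
  show ?case using schwartz_cmult[OF schwartz_gaussian[of 1], of 0] by simp
qed (auto intro: schwartz_add)

definition lap :: "('a::euclidean_space \<Rightarrow> 'b::real_normed_vector) \<Rightarrow> 'a \<Rightarrow> 'b" where
  "lap f x = (\<Sum>b\<in>Basis. dd b (dd b f) x)"

lemma schwartz_lap: "f \<in> schwartz \<Longrightarrow> lap f \<in> schwartz"
  unfolding lap_def[abs_def] by (intro schwartz_sum) (auto intro!: schwartz_dd)

lemma fourier_sum:
  assumes "\<And>i. i \<in> I \<Longrightarrow> integrable lborel (f i)"
  shows "fourier (\<lambda>x. \<Sum>i\<in>I. f i x) \<xi> = (\<Sum>i\<in>I. fourier (f i) \<xi>)"
proof -
  have m: "i \<in> I \<Longrightarrow> f i \<in> borel_measurable borel" for i using assms[of i] by (simp add: borel_measurable_integrable)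
  have "fourier (\<lambda>x. \<Sum>i\<in>I. f i x) \<xi> = (LINT x|lborel. (\<Sum>i\<in>I. cis (- (x \<bullet> \<xi>)) * f i x))"
    using m by (subst fourier_lborel) (auto simp: sum_distrib_left)
  also have "\<dots> = (\<Sum>i\<in>I. fourier (f i) \<xi>)"
    using assms m by (subst Bochner_Integration.integral_sum) (auto simp: fourier_lborel intro!: integrable_cis_mult)
  finally show ?thesis .
qed

lemma fourier_diff:
  assumes "integrable lborel f" "integrable lborel g"
  shows "fourier (\<lambda>x. f x - g x) \<xi> = fourier f \<xi> - fourier g \<xi>"
proof -
  have [measurable]: "f \<in> borel_measurable borel" "g \<in> borel_measurable borel"
    using assms by (simp_all add: borel_measurable_integrable)
  show ?thesis using assms
    by (simp add: fourier_lborel right_diff_distrib integrable_cis_mult)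
qed

lemma fourier_lap:
  assumes f: "f \<in> schwartz" shows "fourier (lap f) \<xi> = - of_real ((norm \<xi>)\<^sup>2) * fourier f \<xi>"
proof -
  have "fourier (lap f) \<xi> = (\<Sum>b\<in>Basis. fourier (dd b (dd b f)) \<xi>)"
    unfolding lap_def[abs_def] using f by (intro fourier_sum schwartz_integrable schwartz_dd) auto
  also have "\<dots> = (\<Sum>b\<in>Basis. - of_real ((\<xi> \<bullet> b)\<^sup>2) * fourier f \<xi>)"
    using f by (intro sum.cong refl) (simp add: fourier_dd schwartz_dd power2_eq_square mult_ac complex_i_mult_minus)
  also have "\<dots> = - of_real ((norm \<xi>)\<^sup>2) * fourier f \<xi>"
    unfolding sum_distrib_right[symmetric] sum_negf power2_norm_eq_inner euclidean_inner[of \<xi> \<xi>]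
    by (simp add: power2_eq_square)
  finally show ?thesis .
qed

lemma fourier_schwartz:
  assumes "f \<in> schwartz" shows "fourier f \<in> schwartz"
proof (rule schwartzI[where P = "fourier ` schwartz"])
  show "dd b g \<in> fourier ` schwartz" if "g \<in> fourier ` schwartz" "b \<in> Basis" for g :: "'a \<Rightarrow> complex" and b
  proof -
    obtain f where f: "f \<in> schwartz" "g = fourier f" using \<open>g \<in> _\<close> by blast
    have "dd b g = fourier (\<lambda>x. - \<i> * (of_real (x \<bullet> b) * f x))"
      using dd_fourier[OF schwartz_rapid[OF f(1)] \<open>b \<in> _\<close>] f by (simp add: mult.assoc)
    then show ?thesis using schwartz_cmult[OF schwartz_coord[OF f(1) \<open>b \<in> _\<close>], of "- \<i>"] by blast
  qed
  show "g differentiable (at x)" if "g \<in> fourier ` schwartz" for g :: "'a \<Rightarrow> complex" and x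
    using that fourier_has_derivative[OF schwartz_rapid] differentiableI by blast
  \<comment> \<open>Multiplying a transform by 1 + |\<xi>|^2 amounts to replacing f by f -
    \<open>lap f\<close>, again a Schwartz function, and the transform of an integrable function is
    bounded.\<close>
  have *: "\<exists>C. \<forall>x. (1 + (norm x)\<^sup>2) ^ k * norm (fourier f x) \<le> C" if "f \<in> schwartz" for f :: "'a \<Rightarrow> complex" and k
    using that
  proof (induction k arbitrary: f)
    case 0
    then show ?case using norm_fourier_le[OF schwartz_integrable] by auto
  next
    case (Suc k)
    have "(\<lambda>x. f x - lap f x) \<in> schwartz" by (intro schwartz_diff schwartz_lap Suc)
    moreover have "fourier (\<lambda>x. f x - lap f x) \<xi> = of_real (1 + (norm \<xi>)\<^sup>2) * fourier f \<xi>" for \<xi>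
      using Suc.prems by (simp add: fourier_diff fourier_lap schwartz_integrable schwartz_lap algebra_simps)
    then have "norm (fourier (\<lambda>x. f x - lap f x) \<xi>) = (1 + (norm \<xi>)\<^sup>2) * norm (fourier f \<xi>)" for \<xi>
      by (simp only: norm_mult norm_of_real) simp
    ultimately show ?case using Suc.IH[of "\<lambda>x. f x - lap f x"] by (simp add: mult_ac)
  qed
  show "\<exists>C. \<forall>x. (1 + norm x) ^ k * norm (g x) \<le> C" if "g \<in> fourier ` schwartz" for g :: "'a \<Rightarrow> complex" and k
  proof -
    obtain f where f: "f \<in> schwartz" "g = fourier f" using \<open>g \<in> _\<close> by blast
    obtain C where C: "\<And>x. (1 + (norm x)\<^sup>2) ^ k * norm (fourier f x) \<le> C" using *[OF f(1)] by blast
    have "(1 + norm x) ^ k * norm (g x) \<le> 2 ^ k * C" for x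
    proof -
      have "norm x \<le> 1 + (norm x)\<^sup>2" using zero_le_power2[of "norm x - 1/2"] by (simp add: power2_diff power_divide)
      then have "1 + norm x \<le> 2 * (1 + (norm x)\<^sup>2)" using zero_le_power2[of "norm x"] by argo
      then have "(1 + norm x) ^ k \<le> (2 * (1 + (norm x)\<^sup>2)) ^ k" by (rule power_mono) simp
      then have "(1 + norm x) ^ k * norm (g x) \<le> (2 * (1 + (norm x)\<^sup>2)) ^ k * norm (g x)" by (rule mult_right_mono) simp
      also have "\<dots> = 2 ^ k * ((1 + (norm x)\<^sup>2) ^ k * norm (fourier f x))" unfolding f power_mult_distrib by (simp only: mult.assoc)
      also have "\<dots> \<le> 2 ^ k * C" by (intro mult_left_mono C) simp
      finally show ?thesis .
    qed
    then show ?thesis by blast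
  qed
qed (use assms in auto)

lemma inv_fourier_schwartz:
  fixes f :: "'a::euclidean_space \<Rightarrow> complex"
  assumes "f \<in> schwartz" shows "inv_fourier f \<in> schwartz"
proof -
  have "inv_fourier f = (\<lambda>x. (1 / of_real ((2 * pi) ^ DIM('a))) * fourier (\<lambda>\<xi>. f (- \<xi>)) x)"
    by (rule ext) (simp only: inv_fourier_eq(1)[OF schwartz_measurable[OF assms]], simp)
  then show ?thesis by (simp only:) (rule schwartz_cmult[OF fourier_schwartz[OF schwartz_reflect[OF assms]]])
qed

section \<open>The heat kernel and Fourier inversion\<close>

definition heat :: "real \<Rightarrow> 'a::euclidean_space \<Rightarrow> real" where
  "heat t x = exp (- ((norm x)\<^sup>2 / (4 * t))) / sqrt (4 * pi * t) ^ DIM('a)"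

lemma heat_nonneg: "t > 0 \<Longrightarrow> 0 \<le> heat t x"
  unfolding heat_def by auto

lemma heat_minus [simp]: "heat t (- x) = heat t x"
  unfolding heat_def by simp

lemma measurable_heat [measurable]: "(\<lambda>(t, x). heat t x) \<in> borel_measurable (borel \<Otimes>\<^sub>M borel)"
  unfolding heat_def by measurable

text \<open>The characteristic function of the standard normal distribution, rescaled by
  \<sigma>.\<close>

lemma normal_density_fourier:
  assumes s: "\<sigma> > 0"
  shows "integrable lborel (\<lambda>y. cis (- (y * u)) * complex_of_real (normal_density 0 \<sigma> y))" (is ?I)
    and "(LINT y|lborel. cis (- (y * u)) * complex_of_real (normal_density 0 \<sigma> y)) = of_real (exp (- (\<sigma>\<^sup>2 * u\<^sup>2 / 2)))"
proof -
  have i: "integrable lborel (\<lambda>y. complex_of_real (normal_density 0 \<sigma> y))"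
    using integrable_normal_density[OF s] by simp
  then show ?I by (rule integrable_cis_mult) measurable
  have "char std_normal_distribution (- (\<sigma> * u)) = of_real (exp (- (\<sigma> * u)\<^sup>2 / 2))"
    using char_std_normal_distribution by (simp add: fun_eq_iff)
  moreover have "char std_normal_distribution (- (\<sigma> * u)) = (LINT y|lborel. std_normal_density y *\<^sub>R cis (- (\<sigma> * u) * y))"
    unfolding char_def by (subst integral_density) (auto simp: cis_conv_exp mult_ac)
  moreover have "(LINT y|lborel. cis (- (y * u)) * complex_of_real (normal_density 0 \<sigma> y)) =
      \<sigma> *\<^sub>R (LINT y|lborel. cis (- ((0 + \<sigma> * y) * u)) * complex_of_real (normal_density 0 \<sigma> (0 + \<sigma> * y)))"
    using s by (subst lborel_integral_real_affine[of \<sigma> _ 0]) auto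
  moreover have "normal_density 0 \<sigma> (0 + \<sigma> * y) = std_normal_density y / \<sigma>" for y
    using s by (simp add: normal_density_def power_mult_distrib real_sqrt_mult field_simps)
  ultimately show "(LINT y|lborel. cis (- (y * u)) * complex_of_real (normal_density 0 \<sigma> y)) = of_real (exp (- (\<sigma>\<^sup>2 * u\<^sup>2 / 2)))"
    using s by (simp add: scaleR_conv_of_real power_mult_distrib mult_ac)
qed

lemma heat_eq_prod:
  fixes x :: "'a::euclidean_space"
  assumes "t > 0" shows "heat t x = (\<Prod>b\<in>Basis. normal_density 0 (sqrt (2 * t)) (x \<bullet> b))"
proof -
  have "(\<Prod>b\<in>(Basis::'a set). normal_density 0 (sqrt (2 * t)) (x \<bullet> b)) = (\<Prod>b\<in>(Basis::'a set). exp (- ((x \<bullet> b)\<^sup>2 / (4 * t))) / sqrt (4 * pi * t))"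
    using assms by (intro prod.cong) (auto simp: normal_density_def mult_ac)
  also have "\<dots> = exp (\<Sum>b\<in>(Basis::'a set). - ((x \<bullet> b)\<^sup>2 / (4 * t))) / sqrt (4 * pi * t) ^ DIM('a)"
    by (simp add: prod_dividef exp_sum)
  also have "(\<Sum>b\<in>(Basis::'a set). - ((x \<bullet> b)\<^sup>2 / (4 * t))) = - ((norm x)\<^sup>2 / (4 * t))"
    unfolding sum_negf sum_divide_distrib[symmetric] power2_norm_eq_inner euclidean_inner[of x x]
    by (simp add: power2_eq_square)
  finally show ?thesis by (simp add: heat_def)
qed

text \<open>The kernel is the product over the coordinates of centred normal densities of variance
  2t, so everything reduces to \<open>normal_density_fourier\<close>; the mass is the value of the
  transform at \<xi> = 0.\<close>

lemma
  fixes \<xi> :: "'a::euclidean_space"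
  assumes t: "t > 0"
  shows heat_cis_integral: "(LINT x|lborel. cis (- (x \<bullet> \<xi>)) * complex_of_real (heat t x)) = of_real (exp (- (t * (norm \<xi>)\<^sup>2)))"
    and heat_integrable: "integrable lborel (heat t :: 'a \<Rightarrow> real)"
    and heat_integral: "(LINT x|lborel. heat t (x :: 'a)) = 1"
proof -
  have s: "sqrt (2 * t) > 0" using t by simp
  have eq: "cis (- (x \<bullet> \<xi>)) * complex_of_real (heat t x) = (\<Prod>b\<in>Basis. cis (- ((x \<bullet> b) * (\<xi> \<bullet> b))) * complex_of_real (normal_density 0 (sqrt (2 * t)) (x \<bullet> b)))" for x \<xi> :: 'a
  proof -
    have "(\<Prod>b\<in>A. cis (f b)) = cis (\<Sum>b\<in>A. f b)" if "finite A" for A :: "'a set" and f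
      using that by (induction rule: finite_induct) (auto simp: cis_mult)
    then have "cis (- (x \<bullet> \<xi>)) = (\<Prod>b\<in>Basis. cis (- ((x \<bullet> b) * (\<xi> \<bullet> b))))"
      by (simp add: euclidean_inner[of x \<xi>] sum_negf)
    then show ?thesis unfolding heat_eq_prod[OF t] by (simp add: prod.distrib)
  qed
  have int: "integrable lborel (\<lambda>x. cis (- (x \<bullet> \<xi>)) * complex_of_real (heat t x))" for \<xi> :: 'a
    unfolding eq by (intro integrable_prod_Basis normal_density_fourier s)
  have val: "(LINT x|lborel. cis (- (x \<bullet> \<xi>)) * complex_of_real (heat t x)) = of_real (exp (- (t * (norm \<xi>)\<^sup>2)))" for \<xi> :: 'a
  proof -
    have "(LINT x|lborel. cis (- (x \<bullet> \<xi>)) * complex_of_real (heat t x)) = (\<Prod>b\<in>(Basis::'a set). of_real (exp (- (t * (\<xi> \<bullet> b)\<^sup>2))))"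
      unfolding eq using t
      by (subst integral_prod_Basis) (auto intro!: normal_density_fourier s prod.cong simp: normal_density_fourier(2)[OF s])
    also have "\<dots> = of_real (exp (\<Sum>b\<in>(Basis::'a set). - (t * (\<xi> \<bullet> b)\<^sup>2)))" by (simp add: exp_sum)
    also have "(\<Sum>b\<in>(Basis::'a set). - (t * (\<xi> \<bullet> b)\<^sup>2)) = - (t * (norm \<xi>)\<^sup>2)"
      unfolding sum_negf sum_distrib_left[symmetric] power2_norm_eq_inner euclidean_inner[of \<xi> \<xi>]
      by (simp add: power2_eq_square)
    finally show ?thesis .
  qed
  show "(LINT x|lborel. cis (- (x \<bullet> \<xi>)) * complex_of_real (heat t x)) = of_real (exp (- (t * (norm \<xi>)\<^sup>2)))" by (rule val)
  show "integrable lborel (heat t :: 'a \<Rightarrow> real)" using int[of 0] by (simp add: complex_of_real_integrable_eq)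
  show "(LINT x|lborel. heat t (x :: 'a)) = 1" using val[of 0] by (simp flip: of_real_eq_iff)
qed

lemma exp_eq_heat:
  fixes x :: "'a::euclidean_space"
  assumes "e > 0" shows "exp (- (e * (norm x)\<^sup>2)) = sqrt (pi / e) ^ DIM('a) * heat (1 / (4 * e)) x"
  using assms unfolding heat_def by (simp add: real_sqrt_divide power_divide)

text \<open>A Gaussian in \<xi> is itself a multiple of the heat kernel at time 1 / (4e), so the
  transform already computed also serves in the inverse direction. The factor comes from sqrt (pi /
  e) * sqrt (4 * pi * e) = 2 * pi.\<close>

lemma exp_cis_integral:
  fixes x :: "'a::euclidean_space"
  assumes e: "e > 0"
  shows "(LINT \<xi>|lborel. cis (x \<bullet> \<xi>) * complex_of_real (exp (- (e * (norm \<xi>)\<^sup>2)))) = of_real ((2 * pi) ^ DIM('a) * heat e x)"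
proof -
  have "(LINT \<xi>|lborel. cis (x \<bullet> \<xi>) * complex_of_real (exp (- (e * (norm \<xi>)\<^sup>2)))) =
    of_real (sqrt (pi / e) ^ DIM('a)) * (LINT \<xi>|lborel. cis (- (\<xi> \<bullet> (- x))) * complex_of_real (heat (1 / (4 * e)) \<xi>))"
    unfolding exp_eq_heat[OF e] integral_mult_right_zero[symmetric]
    by (intro Bochner_Integration.integral_cong) (auto simp: inner_commute)
  also have "\<dots> = of_real (sqrt (pi / e) ^ DIM('a) * exp (- ((norm x)\<^sup>2 / (4 * e))))"
    using e by (subst heat_cis_integral) auto
  also have "sqrt (pi / e) ^ DIM('a) * exp (- ((norm x)\<^sup>2 / (4 * e))) = (2 * pi) ^ DIM('a) * heat e x"
  proof -
    have "sqrt (pi / e) = (2 * pi) / sqrt (4 * pi * e)"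
    proof -
      have "sqrt (pi / e) * sqrt (4 * pi * e) = sqrt ((2 * pi)\<^sup>2)"
        unfolding real_sqrt_mult[symmetric] using e by (simp add: power2_eq_square)
      moreover have "sqrt ((2 * pi)\<^sup>2) = 2 * pi" by (simp only: real_sqrt_abs) simp
      ultimately show ?thesis using e by (simp add: eq_divide_eq)
    qed
    then show ?thesis by (simp add: heat_def power_divide)
  qed
  finally show ?thesis by simp
qed

lemma heat_scale: assumes "t > 0" shows "sqrt t ^ DIM('a) * heat t (sqrt t *\<^sub>R x) = heat 1 (x :: 'a::euclidean_space)"
proof -
  have "(norm (sqrt t *\<^sub>R x))\<^sup>2 = t * (norm x)\<^sup>2" using assms by (simp add: power_mult_distrib)
  moreover have "sqrt (4 * pi * t) = sqrt (4 * pi) * sqrt t" by (rule real_sqrt_mult)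
  ultimately show ?thesis using assms unfolding heat_def by (simp add: power_mult_distrib)
qed

text \<open>The substitution y -> x - sqrt t * y moves the time from the kernel into the argument of
  \<open>f\<close>, so that the single kernel \<open>heat 1\<close> can dominate for all
  times.\<close>

lemma heat_convolution_scale:
  fixes f :: "'a::euclidean_space \<Rightarrow> complex"
  assumes [measurable]: "f \<in> borel_measurable borel" and t: "t > 0"
  shows "(LINT y|lborel. of_real (heat t (x - y)) * f y) = (LINT y|lborel. of_real (heat 1 y) * f (x - sqrt t *\<^sub>R y))"
proof -
  have "(LINT y|lborel. of_real (heat t (x - y)) * f y) = sqrt t ^ DIM('a) *\<^sub>R (LINT y|lborel. of_real (heat t (sqrt t *\<^sub>R y)) * f (x - sqrt t *\<^sub>R y))"
    using t by (subst lborel_integral_affine[of "- sqrt t" _ x]) auto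
  also have "\<dots> = (LINT y|lborel. of_real (sqrt t ^ DIM('a) * heat t (sqrt t *\<^sub>R y)) * f (x - sqrt t *\<^sub>R y))"
    unfolding integral_scaleR_right[symmetric] by (simp add: scaleR_conv_of_real mult.assoc)
  finally show ?thesis unfolding heat_scale[OF t] .
qed

lemma heat_convolution_tendsto:
  fixes f :: "'a::euclidean_space \<Rightarrow> complex"
  assumes f: "continuous_on UNIV f" and b: "\<And>x. norm (f x) \<le> B"
    and t: "\<And>n. t n > 0" "t \<longlonglongrightarrow> 0"
  shows "(\<lambda>n. LINT y|lborel. of_real (heat (t n) (x - y)) * f y) \<longlonglongrightarrow> f x"
proof -
  have [measurable]: "f \<in> borel_measurable borel" by (rule borel_measurable_continuous_onI[OF f])
  have "(\<lambda>n. LINT y|lborel. of_real (heat 1 y) * f (x - sqrt (t n) *\<^sub>R y)) \<longlonglongrightarrow> (LINT y|lborel. of_real (heat 1 (y :: 'a)) * f x)"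
  proof (rule integral_dominated_convergence[where w = "\<lambda>y::'a. heat 1 y * B"])
    show "AE y in lborel. (\<lambda>n. of_real (heat 1 y) * f (x - sqrt (t n) *\<^sub>R y)) \<longlonglongrightarrow> of_real (heat 1 y) * f x"
    proof (rule AE_I2)
      fix y
      have "(\<lambda>n. x - sqrt (t n) *\<^sub>R y) \<longlonglongrightarrow> x - sqrt 0 *\<^sub>R y" by (intro tendsto_intros t)
      moreover have "isCont f x" using f by (simp add: continuous_on_eq_continuous_at)
      ultimately show "(\<lambda>n. of_real (heat 1 y) * f (x - sqrt (t n) *\<^sub>R y)) \<longlonglongrightarrow> of_real (heat 1 y) * f x"
        by (intro tendsto_intros isCont_tendsto_compose[of x f]) auto
    qed
  qed (auto simp: norm_mult heat_nonneg intro!: mult_left_mono b integrable_mult_left heat_integrable)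
  then show ?thesis by (simp add: heat_convolution_scale t heat_integral heat_integrable)
qed

lemma cis_inner_diff: "cis ((x - y) \<bullet> \<xi>) = cis (x \<bullet> \<xi>) * cis (- (y \<bullet> \<xi>))"
  by (simp add: cis_mult inner_diff_left)

text \<open>The Gaussian factor makes the double integral absolutely convergent. The transform of a
  general integrable \<open>f\<close> need not be integrable, so inversion is only reached as t
  tends to 0.\<close>

lemma inv_fourier_gauss:
  fixes f :: "'a::euclidean_space \<Rightarrow> complex"
  assumes f: "integrable lborel f" and t: "t > 0"
  shows "inv_fourier (\<lambda>\<xi>. of_real (exp (- (t * (norm \<xi>)\<^sup>2))) * fourier f \<xi>) x = (LINT y|lborel. of_real (heat t (x - y)) * f y)"
proof -
  have [measurable]: "f \<in> borel_measurable borel" using f by (simp add: borel_measurable_integrable)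
  have mf: "fourier f \<in> borel_measurable borel"
    unfolding fourier_lborel[OF \<open>f \<in> _\<close>, abs_def] by (intro lborel.borel_measurable_lebesgue_integral) measurable
  note [measurable] = mf
  have E: "integrable lborel (\<lambda>\<xi>::'a. exp (- (t * (norm \<xi>)\<^sup>2)))"
    using schwartz_integrable[OF schwartz_gaussian[OF t]] by (simp add: complex_of_real_integrable_eq)
  define c where "c = complex_of_real ((2 * pi) ^ DIM('a))"
  have c: "c \<noteq> 0" by (simp add: c_def)
  have "inv_fourier (\<lambda>\<xi>. of_real (exp (- (t * (norm \<xi>)\<^sup>2))) * fourier f \<xi>) x * c =
    (LINT \<xi>|lborel. LINT y|lborel. cis ((x - y) \<bullet> \<xi>) * of_real (exp (- (t * (norm \<xi>)\<^sup>2))) * f y)"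
  proof -
    have "cis (x \<bullet> \<xi>) * (of_real (exp (- (t * (norm \<xi>)\<^sup>2))) * fourier f \<xi>) =
      (LINT y|lborel. cis ((x - y) \<bullet> \<xi>) * of_real (exp (- (t * (norm \<xi>)\<^sup>2))) * f y)" for \<xi>
      unfolding fourier_lborel[OF \<open>f \<in> _\<close>] integral_mult_right_zero[symmetric]
      by (intro Bochner_Integration.integral_cong refl)
         (simp add: cis_inner_diff mult_ac)
    then show ?thesis using c by (simp add: inv_fourier_lborel c_def)
  qed
  also have "\<dots> = (LINT y|lborel. LINT \<xi>|lborel. cis ((x - y) \<bullet> \<xi>) * of_real (exp (- (t * (norm \<xi>)\<^sup>2))) * f y)"
    by (rule fubini_bounded_swap[OF _ E integrable_norm[OF f]]) (auto simp: norm_mult)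
  also have "\<dots> = (LINT y|lborel. c * (of_real (heat t (x - y)) * f y))"
  proof (intro Bochner_Integration.integral_cong refl)
    show "(LINT \<xi>|lborel. cis ((x - y) \<bullet> \<xi>) * of_real (exp (- (t * (norm \<xi>)\<^sup>2))) * f y) = c * (of_real (heat t (x - y)) * f y)" for y
      unfolding integral_mult_left_zero exp_cis_integral[OF t] by (simp add: c_def)
  qed
  also have "\<dots> = (LINT y|lborel. of_real (heat t (x - y)) * f y) * c" by simp
  finally show ?thesis using c by simp
qed

lemma fourier_measurable:
  fixes f :: "'a::euclidean_space \<Rightarrow> complex"
  assumes f: "integrable lborel f"
  shows "fourier f \<in> borel_measurable borel" "inv_fourier f \<in> borel_measurable borel"
proof -
  have [measurable]: "f \<in> borel_measurable borel" using f by (simp add: borel_measurable_integrable)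
  show "fourier f \<in> borel_measurable borel"
    unfolding fourier_lborel[OF \<open>f \<in> _\<close>, abs_def] by (intro lborel.borel_measurable_lebesgue_integral) measurable
  show "inv_fourier f \<in> borel_measurable borel"
    unfolding inv_fourier_lborel[OF \<open>f \<in> _\<close>, abs_def]
    by (intro borel_measurable_divide lborel.borel_measurable_lebesgue_integral) measurable
qed

lemma heat_inv_fourier:
  fixes a :: "'a::euclidean_space \<Rightarrow> complex"
  assumes a: "integrable lborel a" and t: "t > 0"
  shows "(LINT y|lborel. of_real (heat t y) * inv_fourier a (x - y)) = inv_fourier (\<lambda>\<xi>. of_real (exp (- (t * (norm \<xi>)\<^sup>2))) * a \<xi>) x"
proof -
  have [measurable]: "a \<in> borel_measurable borel" using a by (simp add: borel_measurable_integrable)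
  define c where "c = complex_of_real ((2 * pi) ^ DIM('a))"
  have c: "c \<noteq> 0" by (simp add: c_def)
  have "(LINT y|lborel. of_real (heat t y) * inv_fourier a (x - y)) * c = (LINT y|lborel. LINT \<xi>|lborel. of_real (heat t y) * cis ((x - y) \<bullet> \<xi>) * a \<xi>)"
    unfolding integral_mult_left_zero[symmetric] using c
    by (simp add: inv_fourier_lborel c_def mult.assoc)
  also have "\<dots> = (LINT \<xi>|lborel. LINT y|lborel. of_real (heat t y) * cis ((x - y) \<bullet> \<xi>) * a \<xi>)"
    by (intro fubini_bounded_swap[OF _ heat_integrable[OF t] integrable_norm[OF a]]) (auto simp: norm_mult heat_nonneg t)
  also have "\<dots> = (LINT \<xi>|lborel. cis (x \<bullet> \<xi>) * (of_real (exp (- (t * (norm \<xi>)\<^sup>2))) * a \<xi>))"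
  proof (intro Bochner_Integration.integral_cong refl)
    fix \<xi> :: 'a
    have "(LINT y|lborel. of_real (heat t y) * cis ((x - y) \<bullet> \<xi>) * a \<xi>) = cis (x \<bullet> \<xi>) * a \<xi> * (LINT y|lborel. cis (- (y \<bullet> \<xi>)) * complex_of_real (heat t y))"
      unfolding integral_mult_right_zero[symmetric]
      by (intro Bochner_Integration.integral_cong refl)
         (simp add: cis_inner_diff mult_ac)
    then show "(LINT y|lborel. of_real (heat t y) * cis ((x - y) \<bullet> \<xi>) * a \<xi>) = cis (x \<bullet> \<xi>) * (of_real (exp (- (t * (norm \<xi>)\<^sup>2))) * a \<xi>)"
      unfolding heat_cis_integral[OF t] by (simp only: mult_ac)
  qed
  also have "\<dots> = inv_fourier (\<lambda>\<xi>. of_real (exp (- (t * (norm \<xi>)\<^sup>2))) * a \<xi>) x * c"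
    using c by (simp add: inv_fourier_lborel c_def)
  finally show ?thesis using c by simp
qed

text \<open>Gauss summation: with exp(-t|\<xi>|^2) inserted, the inversion integral is a heat
  average of \<open>f\<close>. As t tends to 0 the average tends to \<open>f x\<close>, while the
  integral tends to the one without the factor.\<close>

lemma inv_fourier_fourier:
  fixes f :: "'a::euclidean_space \<Rightarrow> complex"
  assumes f: "f \<in> schwartz" shows "inv_fourier (fourier f) = f"
proof
  fix x
  note F = fourier_schwartz[OF f]
  note [measurable] = schwartz_measurable[OF f] schwartz_measurable[OF F]
  define t where "t n = 1 / real (Suc n)" for n
  have t: "t n > 0" for n by (simp add: t_def)
  have t0: "t \<longlonglongrightarrow> 0" unfolding t_def by real_asymp
  obtain B where B: "\<And>x. norm (f x) \<le> B" using schwartz_bounded[OF f] by blast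
  have "(\<lambda>n. inv_fourier (\<lambda>\<xi>. of_real (exp (- (t n * (norm \<xi>)\<^sup>2))) * fourier f \<xi>) x) \<longlonglongrightarrow> f x"
    unfolding inv_fourier_gauss[OF schwartz_integrable[OF f] t]
    by (rule heat_convolution_tendsto[OF schwartz_continuous_on[OF f] B t t0])
  moreover have "(\<lambda>n. inv_fourier (\<lambda>\<xi>. of_real (exp (- (t n * (norm \<xi>)\<^sup>2))) * fourier f \<xi>) x) \<longlonglongrightarrow> inv_fourier (fourier f) x"
  proof -
    have "(\<lambda>n. LINT \<xi>|lborel. cis (x \<bullet> \<xi>) * (of_real (exp (- (t n * (norm \<xi>)\<^sup>2))) * fourier f \<xi>)) \<longlonglongrightarrow> (LINT \<xi>|lborel. cis (x \<bullet> \<xi>) * fourier f \<xi>)"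
    proof (rule integral_dominated_convergence[where w = "\<lambda>\<xi>. norm (fourier f \<xi>)"])
      show "AE \<xi> in lborel. (\<lambda>n. cis (x \<bullet> \<xi>) * (of_real (exp (- (t n * (norm \<xi>)\<^sup>2))) * fourier f \<xi>)) \<longlonglongrightarrow> cis (x \<bullet> \<xi>) * fourier f \<xi>"
      proof (rule AE_I2)
        fix \<xi> :: 'a
        have "(\<lambda>n. cis (x \<bullet> \<xi>) * (of_real (exp (- (t n * (norm \<xi>)\<^sup>2))) * fourier f \<xi>)) \<longlonglongrightarrow> cis (x \<bullet> \<xi>) * (of_real (exp (- (0 * (norm \<xi>)\<^sup>2))) * fourier f \<xi>)"
          by (intro tendsto_intros t0)
        then show "(\<lambda>n. cis (x \<bullet> \<xi>) * (of_real (exp (- (t n * (norm \<xi>)\<^sup>2))) * fourier f \<xi>)) \<longlonglongrightarrow> cis (x \<bullet> \<xi>) * fourier f \<xi>" by simp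
      qed
      show "AE \<xi> in lborel. norm (cis (x \<bullet> \<xi>) * (of_real (exp (- (t n * (norm \<xi>)\<^sup>2))) * fourier f \<xi>)) \<le> norm (fourier f \<xi>)" for n
      proof (rule AE_I2)
        fix \<xi> :: 'a
        have "exp (- (t n * (norm \<xi>)\<^sup>2)) \<le> 1" using t[of n] by simp
        then show "norm (cis (x \<bullet> \<xi>) * (of_real (exp (- (t n * (norm \<xi>)\<^sup>2))) * fourier f \<xi>)) \<le> norm (fourier f \<xi>)"
          by (simp add: norm_mult mult_left_le_one_le)
      qed
    qed (use schwartz_integrable[OF F] in auto)
    then show ?thesis unfolding inv_fourier_lborel[OF schwartz_measurable[OF F]]
      by (subst inv_fourier_lborel) (auto intro!: tendsto_intros)
  qed
  ultimately show "inv_fourier (fourier f) x = f x" using LIMSEQ_unique by blast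
qed

lemma fourier_inv_fourier:
  fixes f :: "'a::euclidean_space \<Rightarrow> complex"
  assumes f: "f \<in> schwartz" shows "fourier (inv_fourier f) = f"
proof
  fix x
  note [measurable] = schwartz_measurable[OF f] schwartz_measurable[OF inv_fourier_schwartz[OF f]]
    schwartz_measurable[OF fourier_schwartz[OF f]]
  have c: "complex_of_real ((2 * pi) ^ DIM('a)) \<noteq> 0" by simp
  have "fourier (inv_fourier f) x = fourier (\<lambda>\<xi>. (1 / of_real ((2 * pi) ^ DIM('a))) * fourier f (- \<xi>)) x"
    by (simp only: inv_fourier_eq(2)[OF schwartz_measurable[OF f], abs_def]) simp
  also have "\<dots> = fourier (\<lambda>\<xi>. fourier f (- \<xi>)) x / of_real ((2 * pi) ^ DIM('a))"
    by (simp add: fourier_lborel)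
  also have "\<dots> = inv_fourier (fourier f) x" by (rule inv_fourier_eq(1)[symmetric]) measurable
  finally show "fourier (inv_fourier f) x = f x" by (simp add: inv_fourier_fourier[OF f])
qed

lemma integral_fourier_mult:
  fixes f g :: "'a::euclidean_space \<Rightarrow> complex"
  assumes f: "integrable lborel f" and g: "integrable lborel g"
  shows "(LINT x|lborel. fourier f x * g x) = (LINT x|lborel. f x * fourier g x)"
proof -
  have [measurable]: "f \<in> borel_measurable borel" "g \<in> borel_measurable borel"
    using f g by (simp_all add: borel_measurable_integrable)
  have "(LINT x|lborel. fourier f x * g x) = (LINT x|lborel. LINT y|lborel. cis (- (y \<bullet> x)) * f y * g x)"
    by (simp add: fourier_lborel)
  also have "\<dots> = (LINT y|lborel. LINT x|lborel. cis (- (y \<bullet> x)) * f y * g x)"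
    by (rule fubini_bounded_swap[OF _ integrable_norm[OF g] integrable_norm[OF f]]) (auto simp: norm_mult)
  also have "\<dots> = (LINT y|lborel. f y * fourier g y)"
    unfolding fourier_lborel[OF \<open>g \<in> _\<close>] integral_mult_right_zero[symmetric]
    by (intro Bochner_Integration.integral_cong refl) (simp add: inner_commute mult_ac)
  finally show ?thesis .
qed

lemma integral_inv_fourier_mult:
  fixes f g :: "'a::euclidean_space \<Rightarrow> complex"
  assumes f: "integrable lborel f" and g: "integrable lborel g"
  shows "(LINT x|lborel. inv_fourier f x * g x) = (LINT x|lborel. f x * inv_fourier g x)"
proof -
  have m [measurable]: "f \<in> borel_measurable borel" "g \<in> borel_measurable borel"
    using f g by (simp_all add: borel_measurable_integrable)
  have f': "integrable lborel (\<lambda>x. f (- x))" using lborel_integrable_reflect[OF f, of 0] by simp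
  show ?thesis
    using integral_fourier_mult[OF f' g] lborel_integral_reflect[of "\<lambda>x. f x * fourier g (- x)" 0] fourier_measurable[OF g]
    by (simp add: inv_fourier_eq(1)[OF m(1)] inv_fourier_eq(2)[OF m(2)])
qed

section \<open>Lebesgue spaces\<close>

lemma norm_add_powr_le:
  fixes a b :: "'a::real_normed_vector"
  assumes "p \<ge> 0" shows "norm (a + b) powr p \<le> 2 powr p * (norm a powr p + norm b powr p)"
proof -
  have "norm (a + b) \<le> 2 * max (norm a) (norm b)" using norm_triangle_ineq[of a b] by linarith
  then have "norm (a + b) powr p \<le> (2 * max (norm a) (norm b)) powr p" using assms by (intro powr_mono2) auto
  also have "\<dots> = 2 powr p * max (norm a) (norm b) powr p" by (simp add: powr_mult)
  also have "max (norm a) (norm b) powr p \<le> norm a powr p + norm b powr p" by (simp add: max_def)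
  finally show ?thesis by (simp add: mult_left_mono)
qed

lemma norm_diff_powr_le:
  fixes a b :: "'a::real_normed_vector"
  shows "p \<ge> 0 \<Longrightarrow> norm (a - b) powr p \<le> 2 powr p * (norm a powr p + norm b powr p)"
  using norm_add_powr_le[of p a "- b"] by simp

lemma
  fixes f g :: "'a \<Rightarrow> 'b::euclidean_space"
  assumes p: "p \<ge> 0" and [measurable]: "f \<in> borel_measurable M" "g \<in> borel_measurable M"
    and f: "integrable M (\<lambda>x. norm (f x) powr p)" and g: "integrable M (\<lambda>x. norm (g x) powr p)"
  shows integrable_powr_add: "integrable M (\<lambda>x. norm (f x + g x) powr p)"
    and integrable_powr_diff: "integrable M (\<lambda>x. norm (f x - g x) powr p)"
    and integral_powr_add_le: "(LINT x|M. norm (f x + g x) powr p) \<le> 2 powr p * ((LINT x|M. norm (f x) powr p) + (LINT x|M. norm (g x) powr p))"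
    and integral_powr_diff_le: "(LINT x|M. norm (f x - g x) powr p) \<le> 2 powr p * ((LINT x|M. norm (f x) powr p) + (LINT x|M. norm (g x) powr p))"
proof -
  have i: "integrable M (\<lambda>x. 2 powr p * (norm (f x) powr p + norm (g x) powr p))" using f g by simp
  show 1: "integrable M (\<lambda>x. norm (f x + g x) powr p)"
    by (rule integrable_le[OF i]) (use norm_add_powr_le[OF p] in auto)
  show 2: "integrable M (\<lambda>x. norm (f x - g x) powr p)"
    by (rule integrable_le[OF i]) (use norm_diff_powr_le[OF p] in auto)
  have e: "(LINT x|M. 2 powr p * (norm (f x) powr p + norm (g x) powr p)) = 2 powr p * ((LINT x|M. norm (f x) powr p) + (LINT x|M. norm (g x) powr p))"
    using f g by simp
  show "(LINT x|M. norm (f x + g x) powr p) \<le> 2 powr p * ((LINT x|M. norm (f x) powr p) + (LINT x|M. norm (g x) powr p))"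
    unfolding e[symmetric] by (intro integral_mono 1 i norm_add_powr_le p)
  show "(LINT x|M. norm (f x - g x) powr p) \<le> 2 powr p * ((LINT x|M. norm (f x) powr p) + (LINT x|M. norm (g x) powr p))"
    unfolding e[symmetric] by (intro integral_mono 2 i norm_diff_powr_le p)
qed

section \<open>Conjugate exponents, Young's inequality and convolution\<close>

locale conjugate_exponents =
  fixes p q :: real
  assumes p1: "1 < p" and pq: "1 / p + 1 / q = 1"
begin

lemma p0: "0 < p" using p1 by simp

lemma q_eq: "q = p / (p - 1)"
proof -
  have "1 / q = (p - 1) / p" using pq p1 by (simp add: field_simps)
  then have "inverse (1 / q) = inverse ((p - 1) / p)" by simp
  then show ?thesis by simp
qed

lemma q1: "1 < q" using p1 unfolding q_eq by (simp add: field_simps)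

lemma q0: "0 < q" using q1 by simp

lemma pq_sum: "p * q = p + q" using p1 unfolding q_eq by (simp add: field_simps)

text \<open>The weights 1/p and 1/q are bounded by 1, and a free scale \<delta> is inserted. This
  additive form stands in for Hoelder's inequality: after integration, the best \<delta> recovers
  the product of the norms up to a factor 2.\<close>

lemma young:
  assumes "a \<ge> 0" "b \<ge> 0" "\<delta> > 0"
  shows "a * b \<le> \<delta> powr p * a powr p + \<delta> powr (- q) * b powr q"
proof -
  have "(\<delta> * a) * (b / \<delta>) \<le> (\<delta> * a) powr p / p + (b / \<delta>) powr q / q"
    using assms p1 q1 pq by (intro Youngs_inequality) auto
  also have "\<dots> \<le> (\<delta> * a) powr p + (b / \<delta>) powr q"
    using p1 q1 by (intro add_mono) (auto simp: divide_le_eq mult_left_le_one_le mult_le_cancel_left1)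
  also have "\<dots> = \<delta> powr p * a powr p + \<delta> powr (- q) * b powr q"
    using assms by (simp add: powr_mult powr_divide powr_minus_divide)
  finally show ?thesis using assms by simp
qed

lemma
  fixes f :: "'x \<Rightarrow> 'b::euclidean_space" and g :: "'x \<Rightarrow> 'c::euclidean_space"
    and h :: "'x \<Rightarrow> 'd::{banach, second_countable_topology}"
  assumes [measurable]: "f \<in> borel_measurable M" "g \<in> borel_measurable M" "h \<in> borel_measurable M"
    and f: "integrable M (\<lambda>x. norm (f x) powr p)" and g: "integrable M (\<lambda>x. norm (g x) powr q)"
    and h: "\<And>x. norm (h x) \<le> norm (f x) * norm (g x)"
  shows holder_integrable: "integrable M h"
    and holder_le: "\<delta> > 0 \<Longrightarrow> norm (LINT x|M. h x) \<le> \<delta> powr p * (LINT x|M. norm (f x) powr p) + \<delta> powr (- q) * (LINT x|M. norm (g x) powr q)"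
proof -
  have b: "norm (h x) \<le> \<delta> powr p * norm (f x) powr p + \<delta> powr (- q) * norm (g x) powr q" if "\<delta> > 0" for x \<delta>
    by (rule order_trans[OF h young]) (use that in auto)
  have i: "integrable M (\<lambda>x. \<delta> powr p * norm (f x) powr p + \<delta> powr (- q) * norm (g x) powr q)" for \<delta> using f g by simp
  show ih: "integrable M h" by (rule integrable_le[OF i[of 1]]) (use b[of 1] in auto)
  show "norm (LINT x|M. h x) \<le> \<delta> powr p * (LINT x|M. norm (f x) powr p) + \<delta> powr (- q) * (LINT x|M. norm (g x) powr q)" if "\<delta> > 0"
  proof -
    have "norm (LINT x|M. h x) \<le> (LINT x|M. \<delta> powr p * norm (f x) powr p + \<delta> powr (- q) * norm (g x) powr q)"
      by (rule order_trans[OF integral_norm_bound integral_mono[OF integrable_norm[OF ih] i b[OF that]]])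
    then show ?thesis using f g by simp
  qed
qed

text \<open>A large \<delta> makes the fixed term \<delta>^(-q) b small since q > 0; with that
  \<delta> held fixed, the term containing \<open>a n\<close> tends to zero.\<close>

lemma young_tendsto:
  fixes c :: "nat \<Rightarrow> 'b::real_normed_vector"
  assumes "\<And>n \<delta>. \<delta> > 0 \<Longrightarrow> norm (c n) \<le> \<delta> powr p * a n + \<delta> powr (- q) * b" and "a \<longlonglongrightarrow> 0"
  shows "c \<longlonglongrightarrow> 0"
proof (rule LIMSEQ_I)
  fix e :: real assume e: "e > 0"
  have "((\<lambda>\<delta>. \<delta> powr (- q) * b) \<longlongrightarrow> 0 * b) at_top"
    using q0 by (intro tendsto_mult tendsto_const tendsto_neg_powr filterlim_ident) auto
  then have "eventually (\<lambda>\<delta>. \<delta> powr (- q) * b < e / 2) at_top" using e by (intro order_tendstoD) auto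
  then have "eventually (\<lambda>\<delta>. \<delta> powr (- q) * b < e / 2 \<and> \<delta> > 0) at_top"
    using eventually_gt_at_top by (rule eventually_conj)
  then obtain \<delta> where \<delta>: "\<delta> > 0" "\<delta> powr (- q) * b < e / 2" using eventually_happens'[OF trivial_limit_at_top_linorder] by blast
  have "(\<lambda>n. \<delta> powr p * a n) \<longlonglongrightarrow> \<delta> powr p * 0" by (intro tendsto_intros assms)
  then have "eventually (\<lambda>n. \<delta> powr p * a n < e / 2) sequentially" using e by (intro order_tendstoD) auto
  then obtain N where "\<And>n. n \<ge> N \<Longrightarrow> \<delta> powr p * a n < e / 2" unfolding eventually_sequentially by blast
  then have "norm (c n - 0) < e" if "n \<ge> N" for n
    using assms(1)[OF \<delta>(1), of n] \<delta>(2) that by fastforce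
  then show "\<exists>N. \<forall>n\<ge>N. norm (c n - 0) < e" by blast
qed

end

lemma conjugate_exponents_swap: "conjugate_exponents p q \<Longrightarrow> conjugate_exponents q p"
  using conjugate_exponents.q1 unfolding conjugate_exponents_def by (simp add: add.commute)

lemma conjugate_exponentsI: "1 < p \<Longrightarrow> conjugate_exponents p (p / (p - 1))"
  unfolding conjugate_exponents_def by (simp add: field_simps)

definition conv :: "('a::euclidean_space \<Rightarrow> real) \<Rightarrow> ('a \<Rightarrow> complex) \<Rightarrow> 'a \<Rightarrow> complex" where
  "conv K f x = (LINT y|lborel. of_real (K y) * f (x - y))"

lemma conv_measurable:
  assumes [measurable]: "K \<in> borel_measurable borel" "f \<in> borel_measurable borel"
  shows "conv K f \<in> borel_measurable borel"
  unfolding conv_def[abs_def] by (intro lborel.borel_measurable_lebesgue_integral) measurable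

lemma
  fixes K :: "'a::euclidean_space \<Rightarrow> real" and F :: "'a \<Rightarrow> real"
  assumes K: "integrable lborel K" and F: "integrable lborel F"
  shows conv_integrable_pair: "integrable (lborel \<Otimes>\<^sub>M lborel) (\<lambda>(x, y). K y * F (x - y))"
    and conv_integral: "(LINT x|lborel. LINT y|lborel. K y * F (x - y)) = (LINT y|lborel. K y) * (LINT x|lborel. F x)"
proof -
  have [measurable]: "K \<in> borel_measurable borel" "F \<in> borel_measurable borel"
    using K F by (simp_all add: borel_measurable_integrable)
  have "integrable (lborel \<Otimes>\<^sub>M lborel) (\<lambda>(y, x). K y * F (x - y))"
  proof (rule lborel_pair.Fubini_integrable)
    show "(\<lambda>(y, x). K y * F (x - y)) \<in> borel_measurable (lborel \<Otimes>\<^sub>M lborel)" by measurable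
    have s: "integrable lborel (\<lambda>x. F (x - y))" for y using lborel_integrable_shift[OF F, of "- y"] by simp
    then show "AE y in lborel. integrable lborel (\<lambda>x. case (y, x) of (y, x) \<Rightarrow> K y * F (x - y))" by simp
    have "(LINT x|lborel. norm (K y * F (x - y))) = \<bar>K y\<bar> * (LINT x|lborel. \<bar>F x\<bar>)" for y
      using lborel_integral_shift[of "\<lambda>x. \<bar>F x\<bar>" "- y"] by (simp add: abs_mult)
    then show "integrable lborel (\<lambda>y. LINT x|lborel. norm (case (y, x) of (y, x) \<Rightarrow> K y * F (x - y)))"
      using K by simp
  qed
  from lborel_pair.integrable_product_swap[OF this]
  show *: "integrable (lborel \<Otimes>\<^sub>M lborel) (\<lambda>(x, y). K y * F (x - y))" by (simp add: split_beta')
  have "(LINT x|lborel. F (x - y)) = (LINT x|lborel. F x)" for y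
    using lborel_integral_shift[of F "- y"] by simp
  then show "(LINT x|lborel. LINT y|lborel. K y * F (x - y)) = (LINT y|lborel. K y) * (LINT x|lborel. F x)"
    using lborel_pair.Fubini_integral[OF *] by simp
qed

context conjugate_exponents
begin

text \<open>Young's inequality for the convolution of L^1 with L^p. Pointwise, |K * f|^p is at most
  2^p N^(p-1) times the convolution of |K| with |f|^p, as in Jensen's inequality for the measure
  |K(y)| dy of mass N; the factor 2 is the price of the additive inequality \<open>young\<close>.
  Integration in x then gives the bound.\<close>

lemma
  fixes f :: "'a::euclidean_space \<Rightarrow> complex"
  assumes K: "integrable lborel K" and fm [measurable]: "f \<in> borel_measurable borel"
    and f: "integrable lborel (\<lambda>x. norm (f x) powr p)"
  shows conv_AE_integrable: "AE x in lborel. integrable lborel (\<lambda>y. of_real (K y) * f (x - y))"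
    and conv_powr_integrable: "integrable lborel (\<lambda>x. norm (conv K f x) powr p)"
    and conv_powr_le: "(LINT x|lborel. norm (conv K f x) powr p) \<le> (2 * (LINT y|lborel. \<bar>K y\<bar>)) powr p * (LINT x|lborel. norm (f x) powr p)"
proof -
  define N where "N = (LINT y|lborel. \<bar>K y\<bar>)"
  have N0: "N \<ge> 0" unfolding N_def by simp
  have [measurable]: "K \<in> borel_measurable borel" using K by (simp add: borel_measurable_integrable)
  define I where "I x = (LINT y|lborel. \<bar>K y\<bar> * norm (f (x - y)) powr p)" for x
  have ip: "integrable (lborel \<Otimes>\<^sub>M lborel) (\<lambda>(x, y). \<bar>K y\<bar> * norm (f (x - y)) powr p)"
    using conv_integrable_pair[OF integrable_norm[OF K] f] by simp
  have iI: "integrable lborel I" unfolding I_def[abs_def] using lborel_pair.integrable_fst'[OF ip] by simp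
  have I0: "I x \<ge> 0" for x unfolding I_def by simp
  have II: "(LINT x|lborel. I x) = N * (LINT x|lborel. norm (f x) powr p)"
    unfolding I_def N_def using conv_integral[OF integrable_norm[OF K] f] by simp
  have *: "integrable lborel (\<lambda>y. of_real (K y) * f (x - y)) \<and> norm (conv K f x) powr p \<le> 2 powr p * N powr (p - 1) * I x"
    if i: "integrable lborel (\<lambda>y. \<bar>K y\<bar> * norm (f (x - y)) powr p)" for x
  proof
    have b: "norm (of_real (K y) * f (x - y)) \<le> r powr p * (\<bar>K y\<bar> * norm (f (x - y)) powr p) + r powr (- q) * \<bar>K y\<bar>" if "r > 0" for r y
      using mult_left_mono[OF young[of "norm (f (x - y))" 1 r], of "\<bar>K y\<bar>"] that by (simp add: norm_mult algebra_simps)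
    have ib: "integrable lborel (\<lambda>y. r powr p * (\<bar>K y\<bar> * norm (f (x - y)) powr p) + r powr (- q) * \<bar>K y\<bar>)" for r
      using i K by simp
    show ic: "integrable lborel (\<lambda>y. of_real (K y) * f (x - y))"
      by (rule integrable_le[OF ib[of 1] _ b]) auto
    have le: "norm (conv K f x) \<le> r powr p * I x + r powr (- q) * N" if "r > 0" for r
    proof -
      have "norm (conv K f x) \<le> (LINT y|lborel. r powr p * (\<bar>K y\<bar> * norm (f (x - y)) powr p) + r powr (- q) * \<bar>K y\<bar>)"
        unfolding conv_def by (rule order_trans[OF integral_norm_bound integral_mono[OF integrable_norm[OF ic] ib b[OF that]]])
      then show ?thesis using i K by (simp add: I_def N_def)
    qed
    \<comment> \<open>In the degenerate cases no balancing scale exists; letting r tend to 0 or to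
      infinity shows that the convolution vanishes at x.\<close>
    consider "N = 0" | "I x = 0" | "N > 0" "I x > 0" using N0 I0[of x] by fastforce
    then show "norm (conv K f x) powr p \<le> 2 powr p * N powr (p - 1) * I x"
    proof cases
      case 1
      have "((\<lambda>r. r powr p * I x) \<longlongrightarrow> 0 powr p * I x) (at_right 0)"
        using p0 by (intro tendsto_intros tendsto_powr') (auto simp: eventually_at_filter)
      then have "norm (conv K f x) \<le> 0 powr p * I x"
        using le 1 by (intro tendsto_lowerbound[of _ _ "at_right (0::real)"]) (auto simp: eventually_at_filter)
      then show ?thesis using I0[of x] by simp
    next
      case 2
      have "((\<lambda>r. r powr (- q) * N) \<longlongrightarrow> 0 * N) at_top"
        using q0 by (intro tendsto_mult tendsto_const tendsto_neg_powr filterlim_ident) auto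
      then have "norm (conv K f x) \<le> 0 * N"
        using le 2 by (intro tendsto_lowerbound[of _ _ "at_top :: real filter"]) (auto intro!: eventually_mono[OF eventually_gt_at_top[of 0]])
      then show ?thesis using I0[of x] by simp
    next
      case 3
      \<comment> \<open>This scale equates the two terms r^p * I x and r^(-q) * N; by 1/p + 1/q = 1
        both become N^(1/q) * (I x)^(1/p).\<close>
      define r where "r = (N / I x) powr (1 / (p + q))"
      have r: "r > 0" using 3 by (simp add: r_def)
      have e1: "r powr p * I x = N powr (1 / q) * I x powr (1 / p)"
      proof -
        have "p / (p + q) = 1 / q" using pq_sum p0 q0 by (simp add: field_simps)
        then have "r powr p = (N / I x) powr (1 / q)" using 3 by (simp add: r_def powr_powr)
        also have "\<dots> = N powr (1 / q) / I x powr (1 / q)" using 3 by (simp add: powr_divide)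
        finally have "r powr p * I x = N powr (1 / q) * (I x powr 1 / I x powr (1 / q))" using 3 by simp
        also have "I x powr 1 / I x powr (1 / q) = I x powr (1 / p)"
        proof -
          have "1 - 1 / q = 1 / p" using pq by linarith
          then show ?thesis by (simp only: powr_diff[symmetric])
        qed
        finally show ?thesis .
      qed
      have e2: "r powr (- q) * N = N powr (1 / q) * I x powr (1 / p)"
      proof -
        have "q / (p + q) = 1 / p" using pq_sum p0 q0 by (simp add: field_simps)
        then have "r powr (- q) = (N / I x) powr (- (1 / p))" using 3 by (simp add: r_def powr_powr)
        also have "\<dots> = I x powr (1 / p) / N powr (1 / p)" using 3 by (simp add: powr_divide powr_minus field_simps)
        finally have "r powr (- q) * N = I x powr (1 / p) * (N powr 1 / N powr (1 / p))" using 3 by simp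
        also have "N powr 1 / N powr (1 / p) = N powr (1 / q)"
        proof -
          have "1 - 1 / p = 1 / q" using pq by linarith
          then show ?thesis by (simp only: powr_diff[symmetric])
        qed
        finally show ?thesis by simp
      qed
      have "norm (conv K f x) \<le> 2 * (N powr (1 / q) * I x powr (1 / p))" using le[OF r] e1 e2 by simp
      then have "norm (conv K f x) powr p \<le> (2 * (N powr (1 / q) * I x powr (1 / p))) powr p"
        using p0 by (intro powr_mono2) auto
      also have "\<dots> = 2 powr p * (N powr (p / q) * I x)" using 3 p0 by (simp add: powr_mult powr_powr)
      also have "p / q = p - 1" using p1 unfolding q_eq by simp
      finally show ?thesis by (simp add: mult.assoc)
    qed
  qed
  have AE: "AE x in lborel. integrable lborel (\<lambda>y. \<bar>K y\<bar> * norm (f (x - y)) powr p)"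
    using lborel_pair.AE_integrable_fst'[OF ip] by simp
  then show "AE x in lborel. integrable lborel (\<lambda>y. of_real (K y) * f (x - y))" by eventually_elim (use * in blast)
  have cm [measurable]: "conv K f \<in> borel_measurable borel" by (rule conv_measurable) measurable
  have iI2: "integrable lborel (\<lambda>x. 2 powr p * N powr (p - 1) * I x)" using iI by simp
  have ae: "AE x in lborel. norm (norm (conv K f x) powr p) \<le> norm (2 powr p * N powr (p - 1) * I x)"
    using AE by eventually_elim (use * I0 in \<open>auto simp: abs_mult\<close>)
  show ic: "integrable lborel (\<lambda>x. norm (conv K f x) powr p)"
    by (rule Bochner_Integration.integrable_bound[OF iI2 _ ae]) measurable
  have "(LINT x|lborel. norm (conv K f x) powr p) \<le> (LINT x|lborel. 2 powr p * N powr (p - 1) * I x)"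
    by (rule integral_mono_AE[OF ic iI2]) (use AE in \<open>eventually_elim, use * in blast\<close>)
  also have "\<dots> = 2 powr p * (N powr (p - 1) * N) * (LINT x|lborel. norm (f x) powr p)" using II by simp
  also have "N powr (p - 1) * N = N powr p" using N0 powr_add[of N "p - 1" 1] by (cases "N = 0") auto
  finally show "(LINT x|lborel. norm (conv K f x) powr p) \<le> (2 * (LINT y|lborel. \<bar>K y\<bar>)) powr p * (LINT x|lborel. norm (f x) powr p)"
    using N0 by (simp add: powr_mult N_def[symmetric])
qed

lemma conv_mult_integrable_pair:
  fixes f g :: "'a::euclidean_space \<Rightarrow> complex"
  assumes K: "integrable lborel K"
    and [measurable]: "f \<in> borel_measurable borel" "g \<in> borel_measurable borel"
    and f: "integrable lborel (\<lambda>x. norm (f x) powr p)" and g: "integrable lborel (\<lambda>x. norm (g x) powr q)"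
  shows "integrable (lborel \<Otimes>\<^sub>M lborel) (\<lambda>(x, y). of_real (K y) * f (x - y) * g x)"
proof -
  have [measurable]: "K \<in> borel_measurable borel" using K by (simp add: borel_measurable_integrable)
  have i1: "integrable (lborel \<Otimes>\<^sub>M lborel) (\<lambda>(x, y). \<bar>K y\<bar> * norm (f (x - y)) powr p)"
    using conv_integrable_pair[OF integrable_norm[OF K] f] by simp
  have i2: "integrable (lborel \<Otimes>\<^sub>M lborel) (\<lambda>(x, y). norm (g x) powr q * \<bar>K y\<bar>)"
    by (rule fubini_bounded_integrable[OF _ g integrable_norm[OF K]]) auto
  show ?thesis
  proof (rule integrable_le[OF Bochner_Integration.integrable_add[OF i1 i2]])
    show "norm (case xy of (x, y) \<Rightarrow> of_real (K y) * f (x - y) * g x) \<le>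
      (case xy of (x, y) \<Rightarrow> \<bar>K y\<bar> * norm (f (x - y)) powr p) + (case xy of (x, y) \<Rightarrow> norm (g x) powr q * \<bar>K y\<bar>)" for xy
      using mult_left_mono[OF young[of "norm (f (fst xy - snd xy))" "norm (g (fst xy))" 1], of "\<bar>K (snd xy)\<bar>"]
      by (simp add: split_beta' norm_mult algebra_simps)
  qed measurable
qed

end

text \<open>Fubini, a translation and the reflection y -> -y: evenness of \<open>K\<close> makes
  convolution symmetric for the bilinear pairing. Absolute convergence is taken from
  \<open>conv_mult_integrable_pair\<close>, once with the exponents in either role.\<close>

lemma conv_duality:
  fixes f g :: "'a::euclidean_space \<Rightarrow> complex"
  assumes pq: "conjugate_exponents p q" and K: "integrable lborel K" and even: "\<And>y. K (- y) = K y"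
    and [measurable]: "f \<in> borel_measurable borel" "g \<in> borel_measurable borel"
    and f: "integrable lborel (\<lambda>x. norm (f x) powr p)" and g: "integrable lborel (\<lambda>x. norm (g x) powr q)"
  shows "(LINT x|lborel. conv K f x * g x) = (LINT x|lborel. f x * conv K g x)"
proof -
  have [measurable]: "K \<in> borel_measurable borel" using K by (simp add: borel_measurable_integrable)
  note int1 = conjugate_exponents.conv_mult_integrable_pair[OF pq K _ _ f g]
  note int2 = conjugate_exponents.conv_mult_integrable_pair[OF conjugate_exponents_swap[OF pq] K _ _ g f]
  have "(LINT x|lborel. conv K f x * g x) = (LINT x|lborel. LINT y|lborel. of_real (K y) * f (x - y) * g x)"
    by (simp add: conv_def)
  also have "\<dots> = (LINT y|lborel. LINT x|lborel. of_real (K y) * f (x - y) * g x)"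
    using lborel_pair.Fubini_integral[OF int1] by simp
  also have "\<dots> = (LINT y|lborel. LINT x|lborel. of_real (K y) * f x * g (y + x))"
  proof (rule Bochner_Integration.integral_cong[OF refl])
    show "(LINT x|lborel. of_real (K y) * f (x - y) * g x) = (LINT x|lborel. of_real (K y) * f x * g (y + x))" for y
      using lborel_integral_shift[of "\<lambda>x. of_real (K y) * f (x - y) * g x" y] by simp
  qed
  also have "\<dots> = (LINT y|lborel. LINT x|lborel. of_real (K y) * g (x - y) * f x)"
  proof -
    have "(\<lambda>y. LINT x|lborel. of_real (K y) * f x * g (y + x)) \<in> borel_measurable borel"
      by (intro lborel.borel_measurable_lebesgue_integral) measurable
    then have "(LINT y|lborel. LINT x|lborel. of_real (K y) * f x * g (y + x)) = (LINT y|lborel. LINT x|lborel. of_real (K (0 - y)) * f x * g (0 - y + x))"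
      by (rule lborel_integral_reflect[symmetric])
    then show ?thesis by (simp add: even mult_ac)
  qed
  also have "\<dots> = (LINT x|lborel. f x * conv K g x)"
    using lborel_pair.Fubini_integral[OF int2] by (simp add: conv_def mult.commute)
  finally show ?thesis .
qed

section \<open>Density of smoothed continuous functions in L^p\<close>

lemma ex_continuous_approx:
  fixes f :: "'a::euclidean_space \<Rightarrow> 'b::euclidean_space"
  assumes "f \<in> borel_measurable lebesgue"
  obtains g where "\<And>n::nat. continuous_on UNIV (g n)" "AE x in lborel. (\<lambda>n. g n x) \<longlonglongrightarrow> f x"
proof -
  have "f measurable_on UNIV" using assms by (intro lebesgue_measurable_imp_measurable_on) auto
  then obtain N g where N: "negligible N" "\<And>n. continuous_on UNIV (g n)" "\<And>x. x \<notin> N \<Longrightarrow> (\<lambda>n. g n x) \<longlonglongrightarrow> f x"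
    unfolding measurable_on_def by auto
  have "AE x in lebesgue. x \<notin> N" using N(1) by (simp add: negligible_iff_null_sets AE_not_in)
  then have "AE x in lborel. x \<notin> N" by (simp add: AE_completion_iff)
  then have "AE x in lborel. (\<lambda>n. g n x) \<longlonglongrightarrow> f x" by eventually_elim (rule N)
  with N(2) that show ?thesis by blast
qed

text \<open>For r > 0 this is the radial retraction onto the closed ball of radius \<open>r\<close>,
  written as one continuous formula.\<close>

definition clip :: "real \<Rightarrow> 'b::real_normed_vector \<Rightarrow> 'b" where "clip r z = (r / max r (norm z)) *\<^sub>R z"

definition cutoff :: "real \<Rightarrow> 'a::real_normed_vector \<Rightarrow> real" where "cutoff r x = max 0 (min 1 (r + 1 - norm x))"

lemma cutoff_simps: "norm x \<le> r \<Longrightarrow> cutoff r x = 1" "norm x \<ge> r + 1 \<Longrightarrow> cutoff r x = 0"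
  and cutoff_bounds: "0 \<le> cutoff r x" "cutoff r x \<le> 1"
  unfolding cutoff_def by auto

lemma clip_eq: "r > 0 \<Longrightarrow> norm z \<le> r \<Longrightarrow> clip r z = z" by (simp add: clip_def max_def)

lemma norm_clip_le: "r > 0 \<Longrightarrow> norm (clip r z) \<le> r"
  by (simp add: clip_def max_def field_simps)

lemma continuous_clip: "r > 0 \<Longrightarrow> continuous_on S (clip r)"
  unfolding clip_def[abs_def] by (intro continuous_intros) auto

lemma continuous_cutoff: "continuous_on S (cutoff r)"
  unfolding cutoff_def[abs_def] by (intro continuous_intros)

lemma norm_cutoff_clip_le:
  assumes "r > 0" shows "norm (cutoff r x *\<^sub>R clip r z) \<le> r * indicator (cball 0 (r + 1)) x"
proof (cases "norm x \<le> r + 1")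
  case True
  have "cutoff r x * norm (clip r z) \<le> 1 * r"
    using cutoff_bounds[of r x] norm_clip_le[OF assms, of z] by (intro mult_mono) auto
  then show ?thesis using True cutoff_bounds[of r x] by simp
qed (simp add: cutoff_simps)

text \<open>For t \<le> 1 one has 1 + |x| \<le> (1 + |x - sqrt t * y|) (1 + |y|), so polynomial
  decay survives at the cost of a moment of \<open>heat 1\<close>. The bound does not depend on
  \<open>t\<close>, as dominated convergence requires.\<close>

lemma heat_convolution_decay:
  fixes h :: "'a::euclidean_space \<Rightarrow> complex"
  assumes [measurable]: "h \<in> borel_measurable borel" and h: "\<And>x. norm (h x) \<le> C / (1 + norm x) ^ k"
    and t: "0 < t" "t \<le> 1"
  shows "norm (LINT y|lborel. of_real (heat t (x - y)) * h y) \<le>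
    C * (LINT y|lborel. heat 1 (y :: 'a) * (1 + norm y) ^ k) / (1 + norm x) ^ k"
proof -
  have pos: "1 + norm z > 0" for z :: 'a by (simp add: add_pos_nonneg)
  have C: "C \<ge> 0" using h[of 0] norm_ge_zero[of "h 0"] by (simp del: norm_ge_zero)
  have "(\<lambda>y::'a. complex_of_real (exp (- (1/4 * (norm y)\<^sup>2)))) \<in> rapid"
    by (intro schwartz_rapid schwartz_gaussian) simp
  then have "integrable lborel (\<lambda>y::'a. (1 + norm y) ^ k * exp (- (1/4 * (norm y)\<^sup>2)))"
    unfolding rapid_def by simp
  from integrable_mult_right[OF this, of "1 / sqrt (4 * pi) ^ DIM('a)"]
  have i: "integrable lborel (\<lambda>y::'a. heat 1 y * (1 + norm y) ^ k)"
    by (simp add: heat_def mult_ac)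
  have "norm (LINT y|lborel. of_real (heat t (x - y)) * h y) \<le> (LINT y|lborel. norm (of_real (heat 1 y) * h (x - sqrt t *\<^sub>R y)))"
    unfolding heat_convolution_scale[OF \<open>h \<in> _\<close> t(1)] by (rule integral_norm_bound)
  also have "\<dots> \<le> (LINT y|lborel. C / (1 + norm x) ^ k * (heat 1 (y :: 'a) * (1 + norm y) ^ k))"
  proof (rule integral_mono')
    show "integrable lborel (\<lambda>y::'a. C / (1 + norm x) ^ k * (heat 1 y * (1 + norm y) ^ k))" using i by simp
    show b: "norm (of_real (heat 1 y) * h (x - sqrt t *\<^sub>R y)) \<le> C / (1 + norm x) ^ k * (heat 1 y * (1 + norm y) ^ k)" for y
    proof -
      have "norm x \<le> norm (x - sqrt t *\<^sub>R y) + norm (sqrt t *\<^sub>R y)" using norm_triangle_ineq[of "x - sqrt t *\<^sub>R y" "sqrt t *\<^sub>R y"] by simp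
      moreover have "norm (sqrt t *\<^sub>R y) \<le> norm y" using t by (simp add: mult_left_le_one_le)
      moreover have "0 \<le> norm (x - sqrt t *\<^sub>R y) * norm y" by simp
      ultimately have "1 + norm x \<le> (1 + norm (x - sqrt t *\<^sub>R y)) * (1 + norm y)"
        unfolding distrib_left distrib_right by linarith
      then have "(1 + norm x) ^ k \<le> ((1 + norm (x - sqrt t *\<^sub>R y)) * (1 + norm y)) ^ k" by (rule power_mono) simp
      then have "C / (1 + norm (x - sqrt t *\<^sub>R y)) ^ k \<le> C / (1 + norm x) ^ k * (1 + norm y) ^ k"
        using C pos[of x] pos[of "x - sqrt t *\<^sub>R y"] pos[of y]
        by (simp add: power_mult_distrib divide_le_eq mult_left_mono mult.assoc pos_le_divide_eq mult.commute)
      with h[of "x - sqrt t *\<^sub>R y"] have "norm (h (x - sqrt t *\<^sub>R y)) \<le> C / (1 + norm x) ^ k * (1 + norm y) ^ k" by linarith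
      from mult_left_mono[OF this heat_nonneg[of 1 y]] show ?thesis by (simp add: norm_mult heat_nonneg mult_ac)
    qed
    show "0 \<le> C / (1 + norm x) ^ k * (heat 1 y * (1 + norm y) ^ k)" for y :: 'a
      using order_trans[OF norm_ge_zero b] .
  qed
  also have "\<dots> = C * (LINT y|lborel. heat 1 (y :: 'a) * (1 + norm y) ^ k) / (1 + norm x) ^ k" by simp
  finally show ?thesis .
qed

lemma bounded_support_decay:
  fixes h :: "'a::real_normed_vector \<Rightarrow> 'b::real_normed_vector"
  assumes "\<And>x. norm (h x) \<le> B" "\<And>x. norm x > R \<Longrightarrow> h x = 0" "R \<ge> 0"
  shows "norm (h x) \<le> B * (1 + R) ^ k / (1 + norm x) ^ k"
proof -
  have B: "0 \<le> B" using assms(1)[of 0] norm_ge_zero order_trans by blast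
  have pos: "0 < (1 + norm x) ^ k" by (simp add: add_pos_nonneg)
  show ?thesis
  proof (cases "norm x \<le> R")
    case True
    then have "(1 + norm x) ^ k \<le> (1 + R) ^ k" by (intro power_mono) auto
    then have "norm (h x) * (1 + norm x) ^ k \<le> B * (1 + R) ^ k" using assms(1)[of x] B pos by (intro mult_mono) auto
    then show ?thesis using pos by (simp add: pos_le_divide_eq)
  qed (use assms B in auto)
qed

lemma bounded_support_rapid:
  fixes h :: "'a::euclidean_space \<Rightarrow> complex"
  assumes [measurable]: "h \<in> borel_measurable borel" and "\<And>x. norm (h x) \<le> B" "\<And>x. norm x > R \<Longrightarrow> h x = 0" "R \<ge> 0"
  shows "h \<in> rapid"
proof -
  have "integrable lborel (\<lambda>x. (1 + norm x) ^ k * norm (h x))" for k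
  proof (rule decay_integrable)
    fix x :: 'a
    have pos: "0 < (1 + norm x) ^ (2 * DIM('a) + k)" by (simp add: add_pos_nonneg)
    show "(1 + norm x) ^ (2 * DIM('a)) * norm ((1 + norm x) ^ k * norm (h x)) \<le> B * (1 + R) ^ (2 * DIM('a) + k)"
      using bounded_support_decay[of h B R x "2 * DIM('a) + k"] assms pos
      by (simp add: pos_le_divide_eq power_add mult_ac)
  qed measurable
  then show ?thesis unfolding rapid_def by simp
qed

text \<open>The average is the inverse transform of a slowly increasing function times a Gaussian,
  and that product is a Schwartz function even when \<open>h\<close> is not smooth.\<close>

lemma heat_convolution_schwartz:
  fixes h :: "'a::euclidean_space \<Rightarrow> complex"
  assumes "h \<in> rapid" "t > 0"
  shows "(\<lambda>x. LINT y|lborel. of_real (heat t (x - y)) * h y) \<in> schwartz"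
proof -
  have "(\<lambda>\<xi>. fourier h \<xi> * of_real (exp (- (t * (norm \<xi>)\<^sup>2)))) \<in> schwartz"
    using assms by (intro schwartz_mult schwartz_gaussian fourier_slowly_increasing)
  then have "(\<lambda>\<xi>. of_real (exp (- (t * (norm \<xi>)\<^sup>2))) * fourier h \<xi>) \<in> schwartz" by (simp add: mult.commute)
  from inv_fourier_schwartz[OF this] show ?thesis
    unfolding inv_fourier_gauss[OF rapid_integrable[OF assms(1)] assms(2), abs_def] .
qed

lemma continuous_bounded_support:
  fixes h :: "'a::euclidean_space \<Rightarrow> complex"
  assumes h: "continuous_on UNIV h" "\<And>x. norm x > R \<Longrightarrow> h x = 0"
  obtains B where "\<And>x. norm (h x) \<le> B"
proof -
  have "compact (h ` cball 0 R)" using h by (intro compact_continuous_image) (auto intro: continuous_on_subset)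
  then have "bounded (h ` cball 0 R)" by (rule compact_imp_bounded)
  then obtain B where "\<forall>y\<in>h ` cball 0 R. norm y \<le> B" unfolding bounded_iff by blast
  then have B: "norm x \<le> R \<Longrightarrow> norm (h x) \<le> B" for x by auto
  have "norm (h x) \<le> max B 0" for x using B[of x] h(2)[of x] by (cases "norm x \<le> R") auto
  then show ?thesis using that by blast
qed

lemma continuous_compact_support_rapid:
  fixes h :: "'a::euclidean_space \<Rightarrow> complex"
  assumes h: "continuous_on UNIV h" "\<And>x. norm x > R \<Longrightarrow> h x = 0"
  shows "h \<in> rapid"
proof -
  obtain B where "\<And>x. norm (h x) \<le> B" using continuous_bounded_support[OF h] by blast
  then show ?thesis using h by (intro bounded_support_rapid[of h B "max R 0"] borel_measurable_continuous_onI) auto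
qed

lemma heat_convolution_Lp_tendsto:
  fixes h :: "'a::euclidean_space \<Rightarrow> complex"
  assumes h: "continuous_on UNIV h" "\<And>x. norm x > R \<Longrightarrow> h x = 0" and p: "p \<ge> 1"
    and t: "\<And>n. 0 < t n" "\<And>n. t n \<le> 1" "t \<longlonglongrightarrow> 0"
  shows "(\<lambda>n. LINT x|lborel. norm (h x - (LINT y|lborel. of_real (heat (t n) (x - y)) * h y)) powr p) \<longlonglongrightarrow> 0"
proof -
  obtain B where B: "\<And>x. norm (h x) \<le> B" using continuous_bounded_support[OF h] by blast
  have hm [measurable]: "h \<in> borel_measurable borel" using h by (intro borel_measurable_continuous_onI)
  define k where "k = 2 * DIM('a)"
  define C where "C = B * (1 + max R 0) ^ k"
  define C' where "C' = C + C * (LINT y|lborel. heat 1 (y :: 'a) * (1 + norm y) ^ k)"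
  define W where "W n x = (LINT y|lborel. of_real (heat (t n) (x - y)) * h y)" for n x
  have d1: "norm (h x) \<le> C / (1 + norm x) ^ k" for x
    unfolding C_def using B h by (intro bounded_support_decay) auto
  have d2: "norm (W n x) \<le> C * (LINT y|lborel. heat 1 (y :: 'a) * (1 + norm y) ^ k) / (1 + norm x) ^ k" for n x
    unfolding W_def by (rule heat_convolution_decay[OF hm d1 t(1,2)])
  have d: "norm (h x - W n x) \<le> C' * (1 / (1 + norm x) ^ k)" for n x
    using norm_triangle_ineq4[of "h x" "W n x"] d1[of x] d2[of n x] by (simp add: C'_def add_divide_distrib)
  have C': "C' \<ge> 0" using order_trans[OF norm_ge_zero d[of 0]] by simp
  have Wm [measurable]: "W n \<in> borel_measurable borel" for n
    unfolding W_def[abs_def] by (intro lborel.borel_measurable_lebesgue_integral) measurable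
  have "(\<lambda>n. LINT x|lborel. norm (h x - W n x) powr p) \<longlonglongrightarrow> (LINT x|(lborel::'a measure). 0)"
  proof (rule integral_dominated_convergence[where w = "\<lambda>x. C' powr p * (1 / (1 + norm x) ^ k)"])
    show "AE x in lborel. (\<lambda>n. norm (h x - W n x) powr p) \<longlonglongrightarrow> 0"
    proof (rule AE_I2)
      fix x
      have "(\<lambda>n. norm (h x - W n x) powr p) \<longlonglongrightarrow> norm (h x - h x) powr p"
        unfolding W_def using p by (intro tendsto_powr' tendsto_intros heat_convolution_tendsto[OF h(1) B t(1,3)]) auto
      then show "(\<lambda>n. norm (h x - W n x) powr p) \<longlonglongrightarrow> 0" by simp
    qed
    show "AE x in lborel. norm (norm (h x - W n x) powr p) \<le> C' powr p * (1 / (1 + norm x) ^ k)" for n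
    proof (rule AE_I2)
      fix x :: 'a
      have o: "1 \<le> (1 + norm x) ^ k" by simp
      have "norm (h x - W n x) powr p \<le> (C' * (1 / (1 + norm x) ^ k)) powr p"
        using p d[of x n] by (intro powr_mono2) auto
      also have "\<dots> = C' powr p * (1 / (1 + norm x) ^ k) powr p" using C' by (subst powr_mult) auto
      \<comment> \<open>The base is at most 1 and p \<ge> 1, so the exponent may be lowered to 1,
        where \<open>integrable_decay\<close> applies.\<close>
      also have "(1 / (1 + norm x) ^ k) powr p \<le> (1 / (1 + norm x) ^ k) powr 1"
        using p o by (intro powr_mono') (auto simp: divide_le_eq)
      also have "\<dots> = 1 / (1 + norm x) ^ k" using o by simp
      finally show "norm (norm (h x - W n x) powr p) \<le> C' powr p * (1 / (1 + norm x) ^ k)" by (simp add: mult_left_mono)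
    qed
  qed (use integrable_mult_right[OF integrable_decay[where 'a = 'a]] k_def in auto)
  then show ?thesis unfolding W_def by simp
qed

text \<open>Truncation in value and in domain, continuous approximation of the truncated function,
  heat smoothing. The approximant is returned in the explicit form of a heat average because the
  uniqueness argument moves the heat kernel onto the other factor of the pairing.\<close>

lemma Lp_dense:
  fixes f :: "'a::euclidean_space \<Rightarrow> complex"
  assumes p: "p \<ge> 1" and fm [measurable]: "f \<in> borel_measurable borel" and f: "integrable lborel (\<lambda>x. norm (f x) powr p)"
    and e: "e > 0"
  obtains h R t where "continuous_on UNIV h" "\<And>x. norm x > R \<Longrightarrow> h x = 0" "t > 0"
    "(LINT x|lborel. norm (f x - (LINT y|lborel. of_real (heat t (x - y)) * h y)) powr p) < e"
proof -
  \<comment> \<open>Three errors below \<epsilon> are combined by two applications of the inequality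
    with constant \<open>2 powr p\<close>; this choice makes the total e / 2.\<close>
  define \<epsilon> where "\<epsilon> = e / (2 * (2 powr p * (1 + 2 * 2 powr p)))"
  have P: "2 powr p > 0" by simp
  have \<epsilon>: "\<epsilon> > 0" using e P by (simp add: \<epsilon>_def add_pos_pos)
  obtain g where g: "\<And>n::nat. continuous_on UNIV (g n)" "AE x in lborel. (\<lambda>n. g n x) \<longlonglongrightarrow> f x"
    using ex_continuous_approx[OF measurable_completion[of f lborel borel]] by auto
  define F where "F k x = cutoff k x *\<^sub>R clip k (f x)" for k x
  note clipm [measurable] = borel_measurable_continuous_onI[OF continuous_clip] and cutm [measurable] = borel_measurable_continuous_onI[OF continuous_cutoff]
  have Fm [measurable]: "F k \<in> borel_measurable borel" if "k > 0" for k
    unfolding F_def[abs_def] using measurable_compose[OF fm clipm[OF that]] by measurable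
  have Fle: "norm (f x - F k x) \<le> norm (f x)" if "k > 0" for k x
  proof -
    define \<theta> where "\<theta> = cutoff k x * (k / max k (norm (f x)))"
    have "0 \<le> k / max k (norm (f x))" "k / max k (norm (f x)) \<le> 1" using that by (auto simp: divide_le_eq)
    then have "0 \<le> \<theta>" "\<theta> \<le> 1"
      unfolding \<theta>_def by (simp_all only: mult_nonneg_nonneg mult_le_one cutoff_bounds)
    moreover have "f x - F k x = (1 - \<theta>) *\<^sub>R f x" by (simp add: F_def clip_def \<theta>_def algebra_simps)
    ultimately show ?thesis by (simp add: mult_left_le_one_le)
  qed
  have "(\<lambda>n. LINT x|lborel. norm (f x - F (real (Suc n)) x) powr p) \<longlonglongrightarrow> (LINT x|(lborel::'a measure). 0)"
  proof (rule integral_dominated_convergence[OF _ _ f])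
    show "AE x in lborel. (\<lambda>n. norm (f x - F (real (Suc n)) x) powr p) \<longlonglongrightarrow> 0"
    proof (intro AE_I2 tendsto_eventually)
      fix x
      obtain N where N: "max (norm x) (norm (f x)) \<le> real N" using real_arch_simple by blast
      have "norm (f x - F (real (Suc n)) x) powr p = 0" if "n \<ge> N" for n
        using N that by (simp add: F_def cutoff_simps clip_eq)
      then show "\<forall>\<^sub>F n in sequentially. norm (f x - F (real (Suc n)) x) powr p = 0" unfolding eventually_sequentially by blast
    qed
    show "AE x in lborel. norm (norm (f x - F (real (Suc n)) x) powr p) \<le> norm (f x) powr p" for n
      using p Fle by (auto intro!: powr_mono2)
  qed (use Fm[of "real (Suc _)"] in measurable)
  then have "eventually (\<lambda>n. (LINT x|lborel. norm (f x - F (real (Suc n)) x) powr p) < \<epsilon>) sequentially"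
    using \<epsilon> by (intro order_tendstoD) auto
  then obtain n0 where n0: "(LINT x|lborel. norm (f x - F (real (Suc n0)) x) powr p) < \<epsilon>"
    using eventually_happens'[OF trivial_limit_sequentially] by blast
  define k where "k = real (Suc n0)"
  have k: "k > 0" by (simp add: k_def)
  note [measurable] = Fm[OF k]
  \<comment> \<open>The truncation is applied to the continuous approximants as well, so that their
    almost everywhere convergence becomes bounded and takes place inside one ball.\<close>
  define H where "H n x = cutoff k x *\<^sub>R clip k (g n x)" for n x
  have Hc: "continuous_on UNIV (H n)" for n
    unfolding H_def[abs_def]
    by (intro continuous_intros continuous_cutoff continuous_on_compose2[OF continuous_clip[OF k, of UNIV]] g) auto
  then have Hm [measurable]: "H n \<in> borel_measurable borel" for n by (rule borel_measurable_continuous_onI)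
  have H0: "norm x > k + 1 \<Longrightarrow> H n x = 0" for n x by (simp add: H_def cutoff_simps)
  have ind: "integrable lborel (\<lambda>x::'a. indicat_real (cball 0 (k + 1)) x)"
    by (intro integrable_real_indicator) (auto simp: emeasure_bounded_finite[OF bounded_cball, simplified])
  have "(\<lambda>n. LINT x|lborel. norm (F k x - H n x) powr p) \<longlonglongrightarrow> (LINT x|(lborel::'a measure). 0)"
  proof (rule integral_dominated_convergence[where w = "\<lambda>x. (2 * k) powr p * indicat_real (cball 0 (k + 1)) x"])
    show "AE x in lborel. (\<lambda>n. norm (F k x - H n x) powr p) \<longlonglongrightarrow> 0"
      using g(2)
    proof eventually_elim
      case (elim x)
      have "continuous_on UNIV (clip k :: complex \<Rightarrow> complex)" by (rule continuous_clip[OF k])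
      then have "isCont (clip k) (f x)" by (simp add: continuous_on_eq_continuous_at)
      then have "(\<lambda>n. clip k (g n x)) \<longlonglongrightarrow> clip k (f x)" using elim by (rule isCont_tendsto_compose)
      then have "(\<lambda>n. norm (F k x - H n x) powr p) \<longlonglongrightarrow> norm (F k x - F k x) powr p"
        unfolding H_def F_def using p by (intro tendsto_powr' tendsto_intros) auto
      then show ?case by simp
    qed
    show "AE x in lborel. norm (norm (F k x - H n x) powr p) \<le> (2 * k) powr p * indicat_real (cball 0 (k + 1)) x" for n
    proof (rule AE_I2)
      fix x :: 'a
      have "norm (F k x - H n x) \<le> 2 * k * indicator (cball 0 (k + 1)) x"
        unfolding F_def H_def using norm_triangle_ineq4[of "cutoff k x *\<^sub>R clip k (f x)" "cutoff k x *\<^sub>R clip k (g n x)"]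
          norm_cutoff_clip_le[OF k, of x "f x"] norm_cutoff_clip_le[OF k, of x "g n x"] by linarith
      then have "norm (F k x - H n x) powr p \<le> (2 * k * indicator (cball 0 (k + 1)) x) powr p"
        using p by (intro powr_mono2) auto
      then show "norm (norm (F k x - H n x) powr p) \<le> (2 * k) powr p * indicat_real (cball 0 (k + 1)) x"
        using p k by (auto simp: indicator_def split: if_splits)
    qed
  qed (use ind in auto)
  then have "eventually (\<lambda>n. (LINT x|lborel. norm (F k x - H n x) powr p) < \<epsilon>) sequentially"
    using \<epsilon> by (intro order_tendstoD) auto
  then obtain n1 where n1: "(LINT x|lborel. norm (F k x - H n1 x) powr p) < \<epsilon>"
    using eventually_happens'[OF trivial_limit_sequentially] by blast
  define t where "t n = 1 / real (Suc n)" for n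
  have t: "0 < t n" "t n \<le> 1" for n by (auto simp: t_def)
  have t0: "t \<longlonglongrightarrow> 0" unfolding t_def by real_asymp
  define W where "W n x = (LINT y|lborel. of_real (heat (t n) (x - y)) * H n1 y)" for n x
  have "(\<lambda>n. LINT x|lborel. norm (H n1 x - W n x) powr p) \<longlonglongrightarrow> 0"
    unfolding W_def by (rule heat_convolution_Lp_tendsto[OF Hc H0 p t t0])
  then have "eventually (\<lambda>n. (LINT x|lborel. norm (H n1 x - W n x) powr p) < \<epsilon>) sequentially"
    using \<epsilon> by (intro order_tendstoD) auto
  then obtain n2 where n2: "(LINT x|lborel. norm (H n1 x - W n2 x) powr p) < \<epsilon>"
    using eventually_happens'[OF trivial_limit_sequentially] by blast
  have WS: "W n2 \<in> schwartz"
    unfolding W_def[abs_def] by (rule heat_convolution_schwartz[OF continuous_compact_support_rapid[OF Hc H0] t(1)])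
  note [measurable] = schwartz_measurable[OF WS]
  have p0: "p \<ge> 0" using p by simp
  have "norm (norm (f x - F k x) powr p) \<le> norm (f x) powr p" for x
    using powr_mono2[OF p0 norm_ge_zero Fle[OF k]] by simp
  then have i0: "integrable lborel (\<lambda>x. norm (f x - F k x) powr p)" by (intro integrable_le[OF f]) auto
  have iF: "integrable lborel (\<lambda>x. norm (F k x) powr p)"
    using integrable_powr_diff[OF p0 _ _ f i0] by simp
  have iH: "integrable lborel (\<lambda>x. norm (H n1 x) powr p)"
  proof (rule integrable_le[where g = "\<lambda>x. k powr p * indicat_real (cball 0 (k + 1)) x"])
    show "norm (norm (H n1 x) powr p) \<le> k powr p * indicat_real (cball 0 (k + 1)) x" for x
    proof -
      have "norm (H n1 x) powr p \<le> (k * indicator (cball 0 (k + 1)) x) powr p"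
        unfolding H_def using p norm_cutoff_clip_le[OF k] by (intro powr_mono2) auto
      then show ?thesis using p k by (auto simp: indicator_def split: if_splits)
    qed
  qed (use ind in auto)
  have iW: "integrable lborel (\<lambda>x. norm (W n2 x) powr p)" by (rule schwartz_powr_integrable[OF WS p])
  have i1: "integrable lborel (\<lambda>x. norm (f x - F k x) powr p)" by (rule integrable_powr_diff[OF p0 _ _ f iF]) auto
  have i2: "integrable lborel (\<lambda>x. norm (F k x - H n1 x) powr p)" by (rule integrable_powr_diff[OF p0 _ _ iF iH]) auto
  have i3: "integrable lborel (\<lambda>x. norm (H n1 x - W n2 x) powr p)" by (rule integrable_powr_diff[OF p0 _ _ iH iW]) auto
  have i4: "integrable lborel (\<lambda>x. norm (F k x - W n2 x) powr p)" by (rule integrable_powr_diff[OF p0 _ _ iF iW]) auto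
  have "(LINT x|lborel. norm (F k x - W n2 x) powr p) \<le> 2 powr p * ((LINT x|lborel. norm (F k x - H n1 x) powr p) + (LINT x|lborel. norm (H n1 x - W n2 x) powr p))"
    using integral_powr_add_le[OF p0 _ _ i2 i3] by simp
  also have "\<dots> \<le> 2 powr p * (\<epsilon> + \<epsilon>)" using n1 n2 by (intro mult_left_mono) auto
  finally have le1: "(LINT x|lborel. norm (F k x - W n2 x) powr p) \<le> 2 powr p * (\<epsilon> + \<epsilon>)" .
  have "(LINT x|lborel. norm (f x - W n2 x) powr p) \<le> 2 powr p * ((LINT x|lborel. norm (f x - F k x) powr p) + (LINT x|lborel. norm (F k x - W n2 x) powr p))"
    using integral_powr_add_le[OF p0 _ _ i1 i4] by simp
  also have "\<dots> \<le> 2 powr p * (\<epsilon> + 2 powr p * (\<epsilon> + \<epsilon>))" using n0 le1 unfolding k_def[symmetric] by (intro mult_left_mono) auto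
  also have "\<dots> = e / 2"
  proof -
    define D where "D = 2 powr p * (1 + 2 * 2 powr p)"
    have D: "D > 0" by (simp add: D_def add_pos_pos)
    have "2 powr p * (\<epsilon> + 2 powr p * (\<epsilon> + \<epsilon>)) = \<epsilon> * D" by (simp add: D_def algebra_simps)
    also have "\<dots> = e / 2" using D by (simp add: \<epsilon>_def D_def[symmetric])
    finally show ?thesis .
  qed
  finally have "(LINT x|lborel. norm (f x - W n2 x) powr p) < e" using e by simp
  then show ?thesis using that[OF Hc H0 t(1)] unfolding W_def by blast
qed

text \<open>The function g = cnj (sgn f) * |f|^(p-1) lies in L^q, since (p - 1) q = p, and f * g =
  |f|^p. Approximating g in L^q by the admissible test functions shows that the integral of |f|^p
  vanishes.\<close>

lemma (in conjugate_exponents) Lp_eq_zeroI: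
  fixes f :: "'a::euclidean_space \<Rightarrow> complex"
  assumes fm [measurable]: "f \<in> borel_measurable borel" and f: "integrable lborel (\<lambda>x. norm (f x) powr p)"
    and z: "\<And>h R t. continuous_on UNIV h \<Longrightarrow> (\<And>x. norm x > R \<Longrightarrow> h x = 0) \<Longrightarrow> t > 0 \<Longrightarrow>
      (LINT x|lborel. f x * (LINT y|lborel. of_real (heat t (x - y)) * h y)) = 0"
  shows "AE x in lborel. f x = 0"
proof -
  define g where "g x = cnj (sgn (f x)) * of_real (norm (f x) powr (p - 1))" for x
  have gm [measurable]: "g \<in> borel_measurable borel"
  proof -
    have [measurable]: "cnj \<in> borel_measurable borel" by (intro borel_measurable_continuous_onI continuous_intros)
    show ?thesis unfolding g_def[abs_def] sgn_eq by measurable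
  qed
  have gn: "norm (g x) powr q = norm (f x) powr p" for x
  proof -
    have "(p - 1) * q = p" using p1 by (simp add: q_eq)
    then show ?thesis by (cases "f x = 0") (auto simp: g_def norm_mult norm_sgn powr_powr)
  qed
  have g: "integrable lborel (\<lambda>x. norm (g x) powr q)" using f by (simp add: gn)
  have fg: "f x * g x = of_real (norm (f x) powr p)" for x
  proof (cases "f x = 0")
    case False
    have "f x * cnj (sgn (f x)) = of_real (norm (f x))"
      using False by (simp add: sgn_eq complex_norm_square[symmetric] power2_eq_square)
    moreover have "norm (f x) * norm (f x) powr (p - 1) = norm (f x) powr p"
      using False powr_add[of "norm (f x)" 1 "p - 1"] by simp
    ultimately show ?thesis unfolding g_def by (metis mult.assoc of_real_mult)
  qed (simp add: g_def)
  have "\<forall>n. \<exists>W \<in> borel_measurable borel. integrable lborel (\<lambda>x. norm (W x) powr q) \<and> (LINT x|lborel. f x * W x) = 0 \<and> (LINT x|lborel. norm (g x - W x) powr q) < 1 / real (Suc n)"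
  proof
    fix n :: nat
    have "q \<ge> 1" using q1 by simp
    then obtain h R t where h: "continuous_on UNIV h" "\<And>x. norm x > R \<Longrightarrow> h x = 0" "t > 0"
      and s: "(LINT x|lborel. norm (g x - (LINT y|lborel. of_real (heat t (x - y)) * h y)) powr q) < 1 / real (Suc n)"
      using Lp_dense[OF _ gm g, of "1 / real (Suc n)"] by auto
    have "(\<lambda>x. LINT y|lborel. of_real (heat t (x - y)) * h y) \<in> schwartz"
      by (rule heat_convolution_schwartz[OF continuous_compact_support_rapid[OF h(1,2)] h(3)])
    note W = this
    show "\<exists>W \<in> borel_measurable borel. integrable lborel (\<lambda>x. norm (W x) powr q) \<and> (LINT x|lborel. f x * W x) = 0 \<and> (LINT x|lborel. norm (g x - W x) powr q) < 1 / real (Suc n)"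
      by (rule bexI[OF _ schwartz_measurable[OF W]]) (intro conjI schwartz_powr_integrable[OF W \<open>q \<ge> 1\<close>] z[OF h] s)
  qed
  then have "\<exists>W. \<forall>n. W n \<in> borel_measurable borel \<and> integrable lborel (\<lambda>x. norm (W n x) powr q) \<and> (LINT x|lborel. f x * W n x) = 0 \<and> (LINT x|lborel. norm (g x - W n x) powr q) < 1 / real (Suc n)"
    unfolding Bex_def by (rule choice)
  then obtain W where W [measurable]: "\<And>n. W n \<in> borel_measurable borel" and Wi: "\<And>n. integrable lborel (\<lambda>x. norm (W n x) powr q)"
    and W0: "\<And>n. (LINT x|lborel. f x * W n x) = 0" and Ws: "\<And>n::nat. (LINT x|lborel. norm (g x - W n x) powr q) < 1 / real (Suc n)"
    by blast
  interpret S: conjugate_exponents q p by (rule conjugate_exponents_swap) unfold_locales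
  have "(\<lambda>n::nat. LINT x|lborel. f x * g x) \<longlonglongrightarrow> 0"
  proof (rule S.young_tendsto[where a = "\<lambda>n. LINT x|lborel. norm (g x - W n x) powr q" and b = "LINT x|lborel. norm (f x) powr p"])
    show "(\<lambda>n. LINT x|lborel. norm (g x - W n x) powr q) \<longlonglongrightarrow> 0"
    proof (rule tendsto_sandwich[of "\<lambda>n. 0" _ _ "\<lambda>n. 1 / real (Suc n)"])
      show "(\<lambda>n. 1 / real (Suc n)) \<longlonglongrightarrow> 0" by real_asymp
    qed (use Ws in \<open>auto intro!: always_eventually less_imp_le simp del: of_nat_Suc\<close>)
    fix n :: nat and \<delta> :: real assume \<delta>: "\<delta> > 0"
    have iW: "integrable lborel (\<lambda>x. norm (g x - W n x) powr q)"
      using q0 by (intro integrable_powr_diff g Wi) auto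
    have "(LINT x|lborel. f x * g x) = (LINT x|lborel. f x * (g x - W n x))"
      using W0[of n] holder_integrable[of f lborel g "\<lambda>x. f x * g x"] holder_integrable[of f lborel "W n" "\<lambda>x. f x * W n x"] f g Wi[of n]
      by (simp add: right_diff_distrib norm_mult)
    then show "norm (LINT x|lborel. f x * g x) \<le> \<delta> powr q * (LINT x|lborel. norm (g x - W n x) powr q) + \<delta> powr (- p) * (LINT x|lborel. norm (f x) powr p)"
      using S.holder_le[of "\<lambda>x. g x - W n x" lborel f "\<lambda>x. f x * (g x - W n x)" \<delta>] f iW \<delta> by (simp add: norm_mult)
  qed
  then have "(LINT x|lborel. f x * g x) = 0" by (simp add: LIMSEQ_const_iff)
  then have "(LINT x|lborel. norm (f x) powr p) = 0" unfolding fg by simp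
  then have "AE x in lborel. norm (f x) powr p = 0"
    using f by (subst (asm) integral_nonneg_eq_0_iff_AE) auto
  then show ?thesis by eventually_elim simp
qed

lemma (in conjugate_exponents) Lp_eq_zeroI_schwartz:
  fixes f :: "'a::euclidean_space \<Rightarrow> complex"
  assumes "f \<in> borel_measurable borel" "integrable lborel (\<lambda>x. norm (f x) powr p)"
    and "\<And>\<psi>. \<psi> \<in> schwartz \<Longrightarrow> (LINT x|lborel. f x * \<psi> x) = 0"
  shows "AE x in lborel. f x = 0"
  using assms(1,2)
  by (rule Lp_eq_zeroI) (rule assms(3)[OF heat_convolution_schwartz[OF continuous_compact_support_rapid]])

lemma Lp_dense_schwartz:
  fixes f :: "'a::euclidean_space \<Rightarrow> complex"
  assumes "p \<ge> 1" "f \<in> borel_measurable borel" "integrable lborel (\<lambda>x. norm (f x) powr p)" "e > 0"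
  obtains \<psi> where "\<psi> \<in> schwartz" "(LINT x|lborel. norm (f x - \<psi> x) powr p) < e"
proof -
  obtain h R t where h: "continuous_on UNIV h" "\<And>x. norm x > R \<Longrightarrow> h x = 0" "t > 0"
    "(LINT x|lborel. norm (f x - (LINT y|lborel. of_real (heat t (x - y)) * h y)) powr p) < e"
    using Lp_dense[OF assms] by blast
  show ?thesis
    by (rule that[OF heat_convolution_schwartz[OF continuous_compact_support_rapid[OF h(1,2)] h(3)] h(4)])
qed

section \<open>The operator with symbol \<open>(\<bar>\<xi>\<bar>\<^sup>2 / (\<epsilon> + \<bar>\<xi>\<bar>\<^sup>2))\<^sup>\<alpha>\<close>\<close>

text \<open>By the asymptotics of binomial coefficients the terms are of size n^(-\<alpha>-1), which
  is summable because \<alpha> > 0.\<close>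

lemma summable_gbinomial:
  fixes \<alpha> :: real assumes \<alpha>: "\<alpha> > 0" shows "summable (\<lambda>j. \<bar>\<alpha> gchoose j\<bar>)"
proof -
  have "convergent (\<lambda>n. (\<alpha> gchoose n) / ((- 1) ^ n / exp ((\<alpha> + 1) * of_real (ln (real n)))))"
    using gbinomial_asymptotic[of \<alpha>] by (rule convergentI)
  then have "Bseq (\<lambda>n. (\<alpha> gchoose n) / ((- 1) ^ n / exp ((\<alpha> + 1) * ln (real n))))"
    by (simp add: convergent_imp_Bseq)
  then obtain B where B: "\<And>n. norm ((\<alpha> gchoose n) / ((- 1) ^ n / exp ((\<alpha> + 1) * ln (real n)))) \<le> B"
    unfolding Bseq_def by blast
  have le: "norm \<bar>\<alpha> gchoose n\<bar> \<le> B * real n powr (- (\<alpha> + 1))" if "n \<ge> 1" for n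
  proof -
    have "\<bar>\<alpha> gchoose n\<bar> * exp ((\<alpha> + 1) * ln (real n)) \<le> B" using B[of n] by (simp add: abs_mult power_abs)
    moreover have "real n powr (- (\<alpha> + 1)) = exp (- ((\<alpha> + 1) * ln (real n)))" using that by (simp add: powr_def algebra_simps)
    ultimately show ?thesis by (simp only: exp_minus) (simp add: field_simps)
  qed
  show ?thesis
  proof (rule summable_comparison_test')
    show "summable (\<lambda>n. B * real n powr (- (\<alpha> + 1)))"
      using \<alpha> by (intro summable_mult) (simp add: summable_real_powr_iff)
  qed (rule le)
qed

text \<open>By the binomial series \<open>(l / (1 + l))\<^sup>\<alpha> = (1 - 1 / (1 + l))\<^sup>\<alpha>\<close> is \<open>1\<close> plus a combination of the
  powers \<open>(1 + l)\<^bsup>-j-1\<^esup>\<close>, which are the Laplace transforms of the Erlang densities. Substituting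
  \<open>l = |\<xi>|\<^sup>2 / \<epsilon>\<close> turns the Laplace transform into an average of heat kernels.\<close>

definition weight :: "real \<Rightarrow> real \<Rightarrow> real" where
  "weight \<alpha> t = (\<Sum>j. (- 1) ^ Suc j * (\<alpha> gchoose Suc j) * erlang_density j 1 t)"

lemma measurable_weight [measurable]: "weight \<alpha> \<in> borel_measurable borel"
  unfolding weight_def[abs_def] by measurable

text \<open>Multiplying the Erlang density of rate 1 by exp(-tl) gives the one of rate 1 + l up to
  the factor (1 + l)^(-j-1), and Erlang densities have mass one.\<close>

lemma erlang_density_exp:
  assumes "0 \<le> l"
  shows "integrable lborel (\<lambda>t. erlang_density j 1 t * exp (- (t * l)))"
    and "(LINT t|lborel. erlang_density j 1 t * exp (- (t * l))) = 1 / (1 + l) ^ Suc j"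
proof -
  have l: "0 < 1 + l" using assms by simp
  have e: "erlang_density j 1 t * exp (- (t * l)) = erlang_density j (1 + l) t / (1 + l) ^ Suc j" for t
  proof -
    have "exp (- t) * exp (- (t * l)) = exp (- ((1 + l) * t))" by (simp add: mult_exp_exp algebra_simps)
    moreover have "(- 1 - l) * t = - ((1 + l) * t)" by (simp add: algebra_simps)
    ultimately show ?thesis using l by (simp add: erlang_density_def del: power_Suc)
  qed
  have nn: "(\<integral>\<^sup>+ t. ennreal (erlang_density j (1 + l) t) \<partial>lborel) = 1"
    using nn_integral_erlang_ith_moment[OF l, of j 0] by simp
  have "has_bochner_integral lborel (erlang_density j (1 + l)) 1"
    using nn l by (intro has_bochner_integral_nn_integral) (auto simp: erlang_density_nonneg)
  then show "integrable lborel (\<lambda>t. erlang_density j 1 t * exp (- (t * l)))"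
    "(LINT t|lborel. erlang_density j 1 t * exp (- (t * l))) = 1 / (1 + l) ^ Suc j"
    unfolding e has_bochner_integral_iff by simp_all
qed

text \<open>The series for the weight converges in L^1, since its coefficients are absolutely
  summable and every Erlang density has mass one; hence it may be integrated term by term against
  exp(-tl). The result is the binomial series at -1 / (1 + l), a point inside the unit disc for l >
  0.\<close>

lemma
  fixes \<alpha> :: real
  assumes \<alpha>: "\<alpha> > 0"
  shows integrable_weight: "integrable lborel (weight \<alpha>)"
    and weight_laplace: "l > 0 \<Longrightarrow> 1 + (LINT t|lborel. weight \<alpha> t * exp (- (t * l))) = (l / (1 + l)) powr \<alpha>"
proof -
  define a where "a j = (- 1) ^ Suc j * (\<alpha> gchoose Suc j)" for j
  have aa: "\<bar>a j\<bar> = \<bar>\<alpha> gchoose Suc j\<bar>" for j by (simp add: a_def abs_mult power_abs)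
  have sa: "summable (\<lambda>j. \<bar>a j\<bar>)" unfolding aa using summable_gbinomial[OF \<alpha>] by (subst summable_Suc_iff)
  \<comment> \<open>Pointwise convergence by comparison with the exponential series: the density of
    index j is at most |t|^j / j!, and the coefficients are bounded.\<close>
  have sp: "summable (\<lambda>j. norm (a j * erlang_density j 1 t * exp (- (t * l))))" for t l
  proof -
    have "Bseq (\<lambda>j. \<bar>a j\<bar>)" using summable_LIMSEQ_zero[OF sa] convergentI convergent_imp_Bseq by blast
    then obtain B where B: "\<And>j. \<bar>a j\<bar> \<le> B" unfolding Bseq_def by auto
    show ?thesis
    proof (rule summable_comparison_test')
    show "summable (\<lambda>j. B * exp (- (t * l)) * (inverse (fact j) * \<bar>t\<bar> ^ j))"
      using summable_exp by (intro summable_mult)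
    show "norm (norm (a j * erlang_density j 1 t * exp (- (t * l)))) \<le> B * exp (- (t * l)) * (inverse (fact j) * \<bar>t\<bar> ^ j)" if "0 \<le> j" for j
    proof -
      have "\<bar>erlang_density j 1 t\<bar> \<le> inverse (fact j) * \<bar>t\<bar> ^ j"
        by (auto simp: erlang_density_def divide_inverse mult_left_le mult.commute power_abs)
      then have "\<bar>a j\<bar> * \<bar>erlang_density j 1 t\<bar> * exp (- (t * l)) \<le> B * (inverse (fact j) * \<bar>t\<bar> ^ j) * exp (- (t * l))"
        using B[of j] order_trans[OF abs_ge_zero B[of j]] by (intro mult_right_mono mult_mono) auto
      then show ?thesis by (simp add: abs_mult mult_ac)
    qed
    qed
  qed
  have int: "integrable lborel (\<lambda>t. a j * erlang_density j 1 t * exp (- (t * l)))"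
    "(LINT t|lborel. a j * erlang_density j 1 t * exp (- (t * l))) = a j / (1 + l) ^ Suc j"
    "(LINT t|lborel. norm (a j * erlang_density j 1 t * exp (- (t * l)))) = \<bar>a j\<bar> / (1 + l) ^ Suc j" if "l \<ge> 0" for j l
    using integrable_mult_right[OF erlang_density_exp(1)[OF that, of j], of "a j"] erlang_density_exp(2)[OF that, of j]
    by (simp_all add: mult.assoc abs_mult erlang_density_nonneg)
  have sn: "summable (\<lambda>j. LINT t|lborel. norm (a j * erlang_density j 1 t * exp (- (t * l))))" if l0: "l \<ge> 0" for l
    unfolding int(3)[OF l0]
  proof (rule summable_comparison_test'[OF sa])
    show "norm (\<bar>a j\<bar> / (1 + l) ^ Suc j) \<le> \<bar>a j\<bar>" if "0 \<le> j" for j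
      using l0 one_le_power[of "1 + l" "Suc j"] by (simp add: divide_le_eq mult_le_cancel_left1)
  qed
  have we: "weight \<alpha> t * exp (- (t * l)) = (\<Sum>j. a j * erlang_density j 1 t * exp (- (t * l)))" for t l
    using summable_norm_cancel[OF sp[of t 0]] by (simp add: weight_def a_def suminf_mult2)
  show "integrable lborel (weight \<alpha>)"
  proof -
    have "weight \<alpha> = (\<lambda>t. \<Sum>j. a j * erlang_density j 1 t * exp (- (t * 0)))" using we[of _ 0] by (simp add: fun_eq_iff)
    then show ?thesis using integrable_suminf[OF int(1)[of 0] _ sn[of 0]] sp[of _ 0] by simp
  qed
  assume l: "l > 0"
  then have l0: "l \<ge> 0" by simp
  have "(LINT t|lborel. weight \<alpha> t * exp (- (t * l))) = (\<Sum>j. a j / (1 + l) ^ Suc j)"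
    unfolding we using sp by (subst integral_suminf[OF int(1)[OF l0] _ sn[OF l0]]) (auto simp: int(2)[OF l0])
  moreover have "(\<lambda>j. (\<alpha> gchoose j) * (- (1 / (1 + l))) ^ j) sums (1 + - (1 / (1 + l))) powr \<alpha>"
    using l by (intro gen_binomial_real) (auto simp: field_simps)
  then have "(\<lambda>j. (\<alpha> gchoose Suc j) * (- (1 / (1 + l))) ^ Suc j) sums ((1 + - (1 / (1 + l))) powr \<alpha> - 1)"
    by (subst sums_Suc_iff) simp
  moreover have "(\<alpha> gchoose Suc j) * (- (1 / (1 + l))) ^ Suc j = a j / (1 + l) ^ Suc j" for j
    by (simp only: a_def power_minus[of "1 / (1 + l)"] power_one_over) (simp add: field_simps)
  moreover have "1 + - (1 / (1 + l)) = l / (1 + l)" using l by (simp add: field_simps)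
  ultimately have "(\<lambda>j. a j / (1 + l) ^ Suc j) sums ((l / (1 + l)) powr \<alpha> - 1)"
    and I: "(LINT t|lborel. weight \<alpha> t * exp (- (t * l))) = (\<Sum>j. a j / (1 + l) ^ Suc j)" by simp_all
  from sums_unique[OF this(1)] I
  show "1 + (LINT t|lborel. weight \<alpha> t * exp (- (t * l))) = (l / (1 + l)) powr \<alpha>" by simp
qed

lemma weight_nonpos: "t < 0 \<Longrightarrow> weight \<alpha> t = 0"
  unfolding weight_def by (simp add: erlang_density_def)

text \<open>For \<alpha>, e > 0 this is the kernel of the symbol (|\<xi>|^2 / (e +
  |\<xi>|^2))^\<alpha> - 1. The indicator removes the times t \<le> 0, at which \<open>heat\<close>
  is not the heat kernel.\<close>

definition frac_kernel :: "real \<Rightarrow> real \<Rightarrow> 'a::euclidean_space \<Rightarrow> real" where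
  "frac_kernel \<alpha> e x = (LINT t|lborel. weight \<alpha> t * indicator {0<..} t * heat (t / e) x)"

lemma AE_weight: "AE t in lborel. weight \<alpha> t * indicator {0<..} t = weight \<alpha> t"
proof -
  have "AE t in lborel. t \<noteq> (0::real)" by (rule AE_lborel_singleton)
  then show ?thesis by eventually_elim (auto simp: indicator_def weight_nonpos)
qed

lemma frac_kernel_minus [simp]: "frac_kernel \<alpha> e (- x) = frac_kernel \<alpha> e x"
  unfolding frac_kernel_def by simp

text \<open>Each heat kernel has mass one, so the L^1 norm of the kernel is at most that of the
  weight. This bound is uniform in \<open>e\<close>, which matters when e tends to 0.\<close>

lemma
  fixes \<alpha> e :: real
  assumes \<alpha>: "\<alpha> > 0" and e: "e > 0"
  shows frac_kernel_pair_integrable: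
      "integrable (lborel \<Otimes>\<^sub>M lborel) (\<lambda>(t, x :: 'a::euclidean_space). weight \<alpha> t * indicator {0<..} t * heat (t / e) x)"
    and integrable_frac_kernel: "integrable lborel (frac_kernel \<alpha> e :: 'a \<Rightarrow> real)"
    and frac_kernel_norm_le: "(LINT x|lborel. \<bar>frac_kernel \<alpha> e (x :: 'a)\<bar>) \<le> (LINT t|lborel. \<bar>weight \<alpha> t\<bar>)"
proof -
  have n: "(LINT x|lborel. norm (weight \<alpha> t * indicator {0<..} t * heat (t / e) (x :: 'a))) = \<bar>weight \<alpha> t\<bar> * indicator {0<..} t" for t
    using e by (cases "t > 0") (simp_all add: abs_mult heat_nonneg heat_integral)
  have i: "integrable lborel (\<lambda>t. \<bar>weight \<alpha> t\<bar> * indicator {0<..} t :: real)"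
    by (rule integrable_le[OF integrable_norm[OF integrable_weight[OF \<alpha>]]]) (auto simp: indicator_def)
  show *: "integrable (lborel \<Otimes>\<^sub>M lborel) (\<lambda>(t, x :: 'a). weight \<alpha> t * indicator {0<..} t * heat (t / e) x)"
  proof (rule lborel_pair.Fubini_integrable)
    show "AE t in lborel. integrable lborel (\<lambda>x::'a. case (t, x) of (t, x) \<Rightarrow> weight \<alpha> t * indicator {0<..} t * heat (t / e) x)"
      using e by (auto simp: indicator_def heat_integrable)
    show "integrable lborel (\<lambda>t. LINT x|lborel. norm (case (t, x :: 'a) of (t, x) \<Rightarrow> weight \<alpha> t * indicator {0<..} t * heat (t / e) x))"
      unfolding prod.case n by (rule i)
  qed measurable
  show ik: "integrable lborel (frac_kernel \<alpha> e :: 'a \<Rightarrow> real)"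
    using lborel_pair.integrable_snd[OF *] unfolding frac_kernel_def[abs_def] .
  have m: "(\<lambda>x::'a. LINT t|lborel. norm (weight \<alpha> t * indicator {0<..} t * heat (t / e) x)) \<in> borel_measurable borel"
    by (intro lborel.borel_measurable_lebesgue_integral) measurable
  have in': "integrable (lborel \<Otimes>\<^sub>M lborel) (\<lambda>(t, x :: 'a). norm (weight \<alpha> t * indicator {0<..} t * heat (t / e) x))"
    using integrable_norm[OF *] by (simp add: split_beta')
  have "(LINT x|lborel. \<bar>frac_kernel \<alpha> e (x :: 'a)\<bar>) \<le> (LINT x|lborel. LINT t|lborel. norm (weight \<alpha> t * indicator {0<..} t * heat (t / e) (x :: 'a)))"
    unfolding frac_kernel_def
    by (rule integral_mono) (use integrable_norm[OF ik] lborel_pair.integrable_snd[OF in'] integral_norm_bound in \<open>auto simp: frac_kernel_def[abs_def]\<close>)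
  also have "\<dots> = (LINT t|lborel. LINT x|lborel. norm (weight \<alpha> t * indicator {0<..} t * heat (t / e) (x :: 'a)))"
    using lborel_pair.Fubini_integral[OF in'] by simp
  also have "\<dots> \<le> (LINT t|lborel. \<bar>weight \<alpha> t\<bar>)"
    unfolding n using i integrable_weight[OF \<alpha>] by (intro integral_mono) (auto simp: indicator_def)
  finally show "(LINT x|lborel. \<bar>frac_kernel \<alpha> e (x :: 'a)\<bar>) \<le> (LINT t|lborel. \<bar>weight \<alpha> t\<bar>)" .
qed

lemma norm_inv_fourier_le:
  fixes a :: "'a::euclidean_space \<Rightarrow> complex"
  assumes a: "integrable lborel a"
  shows "norm (inv_fourier a x) \<le> (LINT \<xi>|lborel. norm (a \<xi>)) / (2 * pi) ^ DIM('a)"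
proof -
  have "a \<in> borel_measurable borel" using a by (simp add: borel_measurable_integrable)
  then show ?thesis using norm_fourier_le[OF a, of "- x"]
    by (simp add: inv_fourier_eq(2) norm_divide norm_mult norm_power divide_right_mono)
qed

text \<open>\<open>heat (t / e)\<close> acts as multiplication by exp(-t|\<xi>|^2 / e), and
  averaging in t produces the Laplace transform of the weight at |\<xi>|^2 / e. The resulting symbol
  may be singular at the origin, so the product with it can leave the Schwartz class even when
  \<open>a\<close> belongs to it.\<close>

lemma conv_frac_kernel_inv_fourier:
  fixes a :: "'a::euclidean_space \<Rightarrow> complex"
  assumes \<alpha>: "\<alpha> > 0" and e: "e > 0" and a: "integrable lborel a"
  shows "inv_fourier a x + conv (frac_kernel \<alpha> e) (inv_fourier a) x
    = inv_fourier (\<lambda>\<xi>. of_real (((norm \<xi>)\<^sup>2 / (e + (norm \<xi>)\<^sup>2)) powr \<alpha>) * a \<xi>) x"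
proof -
  have am [measurable]: "a \<in> borel_measurable borel" using a by (simp add: borel_measurable_integrable)
  note [measurable] = fourier_measurable(2)[OF a]
  define w where "w t = weight \<alpha> t * indicator {0<..} t" for t
  have wm [measurable]: "w \<in> borel_measurable borel" unfolding w_def[abs_def] by measurable
  have wi: "integrable lborel w" unfolding w_def[abs_def]
    by (rule integrable_le[OF integrable_norm[OF integrable_weight[OF \<alpha>]]]) (auto simp: indicator_def)
  define c where "c = complex_of_real ((2 * pi) ^ DIM('a))"
  have c: "c \<noteq> 0" by (simp add: c_def)
  define m where "m \<xi> = (LINT t|lborel. w t * exp (- (t / e * (norm \<xi>)\<^sup>2)))" for \<xi> :: 'a
  \<comment> \<open>\<open>weight_laplace\<close> asks for l > 0, which excludes the origin, a null
    set.\<close>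
  have mm: "AE \<xi> in lborel. 1 + m \<xi> = ((norm \<xi>)\<^sup>2 / (e + (norm \<xi>)\<^sup>2)) powr \<alpha>"
  proof -
    have "AE \<xi> in lborel. \<xi> \<noteq> (0::'a)" by (rule AE_lborel_singleton)
    then show ?thesis
    proof eventually_elim
      case (elim \<xi>)
      define l where "l = (norm \<xi>)\<^sup>2 / e"
      have l: "l > 0" using elim e by (simp add: l_def)
      have "m \<xi> = (LINT t|lborel. weight \<alpha> t * exp (- (t * l)))"
        unfolding m_def w_def l_def by (rule integral_cong_AE) (use AE_weight[of \<alpha>] in auto)
      then have "1 + m \<xi> = (l / (1 + l)) powr \<alpha>" using weight_laplace[OF \<alpha> l] by simp
      also have "l / (1 + l) = (norm \<xi>)\<^sup>2 / (e + (norm \<xi>)\<^sup>2)" using e by (simp add: l_def field_simps)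
      finally show ?case .
    qed
  qed
  have mmeas [measurable]: "m \<in> borel_measurable borel"
    unfolding m_def[abs_def] by (intro lborel.borel_measurable_lebesgue_integral) measurable
  have we1: "norm (w t * exp (- (t / e * (norm \<xi>)\<^sup>2))) \<le> \<bar>w t\<bar>" for t and \<xi> :: 'a
    using e by (cases "t > 0") (auto simp: w_def abs_mult mult_left_le)
  have mb: "\<bar>m \<xi>\<bar> \<le> (LINT t|lborel. \<bar>w t\<bar>)" for \<xi>
  proof -
    have "integrable lborel (\<lambda>t. w t * exp (- (t / e * (norm \<xi>)\<^sup>2)))"
      by (rule integrable_le[OF integrable_norm[OF wi]]) (use we1 in auto)
    then have "norm (m \<xi>) \<le> (LINT t|lborel. \<bar>w t\<bar>)"
      unfolding m_def using we1 wi by (intro order_trans[OF integral_norm_bound] integral_mono) auto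
    then show ?thesis by simp
  qed
  have ma: "integrable lborel (\<lambda>\<xi>. of_real (m \<xi>) * a \<xi>)"
    by (rule integrable_le[OF integrable_mult_right[OF integrable_norm[OF a], of "LINT t|lborel. \<bar>w t\<bar>"]])
       (auto simp: norm_mult intro!: mult_right_mono mb)
  define C where "C = (LINT \<xi>|lborel. norm (a \<xi>)) / (2 * pi) ^ DIM('a)"
  have int: "integrable (lborel \<Otimes>\<^sub>M lborel) (\<lambda>(t, y). of_real (w t * heat (t / e) y) * inv_fourier a (x - y))"
  proof (rule integrable_le[OF integrable_mult_right[OF integrable_norm[OF frac_kernel_pair_integrable[OF \<alpha> e, where 'a = 'a]], of C]])
    show "norm (case z of (t, y) \<Rightarrow> of_real (w t * heat (t / e) y) * inv_fourier a (x - y)) \<le>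
      C * norm (case z of (t, x) \<Rightarrow> weight \<alpha> t * indicator {0<..} t * heat (t / e) x)" for z
      using mult_right_mono[OF norm_inv_fourier_le[OF a, of "x - snd z"], of "\<bar>w (fst z) * heat (fst z / e) (snd z)\<bar>"]
      by (simp add: split_beta' norm_mult w_def C_def abs_mult mult_ac)
  qed measurable
  have "conv (frac_kernel \<alpha> e) (inv_fourier a) x = (LINT y|lborel. LINT t|lborel. of_real (w t * heat (t / e) y) * inv_fourier a (x - y))"
    unfolding conv_def frac_kernel_def w_def integral_mult_left_zero integral_complex_of_real ..
  also have "\<dots> = (LINT t|lborel. LINT y|lborel. of_real (w t * heat (t / e) y) * inv_fourier a (x - y))"
    using lborel_pair.Fubini_integral[OF int] by simp
  also have "\<dots> = (LINT t|lborel. of_real (w t) * inv_fourier (\<lambda>\<xi>. of_real (exp (- (t / e * (norm \<xi>)\<^sup>2))) * a \<xi>) x)"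
  proof (rule Bochner_Integration.integral_cong[OF refl])
    fix t
    have "(LINT y|lborel. of_real (w t * heat (t / e) y) * inv_fourier a (x - y)) = of_real (w t) * (LINT y|lborel. of_real (heat (t / e) y) * inv_fourier a (x - y))"
      unfolding integral_mult_right_zero[symmetric] by (simp add: mult.assoc)
    also have "\<dots> = of_real (w t) * inv_fourier (\<lambda>\<xi>. of_real (exp (- (t / e * (norm \<xi>)\<^sup>2))) * a \<xi>) x"
      using e by (cases "t > 0") (simp_all add: heat_inv_fourier[OF a] w_def)
    finally show "(LINT y|lborel. of_real (w t * heat (t / e) y) * inv_fourier a (x - y)) = of_real (w t) * inv_fourier (\<lambda>\<xi>. of_real (exp (- (t / e * (norm \<xi>)\<^sup>2))) * a \<xi>) x" .
  qed
  also have "\<dots> = (LINT t|lborel. LINT \<xi>|lborel. of_real (w t * exp (- (t / e * (norm \<xi>)\<^sup>2))) * (cis (x \<bullet> \<xi>) * a \<xi>)) / c"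
    unfolding integral_divide_zero[symmetric]
    by (simp add: inv_fourier_lborel c_def mult_ac integral_mult_right_zero[symmetric] del: integral_mult_right_zero)
  also have "(LINT t|lborel. LINT \<xi>|lborel. of_real (w t * exp (- (t / e * (norm \<xi>)\<^sup>2))) * (cis (x \<bullet> \<xi>) * a \<xi>))
     = (LINT \<xi>|lborel. LINT t|lborel. of_real (w t * exp (- (t / e * (norm \<xi>)\<^sup>2))) * (cis (x \<bullet> \<xi>) * a \<xi>))"
  proof (rule fubini_bounded_swap[OF _ integrable_norm[OF wi] integrable_norm[OF a]])
    show "norm (of_real (w t * exp (- (t / e * (norm \<xi>)\<^sup>2))) * (cis (x \<bullet> \<xi>) * a \<xi>)) \<le> norm (w t) * norm (a \<xi>)" for t and \<xi> :: 'a
      using mult_right_mono[OF we1[of t \<xi>], of "norm (a \<xi>)"] by (simp add: norm_mult abs_mult)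
  qed measurable
  also have "\<dots> = (LINT \<xi>|lborel. of_real (m \<xi>) * (cis (x \<bullet> \<xi>) * a \<xi>))"
    unfolding m_def integral_mult_left_zero integral_complex_of_real ..
  also have "\<dots> / c = inv_fourier (\<lambda>\<xi>. of_real (m \<xi>) * a \<xi>) x"
    by (simp add: inv_fourier_lborel c_def mult_ac)
  finally have "inv_fourier a x + conv (frac_kernel \<alpha> e) (inv_fourier a) x = inv_fourier a x + inv_fourier (\<lambda>\<xi>. of_real (m \<xi>) * a \<xi>) x" by simp
  also have "\<dots> = inv_fourier (\<lambda>\<xi>. of_real (1 + m \<xi>) * a \<xi>) x"
    using integrable_cis_mult[OF a, of "\<lambda>\<xi>. x \<bullet> \<xi>"] integrable_cis_mult[OF ma, of "\<lambda>\<xi>. x \<bullet> \<xi>"]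
    by (simp add: inv_fourier_lborel distrib_left distrib_right add_divide_distrib)
  also have "\<dots> = inv_fourier (\<lambda>\<xi>. of_real (((norm \<xi>)\<^sup>2 / (e + (norm \<xi>)\<^sup>2)) powr \<alpha>) * a \<xi>) x"
  proof -
    have "(LINT \<xi>|lborel. cis (x \<bullet> \<xi>) * (of_real (1 + m \<xi>) * a \<xi>)) = (LINT \<xi>|lborel. cis (x \<bullet> \<xi>) * (of_real (((norm \<xi>)\<^sup>2 / (e + (norm \<xi>)\<^sup>2)) powr \<alpha>) * a \<xi>))"
    proof (rule integral_cong_AE)
      show "AE \<xi> in lborel. cis (x \<bullet> \<xi>) * (of_real (1 + m \<xi>) * a \<xi>) = cis (x \<bullet> \<xi>) * (of_real (((norm \<xi>)\<^sup>2 / (e + (norm \<xi>)\<^sup>2)) powr \<alpha>) * a \<xi>)"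
        using mm by eventually_elim simp
    qed measurable
    then show ?thesis by (subst (1 2) inv_fourier_lborel) auto
  qed
  finally show ?thesis .
qed

text \<open>This is \<open>(-\<Delta>)\<^sup>\<alpha> (1 - \<Delta>)\<^bsup>-\<alpha>\<^esup>\<close>, which is bounded on every \<open>L\<^sup>p\<close> since its kernel is
  a point mass plus an integrable function.\<close>

definition frac_op :: "real \<Rightarrow> ('a::euclidean_space \<Rightarrow> complex) \<Rightarrow> 'a \<Rightarrow> complex" where
  "frac_op \<alpha> f x = f x + conv (frac_kernel \<alpha> 1) f x"

lemma frac_op_measurable:
  fixes f :: "'a::euclidean_space \<Rightarrow> complex"
  assumes \<alpha>: "\<alpha> > 0" and [measurable]: "f \<in> borel_measurable borel"
  shows "frac_op \<alpha> f \<in> borel_measurable borel"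
proof -
  have "integrable lborel (frac_kernel \<alpha> 1 :: 'a \<Rightarrow> real)" by (rule integrable_frac_kernel[OF \<alpha>]) simp
  then have [measurable]: "frac_kernel \<alpha> 1 \<in> borel_measurable (borel :: 'a measure)"
    by (simp add: borel_measurable_integrable)
  note [measurable] = conv_measurable[OF this \<open>f \<in> _\<close>]
  show ?thesis unfolding frac_op_def[abs_def] by measurable
qed

context conjugate_exponents
begin

lemma
  fixes f :: "'a::euclidean_space \<Rightarrow> complex"
  assumes \<alpha>: "\<alpha> > 0" and [measurable]: "f \<in> borel_measurable borel"
    and f: "integrable lborel (\<lambda>x. norm (f x) powr p)"
  shows frac_op_integrable: "integrable lborel (\<lambda>x. norm (frac_op \<alpha> f x) powr p)"
    and frac_op_le: "(LINT x|lborel. norm (frac_op \<alpha> f x) powr p) \<le>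
      2 powr p * (1 + (2 * (LINT t|lborel. \<bar>weight \<alpha> t\<bar>)) powr p) * (LINT x|lborel. norm (f x) powr p)"
proof -
  have K: "integrable lborel (frac_kernel \<alpha> 1 :: 'a \<Rightarrow> real)" by (rule integrable_frac_kernel[OF \<alpha>]) simp
  have [measurable]: "frac_kernel \<alpha> 1 \<in> borel_measurable (borel :: 'a measure)" using K by (simp add: borel_measurable_integrable)
  note [measurable] = conv_measurable[OF this \<open>f \<in> _\<close>]
  note c = conv_powr_integrable[OF K _ f]
  show "integrable lborel (\<lambda>x. norm (frac_op \<alpha> f x) powr p)"
    unfolding frac_op_def using p0 by (intro integrable_powr_add f c) auto
  have "(LINT x|lborel. norm (frac_op \<alpha> f x) powr p) \<le> 2 powr p * ((LINT x|lborel. norm (f x) powr p) + (LINT x|lborel. norm (conv (frac_kernel \<alpha> 1) f x) powr p))"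
    unfolding frac_op_def using p0 by (intro integral_powr_add_le f c) auto
  also have "\<dots> \<le> 2 powr p * ((LINT x|lborel. norm (f x) powr p) + (2 * (LINT t|lborel. \<bar>weight \<alpha> t\<bar>)) powr p * (LINT x|lborel. norm (f x) powr p))"
  proof -
    have "(LINT x|lborel. norm (conv (frac_kernel \<alpha> 1) f x) powr p) \<le> (2 * (LINT y|lborel. \<bar>frac_kernel \<alpha> 1 (y :: 'a)\<bar>)) powr p * (LINT x|lborel. norm (f x) powr p)"
      by (rule conv_powr_le[OF K _ f]) measurable
    also have "\<dots> \<le> (2 * (LINT t|lborel. \<bar>weight \<alpha> t\<bar>)) powr p * (LINT x|lborel. norm (f x) powr p)"
      using p0 frac_kernel_norm_le[OF \<alpha>, of 1] by (intro mult_right_mono powr_mono2) auto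
    finally show ?thesis by (intro mult_left_mono add_left_mono) auto
  qed
  finally show "(LINT x|lborel. norm (frac_op \<alpha> f x) powr p) \<le>
      2 powr p * (1 + (2 * (LINT t|lborel. \<bar>weight \<alpha> t\<bar>)) powr p) * (LINT x|lborel. norm (f x) powr p)"
    by (simp add: algebra_simps)
qed

lemma frac_op_diff:
  fixes f g :: "'a::euclidean_space \<Rightarrow> complex"
  assumes \<alpha>: "\<alpha> > 0" and [measurable]: "f \<in> borel_measurable borel" "g \<in> borel_measurable borel"
    and f: "integrable lborel (\<lambda>x. norm (f x) powr p)" and g: "integrable lborel (\<lambda>x. norm (g x) powr p)"
  shows "AE x in lborel. frac_op \<alpha> (\<lambda>x. f x - g x) x = frac_op \<alpha> f x - frac_op \<alpha> g x"
proof -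
  have K: "integrable lborel (frac_kernel \<alpha> 1 :: 'a \<Rightarrow> real)" by (rule integrable_frac_kernel[OF \<alpha>]) simp
  show ?thesis
    using conv_AE_integrable[OF K \<open>f \<in> _\<close> f] conv_AE_integrable[OF K \<open>g \<in> _\<close> g]
    by eventually_elim (simp add: frac_op_def conv_def right_diff_distrib)
qed

lemma frac_op_duality:
  fixes f g :: "'a::euclidean_space \<Rightarrow> complex"
  assumes \<alpha>: "\<alpha> > 0" and [measurable]: "f \<in> borel_measurable borel" "g \<in> borel_measurable borel"
    and f: "integrable lborel (\<lambda>x. norm (f x) powr p)" and g: "integrable lborel (\<lambda>x. norm (g x) powr q)"
  shows "(LINT x|lborel. frac_op \<alpha> f x * g x) = (LINT x|lborel. f x * frac_op \<alpha> g x)"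
proof -
  have K: "integrable lborel (frac_kernel \<alpha> 1 :: 'a \<Rightarrow> real)" by (rule integrable_frac_kernel[OF \<alpha>]) simp
  have [measurable]: "frac_kernel \<alpha> 1 \<in> borel_measurable (borel :: 'a measure)" using K by (simp add: borel_measurable_integrable)
  note [measurable] = conv_measurable[OF this \<open>f \<in> _\<close>] conv_measurable[OF this \<open>g \<in> _\<close>]
  have swap: "conjugate_exponents q p" by (rule conjugate_exponents_swap) unfold_locales
  note cf = conv_powr_integrable[OF K \<open>f \<in> _\<close> f] and cg = conjugate_exponents.conv_powr_integrable[OF swap K \<open>g \<in> _\<close> g]
  have "conjugate_exponents p q" by unfold_locales
  from conv_duality[OF this K frac_kernel_minus \<open>f \<in> _\<close> \<open>g \<in> _\<close> f g] show ?thesis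
    using holder_integrable[of f lborel g "\<lambda>x. f x * g x"] holder_integrable[of "conv (frac_kernel \<alpha> 1) f" lborel g "\<lambda>x. conv (frac_kernel \<alpha> 1) f x * g x"]
      holder_integrable[of f lborel "conv (frac_kernel \<alpha> 1) g" "\<lambda>x. f x * conv (frac_kernel \<alpha> 1) g x"] f g cf cg
    by (simp add: frac_op_def distrib_left distrib_right norm_mult)
qed

text \<open>A Schwartz function \<open>\<theta>\<close> need not be in the range of \<open>frac_op \<alpha>\<close>, but replacing \<open>|\<xi>|\<^sup>2\<close> by
  \<open>\<epsilon> + |\<xi>|\<^sup>2\<close> in the inverse symbol puts \<open>\<theta> + c\<^sub>\<epsilon>\<close> there, with \<open>c\<^sub>\<epsilon>\<close> bounded in \<open>L\<^sup>q\<close> and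
  tending to \<open>0\<close> uniformly, hence weakly.\<close>

lemma frac_op_eq_zero:
  fixes f :: "'a::euclidean_space \<Rightarrow> complex"
  assumes \<alpha>: "\<alpha> > 0" and fm [measurable]: "f \<in> borel_measurable borel"
    and f: "integrable lborel (\<lambda>x. norm (f x) powr p)" and z: "AE x in lborel. frac_op \<alpha> f x = 0"
  shows "AE x in lborel. f x = 0"
proof (rule Lp_eq_zeroI_schwartz[OF fm f])
  fix \<theta> :: "'a \<Rightarrow> complex" assume \<theta>: "\<theta> \<in> schwartz"
  note F = fourier_schwartz[OF \<theta>]
  note [measurable] = schwartz_measurable[OF \<theta>] schwartz_measurable[OF F]
  have swap: "conjugate_exponents q p" by (rule conjugate_exponents_swap) unfold_locales
  interpret S: conjugate_exponents q p by (rule swap)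
  have \<theta>q: "integrable lborel (\<lambda>x. norm (\<theta> x) powr q)" using q1 by (intro schwartz_powr_integrable[OF \<theta>]) simp
  define e where "e n = 1 / real (Suc n)" for n
  have e: "e n > 0" for n by (simp add: e_def)
  have e0: "e \<longlonglongrightarrow> 0" unfolding e_def by real_asymp
  define c where "c n = conv (frac_kernel \<alpha> (e n)) \<theta>" for n
  have K: "integrable lborel (frac_kernel \<alpha> (e n) :: 'a \<Rightarrow> real)" for n by (rule integrable_frac_kernel[OF \<alpha> e])
  have [measurable]: "c n \<in> borel_measurable borel" for n
    unfolding c_def using borel_measurable_integrable[OF K] by (intro conv_measurable) auto
  have cq: "integrable lborel (\<lambda>x. norm (c n x) powr q)" for n
    unfolding c_def by (rule S.conv_powr_integrable[OF K _ \<theta>q]) measurable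
  define B where "B = (2 * (LINT t|lborel. \<bar>weight \<alpha> t\<bar>)) powr q * (LINT x|lborel. norm (\<theta> x) powr q)"
  have B: "(LINT x|lborel. norm (c n x) powr q) \<le> B" for n
  proof -
    have "(LINT x|lborel. norm (c n x) powr q) \<le> (2 * (LINT y|lborel. \<bar>frac_kernel \<alpha> (e n) (y :: 'a)\<bar>)) powr q * (LINT x|lborel. norm (\<theta> x) powr q)"
      unfolding c_def by (rule S.conv_powr_le[OF K _ \<theta>q]) measurable
    also have "\<dots> \<le> B" unfolding B_def using q0 frac_kernel_norm_le[OF \<alpha> e] by (intro mult_right_mono powr_mono2) auto
    finally show ?thesis .
  qed
  define m where "m n \<xi> = ((norm \<xi>)\<^sup>2 / (e n + (norm \<xi>)\<^sup>2)) powr \<alpha>" for n and \<xi> :: 'a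
  have m1: "0 \<le> m n \<xi>" "m n \<xi> \<le> 1" for n \<xi>
  proof -
    have "e n + (norm \<xi>)\<^sup>2 > 0" using e[of n] by (simp add: add_pos_nonneg)
    then have "(norm \<xi>)\<^sup>2 / (e n + (norm \<xi>)\<^sup>2) \<le> 1" using e[of n] by simp
    then show "m n \<xi> \<le> 1" unfolding m_def using \<alpha> e[of n] by (intro powr_le1) auto
  qed (simp add: m_def)
  have [measurable]: "m n \<in> borel_measurable borel" for n unfolding m_def[abs_def] by measurable
  have mF: "integrable lborel (\<lambda>\<xi>. of_real (m n \<xi>) * fourier \<theta> \<xi>)" for n
    by (rule integrable_le[OF integrable_norm[OF schwartz_integrable[OF F]]])
       (use m1 in \<open>auto simp: norm_mult mult_left_le_one_le\<close>)
  have \<theta>c: "\<theta> x + c n x = inv_fourier (\<lambda>\<xi>. of_real (m n \<xi>) * fourier \<theta> \<xi>) x" for n x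
    using conv_frac_kernel_inv_fourier[OF \<alpha> e[of n] schwartz_integrable[OF F], of x]
    by (simp add: inv_fourier_fourier[OF \<theta>] c_def m_def)
  define b where "b n = (LINT \<xi>|lborel. norm (of_real (m n \<xi>) * fourier \<theta> \<xi> - fourier \<theta> \<xi>)) / (2 * pi) ^ DIM('a)" for n
  have cb: "norm (c n x) \<le> b n" for n x
  proof -
    have "c n x = inv_fourier (\<lambda>\<xi>. of_real (m n \<xi>) * fourier \<theta> \<xi>) x - inv_fourier (fourier \<theta>) x"
      using \<theta>c[where n = n and x = x] unfolding inv_fourier_fourier[OF \<theta>] by (simp add: eq_diff_eq add.commute)
    also have "\<dots> = inv_fourier (\<lambda>\<xi>. of_real (m n \<xi>) * fourier \<theta> \<xi> - fourier \<theta> \<xi>) x"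
      using integrable_cis_mult[OF mF[of n], of "\<lambda>\<xi>. x \<bullet> \<xi>"] integrable_cis_mult[OF schwartz_integrable[OF F], of "\<lambda>\<xi>. x \<bullet> \<xi>"]
      by (simp add: inv_fourier_lborel right_diff_distrib diff_divide_distrib)
    finally show ?thesis unfolding b_def
      using norm_inv_fourier_le[OF Bochner_Integration.integrable_diff[OF mF schwartz_integrable[OF F]]] by simp
  qed
  \<comment> \<open>The symbols \<open>m n\<close> lie in [0, 1] and tend to 1 off the origin;
    dominated convergence in frequency turns this into uniform convergence in space.\<close>
  have b0: "b \<longlonglongrightarrow> 0"
  proof -
    have "(\<lambda>n. LINT \<xi>|lborel. norm (of_real (m n \<xi>) * fourier \<theta> \<xi> - fourier \<theta> \<xi>)) \<longlonglongrightarrow> (LINT \<xi>|(lborel::'a measure). 0)"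
    proof (rule integral_dominated_convergence[where w = "\<lambda>\<xi>. norm (fourier \<theta> \<xi>)"])
      have "AE \<xi> in lborel. \<xi> \<noteq> (0::'a)" by (rule AE_lborel_singleton)
      then show "AE \<xi> in lborel. (\<lambda>n. norm (of_real (m n \<xi>) * fourier \<theta> \<xi> - fourier \<theta> \<xi>)) \<longlonglongrightarrow> 0"
      proof eventually_elim
        case (elim \<xi>)
        have "(\<lambda>n. m n \<xi>) \<longlonglongrightarrow> ((norm \<xi>)\<^sup>2 / (0 + (norm \<xi>)\<^sup>2)) powr \<alpha>"
          unfolding m_def using elim by (intro tendsto_intros e0) auto
        then have "(\<lambda>n. m n \<xi>) \<longlonglongrightarrow> 1" using elim by simp
        then have "(\<lambda>n. norm (of_real (m n \<xi>) * fourier \<theta> \<xi> - fourier \<theta> \<xi>)) \<longlonglongrightarrow> norm (of_real 1 * fourier \<theta> \<xi> - fourier \<theta> \<xi>)"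
          by (intro tendsto_intros)
        then show ?case by simp
      qed
      show "AE \<xi> in lborel. norm (norm (of_real (m n \<xi>) * fourier \<theta> \<xi> - fourier \<theta> \<xi>)) \<le> norm (fourier \<theta> \<xi>)" for n
      proof (rule AE_I2)
        fix \<xi>
        have "of_real (m n \<xi>) * fourier \<theta> \<xi> - fourier \<theta> \<xi> = of_real (m n \<xi> - 1) * fourier \<theta> \<xi>" by (simp add: algebra_simps)
        moreover have "\<bar>m n \<xi> - 1\<bar> \<le> 1" using m1[of n \<xi>] by simp
        ultimately show "norm (norm (of_real (m n \<xi>) * fourier \<theta> \<xi> - fourier \<theta> \<xi>)) \<le> norm (fourier \<theta> \<xi>)"
          by (simp add: norm_mult mult_left_le_one_le norm_of_real del: of_real_diff)
      qed
    qed (use schwartz_integrable[OF F] in auto)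
    then have "(\<lambda>n. (LINT \<xi>|lborel. norm (of_real (m n \<xi>) * fourier \<theta> \<xi> - fourier \<theta> \<xi>)) / (2 * pi) ^ DIM('a)) \<longlonglongrightarrow> (LINT \<xi>|(lborel::'a measure). 0) / (2 * pi) ^ DIM('a)"
      by (intro tendsto_intros) auto
    then show ?thesis unfolding b_def by simp
  qed
  have key: "(LINT x|lborel. f x * (\<theta> x + c n x)) = 0" for n
  proof -
    \<comment> \<open>Dividing by (|\<xi>|^2 / (1 + |\<xi>|^2))^\<alpha> would create a singularity
      at the origin. With \<open>e n\<close> > 0 added the quotient stays smooth, and
      \<open>frac_op \<alpha>\<close> of its inverse transform has the transform \<open>m n\<close>
      times that of \<theta>.\<close>
    define a where "a \<xi> = of_real ((1 + (norm \<xi>)\<^sup>2) powr \<alpha>) * (of_real ((e n + (norm \<xi>)\<^sup>2) powr - \<alpha>) * fourier \<theta> \<xi>)" for \<xi> :: 'a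
    have a: "a \<in> schwartz" unfolding a_def[abs_def]
      by (intro schwartz_mult slowly_increasing_bracket_powr F e) simp
    define \<psi> where "\<psi> = inv_fourier a"
    have \<psi>: "\<psi> \<in> schwartz" unfolding \<psi>_def by (rule inv_fourier_schwartz[OF a])
    note [measurable] = schwartz_measurable[OF \<psi>]
    have "frac_op \<alpha> \<psi> x = \<theta> x + c n x" for x
    proof -
      have "frac_op \<alpha> \<psi> x = inv_fourier (\<lambda>\<xi>. of_real (((norm \<xi>)\<^sup>2 / (1 + (norm \<xi>)\<^sup>2)) powr \<alpha>) * a \<xi>) x"
        unfolding frac_op_def \<psi>_def by (rule conv_frac_kernel_inv_fourier[OF \<alpha> _ schwartz_integrable[OF a]]) simp
      also have "(\<lambda>\<xi>. of_real (((norm \<xi>)\<^sup>2 / (1 + (norm \<xi>)\<^sup>2)) powr \<alpha>) * a \<xi>) = (\<lambda>\<xi>. of_real (m n \<xi>) * fourier \<theta> \<xi>)"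
      proof
        fix \<xi> :: 'a
        have 1: "1 + (norm \<xi>)\<^sup>2 > 0" "e n + (norm \<xi>)\<^sup>2 > 0" using e[of n] by (simp_all add: add_pos_nonneg)
        then have "((norm \<xi>)\<^sup>2 / (1 + (norm \<xi>)\<^sup>2)) powr \<alpha> * ((1 + (norm \<xi>)\<^sup>2) powr \<alpha> * (e n + (norm \<xi>)\<^sup>2) powr - \<alpha>) = m n \<xi>"
          unfolding m_def by (simp add: powr_divide powr_minus_divide)
        then have "complex_of_real (((norm \<xi>)\<^sup>2 / (1 + (norm \<xi>)\<^sup>2)) powr \<alpha> * ((1 + (norm \<xi>)\<^sup>2) powr \<alpha> * (e n + (norm \<xi>)\<^sup>2) powr - \<alpha>)) = of_real (m n \<xi>)" by simp
        then show "of_real (((norm \<xi>)\<^sup>2 / (1 + (norm \<xi>)\<^sup>2)) powr \<alpha>) * a \<xi> = of_real (m n \<xi>) * fourier \<theta> \<xi>"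
          unfolding a_def of_real_mult by (metis mult.assoc)
      qed
      finally show ?thesis by (simp add: \<theta>c)
    qed
    then have "(LINT x|lborel. f x * (\<theta> x + c n x)) = (LINT x|lborel. f x * frac_op \<alpha> \<psi> x)" by simp
    also have "\<dots> = (LINT x|lborel. frac_op \<alpha> f x * \<psi> x)"
      using q1 by (intro frac_op_duality[symmetric] \<alpha> f schwartz_powr_integrable[OF \<psi>]) auto
    also have "\<dots> = (LINT x|(lborel::'a measure). 0)"
    proof (rule integral_cong_AE)
      show "AE x in lborel. frac_op \<alpha> f x * \<psi> x = 0" using z by eventually_elim simp
    qed (use frac_op_measurable[OF \<alpha> fm] in measurable)
    finally show ?thesis by simp
  qed
  have f\<theta>: "integrable lborel (\<lambda>x. f x * \<theta> x)" and fc: "integrable lborel (\<lambda>x. f x * c n x)" for n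
    using holder_integrable[of f lborel \<theta> "\<lambda>x. f x * \<theta> x"] holder_integrable[of f lborel "c n" "\<lambda>x. f x * c n x"] f \<theta>q cq
    by (auto simp: norm_mult)
  have eq: "(LINT x|lborel. f x * \<theta> x) = - (LINT x|lborel. f x * c n x)" for n
    using key[of n] f\<theta> fc[of n] by (simp add: distrib_left add_eq_0_iff)
  \<comment> \<open>Weak convergence in three choices: \<delta> absorbs the uniform L^q bound on
    \<open>c n\<close>, a Schwartz function h approximates f in L^p up to an error adapted to
    \<delta>, and n makes the sup norm of \<open>c n\<close> small against the L^1 norm of
    h.\<close>
  have "norm (LINT x|lborel. f x * \<theta> x) \<le> \<eta>" if \<eta>: "\<eta> > 0" for \<eta>
  proof -
    have "((\<lambda>\<delta>. \<delta> powr (- q) * B) \<longlongrightarrow> 0 * B) at_top"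
      using q0 by (intro tendsto_mult tendsto_const tendsto_neg_powr filterlim_ident) auto
    then have "eventually (\<lambda>\<delta>. \<delta> powr (- q) * B < \<eta> / 3) at_top" using \<eta> by (intro order_tendstoD) auto
    then have "eventually (\<lambda>\<delta>. \<delta> powr (- q) * B < \<eta> / 3 \<and> \<delta> > 0) at_top"
      using eventually_gt_at_top by (rule eventually_conj)
    then obtain \<delta> where \<delta>: "\<delta> > 0" "\<delta> powr (- q) * B < \<eta> / 3" using eventually_happens'[OF trivial_limit_at_top_linorder] by blast
    obtain h where h: "h \<in> schwartz" and hs: "(LINT x|lborel. norm (f x - h x) powr p) < \<eta> / 3 / \<delta> powr p"
      using Lp_dense_schwartz[OF _ fm f, of "\<eta> / 3 / \<delta> powr p"] p1 \<eta> \<delta> by auto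
    note [measurable] = schwartz_measurable[OF h]
    have ih: "integrable lborel (\<lambda>x. norm (f x - h x) powr p)"
      using p1 by (intro integrable_powr_diff f schwartz_powr_integrable[OF h]) auto
    have "(\<lambda>n. (LINT x|lborel. norm (h x)) * b n) \<longlonglongrightarrow> (LINT x|lborel. norm (h x)) * 0" by (intro tendsto_intros b0)
    then have "eventually (\<lambda>n. (LINT x|lborel. norm (h x)) * b n < \<eta> / 3) sequentially" using \<eta> by (intro order_tendstoD) auto
    then obtain n where n: "(LINT x|lborel. norm (h x)) * b n < \<eta> / 3"
      using eventually_happens'[OF trivial_limit_sequentially] by blast
    have hc: "integrable lborel (\<lambda>x. h x * c n x)" and nhc: "norm (h x * c n x) \<le> norm (h x) * b n" for x
    proof -
      show le: "norm (h x * c n x) \<le> norm (h x) * b n" for x using cb[of n x] by (simp add: norm_mult mult_left_mono)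
      show "integrable lborel (\<lambda>x. h x * c n x)"
        by (rule integrable_le[OF integrable_mult_left[OF integrable_norm[OF schwartz_integrable[OF h]], of "b n"] _ le]) measurable
    qed
    have "norm (LINT x|lborel. h x * c n x) \<le> (LINT x|lborel. norm (h x) * b n)"
      using hc nhc schwartz_integrable[OF h] by (intro order_trans[OF integral_norm_bound] integral_mono) auto
    also have "\<dots> < \<eta> / 3" using n by simp
    finally have 1: "norm (LINT x|lborel. h x * c n x) < \<eta> / 3" .
    have "norm (LINT x|lborel. (f x - h x) * c n x) \<le> \<delta> powr p * (LINT x|lborel. norm (f x - h x) powr p) + \<delta> powr (- q) * (LINT x|lborel. norm (c n x) powr q)"
      by (rule holder_le[OF _ _ _ ih cq _ \<delta>(1)]) (auto simp: norm_mult)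
    also have "\<dots> \<le> \<eta> / 3 + \<eta> / 3"
    proof (rule add_mono)
      show "\<delta> powr p * (LINT x|lborel. norm (f x - h x) powr p) \<le> \<eta> / 3"
        using hs \<delta> by (simp add: pos_less_divide_eq mult.commute)
      show "\<delta> powr (- q) * (LINT x|lborel. norm (c n x) powr q) \<le> \<eta> / 3"
        using mult_left_mono[OF B[of n], of "\<delta> powr (- q)"] \<delta>(2) by simp
    qed
    finally have 2: "norm (LINT x|lborel. (f x - h x) * c n x) \<le> \<eta> / 3 + \<eta> / 3" .
    have "(LINT x|lborel. f x * c n x) = (LINT x|lborel. (f x - h x) * c n x) + (LINT x|lborel. h x * c n x)"
      using fc[of n] hc by (simp add: left_diff_distrib)
    then have "norm (LINT x|lborel. f x * c n x) \<le> \<eta>"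
      using 1 2 norm_triangle_ineq[of "LINT x|lborel. (f x - h x) * c n x" "LINT x|lborel. h x * c n x"] by simp
    then show ?thesis by (simp add: eq[of n])
  qed
  then have "norm (LINT x|lborel. f x * \<theta> x) \<le> 0" by (rule field_le_epsilon) simp
  then show "(LINT x|lborel. f x * \<theta> x) = 0" by simp
qed

end

section \<open>Bessel potential spaces and the fractional Laplacian\<close>

lemma borel_imp_lebesgue_measurable: "f \<in> borel_measurable borel \<Longrightarrow> f \<in> borel_measurable lebesgue"
  by (rule measurable_completion) simp

text \<open>The function spaces are defined with the completed measure, whereas product measures and
  Fubini are used over \<open>lborel\<close>. Borel representatives, found coordinate by coordinate,
  connect the two.\<close>

lemma lebesgue_ex_borel:
  fixes f :: "'a::euclidean_space \<Rightarrow> 'b::euclidean_space"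
  assumes "f \<in> borel_measurable lebesgue"
  obtains g where "g \<in> borel_measurable borel" "AE x in lebesgue. f x = g x"
proof -
  have "\<forall>b\<in>Basis. \<exists>g\<in>borel_measurable lborel. AE x in lborel. f x \<bullet> b = g x"
    using assms by (intro ballI completion_ex_borel_measurable_real) simp
  then obtain g where g: "\<And>b. b \<in> Basis \<Longrightarrow> g b \<in> borel_measurable lborel"
    and ae: "\<And>b. b \<in> Basis \<Longrightarrow> AE x in lborel. f x \<bullet> b = g b x"
    by metis
  have "(\<lambda>x. \<Sum>b\<in>Basis. g b x *\<^sub>R b) \<in> borel_measurable borel"
    using g by (intro borel_measurable_sum borel_measurable_scaleR) auto
  moreover have "AE x in lborel. \<forall>b\<in>Basis. f x \<bullet> b = g b x" using ae by (intro AE_finite_allI) auto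
  then have "AE x in lborel. f x = (\<Sum>b\<in>Basis. g b x *\<^sub>R b)"
  proof eventually_elim
    case (elim x)
    then have "(\<Sum>b\<in>Basis. g b x *\<^sub>R b) = (\<Sum>b\<in>Basis. (f x \<bullet> b) *\<^sub>R b)" by (intro sum.cong) auto
    then show ?case by (simp add: euclidean_representation)
  qed
  ultimately show ?thesis using that by (auto intro: AE_completion)
qed

lemma
  fixes f g :: "'a::euclidean_space \<Rightarrow> 'b::euclidean_space" and h :: "'b \<Rightarrow> 'c::euclidean_space"
  assumes f: "f \<in> borel_measurable lebesgue" and g: "g \<in> borel_measurable borel" and ae: "AE x in lebesgue. f x = g x"
    and h: "h \<in> borel_measurable borel"
  shows lebesgue_integral_AE_eq: "(LINT x|lebesgue. h (f x)) = (LINT x|lborel. h (g x))"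
    and lebesgue_integrable_AE_eq: "integrable lebesgue (\<lambda>x. h (f x)) \<longleftrightarrow> integrable lborel (\<lambda>x. h (g x))"
proof -
  have m: "(\<lambda>x. h (f x)) \<in> borel_measurable lebesgue" "(\<lambda>x. h (g x)) \<in> borel_measurable borel"
    using measurable_compose[OF f h] measurable_compose[OF g h] .
  have ae': "AE x in lebesgue. h (f x) = h (g x)" using ae by eventually_elim simp
  show "(LINT x|lebesgue. h (f x)) = (LINT x|lborel. h (g x))"
    unfolding lebesgue_integral_eq_lborel[OF m(2), symmetric]
    by (rule integral_cong_AE[OF m(1) borel_imp_lebesgue_measurable[OF m(2)] ae'])
  show "integrable lebesgue (\<lambda>x. h (f x)) \<longleftrightarrow> integrable lborel (\<lambda>x. h (g x))"
    unfolding integrable_lebesgue_iff[OF m(2), symmetric]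
    by (rule integrable_cong_AE[OF m(1) borel_imp_lebesgue_measurable[OF m(2)] ae'])
qed

lemma norm_powr_measurable: "(\<lambda>x::'a::euclidean_space. norm x powr p) \<in> borel_measurable borel"
  by measurable

lemma Lp_space_iff:
  fixes f g :: "'a::euclidean_space \<Rightarrow> 'b::euclidean_space"
  assumes "f \<in> borel_measurable lebesgue" "g \<in> borel_measurable borel" "AE x in lebesgue. f x = g x"
  shows "f \<in> Lp_space p \<longleftrightarrow> integrable lborel (\<lambda>x. norm (g x) powr p)"
    and "Lp_norm p f = (LINT x|lborel. norm (g x) powr p) powr (1 / p)"
  unfolding Lp_space_def Lp_norm_def
  using lebesgue_integrable_AE_eq[OF assms norm_powr_measurable] lebesgue_integral_AE_eq[OF assms norm_powr_measurable] assms
  by auto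

lemma Lp_space_borel_iff:
  fixes g :: "'a::euclidean_space \<Rightarrow> 'b::euclidean_space"
  assumes "g \<in> borel_measurable borel"
  shows "g \<in> Lp_space p \<longleftrightarrow> integrable lborel (\<lambda>x. norm (g x) powr p)"
    and "Lp_norm p g = (LINT x|lborel. norm (g x) powr p) powr (1 / p)"
  using Lp_space_iff[OF borel_imp_lebesgue_measurable[OF assms] assms] by auto

section \<open>Distributions given by functions\<close>

lemma distr_of_apply:
  assumes f: "f \<in> borel_measurable borel" and \<phi>: "\<phi> \<in> schwartz"
  shows "distr_of f \<phi> = (LINT x|lborel. f x * \<phi> x)"
  unfolding distr_of_def using f \<phi> schwartz_measurable[OF \<phi>] by (simp add: lebesgue_integral_eq_lborel)

lemma distr_of_cong_AE:
  assumes f: "f \<in> borel_measurable lebesgue" and g: "g \<in> borel_measurable borel" and ae: "AE x in lebesgue. f x = g x"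
  shows "distr_of f = distr_of g"
  unfolding distr_of_def
proof (rule restrict_ext)
  fix \<phi> :: "'a \<Rightarrow> complex" assume "\<phi> \<in> schwartz"
  then have [measurable]: "\<phi> \<in> borel_measurable lebesgue" by (intro borel_imp_lebesgue_measurable schwartz_measurable)
  note [measurable] = f borel_imp_lebesgue_measurable[OF g]
  show "(LINT x|lebesgue. f x * \<phi> x) = (LINT x|lebesgue. g x * \<phi> x)"
    by (rule integral_cong_AE) (use ae in \<open>auto elim!: eventually_mono\<close>)
qed

lemma distr_of_extensional: "distr_of f \<in> extensional schwartz"
  unfolding distr_of_def by (rule restrict_extensional)

lemma (in conjugate_exponents) Lp_schwartz_integrable:
  fixes f :: "'a::euclidean_space \<Rightarrow> complex"
  assumes [measurable]: "f \<in> borel_measurable borel" and f: "integrable lborel (\<lambda>x. norm (f x) powr p)" and \<phi>: "\<phi> \<in> schwartz"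
  shows "integrable lborel (\<lambda>x. f x * \<phi> x)"
proof -
  note [measurable] = schwartz_measurable[OF \<phi>]
  show ?thesis
    by (rule holder_integrable[OF _ _ _ f schwartz_powr_integrable[OF \<phi>]]) (use q1 in \<open>auto simp: norm_mult\<close>)
qed

lemma distr_of_inj:
  fixes f g :: "'a::euclidean_space \<Rightarrow> complex"
  assumes p: "1 < p" and [measurable]: "f \<in> borel_measurable borel" "g \<in> borel_measurable borel"
    and f: "integrable lborel (\<lambda>x. norm (f x) powr p)" and g: "integrable lborel (\<lambda>x. norm (g x) powr p)"
    and eq: "\<And>\<phi>. \<phi> \<in> schwartz \<Longrightarrow> distr_of f \<phi> = distr_of g \<phi>"
  shows "AE x in lborel. f x = g x"
proof -
  interpret conjugate_exponents p "p / (p - 1)" by (rule conjugate_exponentsI[OF p])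
  have "AE x in lborel. f x - g x = 0"
  proof (rule Lp_eq_zeroI_schwartz)
    show "(LINT x|lborel. (f x - g x) * \<psi> x) = 0" if "\<psi> \<in> schwartz" for \<psi>
      using eq[OF that] Lp_schwartz_integrable[OF _ f that] Lp_schwartz_integrable[OF _ g that]
      by (simp add: distr_of_apply that left_diff_distrib)
  qed (use p in \<open>auto intro!: integrable_powr_diff f g\<close>)
  then show ?thesis by eventually_elim simp
qed

section \<open>Bessel potentials on test functions and on distributions\<close>

lemma bracket_powr: "bracket \<xi> powr s = (1 + (norm \<xi>)\<^sup>2) powr (s / 2)"
proof -
  have "sqrt (1 + (norm \<xi>)\<^sup>2) = (1 + (norm \<xi>)\<^sup>2) powr (1 / 2)" by (rule powr_half_sqrt[symmetric]) simp
  then show ?thesis unfolding bracket_def by (simp add: powr_powr)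
qed

lemma bracket_slowly_increasing: "(\<lambda>\<xi>. of_real (bracket \<xi> powr s)) \<in> slowly_increasing"
  unfolding bracket_powr by (rule slowly_increasing_bracket_powr) simp

text \<open>The action on test functions that is dual to \<open>bessel_operator\<close>. A
  distribution is transformed by transforming the test function, so the two transforms occur here in
  the opposite order from \<open>bessel_pot\<close>.\<close>

definition bessel_mult :: "real \<Rightarrow> ('a::euclidean_space \<Rightarrow> complex) \<Rightarrow> 'a \<Rightarrow> complex" where
  "bessel_mult s \<phi> = fourier (\<lambda>\<xi>. of_real (bracket \<xi> powr s) * inv_fourier \<phi> \<xi>)"

definition bessel_pot :: "real \<Rightarrow> ('a::euclidean_space \<Rightarrow> complex) \<Rightarrow> 'a \<Rightarrow> complex" where
  "bessel_pot s \<phi> = inv_fourier (\<lambda>\<xi>. of_real (bracket \<xi> powr s) * fourier \<phi> \<xi>)"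

lemma bessel_mult_schwartz: "\<phi> \<in> schwartz \<Longrightarrow> bessel_mult s \<phi> \<in> schwartz"
  unfolding bessel_mult_def by (intro fourier_schwartz schwartz_mult bracket_slowly_increasing inv_fourier_schwartz)

lemma bessel_pot_schwartz: "\<phi> \<in> schwartz \<Longrightarrow> bessel_pot s \<phi> \<in> schwartz"
  unfolding bessel_pot_def by (intro inv_fourier_schwartz schwartz_mult bracket_slowly_increasing fourier_schwartz)

lemma bracket_cancel: "of_real (bracket \<xi> powr s) * (of_real (bracket \<xi> powr - s) * z) = (z :: complex)"
proof -
  have "1 + (norm \<xi>)\<^sup>2 \<noteq> 0" using add_pos_nonneg[of 1 "(norm \<xi>)\<^sup>2"] by simp
  then have "bracket \<xi> powr s * bracket \<xi> powr - s = 1"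
    unfolding bracket_powr by (simp add: powr_add[symmetric])
  then show ?thesis by (metis mult.assoc mult_1 of_real_1 of_real_mult)
qed

lemma bessel_mult_inverse: "\<phi> \<in> schwartz \<Longrightarrow> bessel_mult s (bessel_mult (- s) \<phi>) = \<phi>"
  unfolding bessel_mult_def
  by (subst inv_fourier_fourier)
     (auto intro!: schwartz_mult bracket_slowly_increasing inv_fourier_schwartz simp: bracket_cancel fourier_inv_fourier)

lemma bessel_pot_inverse: "\<phi> \<in> schwartz \<Longrightarrow> bessel_pot s (bessel_pot (- s) \<phi>) = \<phi>"
  unfolding bessel_pot_def
  by (subst fourier_inv_fourier)
     (auto intro!: schwartz_mult bracket_slowly_increasing fourier_schwartz simp: bracket_cancel inv_fourier_fourier)

lemma bessel_operator_apply:
  "\<phi> \<in> schwartz \<Longrightarrow> bessel_operator s u \<phi> = u (bessel_mult s \<phi>)"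
  unfolding bessel_operator_def distr_inv_fourier_def distr_mult_def distr_fourier_def bessel_mult_def
  by (simp add: inv_fourier_schwartz schwartz_mult bracket_slowly_increasing)

lemma bessel_operator_extensional: "bessel_operator s u \<in> extensional schwartz"
  unfolding bessel_operator_def distr_inv_fourier_def by (rule restrict_extensional)

text \<open>\<open>bessel_mult s\<close> maps onto the Schwartz functions, so \<open>u\<close> is
  recovered from the values of \<open>bessel_operator s u\<close>.\<close>

lemma bessel_operator_inj:
  assumes "u \<in> tempered_distributions" "v \<in> tempered_distributions" "bessel_operator s u = bessel_operator s v"
  shows "u = v"
proof (rule extensionalityI[of _ schwartz])
  show "u \<in> extensional schwartz" "v \<in> extensional schwartz" using assms unfolding tempered_distributions_def by auto
  fix \<phi> :: "'a \<Rightarrow> complex" assume "\<phi> \<in> schwartz"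
  then show "u \<phi> = v \<phi>"
    using bessel_operator_apply[OF bessel_mult_schwartz[of \<phi> "- s"], of s u] bessel_operator_apply[OF bessel_mult_schwartz[of \<phi> "- s"], of s v] assms(3)
    by (simp add: bessel_mult_inverse)
qed

lemma bessel_operator_distr_of:
  fixes \<phi> :: "'a::euclidean_space \<Rightarrow> complex"
  assumes \<phi>: "\<phi> \<in> schwartz" shows "bessel_operator s (distr_of \<phi>) = distr_of (bessel_pot s \<phi>)"
proof (rule extensionalityI[OF bessel_operator_extensional distr_of_extensional])
  fix \<psi> :: "'a \<Rightarrow> complex" assume \<psi>: "\<psi> \<in> schwartz"
  define b where "b \<xi> = complex_of_real (bracket \<xi> powr s)" for \<xi> :: 'a
  have b: "b \<in> slowly_increasing" unfolding b_def by (rule bracket_slowly_increasing)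
  have 1: "(\<lambda>\<xi>. b \<xi> * inv_fourier \<psi> \<xi>) \<in> schwartz" by (intro schwartz_mult b inv_fourier_schwartz \<psi>)
  have 2: "(\<lambda>\<xi>. b \<xi> * fourier \<phi> \<xi>) \<in> schwartz" by (intro schwartz_mult b fourier_schwartz \<phi>)
  have "bessel_operator s (distr_of \<phi>) \<psi> = (LINT x|lborel. \<phi> x * fourier (\<lambda>\<xi>. b \<xi> * inv_fourier \<psi> \<xi>) x)"
    unfolding bessel_operator_apply[OF \<psi>] distr_of_apply[OF schwartz_measurable[OF \<phi>] bessel_mult_schwartz[OF \<psi>]]
    by (simp only: bessel_mult_def b_def)
  also have "\<dots> = (LINT x|lborel. fourier \<phi> x * (b x * inv_fourier \<psi> x))"
    by (rule integral_fourier_mult[symmetric]) (intro schwartz_integrable \<phi> 1)+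
  also have "\<dots> = (LINT x|lborel. (b x * fourier \<phi> x) * inv_fourier \<psi> x)" by (simp add: mult_ac)
  also have "\<dots> = (LINT x|lborel. inv_fourier (\<lambda>\<xi>. b \<xi> * fourier \<phi> \<xi>) x * \<psi> x)"
    by (rule integral_inv_fourier_mult[symmetric]) (intro schwartz_integrable \<psi> 2)+
  also have "\<dots> = distr_of (bessel_pot s \<phi>) \<psi>"
    unfolding distr_of_apply[OF schwartz_measurable[OF bessel_pot_schwartz[OF \<phi>]] \<psi>]
    by (simp only: bessel_pot_def b_def)
  finally show "bessel_operator s (distr_of \<phi>) \<psi> = distr_of (bessel_pot s \<phi>) \<psi>" .
qed

lemma finite_lists_Basis: "finite {bs. bs \<in> lists (Basis :: 'a::euclidean_space set) \<and> length bs \<le> k}"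
proof -
  have "{bs. bs \<in> lists (Basis :: 'a set) \<and> length bs \<le> k} = {bs. set bs \<subseteq> Basis \<and> length bs \<le> k}" by auto
  then show ?thesis using finite_lists_length_le[of "Basis :: 'a set" k] by simp
qed

lemma schwartz_bdd_above:
  assumes "\<phi> \<in> schwartz" "bs \<in> lists Basis"
  shows "bdd_above (range (\<lambda>x. (1 + norm x) ^ k * norm (partial_derivs bs \<phi> x)))"
proof -
  have "bounded (range (\<lambda>x. (1 + norm x) ^ k *\<^sub>R partial_derivs bs \<phi> x))" using assms unfolding schwartz_def by blast
  then obtain B where "\<And>x. norm ((1 + norm x) ^ k *\<^sub>R partial_derivs bs \<phi> x) \<le> B" unfolding bounded_iff by auto
  then show ?thesis by (intro bdd_aboveI[of _ B]) auto
qed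

lemma schwartz_seminorm_mono:
  fixes \<phi> :: "'a::euclidean_space \<Rightarrow> complex"
  assumes \<phi>: "\<phi> \<in> schwartz" and kl: "k \<le> l"
  shows "0 \<le> schwartz_seminorm k \<phi>" "schwartz_seminorm k \<phi> \<le> schwartz_seminorm l \<phi>"
proof -
  have nn: "0 \<le> (SUP x. (1 + norm x) ^ j * norm (partial_derivs bs \<phi> x))" if "bs \<in> lists Basis" for bs j
    by (rule cSUP_upper2[OF schwartz_bdd_above[OF \<phi> that], of 0]) auto
  show "0 \<le> schwartz_seminorm k \<phi>" unfolding schwartz_seminorm_def by (intro sum_nonneg nn) auto
  have "schwartz_seminorm k \<phi> \<le> (\<Sum>bs | bs \<in> lists Basis \<and> length bs \<le> k. SUP x. (1 + norm x) ^ l * norm (partial_derivs bs \<phi> x))"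
    unfolding schwartz_seminorm_def
  proof (intro sum_mono cSUP_mono)
    fix bs :: "'a list" and x :: 'a assume bs: "bs \<in> {bs. bs \<in> lists Basis \<and> length bs \<le> k}"
    then show "bdd_above (range (\<lambda>x. (1 + norm x) ^ l * norm (partial_derivs bs \<phi> x)))" by (intro schwartz_bdd_above[OF \<phi>]) simp
    show "\<exists>y\<in>UNIV. (1 + norm x) ^ k * norm (partial_derivs bs \<phi> x) \<le> (1 + norm y) ^ l * norm (partial_derivs bs \<phi> y)"
      using kl by (intro bexI[of _ x] mult_right_mono power_increasing) auto
  qed auto
  also have "\<dots> \<le> schwartz_seminorm l \<phi>"
    unfolding schwartz_seminorm_def using kl nn by (intro sum_mono2 finite_lists_Basis) auto
  finally show "schwartz_seminorm k \<phi> \<le> schwartz_seminorm l \<phi>" .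
qed

lemma norm_le_schwartz_seminorm:
  fixes \<phi> :: "'a::euclidean_space \<Rightarrow> complex"
  assumes \<phi>: "\<phi> \<in> schwartz" shows "norm (\<phi> x) \<le> schwartz_seminorm k \<phi>"
proof -
  have "{bs. bs \<in> lists (Basis :: 'a set) \<and> length bs \<le> 0} = {[]}" by auto
  then have "schwartz_seminorm 0 \<phi> = (SUP x. norm (\<phi> x))" by (simp add: schwartz_seminorm_def)
  moreover have "norm (\<phi> x) \<le> (SUP x. norm (\<phi> x))"
    using schwartz_bdd_above[OF \<phi>, of "[]" 0] by (intro cSUP_upper) auto
  ultimately show ?thesis using schwartz_seminorm_mono(2)[OF \<phi>, of 0 k] by simp
qed

lemma distr_of_tempered:
  fixes f :: "'a::euclidean_space \<Rightarrow> complex"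
  assumes f: "f \<in> schwartz" shows "distr_of f \<in> tempered_distributions"
proof -
  note fm [measurable] = schwartz_measurable[OF f]
  have i: "integrable lborel (\<lambda>x. f x * \<phi> x)" if \<phi>: "\<phi> \<in> schwartz" for \<phi>
  proof -
    note [measurable] = schwartz_measurable[OF \<phi>]
    show ?thesis
      by (rule integrable_le[OF integrable_mult_left[OF integrable_norm[OF schwartz_integrable[OF f]], of "schwartz_seminorm 0 \<phi>"]])
         (auto simp: norm_mult intro!: mult_left_mono norm_le_schwartz_seminorm \<phi>)
  qed
  have b: "norm (distr_of f \<phi>) \<le> (LINT x|lborel. norm (f x)) * schwartz_seminorm 0 \<phi>" if \<phi>: "\<phi> \<in> schwartz" for \<phi>
  proof -
    have "norm (distr_of f \<phi>) \<le> (LINT x|lborel. norm (f x) * schwartz_seminorm 0 \<phi>)"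
      unfolding distr_of_apply[OF fm \<phi>]
    proof (rule order_trans[OF integral_norm_bound integral_mono])
      show "norm (f x * \<phi> x) \<le> norm (f x) * schwartz_seminorm 0 \<phi>" for x
        by (auto simp: norm_mult intro!: mult_left_mono norm_le_schwartz_seminorm \<phi>)
    qed (intro integrable_norm integrable_mult_left i[OF \<phi>] schwartz_integrable[OF f])+
    then show ?thesis by simp
  qed
  have "distr_of f (\<lambda>x. \<phi> x + \<psi> x) = distr_of f \<phi> + distr_of f \<psi>" if "\<phi> \<in> schwartz" "\<psi> \<in> schwartz" for \<phi> \<psi>
    using that i by (simp add: distr_of_apply[OF fm] schwartz_add distrib_left)
  moreover have "distr_of f (\<lambda>x. c * \<phi> x) = c * distr_of f \<phi>" if "\<phi> \<in> schwartz" for \<phi> c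
    using that by (simp add: distr_of_apply[OF fm] schwartz_cmult mult.left_commute)
  ultimately show ?thesis unfolding tempered_distributions_def using b distr_of_extensional by blast
qed

lemma tempered_distr_diff:
  assumes S: "S \<in> tempered_distributions" and T: "T \<in> tempered_distributions"
  shows "distr_diff S T \<in> tempered_distributions"
proof -
  obtain C k where C: "\<And>\<phi>. \<phi> \<in> schwartz \<Longrightarrow> norm (S \<phi>) \<le> C * schwartz_seminorm k \<phi>"
    using S unfolding tempered_distributions_def by blast
  obtain D l where D: "\<And>\<phi>. \<phi> \<in> schwartz \<Longrightarrow> norm (T \<phi>) \<le> D * schwartz_seminorm l \<phi>"
    using T unfolding tempered_distributions_def by blast
  have "norm (distr_diff S T \<phi>) \<le> (\<bar>C\<bar> + \<bar>D\<bar>) * schwartz_seminorm (k + l) \<phi>" if \<phi>: "\<phi> \<in> schwartz" for \<phi>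
  proof -
    have "norm (S \<phi>) \<le> \<bar>C\<bar> * schwartz_seminorm (k + l) \<phi>"
      using schwartz_seminorm_mono[OF \<phi>, of k "k + l"] by (intro order_trans[OF C[OF \<phi>]] mult_mono) auto
    moreover have "norm (T \<phi>) \<le> \<bar>D\<bar> * schwartz_seminorm (k + l) \<phi>"
      using schwartz_seminorm_mono[OF \<phi>, of l "k + l"] by (intro order_trans[OF D[OF \<phi>]] mult_mono) auto
    ultimately show ?thesis using norm_triangle_ineq4[of "S \<phi>" "T \<phi>"] \<phi> by (simp add: distr_diff_def distrib_right)
  qed
  then have "\<exists>C k. \<forall>\<phi>\<in>schwartz. norm (distr_diff S T \<phi>) \<le> C * schwartz_seminorm k \<phi>" by blast
  moreover have "distr_diff S T \<in> extensional schwartz" unfolding distr_diff_def by (rule restrict_extensional)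
  moreover have "distr_diff S T (\<lambda>x. \<phi> x + \<psi> x) = distr_diff S T \<phi> + distr_diff S T \<psi>" if "\<phi> \<in> schwartz" "\<psi> \<in> schwartz" for \<phi> \<psi>
    using S T that unfolding tempered_distributions_def by (simp add: distr_diff_def schwartz_add)
  moreover have "distr_diff S T (\<lambda>x. c * \<phi> x) = c * distr_diff S T \<phi>" if "\<phi> \<in> schwartz" for \<phi> c
    using S T that unfolding tempered_distributions_def by (simp add: distr_diff_def schwartz_cmult right_diff_distrib)
  ultimately show ?thesis unfolding tempered_distributions_def by blast
qed

lemma bessel_operator_diff: "bessel_operator s (distr_diff S T) = distr_diff (bessel_operator s S) (bessel_operator s T)"
proof (rule extensionalityI[OF bessel_operator_extensional])
  show "distr_diff (bessel_operator s S) (bessel_operator s T) \<in> extensional schwartz" unfolding distr_diff_def by (rule restrict_extensional)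
  fix \<phi> :: "'a \<Rightarrow> complex" assume "\<phi> \<in> schwartz"
  then show "bessel_operator s (distr_diff S T) \<phi> = distr_diff (bessel_operator s S) (bessel_operator s T) \<phi>"
    by (simp add: bessel_operator_apply distr_diff_def bessel_mult_schwartz)
qed

text \<open>Names a Borel density of the Bessel operator applied to \<open>u\<close>, so that null
  sets and choices of representatives are dealt with once.\<close>

definition bessel_rep :: "real \<Rightarrow> real \<Rightarrow> 'a::euclidean_space functional \<Rightarrow> ('a \<Rightarrow> complex) \<Rightarrow> bool" where
  "bessel_rep s p u f \<longleftrightarrow> u \<in> tempered_distributions \<and> f \<in> borel_measurable borel \<and>
     integrable lborel (\<lambda>x. norm (f x) powr p) \<and> bessel_operator s u = distr_of f"

lemma bessel_space_iff_rep: "u \<in> bessel_space s p \<longleftrightarrow> (\<exists>f. bessel_rep s p u f)"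
proof
  assume "u \<in> bessel_space s p"
  then obtain f where f: "f \<in> Lp_space p" "bessel_operator s u = distr_of f" and u: "u \<in> tempered_distributions"
    unfolding bessel_space_def by blast
  then have fm: "f \<in> borel_measurable lebesgue" unfolding Lp_space_def by blast
  then obtain g where g: "g \<in> borel_measurable borel" "AE x in lebesgue. f x = g x" using lebesgue_ex_borel by blast
  then show "\<exists>f. bessel_rep s p u f"
    using f u Lp_space_iff(1)[OF fm g] distr_of_cong_AE[OF fm g] unfolding bessel_rep_def by auto
next
  assume "\<exists>f. bessel_rep s p u f"
  then show "u \<in> bessel_space s p" unfolding bessel_space_def bessel_rep_def using Lp_space_borel_iff by blast
qed

text \<open>\<open>bessel_norm\<close> picks some density; two L^p densities of one distribution
  agree almost everywhere, so the choice does not affect the integral.\<close>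

lemma bessel_norm_eq:
  assumes p: "1 < p" and f: "bessel_rep s p u f"
  shows "bessel_norm s p u = (LINT x|lborel. norm (f x) powr p) powr (1 / p)"
proof -
  note f' = f[unfolded bessel_rep_def]
  define g where "g = (SOME f. f \<in> Lp_space p \<and> bessel_operator s u = distr_of f)"
  have "f \<in> Lp_space p \<and> bessel_operator s u = distr_of f" using f' Lp_space_borel_iff by blast
  then have g: "g \<in> Lp_space p" "bessel_operator s u = distr_of g"
    unfolding g_def by (metis (mono_tags, lifting) someI_ex)+
  then have gm: "g \<in> borel_measurable lebesgue" unfolding Lp_space_def by blast
  then obtain h where h: "h \<in> borel_measurable borel" "AE x in lebesgue. g x = h x" using lebesgue_ex_borel by blast
  have "AE x in lborel. f x = h x"
    using f' g h distr_of_cong_AE[OF gm h] Lp_space_iff(1)[OF gm h] by (intro distr_of_inj[OF p]) auto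
  then have "(LINT x|lborel. norm (f x) powr p) = (LINT x|lborel. norm (h x) powr p)"
    using f' h by (intro integral_cong_AE) (auto elim!: eventually_mono)
  then show ?thesis
    unfolding bessel_norm_def g_def[symmetric] using Lp_space_iff(2)[OF gm h] by simp
qed

lemma bessel_rep_distr_of:
  assumes p: "1 < p" and \<phi>: "\<phi> \<in> schwartz" shows "bessel_rep s p (distr_of \<phi>) (bessel_pot s \<phi>)"
  unfolding bessel_rep_def using p
  by (auto intro!: distr_of_tempered bessel_operator_distr_of schwartz_measurable schwartz_powr_integrable bessel_pot_schwartz \<phi>)

lemma bessel_rep_diff:
  assumes p: "1 < p" and S: "bessel_rep s p S f" and T: "bessel_rep s p T g"
  shows "bessel_rep s p (distr_diff S T) (\<lambda>x. f x - g x)"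
proof -
  interpret conjugate_exponents p "p / (p - 1)" by (rule conjugate_exponentsI[OF p])
  note S' = S[unfolded bessel_rep_def] and T' = T[unfolded bessel_rep_def]
  have "distr_diff (distr_of f) (distr_of g) = distr_of (\<lambda>x. f x - g x)"
  proof (rule extensionalityI[OF _ distr_of_extensional])
    show "distr_diff (distr_of f) (distr_of g) \<in> extensional schwartz" unfolding distr_diff_def by (rule restrict_extensional)
    fix \<phi> :: "'a \<Rightarrow> complex" assume \<phi>: "\<phi> \<in> schwartz"
    have "(\<lambda>x. f x - g x) \<in> borel_measurable borel" using S' T' by (intro borel_measurable_diff) auto
    then show "distr_diff (distr_of f) (distr_of g) \<phi> = distr_of (\<lambda>x. f x - g x) \<phi>"
      using \<phi> S' T' Lp_schwartz_integrable[of f \<phi>] Lp_schwartz_integrable[of g \<phi>]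
      by (simp add: distr_diff_def distr_of_apply left_diff_distrib)
  qed
  then show ?thesis unfolding bessel_rep_def bessel_operator_diff
    using S' T' p by (auto intro!: tempered_distr_diff integrable_powr_diff)
qed

text \<open>The symbol factors as |\<xi>|^s = (|\<xi>|^2 / (1 + |\<xi>|^2))^(s/2) * (1 +
  |\<xi>|^2)^(s/2): the second factor is smooth and defines the Bessel space, the first is bounded
  and carries the singularity.\<close>

lemma frac_laplacian_schwartz_eq:
  fixes \<phi> :: "'a::euclidean_space \<Rightarrow> complex"
  assumes \<phi>: "\<phi> \<in> schwartz" and s: "s > 0"
  shows "frac_laplacian_schwartz (s / 2) \<phi> = frac_op (s / 2) (bessel_pot s \<phi>)"
proof
  fix x
  define a where "a \<xi> = of_real (bracket \<xi> powr s) * fourier \<phi> \<xi>" for \<xi> :: 'a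
  have a: "a \<in> schwartz" unfolding a_def by (intro schwartz_mult bracket_slowly_increasing fourier_schwartz \<phi>)
  have "frac_op (s / 2) (bessel_pot s \<phi>) x = inv_fourier (\<lambda>\<xi>. of_real (((norm \<xi>)\<^sup>2 / (1 + (norm \<xi>)\<^sup>2)) powr (s / 2)) * a \<xi>) x"
    unfolding frac_op_def bessel_pot_def a_def[symmetric] using s
    by (intro conv_frac_kernel_inv_fourier schwartz_integrable[OF a]) auto
  also have "(\<lambda>\<xi>. of_real (((norm \<xi>)\<^sup>2 / (1 + (norm \<xi>)\<^sup>2)) powr (s / 2)) * a \<xi>) = (\<lambda>\<xi>. of_real (norm \<xi> powr (2 * (s / 2))) * fourier \<phi> \<xi>)"
  proof
    fix \<xi> :: 'a
    have pos: "1 + (norm \<xi>)\<^sup>2 > 0" by (simp add: add_pos_nonneg)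
    have "((norm \<xi>)\<^sup>2) powr (s / 2) = norm \<xi> powr s"
      by (cases "\<xi> = 0") (simp_all add: powr_numeral[symmetric] powr_powr del: powr_numeral)
    then have "((norm \<xi>)\<^sup>2 / (1 + (norm \<xi>)\<^sup>2)) powr (s / 2) * bracket \<xi> powr s = norm \<xi> powr (2 * (s / 2))"
      unfolding bracket_powr using pos by (simp add: powr_divide)
    then show "of_real (((norm \<xi>)\<^sup>2 / (1 + (norm \<xi>)\<^sup>2)) powr (s / 2)) * a \<xi> = of_real (norm \<xi> powr (2 * (s / 2))) * fourier \<phi> \<xi>"
      unfolding a_def by (metis mult.assoc of_real_mult)
  qed
  finally show "frac_laplacian_schwartz (s / 2) \<phi> x = frac_op (s / 2) (bessel_pot s \<phi>) x"
    unfolding frac_laplacian_schwartz_def by simp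
qed

section \<open>Identification of the fractional Laplacian with \<open>frac_op\<close>\<close>

lemma powr_tendsto_zero_iff:
  fixes a :: "nat \<Rightarrow> real"
  assumes "\<And>n. a n \<ge> 0" "p > 0"
  shows "(\<lambda>n. a n powr (1 / p)) \<longlonglongrightarrow> 0 \<longleftrightarrow> a \<longlonglongrightarrow> 0"
proof
  assume "(\<lambda>n. a n powr (1 / p)) \<longlonglongrightarrow> 0"
  then have "(\<lambda>n. (a n powr (1 / p)) powr p) \<longlonglongrightarrow> 0 powr p"
    using assms by (intro tendsto_powr') auto
  then show "a \<longlonglongrightarrow> 0" using assms by (simp add: powr_powr)
next
  assume "a \<longlonglongrightarrow> 0"
  then have "(\<lambda>n. a n powr (1 / p)) \<longlonglongrightarrow> 0 powr (1 / p)"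
    using assms by (intro tendsto_powr') auto
  then show "(\<lambda>n. a n powr (1 / p)) \<longlonglongrightarrow> 0" using assms by simp
qed

text \<open>On Schwartz functions the fractional Laplacian is \<open>frac_op\<close> of the Bessel
  potential, and \<open>frac_op\<close> is bounded on L^p. Convergence in the Bessel norm therefore
  forces the images to converge to \<open>frac_op (s / 2) f\<close> along every sequence, and
  density of the Schwartz functions provides one. A definition by limits becomes a formula.\<close>

lemma
  fixes w :: "'a::euclidean_space \<Rightarrow> complex"
  assumes p: "1 < p" and s: "0 < s" and f: "bessel_rep s p u f" and wm: "w \<in> borel_measurable lebesgue"
  shows has_frac_laplacian_iff: "has_frac_laplacian (s / 2) p u w \<longleftrightarrow> (AE x in lebesgue. w x = frac_op (s / 2) f x)"
proof -
  interpret conjugate_exponents p "p / (p - 1)" by (rule conjugate_exponentsI[OF p])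
  note f' = f[unfolded bessel_rep_def]
  then have fm [measurable]: "f \<in> borel_measurable borel" and fi: "integrable lborel (\<lambda>x. norm (f x) powr p)" by auto
  have s2: "s / 2 > 0" "2 * (s / 2) = s" using s by auto
  have Tm [measurable]: "frac_op (s / 2) f \<in> borel_measurable borel" by (rule frac_op_measurable[OF s2(1) fm])
  have Ti: "integrable lborel (\<lambda>x. norm (frac_op (s / 2) f x) powr p)" by (rule frac_op_integrable[OF s2(1) fm fi])
  define C where "C = 2 powr p * (1 + (2 * (LINT t|lborel. \<bar>weight (s / 2) t\<bar>)) powr p)"
  have step: "(LINT x|lborel. norm (frac_laplacian_schwartz (s / 2) \<phi> x - frac_op (s / 2) f x) powr p) \<le> C * (LINT x|lborel. norm (bessel_pot s \<phi> x - f x) powr p)"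
    and Pm: "frac_laplacian_schwartz (s / 2) \<phi> \<in> borel_measurable borel"
    and Pi: "integrable lborel (\<lambda>x. norm (frac_laplacian_schwartz (s / 2) \<phi> x) powr p)"
    and Ri: "integrable lborel (\<lambda>x. norm (bessel_pot s \<phi> x - f x) powr p)" if \<phi>: "\<phi> \<in> schwartz" for \<phi>
  proof -
    note [measurable] = schwartz_measurable[OF bessel_pot_schwartz[OF \<phi>, of s]]
    have i: "integrable lborel (\<lambda>x. norm (bessel_pot s \<phi> x) powr p)"
      using p by (intro schwartz_powr_integrable bessel_pot_schwartz \<phi>) auto
    show Pm [measurable]: "frac_laplacian_schwartz (s / 2) \<phi> \<in> borel_measurable borel"
      unfolding frac_laplacian_schwartz_eq[OF \<phi> s] by (rule frac_op_measurable[OF s2(1)]) measurable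
    show "integrable lborel (\<lambda>x. norm (frac_laplacian_schwartz (s / 2) \<phi> x) powr p)"
      unfolding frac_laplacian_schwartz_eq[OF \<phi> s] by (rule frac_op_integrable[OF s2(1) _ i]) measurable
    show Ri: "integrable lborel (\<lambda>x. norm (bessel_pot s \<phi> x - f x) powr p)"
      using p by (intro integrable_powr_diff i fi) auto
    have [measurable]: "frac_op (s / 2) (\<lambda>x. bessel_pot s \<phi> x - f x) \<in> borel_measurable borel"
      by (rule frac_op_measurable[OF s2(1)]) measurable
    have "AE x in lborel. frac_op (s / 2) (\<lambda>x. bessel_pot s \<phi> x - f x) x = frac_laplacian_schwartz (s / 2) \<phi> x - frac_op (s / 2) f x"
      unfolding frac_laplacian_schwartz_eq[OF \<phi> s] by (rule frac_op_diff[OF s2(1) _ _ i fi]) measurable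
    then have "(LINT x|lborel. norm (frac_laplacian_schwartz (s / 2) \<phi> x - frac_op (s / 2) f x) powr p) = (LINT x|lborel. norm (frac_op (s / 2) (\<lambda>x. bessel_pot s \<phi> x - f x) x) powr p)"
      by (intro integral_cong_AE) (auto elim!: eventually_mono)
    also have "\<dots> \<le> C * (LINT x|lborel. norm (bessel_pot s \<phi> x - f x) powr p)"
      unfolding C_def by (rule frac_op_le[OF s2(1) _ Ri]) measurable
    finally show "(LINT x|lborel. norm (frac_laplacian_schwartz (s / 2) \<phi> x - frac_op (s / 2) f x) powr p) \<le> C * (LINT x|lborel. norm (bessel_pot s \<phi> x - f x) powr p)" .
  qed
  obtain g where g [measurable]: "g \<in> borel_measurable borel" and wg: "AE x in lebesgue. w x = g x"
    using lebesgue_ex_borel[OF wm] by blast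
  have bn: "bessel_norm s p (distr_diff (distr_of \<phi>) u) = (LINT x|lborel. norm (bessel_pot s \<phi> x - f x) powr p) powr (1 / p)" if "\<phi> \<in> schwartz" for \<phi>
    by (rule bessel_norm_eq[OF p bessel_rep_diff[OF p bessel_rep_distr_of[OF p that] f]])
  have fw: "(\<lambda>x. frac_laplacian_schwartz (s / 2) \<phi> x - w x) \<in> borel_measurable lebesgue"
    "AE x in lebesgue. frac_laplacian_schwartz (s / 2) \<phi> x - w x = frac_laplacian_schwartz (s / 2) \<phi> x - g x"
    "(\<lambda>x. frac_laplacian_schwartz (s / 2) \<phi> x - g x) \<in> borel_measurable borel" if "\<phi> \<in> schwartz" for \<phi>
    using borel_imp_lebesgue_measurable[OF Pm[OF that]] wm Pm[OF that] wg by (auto elim!: eventually_mono)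
  have Lw: "w \<in> Lp_space p \<longleftrightarrow> integrable lborel (\<lambda>x. norm (g x) powr p)" by (rule Lp_space_iff[OF wm g wg])
  have C0: "C \<ge> 0" unfolding C_def by (intro mult_nonneg_nonneg add_nonneg_nonneg) auto
  show ?thesis
  proof
    assume "has_frac_laplacian (s / 2) p u w"
    then obtain \<phi> where wL: "w \<in> Lp_space p" and \<phi>: "\<And>k::nat. \<phi> k \<in> schwartz"
      and l1: "(\<lambda>k. bessel_norm s p (distr_diff (distr_of (\<phi> k)) u)) \<longlonglongrightarrow> 0"
      and l2: "(\<lambda>k. Lp_norm p (\<lambda>x. frac_laplacian_schwartz (s / 2) (\<phi> k) x - w x)) \<longlonglongrightarrow> 0"
      unfolding has_frac_laplacian_def s2(2) by blast
    have gi: "integrable lborel (\<lambda>x. norm (g x) powr p)" using wL Lw by simp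
    have L1: "(\<lambda>k. LINT x|lborel. norm (bessel_pot s (\<phi> k) x - f x) powr p) \<longlonglongrightarrow> 0"
      using l1 p unfolding bn[OF \<phi>] by (subst (asm) powr_tendsto_zero_iff) auto
    have L2: "(\<lambda>k. LINT x|lborel. norm (frac_laplacian_schwartz (s / 2) (\<phi> k) x - g x) powr p) \<longlonglongrightarrow> 0"
      using l2 p unfolding Lp_space_iff(2)[OF fw(1)[OF \<phi>] fw(3)[OF \<phi>] fw(2)[OF \<phi>]] by (subst (asm) powr_tendsto_zero_iff) auto
    define d where "d k = 2 powr p * ((LINT x|lborel. norm (frac_laplacian_schwartz (s / 2) (\<phi> k) x - g x) powr p) + C * (LINT x|lborel. norm (bessel_pot s (\<phi> k) x - f x) powr p))" for k
    have "d \<longlonglongrightarrow> 2 powr p * (0 + C * 0)" unfolding d_def by (intro tendsto_intros L1 L2)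
    moreover have "(LINT x|lborel. norm (frac_op (s / 2) f x - g x) powr p) \<le> d k" for k
    proof -
      note [measurable] = Pm[OF \<phi>[of k]]
      have i1: "integrable lborel (\<lambda>x. norm (frac_laplacian_schwartz (s / 2) (\<phi> k) x - g x) powr p)"
        and i2: "integrable lborel (\<lambda>x. norm (frac_laplacian_schwartz (s / 2) (\<phi> k) x - frac_op (s / 2) f x) powr p)"
        using p by (intro integrable_powr_diff Pi[OF \<phi>] gi Ti; simp)+
      have "(LINT x|lborel. norm (frac_op (s / 2) f x - g x) powr p) \<le> 2 powr p * ((LINT x|lborel. norm (frac_laplacian_schwartz (s / 2) (\<phi> k) x - g x) powr p) + (LINT x|lborel. norm (frac_laplacian_schwartz (s / 2) (\<phi> k) x - frac_op (s / 2) f x) powr p))"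
        using integral_powr_diff_le[OF _ _ _ i1 i2] p by simp
      also have "\<dots> \<le> d k" unfolding d_def by (intro mult_left_mono add_left_mono step[OF \<phi>]) auto
      finally show ?thesis .
    qed
    ultimately have "(LINT x|lborel. norm (frac_op (s / 2) f x - g x) powr p) \<le> 0"
      by (intro tendsto_lowerbound[where f = d and F = sequentially]) auto
    then have "(LINT x|lborel. norm (frac_op (s / 2) f x - g x) powr p) = 0" by (simp add: antisym)
    moreover have "integrable lborel (\<lambda>x. norm (frac_op (s / 2) f x - g x) powr p)"
      using p by (intro integrable_powr_diff Ti gi) auto
    ultimately have "AE x in lborel. norm (frac_op (s / 2) f x - g x) powr p = 0"
      by (subst (asm) integral_nonneg_eq_0_iff_AE) auto
    then have "AE x in lebesgue. norm (frac_op (s / 2) f x - g x) powr p = 0" by (rule AE_completion)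
    then show "AE x in lebesgue. w x = frac_op (s / 2) f x" using wg by eventually_elim simp
  next
    assume eq: "AE x in lebesgue. w x = frac_op (s / 2) f x"
    have wL: "w \<in> Lp_space p" using Lp_space_iff(1)[OF wm Tm eq] Ti by simp
    \<comment> \<open>\<open>bessel_pot s\<close> is onto the Schwartz functions, so a Schwartz
      approximant \<psi> of f is pulled back to \<open>bessel_pot (- s) \<psi>\<close>.\<close>
    have "\<exists>\<phi>\<in>schwartz. (LINT x|lborel. norm (bessel_pot s \<phi> x - f x) powr p) < 1 / real (Suc n)" for n
    proof -
      obtain \<psi> where \<psi>: "\<psi> \<in> schwartz" "(LINT x|lborel. norm (f x - \<psi> x) powr p) < 1 / real (Suc n)"
        using Lp_dense_schwartz[of p f "1 / real (Suc n)"] p fi by auto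
      then show ?thesis
        using bessel_pot_schwartz[OF \<psi>(1), of "- s"] bessel_pot_inverse[OF \<psi>(1), of s]
        by (intro bexI[of _ "bessel_pot (- s) \<psi>"]) (auto simp: norm_minus_commute)
    qed
    then obtain \<phi> where \<phi>: "\<And>n. \<phi> n \<in> schwartz" and s': "\<And>n. (LINT x|lborel. norm (bessel_pot s (\<phi> n) x - f x) powr p) < 1 / real (Suc n)"
      by metis
    have L1: "(\<lambda>n. LINT x|lborel. norm (bessel_pot s (\<phi> n) x - f x) powr p) \<longlonglongrightarrow> 0"
    proof (rule tendsto_sandwich[of "\<lambda>n. 0" _ _ "\<lambda>n. 1 / real (Suc n)"])
      show "(\<lambda>n. 1 / real (Suc n)) \<longlonglongrightarrow> 0" by real_asymp
    qed (use s' in \<open>auto intro!: always_eventually less_imp_le simp del: of_nat_Suc\<close>)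
    have L2: "(\<lambda>n. LINT x|lborel. norm (frac_laplacian_schwartz (s / 2) (\<phi> n) x - frac_op (s / 2) f x) powr p) \<longlonglongrightarrow> 0"
    proof (rule tendsto_sandwich[of "\<lambda>n. 0"])
      have "(\<lambda>n. C * (LINT x|lborel. norm (bessel_pot s (\<phi> n) x - f x) powr p)) \<longlonglongrightarrow> C * 0" by (intro tendsto_intros L1)
      then show "(\<lambda>n. C * (LINT x|lborel. norm (bessel_pot s (\<phi> n) x - f x) powr p)) \<longlonglongrightarrow> 0" by simp
    qed (use step[OF \<phi>] in \<open>auto intro!: always_eventually\<close>)
    have fT: "AE x in lebesgue. frac_laplacian_schwartz (s / 2) (\<phi> n) x - w x = frac_laplacian_schwartz (s / 2) (\<phi> n) x - frac_op (s / 2) f x"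
      "(\<lambda>x. frac_laplacian_schwartz (s / 2) (\<phi> n) x - frac_op (s / 2) f x) \<in> borel_measurable borel"
      "integrable lborel (\<lambda>x. norm (frac_laplacian_schwartz (s / 2) (\<phi> n) x - frac_op (s / 2) f x) powr p)" for n
      using eq Pm[OF \<phi>] Tm p Pi[OF \<phi>] Ti by (auto elim!: eventually_mono intro!: integrable_powr_diff)
    have "u \<in> bessel_space s p" using f bessel_space_iff_rep by blast
    moreover have "distr_diff (distr_of (\<phi> n)) u \<in> bessel_space s p" for n
      using bessel_rep_diff[OF p bessel_rep_distr_of[OF p \<phi>] f] bessel_space_iff_rep by blast
    moreover have "(\<lambda>x. frac_laplacian_schwartz (s / 2) (\<phi> n) x - w x) \<in> Lp_space p" for n
      using Lp_space_iff(1)[OF fw(1)[OF \<phi>] fT(2,1)] fT(3) by simp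
    moreover have "(\<lambda>n. bessel_norm s p (distr_diff (distr_of (\<phi> n)) u)) \<longlonglongrightarrow> 0"
      using L1 p unfolding bn[OF \<phi>] by (subst powr_tendsto_zero_iff) auto
    moreover have "(\<lambda>n. Lp_norm p (\<lambda>x. frac_laplacian_schwartz (s / 2) (\<phi> n) x - w x)) \<longlonglongrightarrow> 0"
      using L2 p unfolding Lp_space_iff(2)[OF fw(1)[OF \<phi>] fT(2,1)] by (subst powr_tendsto_zero_iff) auto
    ultimately show "has_frac_laplacian (s / 2) p u w"
      unfolding has_frac_laplacian_def s2(2) using wL \<phi> by blast
  qed
qed

text \<open>Conjugating a function conjugates and reflects its transform, and the bracket is
  even.\<close>

lemma bessel_mult_cnj:
  fixes \<phi> :: "'a::euclidean_space \<Rightarrow> complex"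
  assumes \<phi>: "\<phi> \<in> schwartz"
  shows "bessel_mult s (\<lambda>x. cnj (\<phi> x)) = (\<lambda>x. cnj (bessel_mult s \<phi> x))"
proof
  fix x
  note m = schwartz_measurable[OF \<phi>] and mc = schwartz_measurable[OF schwartz_cnj[OF \<phi>]]
  define a where "a \<xi> = of_real (bracket \<xi> powr s) * inv_fourier \<phi> \<xi>" for \<xi> :: 'a
  have am: "a \<in> borel_measurable borel" unfolding a_def
    by (intro schwartz_measurable schwartz_mult bracket_slowly_increasing inv_fourier_schwartz \<phi>)
  have 1: "inv_fourier (\<lambda>x. cnj (\<phi> x)) \<xi> = cnj (inv_fourier \<phi> (- \<xi>))" for \<xi>
    unfolding inv_fourier_lborel[OF m] inv_fourier_lborel[OF mc] complex_cnj_divide Bochner_Integration.integral_cnj[symmetric]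
    by (simp add: cis_cnj del: Bochner_Integration.integral_cnj)
  have "bessel_mult s (\<lambda>x. cnj (\<phi> x)) x = fourier (\<lambda>\<xi>. cnj (a (- \<xi>))) x"
    by (simp add: bessel_mult_def a_def 1 bracket_def)
  also have "\<dots> = (LINT \<xi>|lborel. cis (- (\<xi> \<bullet> x)) * cnj (a (- \<xi>)))"
  proof -
    have "(\<lambda>\<xi>. a (- \<xi>)) \<in> borel_measurable borel" using am by measurable
    then have "(\<lambda>\<xi>. cnj (a (- \<xi>))) \<in> borel_measurable borel"
      by (rule measurable_compose) (intro borel_measurable_continuous_onI continuous_intros)
    then show ?thesis by (rule fourier_lborel)
  qed
  also have "\<dots> = cnj (LINT \<xi>|lborel. cis (- ((0 - \<xi>) \<bullet> x)) * a (0 - \<xi>))"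
    unfolding Bochner_Integration.integral_cnj[symmetric] by (simp add: cis_cnj del: Bochner_Integration.integral_cnj)
  also have "(LINT \<xi>|lborel. cis (- ((0 - \<xi>) \<bullet> x)) * a (0 - \<xi>)) = (LINT \<xi>|lborel. cis (- (\<xi> \<bullet> x)) * a \<xi>)"
    using am by (intro lborel_integral_reflect[of "\<lambda>\<xi>. cis (- (\<xi> \<bullet> x)) * a \<xi>" 0]) measurable
  also have "\<dots> = bessel_mult s \<phi> x" unfolding bessel_mult_def a_def[symmetric] by (rule fourier_lborel[OF am, symmetric])
  finally show "bessel_mult s (\<lambda>x. cnj (\<phi> x)) x = cnj (bessel_mult s \<phi> x)" .
qed

text \<open>Since \<open>bessel_mult\<close> commutes with conjugation, a real \<open>u\<close>
  gives the same functional with density \<open>f\<close> and with its conjugate; the two densities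
  then agree almost everywhere.\<close>

lemma bessel_rep_real:
  assumes p: "1 < p" and f: "bessel_rep s p u f" and r: "Defs.real_distribution u"
  shows "AE x in lborel. f x = of_real (Re (f x))"
proof -
  note f' = f[unfolded bessel_rep_def]
  then have fm [measurable]: "f \<in> borel_measurable borel" by blast
  have [measurable]: "cnj \<in> borel_measurable borel" by (intro borel_measurable_continuous_onI continuous_intros)
  have cm: "(\<lambda>x. cnj (f x)) \<in> borel_measurable borel" by measurable
  have "AE x in lborel. f x = cnj (f x)"
  proof (rule distr_of_inj[OF p fm cm])
    fix \<phi> :: "'a \<Rightarrow> complex" assume \<phi>: "\<phi> \<in> schwartz"
    define \<psi> where "\<psi> x = cnj (\<phi> x)" for x
    have \<psi>: "\<psi> \<in> schwartz" unfolding \<psi>_def by (rule schwartz_cnj[OF \<phi>])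
    have e: "\<phi> = (\<lambda>x. cnj (\<psi> x))" by (simp add: \<psi>_def)
    have "distr_of f \<phi> = u (bessel_mult s (\<lambda>x. cnj (\<psi> x)))"
      using f' bessel_operator_apply[OF \<phi>, of s u] unfolding e by metis
    also have "\<dots> = cnj (u (bessel_mult s \<psi>))"
      unfolding bessel_mult_cnj[OF \<psi>] using r bessel_mult_schwartz[OF \<psi>] unfolding Defs.real_distribution_def by blast
    also have "u (bessel_mult s \<psi>) = distr_of f \<psi>"
      using f' bessel_operator_apply[OF \<psi>, of s u] by metis
    also have "cnj (distr_of f \<psi>) = distr_of (\<lambda>x. cnj (f x)) \<phi>"
      unfolding distr_of_apply[OF fm \<psi>] distr_of_apply[OF cm \<phi>] Bochner_Integration.integral_cnj[symmetric] by (simp add: \<psi>_def del: Bochner_Integration.integral_cnj)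
    finally show "distr_of f \<phi> = distr_of (\<lambda>x. cnj (f x)) \<phi>" .
  qed (use f' in auto)
  then show ?thesis by eventually_elim (metis Reals_cnj_iff of_real_Re)
qed

text \<open>Reality of the components of \<open>u\<close> is what makes the predicate of the choice operator in
  \<^const>\<open>frac_laplacian\<close> satisfiable.\<close>

lemma frac_laplacian_AE:
  fixes u :: "'a::euclidean_space functional ^ 'm" and f :: "'m \<Rightarrow> 'a \<Rightarrow> complex"
  assumes p: "1 < p" and s: "0 < s" and u: "u \<in> bessel_space_vec s p" and f: "\<And>i. bessel_rep s p (u $ i) (f i)"
  shows "AE x in lebesgue. of_real (frac_laplacian (s / 2) p u x $ i) = frac_op (s / 2) (f i) x"
    and "(\<lambda>x. frac_laplacian (s / 2) p u x $ i) \<in> borel_measurable lebesgue"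
proof -
  have s2: "s / 2 > 0" using s by simp
  define w where "w x = (\<chi> i. Re (frac_op (s / 2) (f i) x))" for x
  have fm [measurable]: "f i \<in> borel_measurable borel" for i using f[of i] unfolding bessel_rep_def by blast
  note Tm [measurable] = frac_op_measurable[OF s2 fm]
  have wm: "(\<lambda>x. complex_of_real (w x $ i)) \<in> borel_measurable borel" for i
    unfolding w_def by simp
  have "has_frac_laplacian (s / 2) p (u $ i) (\<lambda>x. of_real (w x $ i))" for i
  proof (subst has_frac_laplacian_iff[OF p s f borel_imp_lebesgue_measurable[OF wm]])
    have r: "AE x in lborel. f i x = of_real (Re (f i x))"
      by (rule bessel_rep_real[OF p f]) (use u in \<open>auto simp: bessel_space_vec_def\<close>)
    \<comment> \<open>Equality almost everywhere of the functions gives equality of the convolutions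
      at every x, because y -> x - y preserves Lebesgue measure.\<close>
    have c: "conv (frac_kernel (s / 2) 1) (f i) x = conv (frac_kernel (s / 2) 1) (\<lambda>x. of_real (Re (f i x))) x" for x
      unfolding conv_def
    proof (rule integral_cong_AE)
      have km: "frac_kernel (s / 2) 1 \<in> borel_measurable (borel :: 'a measure)"
        using borel_measurable_integrable[OF integrable_frac_kernel[OF s2, of 1]] by simp
      then show "(\<lambda>y. of_real (frac_kernel (s / 2) 1 y) * f i (x - y)) \<in> borel_measurable lborel"
        "(\<lambda>y. complex_of_real (frac_kernel (s / 2) 1 y) * of_real (Re (f i (x - y)))) \<in> borel_measurable lborel"
        by measurable
      have "AE y in distr lborel borel (\<lambda>y. x - y). f i y = of_real (Re (f i y))"
      proof -
        have "distr lborel borel (\<lambda>y. x - y) = (lborel :: 'a measure)"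
          using lborel_affine[of "-1" x] by (simp add: density_1)
        then show ?thesis using r by (simp only:)
      qed
      then have "AE y in lborel. f i (x - y) = of_real (Re (f i (x - y)))"
        by (subst (asm) AE_distr_iff) auto
      then show "AE y in lborel. complex_of_real (frac_kernel (s / 2) 1 y) * f i (x - y) = of_real (frac_kernel (s / 2) 1 y) * of_real (Re (f i (x - y)))"
        by eventually_elim simp
    qed
    have c': "conv (frac_kernel (s / 2) 1) (f i) x = of_real (Re (conv (frac_kernel (s / 2) 1) (f i) x))" for x
    proof -
      have "conv (frac_kernel (s / 2) 1) (f i) x = (LINT y|lborel. complex_of_real (frac_kernel (s / 2) 1 y * Re (f i (x - y))))"
        unfolding c unfolding conv_def by simp
      then show ?thesis unfolding integral_complex_of_real by simp
    qed
    have "AE x in lborel. of_real (w x $ i) = frac_op (s / 2) (f i) x"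
      using r
    proof eventually_elim
      case (elim x)
      have "Im (f i x) = 0" by (metis elim Im_complex_of_real)
      moreover have "Im (conv (frac_kernel (s / 2) 1) (f i) x) = 0" by (metis c' Im_complex_of_real)
      ultimately show ?case by (simp add: w_def frac_op_def complex_eq_iff)
    qed
    then show "AE x in lebesgue. of_real (w x $ i) = frac_op (s / 2) (f i) x" by (rule AE_completion)
  qed
  then have "\<exists>w. \<forall>i. has_frac_laplacian (s / 2) p (u $ i) (\<lambda>x. of_real (w x $ i))" by blast
  then have *: "has_frac_laplacian (s / 2) p (u $ i) (\<lambda>x. of_real (frac_laplacian (s / 2) p u x $ i))" for i
    unfolding frac_laplacian_def by (rule someI2_ex) blast
  have m: "(\<lambda>x. complex_of_real (frac_laplacian (s / 2) p u x $ i)) \<in> borel_measurable lebesgue" for i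
    using *[of i] unfolding has_frac_laplacian_def Lp_space_def by blast
  show "AE x in lebesgue. of_real (frac_laplacian (s / 2) p u x $ i) = frac_op (s / 2) (f i) x"
    using *[of i] unfolding has_frac_laplacian_iff[OF p s f m] .
  show "(\<lambda>x. frac_laplacian (s / 2) p u x $ i) \<in> borel_measurable lebesgue"
    using measurable_compose[OF m[of i] borel_measurable_Re] by simp
qed

section \<open>Square roots of positive definite matrices\<close>

lemma sym_matrix_inner: "transpose A = A \<Longrightarrow> (A *v x) \<bullet> y = x \<bullet> (A *v y)" for A :: "real ^ 'n ^ 'n"
  by (metis dot_lmul_matrix transpose_matrix_vector)

lemma sym_matrix_nth: "transpose A = A \<Longrightarrow> A $ i $ j = A $ j $ i" for A :: "real ^ 'n ^ 'n"
proof -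
  assume "transpose A = A"
  moreover have "transpose A $ i $ j = A $ j $ i" by (simp add: transpose_def)
  ultimately show ?thesis by simp
qed

lemma norm_matrix_eq: "norm (A :: real ^ 'n ^ 'm) = sqrt (\<Sum>i\<in>UNIV. \<Sum>j\<in>UNIV. (A $ i $ j)\<^sup>2)"
  by (simp add: norm_vec_def L2_set_def sum_nonneg)

lemma norm_transpose: "norm (transpose A) = norm (A :: real ^ 'n ^ 'm)"
  unfolding norm_matrix_eq by (simp add: transpose_def) (rule sum.swap)

lemma row_matrix_mult_sym:
  fixes Y Z :: "real ^ 'n ^ 'n"
  assumes "transpose Y = Y" shows "(Z ** Y) $ i = Y *v (Z $ i)"
proof -
  have "Y $ j $ k = Y $ k $ j" for j k using assms by (rule sym_matrix_nth)
  then show ?thesis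
    by (simp add: vec_eq_iff matrix_matrix_mult_def matrix_vector_mult_def mult.commute)
qed

text \<open>The norm of the matrix type is the Frobenius norm, assembled from the rows, and right
  multiplication by a symmetric \<open>Y\<close> acts on each row as \<open>Y\<close>. An operator
  bound on \<open>Y\<close> thus becomes a bound in the norm used for the fixed point
  theorem.\<close>

lemma norm_matrix_mult_sym_le:
  fixes Y Z :: "real ^ 'n ^ 'n"
  assumes "transpose Y = Y" and r: "\<And>v. norm (Y *v v) \<le> r * norm v" "r \<ge> 0"
  shows "norm (Z ** Y) \<le> r * norm Z"
proof -
  have "norm (Z ** Y) = L2_set (\<lambda>i. norm (Y *v (Z $ i))) UNIV"
    by (simp add: norm_vec_def row_matrix_mult_sym[OF assms(1)])
  also have "\<dots> \<le> L2_set (\<lambda>i. r * norm (Z $ i)) UNIV" by (intro L2_set_mono r) auto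
  also have "\<dots> = r * norm Z" unfolding norm_vec_def using r by (simp add: L2_set_right_distrib)
  finally show ?thesis .
qed

text \<open>Polarisation with a vector w of the length of v in the direction of E v: by symmetry 4
  (E v \<bullet> w) is the difference of the forms at v + w and v - w, and the parallelogram law
  bounds it by 4 \<rho> |v|^2.\<close>

lemma sym_form_operator_bound:
  fixes E :: "real ^ 'n ^ 'n"
  assumes sym: "transpose E = E" and b: "\<And>v. \<bar>(E *v v) \<bullet> v\<bar> \<le> \<rho> * (norm v)\<^sup>2"
  shows "norm (E *v v) \<le> \<rho> * norm v"
proof (cases "E *v v = 0 \<or> v = 0")
  case True
  have "0 \<le> \<rho> * (norm v)\<^sup>2" using b[of v] by linarith
  then have "v \<noteq> 0 \<Longrightarrow> 0 \<le> \<rho>" by (simp add: zero_le_mult_iff)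
  then show ?thesis using True by (cases "v = 0") auto
next
  case False
  define w where "w = (norm v / norm (E *v v)) *\<^sub>R (E *v v)"
  have w: "norm w = norm v" using False by (simp add: w_def)
  have "4 * ((E *v v) \<bullet> w) = (E *v (v + w)) \<bullet> (v + w) - (E *v (v - w)) \<bullet> (v - w)"
    using sym_matrix_inner[OF sym, of w v]
    by (simp add: matrix_vector_right_distrib matrix_vector_mult_diff_distrib inner_add_left inner_add_right inner_diff_left inner_diff_right inner_commute)
  also have "\<dots> \<le> \<rho> * (norm (v + w))\<^sup>2 + \<rho> * (norm (v - w))\<^sup>2" using b[of "v + w"] b[of "v - w"] by linarith
  also have "\<dots> = \<rho> * (2 * (norm v)\<^sup>2 + 2 * (norm w)\<^sup>2)"
    by (simp add: power2_norm_eq_inner inner_add_left inner_add_right inner_diff_left inner_diff_right inner_commute algebra_simps)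
  also have "\<dots> = 4 * (\<rho> * (norm v)\<^sup>2)" by (simp add: w)
  finally have "(E *v v) \<bullet> w \<le> \<rho> * (norm v)\<^sup>2" by simp
  moreover have "(E *v v) \<bullet> w = norm v * norm (E *v v)"
    using False by (simp add: w_def power2_norm_eq_inner[symmetric] power2_eq_square)
  ultimately have "norm v * norm (E *v v) \<le> norm v * (\<rho> * norm v)" by (simp add: power2_eq_square mult_ac)
  then show ?thesis using False by simp
qed

lemma matrix_scaleR_mult: "(c *\<^sub>R A) ** B = c *\<^sub>R (A ** B)" "A ** (c *\<^sub>R B) = c *\<^sub>R (A ** B)" for A B :: "real ^ 'n ^ 'n"
  by (simp_all add: vec_eq_iff matrix_matrix_mult_def sum_distrib_left mult_ac)

lemma transpose_arith: "transpose (A + B) = transpose A + transpose B" "transpose (A - B) = transpose A - transpose B"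
  "transpose (c *\<^sub>R A) = c *\<^sub>R transpose A" for A B :: "real ^ 'n ^ 'n"
  by (simp_all add: vec_eq_iff transpose_def)

lemma matrix_mult_diff: "A ** (B - C) = A ** B - A ** C" "(B - C) ** A = B ** A - C ** A" for A B C :: "real ^ 'n ^ 'n"
  by (simp_all add: vec_eq_iff matrix_matrix_mult_def sum_subtractf algebra_simps)

text \<open>\<open>I - Y\<close> is a square root of \<open>I - E\<close> iff \<open>Y = (E + Y\<^sup>2) / 2\<close>, which is a contraction in \<open>Y\<close>
  on the symmetric matrices of operator norm at most \<open>1 - sqrt (1 - \<rho>)\<close>.\<close>

lemma matrix_sqrt_near_one:
  fixes E :: "real ^ 'n ^ 'n"
  assumes sym: "transpose E = E" and \<rho>: "0 \<le> \<rho>" "\<rho> < 1" and E: "\<And>v. norm (E *v v) \<le> \<rho> * norm v"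
  obtains Y where "transpose Y = Y" "(mat 1 - Y) ** (mat 1 - Y) = mat 1 - E" "\<And>v. v \<noteq> 0 \<Longrightarrow> ((mat 1 - Y) *v v) \<bullet> v > 0"
proof -
  \<comment> \<open>The smaller root of r = (\<rho> + r^2) / 2, so that \<open>F\<close> maps
    \<open>X\<close> into itself; r < 1 because \<rho> < 1.\<close>
  define r where "r = 1 - sqrt (1 - \<rho>)"
  have r: "0 \<le> r" "r < 1" using \<rho> by (auto simp: r_def)
  have rr: "(\<rho> + r * r) / 2 = r"
  proof -
    have "r * r = 1 - 2 * sqrt (1 - \<rho>) + (sqrt (1 - \<rho>))\<^sup>2" by (simp add: r_def power2_eq_square algebra_simps)
    then show ?thesis using \<rho> by (simp add: r_def)
  qed
  define X where "X = {Y :: real ^ 'n ^ 'n. transpose Y = Y \<and> (\<forall>v. norm (Y *v v) \<le> r * norm v)}"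
  define F where "F Y = (1 / 2) *\<^sub>R (E + Y ** Y)" for Y
  have cont: "continuous_on UNIV (\<lambda>Y :: real ^ 'n ^ 'n. Y *v v)" for v
    unfolding matrix_vector_mult_def by (intro continuous_intros)
  have contT: "continuous_on UNIV (\<lambda>Y :: real ^ 'n ^ 'n. transpose Y)"
    unfolding transpose_def by (intro continuous_intros)
  have "closed X"
  proof -
    have "X = {Y. transpose Y = Y} \<inter> (\<Inter>v. {Y. norm (Y *v v) \<le> r * norm v})" by (auto simp: X_def)
    moreover have "closed {Y :: real ^ 'n ^ 'n. transpose Y = Y}" by (rule closed_Collect_eq[OF contT continuous_on_id])
    moreover have "closed {Y :: real ^ 'n ^ 'n. norm (Y *v v) \<le> r * norm v}" for v
      by (rule closed_Collect_le[OF continuous_on_norm[OF cont] continuous_on_const])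
    ultimately show ?thesis by (simp add: closed_Int closed_INT)
  qed
  note complete = complete_eq_closed[THEN iffD2, OF \<open>closed X\<close>]
  have "(0 :: real ^ 'n ^ 'n) \<in> X" unfolding X_def using r by (simp add: transpose_def vec_eq_iff)
  then have "X \<noteq> {}" by blast
  moreover have "F ` X \<subseteq> X"
  proof safe
    fix Y assume Y: "Y \<in> X"
    have "transpose (F Y) = F Y" using Y sym unfolding F_def X_def by (simp add: transpose_arith matrix_transpose_mul)
    moreover have "norm (F Y *v v) \<le> r * norm v" for v
    proof -
      have "F Y *v v = (1 / 2) *\<^sub>R (E *v v + Y *v (Y *v v))"
        by (simp add: F_def matrix_vector_mult_add_rdistrib scaleR_matrix_vector_assoc[symmetric] matrix_vector_mul_assoc)
      also have "norm \<dots> \<le> (\<rho> * norm v + r * (r * norm v)) / 2"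
      proof -
        have "norm (Y *v (Y *v v)) \<le> r * norm (Y *v v)" using Y by (simp add: X_def)
        also have "\<dots> \<le> r * (r * norm v)" using Y r by (intro mult_left_mono) (auto simp: X_def)
        finally have "norm (Y *v (Y *v v)) \<le> r * (r * norm v)" .
        then show ?thesis using E[of v] norm_triangle_ineq[of "E *v v" "Y *v (Y *v v)"] by simp
      qed
      also have "\<dots> = ((\<rho> + r * r) / 2) * norm v" by (simp add: algebra_simps)
      finally show ?thesis unfolding rr .
    qed
    ultimately show "F Y \<in> X" by (simp add: X_def)
  qed
  moreover have "dist (F Y) (F Z) \<le> r * dist Y Z" if Y: "Y \<in> X" and Z: "Z \<in> X" for Y Z
  proof -
    have "F Y - F Z = (1 / 2) *\<^sub>R (Y ** (Y - Z) + (Y - Z) ** Z)"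
      by (simp add: F_def matrix_mult_diff scaleR_diff_right algebra_simps)
    then have "norm (F Y - F Z) \<le> (norm (Y ** (Y - Z)) + norm ((Y - Z) ** Z)) / 2"
      using norm_triangle_ineq[of "Y ** (Y - Z)" "(Y - Z) ** Z"] by simp
    moreover have "norm ((Y - Z) ** Z) \<le> r * norm (Y - Z)"
      using Z r by (intro norm_matrix_mult_sym_le) (auto simp: X_def)
    \<comment> \<open>Transposition turns left multiplication by the symmetric Y into right
      multiplication, the case covered by \<open>norm_matrix_mult_sym_le\<close>.\<close>
    moreover have "norm (Y ** (Y - Z)) = norm ((Y - Z) ** Y)"
      using Y Z norm_transpose[of "Y ** (Y - Z)"] by (simp add: matrix_transpose_mul transpose_arith X_def)
    moreover have "norm ((Y - Z) ** Y) \<le> r * norm (Y - Z)"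
      using Y r by (intro norm_matrix_mult_sym_le) (auto simp: X_def)
    ultimately show ?thesis by (simp add: dist_norm)
  qed
  ultimately obtain Y where Y: "Y \<in> X" "F Y = Y"
    using Banach_fix[OF complete, of r F] r by blast
  have "2 *\<^sub>R F Y = 2 *\<^sub>R Y" using Y by simp
  then have Y2: "E + Y ** Y = 2 *\<^sub>R Y" by (simp add: F_def)
  have "(mat 1 - Y) ** (mat 1 - Y) = mat 1 - 2 *\<^sub>R Y + Y ** Y"
    by (simp add: matrix_mult_diff scaleR_2)
  also have "\<dots> = mat 1 - E" unfolding Y2[symmetric] by simp
  finally have sq: "(mat 1 - Y) ** (mat 1 - Y) = mat 1 - E" .
  have pos: "((mat 1 - Y) *v v) \<bullet> v > 0" if "v \<noteq> 0" for v
  proof -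
    have "(Y *v v) \<bullet> v \<le> norm (Y *v v) * norm v" by (rule norm_cauchy_schwarz)
    also have "\<dots> \<le> (r * norm v) * norm v" using Y by (intro mult_right_mono) (auto simp: X_def)
    also have "\<dots> < norm v * norm v" using r that by simp
    finally show ?thesis by (simp add: matrix_vector_mult_diff_rdistrib inner_diff_left power2_norm_eq_inner[symmetric] power2_eq_square)
  qed
  show ?thesis using that[of Y] Y sq pos by (auto simp: X_def)
qed

text \<open>After scaling by the upper bound L, the form of E = 1 - M / L lies between 0 and (1 - l
  / L) |v|^2, so E has operator norm below 1. The root of 1 - E is then multiplied by sqrt
  L.\<close>

lemma sym_pos_def_sqrt_exists:
  fixes M :: "real ^ 'n ^ 'n"
  assumes sym: "transpose M = M" and l: "0 < l" "l < L"
    and b: "\<And>v. l * (norm v)\<^sup>2 \<le> (M *v v) \<bullet> v" "\<And>v. (M *v v) \<bullet> v \<le> L * (norm v)\<^sup>2"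
  shows "\<exists>B. sym_pos_def B \<and> B ** B = M"
proof -
  have L: "L > 0" using l by simp
  define E where "E = mat 1 - (1 / L) *\<^sub>R M"
  define \<rho> where "\<rho> = 1 - l / L"
  have \<rho>: "0 \<le> \<rho>" "\<rho> < 1" using l L by (auto simp: \<rho>_def)
  have symE: "transpose E = E" by (simp add: E_def transpose_arith transpose_mat sym)
  have "norm (E *v v) \<le> \<rho> * norm v" for v
  proof (rule sym_form_operator_bound[OF symE])
    fix v
    have e: "(E *v v) \<bullet> v = (norm v)\<^sup>2 - ((M *v v) \<bullet> v) / L"
      by (simp add: E_def matrix_vector_mult_diff_rdistrib inner_diff_left power2_norm_eq_inner scaleR_matrix_vector_assoc[symmetric])
    have "l / L * (norm v)\<^sup>2 \<le> ((M *v v) \<bullet> v) / L" "((M *v v) \<bullet> v) / L \<le> (norm v)\<^sup>2"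
      using b[of v] L by (auto simp: field_simps)
    then show "\<bar>(E *v v) \<bullet> v\<bar> \<le> \<rho> * (norm v)\<^sup>2" unfolding e \<rho>_def by (simp add: left_diff_distrib)
  qed
  then obtain Y where Y: "transpose Y = Y" "(mat 1 - Y) ** (mat 1 - Y) = mat 1 - E" "\<And>v. v \<noteq> 0 \<Longrightarrow> ((mat 1 - Y) *v v) \<bullet> v > 0"
    using matrix_sqrt_near_one[OF symE \<rho>] by blast
  define B where "B = sqrt L *\<^sub>R (mat 1 - Y)"
  have "B ** B = (sqrt L * sqrt L) *\<^sub>R (mat 1 - E)" by (simp add: B_def matrix_scaleR_mult Y(2))
  also have "\<dots> = M" using L by (simp add: E_def)
  finally have "B ** B = M" .
  moreover have "sym_pos_def B"
    unfolding sym_pos_def_def using Y L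
    by (auto simp: B_def transpose_arith transpose_mat scaleR_matrix_vector_assoc[symmetric])
  ultimately show ?thesis by blast
qed

lemma diag_conjugate:
  fixes B D :: "real ^ 'n ^ 'n"
  assumes "transpose D = D" shows "(D ** (B ** D)) $ i $ i = D $ i \<bullet> (B *v (D $ i))"
proof -
  have "(B ** D) $ k $ i = (B *v (D $ i)) $ k" for k
  proof -
    have "D $ j $ i = D $ i $ j" for j using assms by (rule sym_matrix_nth)
    then show ?thesis by (simp add: matrix_matrix_mult_def matrix_vector_mult_def)
  qed
  then show ?thesis by (simp add: matrix_matrix_mult_def[of D] inner_vec_def)
qed

text \<open>For D = B - C one has B D + D C = 0. Multiplying by D and taking the trace gives a
  vanishing sum of the forms of B and C at the rows of D; all terms are nonnegative, and
  definiteness forces D = 0.\<close>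

lemma sym_pos_def_sqrt_unique:
  fixes B C :: "real ^ 'n ^ 'n"
  assumes B: "sym_pos_def B" and C: "sym_pos_def C" and eq: "B ** B = C ** C"
  shows "B = C"
proof -
  define D where "D = B - C"
  have D: "transpose D = D" using B C by (simp add: D_def sym_pos_def_def transpose_arith)
  have "B ** D + D ** C = 0" by (simp add: D_def matrix_mult_diff eq)
  then have "D ** (B ** D + D ** C) = 0" by (simp add: matrix_matrix_mult_def vec_eq_iff)
  then have "trace (D ** (B ** D)) + trace (D ** (D ** C)) = 0"
  proof -
    have "D ** (B ** D) + D ** (D ** C) = 0" using \<open>D ** (B ** D + D ** C) = 0\<close> by (simp add: matrix_add_ldistrib)
    then have "trace (D ** (B ** D) + D ** (D ** C)) = trace (0 :: real ^ 'n ^ 'n)" by simp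
    then show ?thesis by (simp add: trace_add) (simp add: trace_def)
  qed
  moreover have "trace (D ** (D ** C)) = trace (D ** (C ** D))"
    by (metis matrix_mul_assoc trace_mul_sym)
  ultimately have "(\<Sum>i\<in>UNIV. D $ i \<bullet> (B *v (D $ i)) + D $ i \<bullet> (C *v (D $ i))) = 0"
    by (simp add: trace_def diag_conjugate[OF D] sum.distrib)
  moreover have nn: "0 \<le> v \<bullet> (B *v v)" "0 \<le> v \<bullet> (C *v v)" for v
    using B C unfolding sym_pos_def_def by (cases "v = 0"; auto simp: inner_commute less_imp_le)+
  ultimately have s0: "D $ i \<bullet> (B *v (D $ i)) + D $ i \<bullet> (C *v (D $ i)) = 0" for i
    by (subst (asm) sum_nonneg_eq_0_iff) (auto intro!: add_nonneg_nonneg)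
  have "D $ i \<bullet> (B *v (D $ i)) = 0" for i using nn[of "D $ i"] s0[of i] by linarith
  then have "D $ i = 0" for i using B unfolding sym_pos_def_def by (metis inner_commute less_irrefl)
  then have "D = 0" by (simp add: vec_eq_iff)
  then show ?thesis by (simp add: D_def)
qed

lemma matrix_sqrt:
  fixes M :: "real ^ 'n ^ 'n"
  assumes sym: "transpose M = M" and l: "0 < l" "l < L"
    and b: "\<And>v. l * (norm v)\<^sup>2 \<le> (M *v v) \<bullet> v" "\<And>v. (M *v v) \<bullet> v \<le> L * (norm v)\<^sup>2"
  shows "sym_pos_def (matrix_sqrt M)" "matrix_sqrt M ** matrix_sqrt M = M"
proof -
  have "\<exists>!B. sym_pos_def B \<and> B ** B = M"
    using sym_pos_def_sqrt_exists[OF assms] sym_pos_def_sqrt_unique by metis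
  from theI'[OF this] show "sym_pos_def (matrix_sqrt M)" "matrix_sqrt M ** matrix_sqrt M = M"
    unfolding matrix_sqrt_def by auto
qed

definition flux :: "real \<Rightarrow> real ^ 'm ^ 'm \<Rightarrow> real ^ 'm \<Rightarrow> real ^ 'm" where
  "flux p M w = norm (matrix_sqrt M *v w) powr (p - 2) *\<^sub>R (M *v w)"

text \<open>Let B be the square root, so that |B w|^2 = (M w) \<bullet> w. For injectivity,
  cancelling B twice leaves |B w|^(p-2) w = |B w'|^(p-2) w'. Applying B and taking norms gives |B
  w|^(p-1) = |B w'|^(p-1), and p > 1 turns this into |B w| = |B w'|, so the scalar factors
  coincide.\<close>

lemma
  fixes M :: "real ^ 'n ^ 'n"
  assumes sym: "transpose M = M" and l: "0 < l" "l < L"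
    and b: "\<And>v. l\<^sup>2 * (norm v)\<^sup>2 \<le> (M *v v) \<bullet> v" "\<And>v. (M *v v) \<bullet> v \<le> L\<^sup>2 * (norm v)\<^sup>2"
  shows norm_matrix_sqrt: "norm (matrix_sqrt M *v w) = sqrt ((M *v w) \<bullet> w)"
    and flux_norm_le: "1 < p \<Longrightarrow> norm (flux p M w) \<le> L powr p * norm w powr (p - 1)"
    and flux_inj: "1 < p \<Longrightarrow> flux p M w = flux p M w' \<Longrightarrow> w = w'"
proof -
  have l2: "0 < l\<^sup>2" "l\<^sup>2 < L\<^sup>2" using l by (auto intro!: power_strict_mono)
  note B = matrix_sqrt[OF sym l2 b]
  define B where "B = matrix_sqrt M"
  have Bs: "transpose B = B" and BB: "B ** B = M" using B by (auto simp: B_def sym_pos_def_def)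
  have n: "norm (B *v w) = sqrt ((M *v w) \<bullet> w)" for w
    unfolding norm_eq_sqrt_inner sym_matrix_inner[OF Bs] by (simp add: matrix_vector_mul_assoc BB inner_commute)
  then show "norm (matrix_sqrt M *v w) = sqrt ((M *v w) \<bullet> w)" unfolding B_def .
  have nL: "norm (B *v w) \<le> L * norm w" for w
  proof -
    have "sqrt ((M *v w) \<bullet> w) \<le> sqrt ((L * norm w)\<^sup>2)" using b(2)[of w] by (intro real_sqrt_le_mono) (simp add: power_mult_distrib)
    then show ?thesis using n[of w] l by simp
  qed
  have n0: "norm (B *v w) > 0" if "w \<noteq> 0" for w
  proof -
    have "0 < l\<^sup>2 * (norm w)\<^sup>2" using l that by simp
    then have "0 < (M *v w) \<bullet> w" using b(1)[of w] by linarith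
    then show ?thesis unfolding n by simp
  qed
  assume p: "1 < p"
  show "norm (flux p M w) \<le> L powr p * norm w powr (p - 1)"
  proof -
    have "norm (flux p M w) = norm (B *v w) powr (p - 2) * norm (B *v (B *v w))"
      by (simp add: flux_def B_def[symmetric] matrix_vector_mul_assoc BB)
    also have "\<dots> \<le> norm (B *v w) powr (p - 2) * (L * norm (B *v w))" by (intro mult_left_mono nL) simp
    also have "\<dots> = L * norm (B *v w) powr (p - 1)"
      using powr_add[of "norm (B *v w)" "p - 2" 1] by (cases "B *v w = 0") (auto simp: mult_ac)
    also have "\<dots> \<le> L * (L * norm w) powr (p - 1)" using p l nL by (intro mult_left_mono powr_mono2) auto
    also have "\<dots> = L powr p * norm w powr (p - 1)" using l powr_add[of L 1 "p - 1"] by (simp add: powr_mult mult_ac)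
    finally show ?thesis .
  qed
  assume eq: "flux p M w = flux p M w'"
  define c where "c w = norm (B *v w) powr (p - 2)" for w
  have fl: "B *v flux p M w = B *v (B *v (c w *\<^sub>R (B *v w)))" "flux p M w = B *v (B *v (c w *\<^sub>R w))" for w
    by (simp_all add: flux_def B_def[symmetric] c_def matrix_vector_mul_assoc BB matrix_vector_mult_scaleR)
  have Binj: "x = y" if "B *v x = B *v y" for x y
  proof -
    have "B *v (x - y) = 0" using that by (simp add: matrix_vector_mult_diff_distrib)
    then show ?thesis using n0[of "x - y"] by auto
  qed
  have cw: "c w *\<^sub>R w = c w' *\<^sub>R w'" using eq unfolding fl(2) by (rule Binj[OF Binj])
  have nc: "norm (B *v (c w *\<^sub>R w)) = norm (B *v w) powr (p - 1)" for w
    using powr_add[of "norm (B *v w)" "p - 2" 1]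
    by (cases "B *v w = 0") (auto simp: c_def matrix_vector_mult_scaleR)
  have "norm (B *v w) powr (p - 1) = norm (B *v w') powr (p - 1)" unfolding nc[symmetric] cw ..
  then have "(norm (B *v w) powr (p - 1)) powr (1 / (p - 1)) = (norm (B *v w') powr (p - 1)) powr (1 / (p - 1))" by simp
  then have nw: "norm (B *v w) = norm (B *v w')" using p by (simp add: powr_powr)
  show "w = w'"
  proof (cases "w = 0")
    case True
    then show ?thesis using nw n0[of w'] by auto
  next
    case False
    then have "c w \<noteq> 0" using n0[of w] by (simp add: c_def)
    moreover have "c w = c w'" by (simp add: c_def nw)
    ultimately show ?thesis using cw by simp
  qed
qed

section \<open>Test functions\<close>

lemma partial_derivs_linear:
  assumes L: "bounded_linear L" and f: "smooth f" and bs: "bs \<in> lists Basis"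
  shows "partial_derivs bs (\<lambda>x. L (f x)) = (\<lambda>x. L (partial_derivs bs f x))"
  using bs
proof (induction bs)
  case (Cons b bs)
  have "((\<lambda>x. L (partial_derivs bs f x)) has_derivative (\<lambda>h. L (frechet_derivative (partial_derivs bs f) (at x) h))) (at x)" for x
    using Cons by (intro bounded_linear.has_derivative[OF L] smooth_has_derivative smooth_partial_derivs f) auto
  from dd_eqI[OF this, of b] show ?case using Cons by simp
qed simp

lemma smooth_linear:
  fixes f :: "'a::euclidean_space \<Rightarrow> 'b::real_normed_vector"
  assumes L: "bounded_linear L" and f: "smooth f" shows "smooth (\<lambda>x. L (f x))"
  unfolding smooth_def
proof (intro ballI allI)
  fix bs :: "'a list" and x :: 'a assume bs: "bs \<in> lists Basis"
  have "((\<lambda>x. L (partial_derivs bs f x)) has_derivative (\<lambda>h. L (frechet_derivative (partial_derivs bs f) (at x) h))) (at x)"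
    by (intro bounded_linear.has_derivative[OF L] smooth_has_derivative smooth_partial_derivs f bs)
  then show "partial_derivs bs (\<lambda>x. L (f x)) differentiable at x"
    unfolding partial_derivs_linear[OF L f bs] differentiable_def by blast
qed

lemma smooth_add:
  fixes f g :: "'a::euclidean_space \<Rightarrow> 'b::real_normed_vector"
  assumes "smooth f" "smooth g" shows "smooth (\<lambda>x. f x + g x)"
proof (rule smoothI[where P = "{\<lambda>x. f x + g x |f g. smooth f \<and> smooth g}"])
  fix h :: "'a \<Rightarrow> 'b" and b :: 'a assume "h \<in> {\<lambda>x. f x + g x |f g. smooth f \<and> smooth g}" and b: "b \<in> Basis"
  then obtain f g where h: "h = (\<lambda>x. f x + g x)" and f: "smooth f" and g: "smooth g" by blast
  have "(h has_derivative (\<lambda>d. frechet_derivative f (at x) d + frechet_derivative g (at x) d)) (at x)" for x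
    unfolding h by (intro has_derivative_add smooth_has_derivative f g)
  from dd_eqI[OF this, of b] show "dd b h \<in> {\<lambda>x. f x + g x |f g. smooth f \<and> smooth g}"
    using smooth_dd[OF f b] smooth_dd[OF g b]
    by (intro CollectI exI[of _ "dd b f"] exI[of _ "dd b g"] conjI)
next
  fix h :: "'a \<Rightarrow> 'b" and x assume "h \<in> {\<lambda>x. f x + g x |f g. smooth f \<and> smooth g}"
  then show "h differentiable (at x)" by (auto simp: differentiable_add[OF smooth_differentiable smooth_differentiable])
next
  show "(\<lambda>x. f x + g x) \<in> {\<lambda>x. f x + g x |f g. smooth f \<and> smooth g}"
    using assms by (intro CollectI exI[of _ f] exI[of _ g] conjI refl)
qed

lemma smooth_zero: "smooth (\<lambda>x. 0)"
  by (rule smoothI[where P = "{\<lambda>x. 0}"]) (auto simp: dd_const)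

lemma smooth_sum: "finite I \<Longrightarrow> (\<And>i. i \<in> I \<Longrightarrow> smooth (f i)) \<Longrightarrow> smooth (\<lambda>x. \<Sum>i\<in>I. f i x)"
  by (induction rule: finite_induct) (auto intro: smooth_add smooth_zero)

text \<open>The support is confined to a closed ball, which differentiation preserves. All iterated
  Laplacians of a member are thus test functions on the same ball.\<close>

definition smooth_cball :: "'a \<Rightarrow> real \<Rightarrow> ('a::euclidean_space \<Rightarrow> 'b::real_normed_vector) set" where
  "smooth_cball c r = {\<phi>. smooth \<phi> \<and> (\<forall>x. r < norm (x - c) \<longrightarrow> \<phi> x = 0)}"

lemma smooth_cball_dd:
  assumes \<phi>: "\<phi> \<in> smooth_cball c r" and b: "b \<in> Basis" shows "dd b \<phi> \<in> smooth_cball c r"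
proof -
  have "dd b \<phi> x = 0" if x: "r < norm (x - c)" for x
  proof -
    have "open {x. r < norm (x - c)}" by (intro open_Collect_less continuous_intros)
    then have "(\<phi> has_derivative (\<lambda>h. 0)) (at x)"
      by (rule has_derivative_transform_within_open[rotated])
         (use \<phi> x in \<open>auto simp: smooth_cball_def\<close>)
    then show ?thesis using frechet_derivative_at by metis
  qed
  then show ?thesis using \<phi> smooth_dd[OF _ b] unfolding smooth_cball_def by blast
qed

lemma smooth_cball_linear: "bounded_linear L \<Longrightarrow> \<phi> \<in> smooth_cball c r \<Longrightarrow> (\<lambda>x. L (\<phi> x)) \<in> smooth_cball c r"
  unfolding smooth_cball_def by (auto intro: smooth_linear simp: linear_simps(3))

definition nlap :: "('a::euclidean_space \<Rightarrow> 'b::real_normed_vector) \<Rightarrow> 'a \<Rightarrow> 'b" where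
  "nlap f x = - lap f x"

lemma smooth_cball_nlap:
  assumes \<phi>: "\<phi> \<in> smooth_cball c r" shows "nlap \<phi> \<in> smooth_cball c r"
proof -
  have "(\<lambda>x. \<Sum>b\<in>Basis. dd b (dd b \<phi>) x) \<in> smooth_cball c r"
    using smooth_cball_dd[OF smooth_cball_dd[OF \<phi>]] unfolding smooth_cball_def
    by (auto intro!: smooth_sum sum.neutral)
  from smooth_cball_linear[OF bounded_linear_minus[OF bounded_linear_ident] this]
  show ?thesis unfolding nlap_def[abs_def] lap_def .
qed

lemma nlap_linear:
  assumes L: "bounded_linear L" and f: "smooth f" shows "nlap (\<lambda>x. L (f x)) = (\<lambda>x. L (nlap f x))"
proof
  fix x
  have "dd b (dd b (\<lambda>x. L (f x))) x = L (dd b (dd b f) x)" if "b \<in> Basis" for b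
    using fun_cong[OF partial_derivs_linear[OF L f, of "[b, b]"], of x] that by simp
  then have "lap (\<lambda>x. L (f x)) x = L (lap f x)"
    unfolding lap_def linear_sum[OF bounded_linear.linear[OF L]] by (intro sum.cong refl)
  then show "nlap (\<lambda>x. L (f x)) x = L (nlap f x)"
    unfolding nlap_def by (simp add: linear_neg[OF bounded_linear.linear[OF L]])
qed

lemma smooth_cball_nlap_power: "\<phi> \<in> smooth_cball c r \<Longrightarrow> (nlap ^^ k) \<phi> \<in> smooth_cball c r"
  by (induction k) (auto intro: smooth_cball_nlap)

lemma nlap_power_of_real:
  assumes "\<phi> \<in> smooth_cball c r"
  shows "(nlap ^^ k) (\<lambda>x. complex_of_real (\<phi> x)) = (\<lambda>x. of_real ((nlap ^^ k) \<phi> x))"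
proof (induction k)
  case (Suc k)
  have "smooth ((nlap ^^ k) \<phi>)" using smooth_cball_nlap_power[OF assms] unfolding smooth_cball_def by blast
  then show ?case using Suc nlap_linear[OF bounded_linear_of_real] by simp
qed simp

lemma smooth_cball_schwartz:
  fixes \<phi> :: "'a::euclidean_space \<Rightarrow> complex"
  assumes "\<phi> \<in> smooth_cball c r" shows "\<phi> \<in> schwartz"
proof (rule schwartzI[where P = "smooth_cball c r"])
  fix g :: "'a \<Rightarrow> complex" and k assume g: "g \<in> smooth_cball c r"
  have "continuous_on (cball c r) g" using g smooth_continuous_on unfolding smooth_cball_def by blast
  then have "compact ((\<lambda>x. (1 + norm x) ^ k * norm (g x)) ` cball c r)"
    by (intro compact_continuous_image continuous_intros) auto
  then have "bounded ((\<lambda>x. (1 + norm x) ^ k * norm (g x)) ` cball c r)" by (rule compact_imp_bounded)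
  then obtain B where B: "\<forall>y\<in>(\<lambda>x. (1 + norm x) ^ k * norm (g x)) ` cball c r. norm y \<le> B" unfolding bounded_iff by blast
  have "(1 + norm x) ^ k * norm (g x) \<le> max B 0" for x
  proof (cases "norm (x - c) \<le> r")
    case True
    then have "norm ((1 + norm x) ^ k * norm (g x)) \<le> B" using B by (auto simp: dist_norm norm_minus_commute)
    then show ?thesis by simp
  qed (use g in \<open>auto simp: smooth_cball_def\<close>)
  then show "\<exists>C. \<forall>x. (1 + norm x) ^ k * norm (g x) \<le> C" by blast
qed (use assms smooth_cball_dd in \<open>auto simp: smooth_cball_def intro: smooth_differentiable\<close>)

lemma fourier_nlap_power:
  assumes "\<phi> \<in> schwartz"
  shows "(nlap ^^ k) \<phi> \<in> schwartz" "fourier ((nlap ^^ k) \<phi>) \<xi> = of_real (norm \<xi> ^ (2 * k)) * fourier \<phi> \<xi>"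
proof -
  have "(nlap ^^ k) \<phi> \<in> schwartz \<and> (\<forall>\<xi>. fourier ((nlap ^^ k) \<phi>) \<xi> = of_real (norm \<xi> ^ (2 * k)) * fourier \<phi> \<xi>)"
  proof (induction k)
    case (Suc k)
    define \<psi> where "\<psi> = (nlap ^^ k) \<phi>"
    have \<psi>: "\<psi> \<in> schwartz" using Suc by (simp add: \<psi>_def)
    have n: "nlap \<psi> = (\<lambda>x. (- 1) * lap \<psi> x)" by (simp add: nlap_def fun_eq_iff)
    have "nlap \<psi> \<in> schwartz" unfolding n by (intro schwartz_cmult schwartz_lap \<psi>)
    moreover have "fourier (nlap \<psi>) \<xi> = of_real ((norm \<xi>)\<^sup>2) * fourier \<psi> \<xi>" for \<xi>
      using fourier_lap[OF \<psi>, of \<xi>] schwartz_measurable[OF schwartz_lap[OF \<psi>]] by (simp add: n fourier_lborel)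
    ultimately show ?case using Suc by (simp add: \<psi>_def power2_eq_square mult_ac)
  qed (use assms in simp)
  then show "(nlap ^^ k) \<phi> \<in> schwartz" "fourier ((nlap ^^ k) \<phi>) \<xi> = of_real (norm \<xi> ^ (2 * k)) * fourier \<phi> \<xi>" by auto
qed

lemma smooth_cball_test_function:
  fixes \<phi> :: "'a::euclidean_space \<Rightarrow> 'b::euclidean_space"
  assumes "\<phi> \<in> smooth_cball c r" "cball c r \<subseteq> \<Omega>" shows "\<phi> \<in> test_functions \<Omega>"
proof -
  have "{x. \<phi> x \<noteq> 0} \<subseteq> cball c r"
  proof
    fix x assume "x \<in> {x. \<phi> x \<noteq> 0}"
    then have "\<not> r < norm (x - c)" using assms(1) unfolding smooth_cball_def by blast
    then show "x \<in> cball c r" by (simp add: dist_norm norm_minus_commute)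
  qed
  then have "closure {x. \<phi> x \<noteq> 0} \<subseteq> cball c r" by (intro closure_minimal) auto
  moreover from this have "compact (closure {x. \<phi> x \<noteq> 0})"
    by (metis bounded_cball bounded_subset closed_closure compact_eq_bounded_closed)
  ultimately show ?thesis using assms unfolding test_functions_def smooth_cball_def by auto
qed

text \<open>The flat function exp(-1/s) together with the powers of 1/s that differentiation
  creates; the derivative of index k is a combination of the indices k + 1 and k + 2.\<close>

definition exp_flat :: "nat \<Rightarrow> real \<Rightarrow> real" where
  "exp_flat k s = (if s > 0 then (1 / s) ^ k * exp (- (1 / s)) else 0)"

lemma exp_flat_tendsto: "((\<lambda>s. (1 / s) ^ k * exp (- (1 / s))) \<longlongrightarrow> 0) (at_right (0::real))"
proof -
  have "((\<lambda>y::real. y ^ k * exp (- y)) \<longlongrightarrow> 0) at_top" by real_asymp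
  moreover have "filterlim (\<lambda>s::real. 1 / s) at_top (at_right 0)" by real_asymp
  ultimately show ?thesis by (rule filterlim_compose)
qed

lemma exp_flat_derivative:
  "(exp_flat k has_real_derivative (- real k * exp_flat (k + 1) s + exp_flat (k + 2) s)) (at s)"
proof -
  consider "s > 0" | "s < 0" | "s = 0" by linarith
  then show ?thesis
  proof cases
    case 1
    have "((\<lambda>s. (1 / s) ^ k * exp (- (1 / s))) has_real_derivative (- real k * ((1 / s) ^ (k + 1) * exp (- (1 / s))) + (1 / s) ^ (k + 2) * exp (- (1 / s)))) (at s)"
    proof -
      have "((\<lambda>y. y ^ k * exp (- y)) has_real_derivative (real k * y ^ (k - 1) * exp (- y) - y ^ k * exp (- y))) (at y)" for y :: real
        by (auto intro!: derivative_eq_intros)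
      moreover have "((\<lambda>s. 1 / s) has_real_derivative - ((1 / s)\<^sup>2)) (at s)"
        using 1 by (auto intro!: derivative_eq_intros simp: power2_eq_square)
      ultimately have "((\<lambda>s. (1 / s) ^ k * exp (- (1 / s))) has_real_derivative (real k * (1 / s) ^ (k - 1) * exp (- (1 / s)) - (1 / s) ^ k * exp (- (1 / s))) * - ((1 / s)\<^sup>2)) (at s)"
        by (rule DERIV_chain2)
      moreover have "(real k * y ^ (k - 1) * exp (- y) - y ^ k * exp (- y)) * - (y\<^sup>2) = - real k * (y ^ (k + 1) * exp (- y)) + y ^ (k + 2) * exp (- y)" for y :: real
        by (cases k) (simp_all add: power2_eq_square algebra_simps)
      ultimately show ?thesis by simp
    qed
    then have "(exp_flat k has_real_derivative (- real k * ((1 / s) ^ (k + 1) * exp (- (1 / s))) + (1 / s) ^ (k + 2) * exp (- (1 / s)))) (at s)"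
      by (rule has_field_derivative_transform_within_open[where S = "{0<..}"]) (use 1 in \<open>auto simp: exp_flat_def\<close>)
    then show ?thesis using 1 by (simp add: exp_flat_def)
  next
    case 2
    have "((\<lambda>s. 0) has_real_derivative 0) (at s)" by simp
    then have "(exp_flat k has_real_derivative 0) (at s)"
      by (rule has_field_derivative_transform_within_open[where S = "{..<0}"]) (use 2 in \<open>auto simp: exp_flat_def\<close>)
    then show ?thesis using 2 by (simp add: exp_flat_def)
  next
    case 3
    \<comment> \<open>At s = 0 the difference quotient from the right is the function of index k +
      1, which tends to 0; from the left it is constantly 0.\<close>
    have "((\<lambda>h. (exp_flat k (0 + h) - exp_flat k 0) / h) \<longlongrightarrow> 0) (at 0)"
    proof (rule filterlim_split_at)
      have "eventually (\<lambda>h::real. (exp_flat k (0 + h) - exp_flat k 0) / h = 0) (at_left 0)"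
        by (auto simp: eventually_at_filter exp_flat_def)
      then show "((\<lambda>h. (exp_flat k (0 + h) - exp_flat k 0) / h) \<longlongrightarrow> 0) (at_left 0)" by (rule tendsto_eventually)
      show "((\<lambda>h. (exp_flat k (0 + h) - exp_flat k 0) / h) \<longlongrightarrow> 0) (at_right 0)"
        by (rule Lim_transform_eventually[OF exp_flat_tendsto[of "k + 1"]])
           (auto simp: eventually_at_filter exp_flat_def field_simps)
    qed
    then show ?thesis using 3 by (simp add: DERIV_def exp_flat_def)
  qed
qed

text \<open>The flat function is composed with r^2 - |x - c|^2, a polynomial, so the norm is never
  differentiated at its singular point. All derivatives stay in the polynomial span of the functions
  \<open>B k\<close>.\<close>

lemma ex_bump:
  fixes c :: "'a::euclidean_space"
  assumes r: "r > 0"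
  obtains \<phi> :: "'a \<Rightarrow> real" where "\<phi> \<in> smooth_cball c r" "\<And>x. \<phi> x \<ge> 0" "\<And>x. norm (x - c) < r \<Longrightarrow> \<phi> x > 0"
proof -
  define B where "B k x = complex_of_real (exp_flat k (r\<^sup>2 - (norm (x - c))\<^sup>2))" for k and x :: 'a
  have D: "(B k has_derivative (\<lambda>h. of_real ((- 2 * ((x - c) \<bullet> h)) * (- real k * exp_flat (k + 1) (r\<^sup>2 - (norm (x - c))\<^sup>2) + exp_flat (k + 2) (r\<^sup>2 - (norm (x - c))\<^sup>2))))) (at x)" for k x
  proof -
    have "((\<lambda>x. r\<^sup>2 - (x - c) \<bullet> (x - c)) has_derivative (\<lambda>h. - 2 * ((x - c) \<bullet> h))) (at x)"
      by (auto intro!: derivative_eq_intros simp: inner_commute)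
    from has_derivative_compose[OF this exp_flat_derivative[THEN has_field_derivative_imp_has_derivative]]
    have "((\<lambda>x. exp_flat k (r\<^sup>2 - (x - c) \<bullet> (x - c))) has_derivative (\<lambda>h. (- real k * exp_flat (k + 1) (r\<^sup>2 - (x - c) \<bullet> (x - c)) + exp_flat (k + 2) (r\<^sup>2 - (x - c) \<bullet> (x - c))) * (- 2 * ((x - c) \<bullet> h)))) (at x)" .
    from bounded_linear.has_derivative[OF bounded_linear_of_real[where 'a = complex] this]
    show ?thesis unfolding B_def power2_norm_eq_inner by (simp add: mult.commute)
  qed
  have d1: "\<And>f x. f \<in> range B \<Longrightarrow> f differentiable (at x)" using D unfolding differentiable_def by blast
  have d2: "dd b f \<in> poly_span (range B)" if "f \<in> range B" and b: "b \<in> Basis" for f b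
  proof -
    from that(1) obtain k where f: "f = B k" by (rule rangeE)
    define G where "G x = - of_nat k * B (k + 1) x + B (k + 2) x" for x
    have bs: "B j \<in> poly_span (range B)" for j by (intro poly_span.base) simp
    have G: "G \<in> poly_span (range B)"
      unfolding G_def[abs_def] by (rule poly_span.add[OF poly_span.scale[OF bs] bs])
    have "dd b f = (\<lambda>x. (- 2) * (of_real (x \<bullet> b) * G x) + (2 * of_real (c \<bullet> b)) * G x)"
      unfolding f dd_eqI[OF D] by (simp add: fun_eq_iff G_def B_def inner_diff_left algebra_simps)
    then show ?thesis by (simp only:) (rule poly_span.add[OF poly_span.scale[OF poly_span.coord[OF G b]] poly_span.scale[OF G]])
  qed
  have "smooth (B 0)"
    using poly_span_derivative[OF d1 d2] by (intro smoothI[of "poly_span (range B)"]) (auto intro: poly_span.base)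
  from smooth_linear[OF bounded_linear_Re this]
  have "smooth (\<lambda>x. exp_flat 0 (r\<^sup>2 - (norm (x - c))\<^sup>2))" by (simp add: B_def)
  moreover have "exp_flat 0 (r\<^sup>2 - (norm (x - c))\<^sup>2) = 0" if "r < norm (x - c)" for x
  proof -
    have "r\<^sup>2 < (norm (x - c))\<^sup>2" using that r by (intro power_strict_mono) auto
    then show ?thesis by (simp add: exp_flat_def)
  qed
  moreover have "exp_flat 0 (r\<^sup>2 - (norm (x - c))\<^sup>2) > 0" if "norm (x - c) < r" for x
  proof -
    have "(norm (x - c))\<^sup>2 < r\<^sup>2" using that by (intro power_strict_mono) auto
    then show ?thesis by (simp add: exp_flat_def)
  qed
  ultimately show ?thesis
    by (intro that[of "\<lambda>x. exp_flat 0 (r\<^sup>2 - (norm (x - c))\<^sup>2)"]) (auto simp: smooth_cball_def exp_flat_def)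
qed

section \<open>The fractional Laplacian of a test function away from its support\<close>

definition exp_remainder :: "nat \<Rightarrow> real \<Rightarrow> real" where
  "exp_remainder M u = exp (- u) - (\<Sum>j<M. (- u) ^ j / fact j)"

lemma exp_remainder_0: "exp_remainder (Suc M) 0 = 0"
  unfolding exp_remainder_def by (subst sum.lessThan_Suc_shift) simp

lemma exp_remainder_derivative: "(exp_remainder (Suc M) has_real_derivative - exp_remainder M u) (at u)"
proof (induction M)
  case 0
  have "((\<lambda>u. exp (- u) - 1) has_real_derivative - exp (- u)) (at u)" by (auto intro!: derivative_eq_intros)
  then show ?case by (simp add: exp_remainder_def[abs_def])
next
  case (Suc M)
  have e: "exp_remainder (Suc (Suc M)) = (\<lambda>u. exp_remainder (Suc M) u - (- u) ^ Suc M / fact (Suc M))"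
    by (simp add: exp_remainder_def fun_eq_iff)
  have "((\<lambda>u::real. (- u) ^ Suc M / fact (Suc M)) has_real_derivative - ((- u) ^ M / fact M)) (at u)"
  proof -
    have "((\<lambda>u::real. (- u) ^ Suc M / fact (Suc M)) has_real_derivative (real (Suc M) * (- u) ^ M * (- 1)) / fact (Suc M)) (at u)"
      by (auto intro!: derivative_eq_intros simp del: power_Suc)
    moreover have "(real (Suc M) * (- u) ^ M * (- 1)) / fact (Suc M) = - ((- u) ^ M / fact M)"
      by (simp add: fact_Suc del: of_nat_Suc)
    ultimately show ?thesis by simp
  qed
  moreover have "- exp_remainder M u - - ((- u) ^ M / fact M) = - exp_remainder (Suc M) u"
    by (simp add: exp_remainder_def)
  ultimately show ?case using DERIV_diff[OF Suc] unfolding e by metis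
qed

text \<open>The derivative of the remainder of order M + 1 is minus the remainder of order M, so
  sign and size propagate by monotonicity. The definite sign is what keeps the weighted integral of
  the remainder from vanishing.\<close>

lemma exp_remainder_bounds:
  "u \<ge> 0 \<Longrightarrow> 0 \<le> (- 1) ^ M * exp_remainder M u \<and> (- 1) ^ M * exp_remainder M u \<le> u ^ M / fact M \<and>
    (u > 0 \<longrightarrow> 0 < (- 1) ^ M * exp_remainder M u)"
proof (induction M arbitrary: u)
  case 0
  then show ?case by (simp add: exp_remainder_def)
next
  case (Suc M)
  define f where "f u = (- 1) ^ Suc M * exp_remainder (Suc M) u" for u
  have f': "(f has_real_derivative (- 1) ^ M * exp_remainder M u) (at u)" for u
    using DERIV_cmult[OF exp_remainder_derivative, of "(- 1) ^ Suc M" M u] by (simp add: f_def[abs_def])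
  have f0: "f 0 = 0" by (simp add: f_def exp_remainder_0)
  have 1: "f 0 \<le> f u"
    by (rule DERIV_nonneg_imp_nondecreasing[OF Suc.prems]) (use f' Suc.IH in blast)
  define g where "g u = u ^ Suc M / fact (Suc M) - f u" for u
  have g': "(g has_real_derivative u ^ M / fact M - (- 1) ^ M * exp_remainder M u) (at u)" for u
  proof -
    have "((\<lambda>u::real. u ^ Suc M / fact (Suc M)) has_real_derivative (real (Suc M) * u ^ M) / fact (Suc M)) (at u)"
      by (auto intro!: derivative_eq_intros simp del: power_Suc)
    moreover have "(real (Suc M) * u ^ M) / fact (Suc M) = u ^ M / fact M" by (simp add: fact_Suc del: of_nat_Suc)
    ultimately show ?thesis unfolding g_def[abs_def] using DERIV_diff[OF _ f'] by simp
  qed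
  have 2: "g 0 \<le> g u"
    by (rule DERIV_nonneg_imp_nondecreasing[OF Suc.prems]) (use g' Suc.IH in \<open>metis diff_ge_0_iff_ge\<close>)
  have 3: "f 0 < f u" if "u > 0"
  proof (rule DERIV_pos_imp_increasing_open[OF that])
    show "\<exists>y. DERIV f x :> y \<and> 0 < y" if "0 < x" "x < u" for x using f' Suc.IH[of x] that by force
    show "continuous_on {0..u} f" by (intro continuous_at_imp_continuous_on ballI DERIV_isCont[OF f'])
  qed
  show ?case using 1 2 3 unfolding f0 by (simp add: g_def f0 f_def exp_remainder_0)
qed

text \<open>Applied to one remainder of order M + 1, these are bounds of different order: the power
  M + 1 is the useful one near 0, the power M at infinity.\<close>

lemma exp_remainder_abs:
  assumes "u \<ge> 0"
  shows "\<bar>exp_remainder M u\<bar> \<le> u ^ M / fact M" "\<bar>exp_remainder (Suc M) u\<bar> \<le> 2 * u ^ M / fact M"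
proof -
  show 1: "\<bar>exp_remainder M u\<bar> \<le> u ^ M / fact M"
    using exp_remainder_bounds[OF assms, of M] by (cases "even M") auto
  have "exp_remainder (Suc M) u = exp_remainder M u - (- u) ^ M / fact M" by (simp add: exp_remainder_def)
  moreover have "\<bar>(- u) ^ M / fact M\<bar> = u ^ M / fact M" using assms by (simp add: power_abs)
  ultimately show "\<bar>exp_remainder (Suc M) u\<bar> \<le> 2 * u ^ M / fact M" using 1 by linarith
qed

lemma exp_remainder_measurable [measurable]: "exp_remainder M \<in> borel_measurable borel"
  unfolding exp_remainder_def[abs_def] by measurable

lemma integrable_powr_01:
  assumes "e > - 1" shows "integrable lborel (\<lambda>t::real. indicator {0..1} t * t powr e)"
proof -
  have "(\<integral>\<^sup>+ t. ennreal (indicator {0..1} t * t powr e) \<partial>lborel) = ennreal (1 powr (e + 1) / (e + 1))"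
    by (rule nn_integral_has_integral_lebesgue[OF _ has_integral_powr_from_0]) (use assms in auto)
  then show ?thesis by (intro integrableI_nonneg) auto
qed

lemma integrable_powr_1_inf:
  assumes "e < - 1" shows "integrable lborel (\<lambda>t::real. indicator {1..} t * t powr e)"
proof -
  have "(\<integral>\<^sup>+ t. ennreal (indicator {1..} t * t powr e) \<partial>lborel) = ennreal (- (1 powr (e + 1)) / (e + 1))"
    by (rule nn_integral_has_integral_lebesgue[OF _ has_integral_powr_to_inf]) (use assms in auto)
  then show ?thesis by (intro integrableI_nonneg) auto
qed

lemma integrable_powr_weight:
  fixes f :: "real \<Rightarrow> real"
  assumes [measurable]: "f \<in> borel_measurable borel"
    and a: "\<And>t. 0 < t \<Longrightarrow> t \<le> 1 \<Longrightarrow> \<bar>f t\<bar> \<le> A * t powr a" "e + a > - 1"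
    and b: "\<And>t. 1 \<le> t \<Longrightarrow> \<bar>f t\<bar> \<le> B * t powr b" "e + b < - 1"
  shows "integrable lborel (\<lambda>t. indicator {0<..} t * t powr e * f t)"
proof (rule integrable_le)
  show "integrable lborel (\<lambda>t. \<bar>A\<bar> * (indicator {0..1} t * t powr (e + a)) + \<bar>B\<bar> * (indicator {1..} t * t powr (e + b)))"
    by (intro Bochner_Integration.integrable_add integrable_mult_right integrable_powr_01 integrable_powr_1_inf a b)
  show "norm (indicator {0<..} t * t powr e * f t) \<le> \<bar>A\<bar> * (indicator {0..1} t * t powr (e + a)) + \<bar>B\<bar> * (indicator {1..} t * t powr (e + b))" for t
  proof (cases "t > 0")
    case True
    have A: "t powr e * \<bar>f t\<bar> \<le> \<bar>A\<bar> * t powr (e + a)" if "t \<le> 1"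
    proof -
      have "t powr e * \<bar>f t\<bar> \<le> t powr e * (\<bar>A\<bar> * t powr a)"
        by (intro mult_left_mono order_trans[OF a(1)] mult_right_mono) (use that True in auto)
      then show ?thesis by (simp add: powr_add mult_ac)
    qed
    have B: "t powr e * \<bar>f t\<bar> \<le> \<bar>B\<bar> * t powr (e + b)" if "t \<ge> 1"
    proof -
      have "t powr e * \<bar>f t\<bar> \<le> t powr e * (\<bar>B\<bar> * t powr b)"
        by (intro mult_left_mono order_trans[OF b(1)] mult_right_mono) (use that True in auto)
      then show ?thesis by (simp add: powr_add mult_ac)
    qed
    have "0 \<le> \<bar>A\<bar> * t powr (e + a)" "0 \<le> \<bar>B\<bar> * t powr (e + b)" by auto
    then show ?thesis using A B True by (cases "t \<le> 1"; cases "t \<ge> 1") (auto simp: abs_mult)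
  qed (auto simp: indicator_def)
qed measurable

text \<open>With e = -\<gamma> - 1 the factor is l^\<gamma>. It yields |\<xi>|^(2\<gamma>) for l =
  |\<xi>|^2, and |z|^(-2\<gamma>) for l = 1 / |z|^2.\<close>

lemma lborel_integral_scale:
  fixes f :: "real \<Rightarrow> real"
  assumes l: "l > 0"
  shows "(LINT t|lborel. indicator {0<..} t * t powr e * f (t * l)) = l powr (- e - 1) * (LINT u|lborel. indicator {0<..} u * u powr e * f u)"
proof -
  have "(LINT u|lborel. indicator {0<..} u * u powr e * f u) = l * (LINT t|lborel. indicator {0<..} (l * t) * (l * t) powr e * f (l * t))"
    using l by (subst lborel_integral_real_affine[of l _ 0]) auto
  also have "\<dots> = l * (LINT t|lborel. l powr e * (indicator {0<..} t * t powr e * f (t * l)))"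
    using l by (intro arg_cong[where f = "\<lambda>x. l * x"] Bochner_Integration.integral_cong refl)
      (auto simp: indicator_def powr_mult zero_less_mult_iff mult_ac)
  also have "\<dots> = l powr (e + 1) * (LINT t|lborel. indicator {0<..} t * t powr e * f (t * l))"
    using l by (simp add: powr_add)
  finally show ?thesis using l by (simp add: powr_add[symmetric] mult.assoc[symmetric])
qed

lemma lborel_integrable_scale:
  fixes f :: "real \<Rightarrow> real"
  assumes l: "l > 0" and i: "integrable lborel (\<lambda>u. indicator {0<..} u * u powr e * f u)"
  shows "integrable lborel (\<lambda>t. indicator {0<..} t * t powr e * f (t * l))"
proof -
  have "integrable lborel (\<lambda>t. indicator {0<..} (0 + l * t) * (0 + l * t) powr e * f (0 + l * t))"
    using l i by (subst lborel_integrable_real_affine_iff) auto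
  note integrable_mult_right[OF this, of "l powr - e"]
  moreover have "l powr - e * (indicator {0<..} (0 + l * t) * (0 + l * t) powr e * f (0 + l * t)) = indicator {0<..} t * t powr e * f (t * l)" for t
    using l by (auto simp: indicator_def powr_mult zero_less_mult_iff powr_minus mult_ac)
  ultimately show ?thesis by (simp only:)
qed

text \<open>The integrand is of order t^(M-\<gamma>) at 0 and t^(M-\<gamma>-1) at infinity,
  integrable at both ends precisely for M < \<gamma> < M + 1. This fixes how many Taylor terms are
  subtracted.\<close>

lemma integrable_exp_remainder:
  assumes \<gamma>: "real M < \<gamma>" "\<gamma> < real (Suc M)"
  shows "integrable lborel (\<lambda>t. indicator {0<..} t * t powr (- \<gamma> - 1) * exp_remainder (Suc M) t)"
proof (rule integrable_powr_weight)
  show "\<bar>exp_remainder (Suc M) t\<bar> \<le> (1 / fact (Suc M)) * t powr real (Suc M)" if "0 < t" for t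
    using exp_remainder_abs(1)[of t "Suc M"] that by (subst powr_realpow) auto
  show "\<bar>exp_remainder (Suc M) t\<bar> \<le> (2 / fact M) * t powr real M" if "1 \<le> t" for t
    using exp_remainder_abs(2)[of t M] that by (subst powr_realpow) auto
qed (use \<gamma> in auto)

text \<open>Up to the sign (-1)^(M+1) the integrand is positive for all t > 0.\<close>

lemma integral_exp_remainder_nonzero:
  assumes \<gamma>: "real M < \<gamma>" "\<gamma> < real (Suc M)"
  shows "(LINT t|lborel. indicator {0<..} t * t powr (- \<gamma> - 1) * exp_remainder (Suc M) t) \<noteq> 0"
proof
  define f where "f t = (- 1) ^ Suc M * (indicator {0<..} t * t powr (- \<gamma> - 1) * exp_remainder (Suc M) t)" for t :: real
  have f_eq: "f t = indicator {0<..} t * t powr (- \<gamma> - 1) * ((- 1) ^ Suc M * exp_remainder (Suc M) t)" for t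
    by (simp add: f_def)
  have pos: "0 < f t" if "t > 0" for t
  proof -
    have "0 < (- 1) ^ Suc M * exp_remainder (Suc M) t" using exp_remainder_bounds[of t "Suc M"] that less_imp_le by blast
    then show ?thesis unfolding f_eq by (rule mult_pos_pos[rotated]) (use that in simp)
  qed
  then have nn: "0 \<le> f t" for t
    by (cases "t > 0") (auto simp: f_def less_imp_le)
  assume "(LINT t|lborel. indicator {0<..} t * t powr (- \<gamma> - 1) * exp_remainder (Suc M) t) = 0"
  then have "integral\<^sup>L lborel f = 0" by (simp add: f_def[abs_def])
  moreover have "integrable lborel f" unfolding f_def[abs_def]
    by (intro integrable_mult_right integrable_exp_remainder \<gamma>)
  ultimately have "AE t in lborel. f t = 0" using nn by (subst (asm) integral_nonneg_eq_0_iff_AE) auto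
  then have "AE t in lborel. \<not> (t \<in> {0<..<1::real})" by eventually_elim (use pos in force)
  then have "{0<..<1::real} \<in> null_sets lborel" by (subst AE_iff_null_sets) auto
  then have "emeasure lborel {0<..<1::real} = 0" by (rule null_setsD1)
  then show False by simp
qed

text \<open>Away from the support of \<open>\<phi>\<close> the Taylor polynomial of \<open>e\<^bsup>-t|\<xi>|\<^sup>2\<^esup>\<close> contributes only
  derivatives of \<open>\<phi>\<close>, which vanish; integrating the remainder against \<open>t\<^bsup>-\<gamma>-1\<^esup>\<close> gives \<open>|\<xi>|\<^bsup>2\<gamma>\<^esup>\<close>.\<close>

lemma frac_power_off_support:
  fixes \<phi> :: "'a::euclidean_space \<Rightarrow> complex"
  assumes \<gamma>: "real M < \<gamma>" "\<gamma> < real (Suc M)" and \<phi>: "\<phi> \<in> smooth_cball c r" and x: "r < norm (x - c)"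
  shows "of_real (LINT t|lborel. indicator {0<..} t * t powr (- \<gamma> - 1) * exp_remainder (Suc M) t) *
      inv_fourier (\<lambda>\<xi>. of_real (norm \<xi> powr (2 * \<gamma>)) * fourier \<phi> \<xi>) x
    = (LINT t|lborel. of_real (indicator {0<..} t * t powr (- \<gamma> - 1)) * (LINT y|lborel. of_real (heat t (x - y)) * \<phi> y))"
proof -
  define \<kappa> where "\<kappa> = (LINT t|lborel. indicator {0<..} t * t powr (- \<gamma> - 1) * exp_remainder (Suc M) t)"
  define R where "R = exp_remainder (Suc M)"
  have [measurable]: "R \<in> borel_measurable borel" unfolding R_def by measurable
  have \<phi>S: "\<phi> \<in> schwartz" by (rule smooth_cball_schwartz[OF \<phi>])
  note F = fourier_schwartz[OF \<phi>S]
  note [measurable] = schwartz_measurable[OF \<phi>S] schwartz_measurable[OF F]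
  define C where "C = complex_of_real ((2 * pi) ^ DIM('a))"
  have C0: "C \<noteq> 0" by (simp add: C_def)
  define w where "w t = indicator {0<..} t * t powr (- \<gamma> - 1)" for t :: real
  have [measurable]: "w \<in> borel_measurable borel" unfolding w_def[abs_def] by measurable
  have wR: "integrable lborel (\<lambda>t. w t * R t)"
    unfolding w_def R_def by (rule integrable_exp_remainder[OF \<gamma>])
  have pw: "norm \<xi> powr (2 * \<gamma>) = ((norm \<xi>)\<^sup>2) powr \<gamma>" for \<xi> :: 'a
    by (cases "\<xi> = 0") (simp_all add: powr_powr powr_numeral[symmetric] del: powr_numeral)
  have i1: "integrable lborel (\<lambda>t. w t * R (t * (norm \<xi>)\<^sup>2))"
    and v1: "(LINT t|lborel. w t * R (t * (norm \<xi>)\<^sup>2)) = norm \<xi> powr (2 * \<gamma>) * \<kappa>" if "\<xi> \<noteq> 0" for \<xi> :: 'a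
    using that lborel_integrable_scale[of "(norm \<xi>)\<^sup>2" "- \<gamma> - 1" R] lborel_integral_scale[of "(norm \<xi>)\<^sup>2" "- \<gamma> - 1" R] wR
    by (simp_all add: w_def \<kappa>_def R_def pw)
  have va: "(LINT t|lborel. \<bar>w t * R (t * (norm \<xi>)\<^sup>2)\<bar>) = norm \<xi> powr (2 * \<gamma>) * (LINT t|lborel. \<bar>w t * R t\<bar>)" if "\<xi> \<noteq> 0" for \<xi> :: 'a
    using that lborel_integral_scale[of "(norm \<xi>)\<^sup>2" "- \<gamma> - 1" "\<lambda>u. \<bar>R u\<bar>"]
    by (simp add: w_def pw abs_mult)
  have pF: "integrable lborel (\<lambda>\<xi>. norm \<xi> powr (2 * \<gamma>) * norm (fourier \<phi> \<xi>))"
  proof (rule integrable_le)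
    show "integrable lborel (\<lambda>\<xi>. (1 + norm \<xi>) ^ (2 * Suc M) * norm (fourier \<phi> \<xi>))"
      using schwartz_rapid[OF F] unfolding rapid_def by blast
    show "norm (norm \<xi> powr (2 * \<gamma>) * norm (fourier \<phi> \<xi>)) \<le> (1 + norm \<xi>) ^ (2 * Suc M) * norm (fourier \<phi> \<xi>)" for \<xi>
    proof -
      have "norm \<xi> powr (2 * \<gamma>) \<le> (1 + norm \<xi>) powr (2 * \<gamma>)" using \<gamma> by (intro powr_mono2) auto
      also have "\<dots> \<le> (1 + norm \<xi>) powr real (2 * Suc M)" using \<gamma> by (intro powr_mono) auto
      also have "\<dots> = (1 + norm \<xi>) ^ (2 * Suc M)" using add_pos_nonneg[of 1 "norm \<xi>"] by (subst powr_realpow) auto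
      finally show ?thesis by (simp add: mult_right_mono)
    qed
  qed measurable
  have AE0: "AE \<xi> in lborel. \<xi> \<noteq> (0::'a)" by (rule AE_lborel_singleton)
  \<comment> \<open>By scaling, the t-integral of the absolute value is a multiple of
    |\<xi>|^(2\<gamma>), against which the rapidly decreasing transform of \<phi> is
    integrable.\<close>
  have int: "integrable (lborel \<Otimes>\<^sub>M lborel) (\<lambda>(\<xi>, t). of_real (w t * R (t * (norm \<xi>)\<^sup>2)) * (cis (x \<bullet> \<xi>) * fourier \<phi> \<xi>))"
  proof (rule lborel_pair.Fubini_integrable)
    show "AE \<xi> in lborel. integrable lborel (\<lambda>t. case (\<xi>, t) of (\<xi>, t) \<Rightarrow> of_real (w t * R (t * (norm \<xi>)\<^sup>2)) * (cis (x \<bullet> \<xi>) * fourier \<phi> \<xi>))"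
      using AE0 by eventually_elim (simp add: i1 del: of_real_mult)
    have nn: "(LINT t|lborel. norm (of_real (w t * R (t * (norm \<xi>)\<^sup>2)) * (cis (x \<bullet> \<xi>) * fourier \<phi> \<xi>))) = (LINT t|lborel. \<bar>w t * R (t * (norm \<xi>)\<^sup>2)\<bar>) * norm (fourier \<phi> \<xi>)" for \<xi>
      by (simp add: norm_mult abs_mult)
    have "integrable lborel (\<lambda>\<xi>. (LINT t|lborel. \<bar>w t * R t\<bar>) * (norm \<xi> powr (2 * \<gamma>) * norm (fourier \<phi> \<xi>)))"
      by (intro integrable_mult_right pF)
    then show "integrable lborel (\<lambda>\<xi>. LINT t|lborel. norm (case (\<xi>, t) of (\<xi>, t) \<Rightarrow> of_real (w t * R (t * (norm \<xi>)\<^sup>2)) * (cis (x \<bullet> \<xi>) * fourier \<phi> \<xi>)))"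
    proof (rule integrable_cong_AE_imp)
      show "(\<lambda>\<xi>. LINT t|lborel. norm (case (\<xi>, t) of (\<xi>, t) \<Rightarrow> of_real (w t * R (t * (norm \<xi>)\<^sup>2)) * (cis (x \<bullet> \<xi>) * fourier \<phi> \<xi>))) \<in> borel_measurable lborel"
        by (intro lborel.borel_measurable_lebesgue_integral) measurable
      show "AE \<xi> in lborel. (LINT t|lborel. \<bar>w t * R t\<bar>) * (norm \<xi> powr (2 * \<gamma>) * norm (fourier \<phi> \<xi>)) = (LINT t|lborel. norm (case (\<xi>, t) of (\<xi>, t) \<Rightarrow> of_real (w t * R (t * (norm \<xi>)\<^sup>2)) * (cis (x \<bullet> \<xi>) * fourier \<phi> \<xi>)))"
        using AE0
      proof eventually_elim
        case (elim \<xi>)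
        show ?case unfolding prod.case nn va[OF elim] by (simp only: mult_ac)
      qed
    qed
  qed measurable
  have pm: "(\<lambda>\<xi>. of_real (norm \<xi> powr (2 * \<gamma>)) * fourier \<phi> \<xi>) \<in> borel_measurable borel" by measurable
  have "of_real \<kappa> * inv_fourier (\<lambda>\<xi>. of_real (norm \<xi> powr (2 * \<gamma>)) * fourier \<phi> \<xi>) x * C
      = (LINT \<xi>|lborel. of_real (norm \<xi> powr (2 * \<gamma>) * \<kappa>) * (cis (x \<bullet> \<xi>) * fourier \<phi> \<xi>))"
  proof -
    have "of_real \<kappa> * (LINT \<xi>|lborel. cis (x \<bullet> \<xi>) * (of_real (norm \<xi> powr (2 * \<gamma>)) * fourier \<phi> \<xi>))
      = (LINT \<xi>|lborel. of_real (norm \<xi> powr (2 * \<gamma>) * \<kappa>) * (cis (x \<bullet> \<xi>) * fourier \<phi> \<xi>))"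
      unfolding integral_mult_right_zero[symmetric] by (simp add: mult_ac)
    moreover have "inv_fourier (\<lambda>\<xi>. of_real (norm \<xi> powr (2 * \<gamma>)) * fourier \<phi> \<xi>) x * C = (LINT \<xi>|lborel. cis (x \<bullet> \<xi>) * (of_real (norm \<xi> powr (2 * \<gamma>)) * fourier \<phi> \<xi>))"
      unfolding inv_fourier_lborel[OF pm] C_def by simp
    ultimately show ?thesis by (simp only: mult.assoc)
  qed
  also have "\<dots> = (LINT \<xi>|lborel. LINT t|lborel. of_real (w t * R (t * (norm \<xi>)\<^sup>2)) * (cis (x \<bullet> \<xi>) * fourier \<phi> \<xi>))"
  proof (rule integral_cong_AE)
    show "AE \<xi> in lborel. of_real (norm \<xi> powr (2 * \<gamma>) * \<kappa>) * (cis (x \<bullet> \<xi>) * fourier \<phi> \<xi>) = (LINT t|lborel. of_real (w t * R (t * (norm \<xi>)\<^sup>2)) * (cis (x \<bullet> \<xi>) * fourier \<phi> \<xi>))"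
      using AE0
    proof eventually_elim
      case (elim \<xi>)
      show ?case unfolding integral_mult_left_zero integral_complex_of_real v1[OF elim] ..
    qed
    show "(\<lambda>\<xi>. LINT t|lborel. of_real (w t * R (t * (norm \<xi>)\<^sup>2)) * (cis (x \<bullet> \<xi>) * fourier \<phi> \<xi>)) \<in> borel_measurable lborel"
      by (intro lborel.borel_measurable_lebesgue_integral) measurable
  qed measurable
  also have "\<dots> = (LINT t|lborel. LINT \<xi>|lborel. of_real (w t * R (t * (norm \<xi>)\<^sup>2)) * (cis (x \<bullet> \<xi>) * fourier \<phi> \<xi>))"
    using lborel_pair.Fubini_integral[OF int] by simp
  also have "\<dots> = (LINT t|lborel. of_real (w t) * (LINT y|lborel. of_real (heat t (x - y)) * \<phi> y) * C)"
  proof (rule Bochner_Integration.integral_cong[OF refl])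
    fix t
    show "(LINT \<xi>|lborel. of_real (w t * R (t * (norm \<xi>)\<^sup>2)) * (cis (x \<bullet> \<xi>) * fourier \<phi> \<xi>)) = of_real (w t) * (LINT y|lborel. of_real (heat t (x - y)) * \<phi> y) * C"
    proof (cases "t > 0")
      case True
      define E where "E \<xi> = cis (x \<bullet> \<xi>) * (of_real (exp (- (t * (norm \<xi>)\<^sup>2))) * fourier \<phi> \<xi>)" for \<xi>
      define P where "P j \<xi> = cis (x \<bullet> \<xi>) * (of_real (norm \<xi> ^ (2 * j)) * fourier \<phi> \<xi>)" for j \<xi>
      have iE: "integrable lborel E"
      proof -
        have "(\<lambda>\<xi>. of_real (exp (- (t * (norm \<xi>)\<^sup>2))) * fourier \<phi> \<xi>) \<in> schwartz"
          using schwartz_mult[OF fourier_slowly_increasing[OF schwartz_rapid[OF \<phi>S]] schwartz_gaussian[OF True]] by (simp add: mult.commute)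
        then show ?thesis unfolding E_def by (intro integrable_cis_mult schwartz_integrable) auto
      qed
      have vE: "integral\<^sup>L lborel E = (LINT y|lborel. of_real (heat t (x - y)) * \<phi> y) * C"
      proof -
        have "inv_fourier (\<lambda>\<xi>. of_real (exp (- (t * (norm \<xi>)\<^sup>2))) * fourier \<phi> \<xi>) x = integral\<^sup>L lborel E / C"
          unfolding E_def C_def by (rule inv_fourier_lborel) measurable
        then show ?thesis using inv_fourier_gauss[OF schwartz_integrable[OF \<phi>S] True, of x] C0 by (simp add: field_simps)
      qed
      have PS: "P j = (\<lambda>\<xi>. cis (x \<bullet> \<xi>) * fourier ((nlap ^^ j) \<phi>) \<xi>)" for j
        by (rule ext) (simp only: P_def fourier_nlap_power(2)[OF \<phi>S])
      have iP: "integrable lborel (P j)" for j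
        unfolding PS by (intro integrable_cis_mult schwartz_integrable fourier_schwartz fourier_nlap_power \<phi>S) auto
      have vP: "integral\<^sup>L lborel (P j) = 0" for j
      proof -
        note S = fourier_nlap_power(1)[OF \<phi>S, of j]
        have "integral\<^sup>L lborel (P j) / C = inv_fourier (fourier ((nlap ^^ j) \<phi>)) x"
          unfolding PS C_def by (rule inv_fourier_lborel[symmetric]) (rule schwartz_measurable[OF fourier_schwartz[OF S]])
        also have "\<dots> = (nlap ^^ j) \<phi> x" by (simp add: inv_fourier_fourier[OF S])
        also have "\<dots> = 0" using smooth_cball_nlap_power[OF \<phi>, of j] x unfolding smooth_cball_def by blast
        finally show ?thesis using C0 by simp
      qed
      have "of_real (w t * R (t * (norm \<xi>)\<^sup>2)) * (cis (x \<bullet> \<xi>) * fourier \<phi> \<xi>) = of_real (w t) * (E \<xi> - (\<Sum>j<Suc M. of_real ((- t) ^ j / fact j) * P j \<xi>))" for \<xi>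
      proof -
        have "(- (t * (norm \<xi>)\<^sup>2)) ^ j = (- t) ^ j * norm \<xi> ^ (2 * j)" for j
          by (simp only: power_mult power_mult_distrib[symmetric]) simp
        then have "R (t * (norm \<xi>)\<^sup>2) = exp (- (t * (norm \<xi>)\<^sup>2)) - (\<Sum>j<Suc M. (- t) ^ j / fact j * norm \<xi> ^ (2 * j))"
          by (simp add: R_def exp_remainder_def)
        then show ?thesis
          by (simp add: E_def P_def left_diff_distrib right_diff_distrib sum_distrib_left sum_distrib_right mult_ac del: sum.lessThan_Suc)
      qed
      then have "(LINT \<xi>|lborel. of_real (w t * R (t * (norm \<xi>)\<^sup>2)) * (cis (x \<bullet> \<xi>) * fourier \<phi> \<xi>)) = of_real (w t) * (LINT \<xi>|lborel. E \<xi> - (\<Sum>j<Suc M. of_real ((- t) ^ j / fact j) * P j \<xi>))"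
        by (simp only: integral_mult_right_zero)
      also have "(LINT \<xi>|lborel. E \<xi> - (\<Sum>j<Suc M. of_real ((- t) ^ j / fact j) * P j \<xi>)) = integral\<^sup>L lborel E - (\<Sum>j<Suc M. of_real ((- t) ^ j / fact j) * integral\<^sup>L lborel (P j))"
        by (subst Bochner_Integration.integral_diff[OF iE])
           (auto intro!: Bochner_Integration.integrable_sum integrable_mult_right iP simp: Bochner_Integration.integral_sum iP simp del: sum.lessThan_Suc)
      also have "\<dots> = (LINT y|lborel. of_real (heat t (x - y)) * \<phi> y) * C" by (simp add: vP vE)
      finally show ?thesis by (simp add: mult.assoc)
    qed (simp add: w_def)
  qed
  also have "\<dots> = (LINT t|lborel. of_real (w t) * (LINT y|lborel. of_real (heat t (x - y)) * \<phi> y)) * C" by (simp only: integral_mult_left_zero)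
  finally have "of_real \<kappa> * inv_fourier (\<lambda>\<xi>. of_real (norm \<xi> powr (2 * \<gamma>)) * fourier \<phi> \<xi>) x = (LINT t|lborel. of_real (w t) * (LINT y|lborel. of_real (heat t (x - y)) * \<phi> y))"
    using C0 by simp
  then show ?thesis unfolding \<kappa>_def w_def by simp
qed

text \<open>The heat kernel at distance one as a function of time. By homogeneity it determines the
  kernel at every other point z, with time measured in units of |z|^2.\<close>

definition heat_profile :: "nat \<Rightarrow> real \<Rightarrow> real" where
  "heat_profile n u = exp (- (1 / (4 * u))) / sqrt (4 * pi * u) ^ n"

lemma heat_profile_measurable [measurable]: "heat_profile n \<in> borel_measurable borel"
  unfolding heat_profile_def[abs_def] by measurable

lemma heat_eq_profile:
  fixes z :: "'a::euclidean_space"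
  assumes "z \<noteq> 0" shows "heat t z = norm z powr (- real DIM('a)) * heat_profile DIM('a) (t * (1 / (norm z)\<^sup>2))"
proof -
  have "sqrt (4 * pi * (t * (1 / (norm z)\<^sup>2))) = sqrt (4 * pi * t) / norm z"
    using assms by (simp add: real_sqrt_divide)
  moreover have "norm z powr (- real DIM('a)) = 1 / norm z ^ DIM('a)" using assms by (simp add: powr_minus_divide powr_realpow)
  ultimately show ?thesis using assms unfolding heat_def heat_profile_def by (simp add: power_divide)
qed

lemma heat_profile_integrable:
  assumes \<gamma>: "\<gamma> > 0" shows "integrable lborel (\<lambda>t. indicator {0<..} t * t powr (- \<gamma> - 1) * heat_profile n t)"
proof -
  \<comment> \<open>An integer above \<gamma>: near 0 the factor exp(-1/(4t)) is at most a multiple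
    of t^(n+m), of which n powers cancel the denominator and m make t^(-\<gamma>-1)
    integrable.\<close>
  define m where "m = nat \<lceil>\<gamma>\<rceil> + 1"
  have m: "\<gamma> < real m" unfolding m_def by linarith
  have pi4: "1 \<le> 4 * pi" using pi_gt3 by simp
  show ?thesis
  proof (rule integrable_powr_weight[where a = "real m" and b = 0 and A = "fact (n + m) * 4 ^ (n + m)" and B = 1])
    fix t :: real assume t: "0 < t" "t \<le> 1"
    have "(1 / (4 * t)) ^ (n + m) / fact (n + m) \<le> exp (1 / (4 * t))"
    proof -
      define y where "y = 1 / (4 * t)"
      have y: "y \<ge> 0" using t by (simp add: y_def)
      have "(\<lambda>j. y ^ j /\<^sub>R fact j) sums exp y" by (rule exp_converges)
      then have s: "summable (\<lambda>j. y ^ j /\<^sub>R fact j)" "exp y = (\<Sum>j. y ^ j /\<^sub>R fact j)" by (auto simp: sums_iff)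
      have "(\<Sum>j\<in>{n + m}. y ^ j /\<^sub>R fact j) \<le> (\<Sum>j. y ^ j /\<^sub>R fact j)"
        using y by (intro sum_le_suminf s) auto
      then show ?thesis unfolding s(2)[symmetric] y_def[symmetric] by (simp add: divide_inverse mult.commute)
    qed
    then have e: "exp (- (1 / (4 * t))) \<le> fact (n + m) * (4 * t) ^ (n + m)"
      using t by (simp add: exp_minus field_simps)
    have "t * t \<le> t" using t by (simp add: mult_left_le)
    also have "\<dots> \<le> 4 * pi * t" using pi4 t by simp
    finally have "sqrt (t * t) \<le> sqrt (4 * pi * t)" by (rule real_sqrt_le_mono)
    then have s: "t ^ n \<le> sqrt (4 * pi * t) ^ n" using t by (intro power_mono) auto
    have "heat_profile n t \<le> (fact (n + m) * (4 * t) ^ (n + m)) / t ^ n"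
      unfolding heat_profile_def using e s t by (intro frac_le) auto
    also have "\<dots> = fact (n + m) * 4 ^ (n + m) * t powr real m"
      using t by (simp add: powr_realpow power_add power_mult_distrib)
    finally show "\<bar>heat_profile n t\<bar> \<le> fact (n + m) * 4 ^ (n + m) * t powr real m"
      using t by (simp add: heat_profile_def)
  next
    fix t :: real assume t: "1 \<le> t"
    have "1 \<le> 4 * pi * t" using pi4 t mult_mono[of 1 "4 * pi" 1 t] by simp
    then have "1 \<le> sqrt (4 * pi * t) ^ n" by (intro one_le_power) simp
    then have "heat_profile n t \<le> 1 / 1" unfolding heat_profile_def using t by (intro frac_le) auto
    then show "\<bar>heat_profile n t\<bar> \<le> 1 * t powr 0" using t by (simp add: heat_profile_def)
  qed (use m \<gamma> in auto)
qed

text \<open>For \<gamma> > 0 the substitution s = 1 / (4t) identifies it as 4^\<gamma> * Gamma (n/2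
  + \<gamma>) / pi^(n/2).\<close>

definition heat_const :: "nat \<Rightarrow> real \<Rightarrow> real" where
  "heat_const n \<gamma> = (LINT t|lborel. indicator {0<..} t * t powr (- \<gamma> - 1) * heat_profile n t)"

lemma heat_const_pos:
  assumes \<gamma>: "\<gamma> > 0" shows "heat_const n \<gamma> > 0"
proof -
  define f where "f t = indicator {0<..} t * t powr (- \<gamma> - 1) * heat_profile n t" for t :: real
  have pos: "f t > 0" if "t > 0" for t using that by (simp add: f_def heat_profile_def)
  have nn: "f t \<ge> 0" for t using pos[of t] by (cases "t > 0") (auto simp: f_def)
  have i: "integrable lborel f" unfolding f_def[abs_def] by (rule heat_profile_integrable[OF \<gamma>])
  have "integral\<^sup>L lborel f \<noteq> 0"
  proof
    assume "integral\<^sup>L lborel f = 0"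
    then have "AE t in lborel. f t = 0" using i nn by (subst (asm) integral_nonneg_eq_0_iff_AE) auto
    then have "AE t in lborel. t \<notin> {0<..<1::real}" by eventually_elim (use pos in force)
    then have "{0<..<1::real} \<in> null_sets lborel" by (subst AE_iff_null_sets) auto
    then have "emeasure lborel {0<..<1::real} = 0" by (rule null_setsD1)
    then show False by simp
  qed
  moreover have "integral\<^sup>L lborel f \<ge> 0" using nn by simp
  ultimately show ?thesis unfolding heat_const_def f_def by simp
qed

lemma heat_time_integral:
  fixes z :: "'a::euclidean_space"
  assumes \<gamma>: "\<gamma> > 0" and z: "z \<noteq> 0"
  shows "integrable lborel (\<lambda>t. indicator {0<..} t * t powr (- \<gamma> - 1) * heat t z)"
    and "(LINT t|lborel. indicator {0<..} t * t powr (- \<gamma> - 1) * heat t z) = heat_const DIM('a) \<gamma> * norm z powr (- (real DIM('a) + 2 * \<gamma>))"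
proof -
  define l where "l = 1 / (norm z)\<^sup>2"
  have l: "l > 0" using z by (simp add: l_def)
  have e: "indicator {0<..} t * t powr (- \<gamma> - 1) * heat t z =
    norm z powr (- real DIM('a)) * (indicator {0<..} t * t powr (- \<gamma> - 1) * heat_profile DIM('a) (t * l))" for t
    unfolding heat_eq_profile[OF z] l_def by simp
  show "integrable lborel (\<lambda>t. indicator {0<..} t * t powr (- \<gamma> - 1) * heat t z)"
    unfolding e by (intro integrable_mult_right lborel_integrable_scale[OF l] heat_profile_integrable \<gamma>)
  have "l powr \<gamma> = norm z powr (- 2 * \<gamma>)"
  proof -
    have "l = norm z powr (- 2)" using z by (simp add: l_def powr_minus_divide powr_numeral)
    then show ?thesis by (simp add: powr_powr)
  qed
  then show "(LINT t|lborel. indicator {0<..} t * t powr (- \<gamma> - 1) * heat t z) = heat_const DIM('a) \<gamma> * norm z powr (- (real DIM('a) + 2 * \<gamma>))"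
    unfolding e integral_mult_right_zero lborel_integral_scale[OF l]
    using z by (simp add: heat_const_def powr_add[symmetric] mult.assoc[symmetric])
qed

lemma smooth_cball_distance:
  assumes "\<phi> \<in> smooth_cball c r" "2 * r \<le> norm (x - c)" "\<phi> y \<noteq> 0" shows "r \<le> norm (x - y)"
proof -
  have "norm (y - c) \<le> r" using assms unfolding smooth_cball_def by force
  then show ?thesis using assms(2) norm_triangle_ineq[of "x - y" "y - c"] by simp
qed

text \<open>The time integral of the heat kernel is \<open>heat_const\<close> times the kernel |x -
  y|^(-n-2\<gamma>), so \<kappa> is the quotient of a positive constant by the nonzero integral of
  the remainder; it is obtained before \<phi>, c, r and x. A distance of 2r from the centre keeps x
  at distance at least r from the support, which bounds the kernel.\<close>

lemma frac_potential:
  assumes \<gamma>: "real M < \<gamma>" "\<gamma> < real (Suc M)"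
  obtains \<kappa> :: real where "\<kappa> \<noteq> 0"
    "\<And>(\<phi> :: 'a::euclidean_space \<Rightarrow> complex) c r x. \<phi> \<in> smooth_cball c r \<Longrightarrow> 0 < r \<Longrightarrow> 2 * r \<le> norm (x - c) \<Longrightarrow>
      integrable lborel (\<lambda>y. \<phi> y * of_real (norm (x - y) powr (- (real DIM('a) + 2 * \<gamma>)))) \<and>
      inv_fourier (\<lambda>\<xi>. of_real (norm \<xi> powr (2 * \<gamma>)) * fourier \<phi> \<xi>) x =
        of_real \<kappa> * (LINT y|lborel. \<phi> y * of_real (norm (x - y) powr (- (real DIM('a) + 2 * \<gamma>))))"
proof -
  have g0: "\<gamma> > 0" using \<gamma> by linarith
  define m where "m = (LINT t|lborel. indicator {0<..} t * t powr (- \<gamma> - 1) * exp_remainder (Suc M) t)"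
  have m: "m \<noteq> 0" unfolding m_def by (rule integral_exp_remainder_nonzero[OF \<gamma>])
  define H where "H = heat_const DIM('a) \<gamma>"
  have H: "H > 0" unfolding H_def by (rule heat_const_pos[OF g0])
  define d where "d = - (real DIM('a) + 2 * \<gamma>)"
  show ?thesis
  proof (rule that[of "H / m"])
    show "H / m \<noteq> 0" using m H by simp
    fix \<phi> :: "'a \<Rightarrow> complex" and c r x
    assume \<phi>: "\<phi> \<in> smooth_cball c r" and r: "0 < r" and x: "2 * r \<le> norm (x - c)"
    note \<phi>S = smooth_cball_schwartz[OF \<phi>]
    note [measurable] = schwartz_measurable[OF \<phi>S]
    have b: "norm (\<phi> y * of_real (norm (x - y) powr d)) \<le> r powr d * norm (\<phi> y)" for y
    proof (cases "\<phi> y = 0")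
      case False
      have "norm (x - y) powr d \<le> r powr d"
        using smooth_cball_distance[OF \<phi> x False] r g0 by (intro powr_mono2') (auto simp: d_def)
      then show ?thesis by (simp add: norm_mult mult_left_mono mult.commute[of "r powr d"])
    qed simp
    have i: "integrable lborel (\<lambda>y. \<phi> y * of_real (norm (x - y) powr d))"
      by (rule integrable_le[OF integrable_mult_right[OF integrable_norm[OF schwartz_integrable[OF \<phi>S]], of "r powr d"] _ b]) measurable
    define w where "w t = indicator {0<..} t * t powr (- \<gamma> - 1)" for t :: real
    have [measurable]: "w \<in> borel_measurable borel" unfolding w_def[abs_def] by measurable
    have ne: "x - y \<noteq> 0" if "\<phi> y \<noteq> 0" for y using smooth_cball_distance[OF \<phi> x that] r by auto
    have it: "integrable lborel (\<lambda>t. w t * heat t (x - y))" "(LINT t|lborel. w t * heat t (x - y)) = H * norm (x - y) powr d"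
      if "\<phi> y \<noteq> 0" for y
      using heat_time_integral[OF g0 ne[OF that]] unfolding w_def H_def d_def by auto
    have wn: "\<bar>w t * heat t z\<bar> = w t * heat t z" for t and z :: 'a by (cases "t > 0") (auto simp: w_def heat_nonneg)
    have int: "integrable (lborel \<Otimes>\<^sub>M lborel) (\<lambda>(y, t). of_real (w t * heat t (x - y)) * \<phi> y)"
    proof (rule lborel_pair.Fubini_integrable)
      show "AE y in lborel. integrable lborel (\<lambda>t. case (y, t) of (y, t) \<Rightarrow> of_real (w t * heat t (x - y)) * \<phi> y)"
      proof (rule AE_I2)
        fix y show "integrable lborel (\<lambda>t. case (y, t) of (y, t) \<Rightarrow> of_real (w t * heat t (x - y)) * \<phi> y)"
          using it(1)[of y] by (cases "\<phi> y = 0") (simp_all del: of_real_mult)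
      qed
      have "(LINT t|lborel. norm (of_real (w t * heat t (x - y)) * \<phi> y)) = H * norm (\<phi> y * of_real (norm (x - y) powr d))" for y
      proof (cases "\<phi> y = 0")
        case False
        have "(LINT t|lborel. norm (of_real (w t * heat t (x - y)) * \<phi> y)) = (LINT t|lborel. w t * heat t (x - y)) * norm (\<phi> y)"
          by (simp only: norm_mult norm_of_real wn integral_mult_left_zero)
        then show ?thesis unfolding it(2)[OF False] by (simp add: norm_mult)
      qed simp
      then show "integrable lborel (\<lambda>y. LINT t|lborel. norm (case (y, t) of (y, t) \<Rightarrow> of_real (w t * heat t (x - y)) * \<phi> y))"
        using integrable_mult_right[OF integrable_norm[OF i], of H] by simp
    qed measurable
    have "of_real m * inv_fourier (\<lambda>\<xi>. of_real (norm \<xi> powr (2 * \<gamma>)) * fourier \<phi> \<xi>) x = (LINT t|lborel. of_real (w t) * (LINT y|lborel. of_real (heat t (x - y)) * \<phi> y))"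
      using frac_power_off_support[OF \<gamma> \<phi>, of x] x r unfolding m_def w_def by simp
    also have "\<dots> = (LINT t|lborel. LINT y|lborel. of_real (w t * heat t (x - y)) * \<phi> y)"
      unfolding integral_mult_right_zero[symmetric] by (simp add: mult.assoc)
    also have "\<dots> = (LINT y|lborel. LINT t|lborel. of_real (w t * heat t (x - y)) * \<phi> y)"
      using lborel_pair.Fubini_integral[OF int] by simp
    also have "\<dots> = (LINT y|lborel. of_real H * (\<phi> y * of_real (norm (x - y) powr d)))"
    proof (rule Bochner_Integration.integral_cong[OF refl])
      fix y
      show "(LINT t|lborel. of_real (w t * heat t (x - y)) * \<phi> y) = of_real H * (\<phi> y * of_real (norm (x - y) powr d))"
      proof (cases "\<phi> y = 0")
        case False
        show ?thesis unfolding integral_mult_left_zero integral_complex_of_real it(2)[OF False] by simp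
      qed simp
    qed
    also have "\<dots> = of_real H * (LINT y|lborel. \<phi> y * of_real (norm (x - y) powr d))" by (simp only: integral_mult_right_zero)
    finally show "integrable lborel (\<lambda>y. \<phi> y * of_real (norm (x - y) powr (- (real DIM('a) + 2 * \<gamma>)))) \<and>
      inv_fourier (\<lambda>\<xi>. of_real (norm \<xi> powr (2 * \<gamma>)) * fourier \<phi> \<xi>) x =
        of_real (H / m) * (LINT y|lborel. \<phi> y * of_real (norm (x - y) powr (- (real DIM('a) + 2 * \<gamma>))))"
      using i m unfolding d_def[symmetric] by (simp add: field_simps)
  qed
qed

text \<open>A convergent power series that vanishes at 0 and has a nonzero coefficient of positive
  index has an isolated zero there; the constant coefficient is E 0. Convergence for every z then
  carries the zero from a neighbourhood of 0 to the whole line.\<close>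

lemma powser_eq_zero:
  fixes c :: "nat \<Rightarrow> real"
  assumes s: "\<And>z. (\<lambda>j. c j * z ^ j) sums E z" and \<delta>: "\<delta> > 0" "\<And>z. \<bar>z\<bar> < \<delta> \<Longrightarrow> E z = 0"
  shows "E z = 0"
proof -
  have "c j = 0" for j
  proof (induction j rule: less_induct)
    case (less j)
    show ?case
    proof (rule ccontr)
      assume cj: "c j \<noteq> 0"
      show False
      proof (cases "j = 0")
        case True
        have "(\<lambda>j. c j * 0 ^ j) sums c 0" by (rule powser_sums_zero)
        then show False using s[of 0] \<delta>(2)[of 0] \<delta>(1) cj True sums_unique2 by fastforce
      next
        case False
        obtain t where t: "0 < t" "\<And>z. z \<in> cball 0 t - {0} \<Longrightarrow> E z \<noteq> 0"
        proof -
          have "(\<lambda>n. c n * (z - 0) ^ n) sums E z" for z using s by simp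
          moreover have "E 0 = 0" using \<delta> by simp
          ultimately show ?thesis using powser_0_nonzero[OF \<delta>(1), where a = c and \<xi> = 0 and f = E and m = j] cj False that by blast
        qed
        have "E (min t (\<delta> / 2)) \<noteq> 0" by (rule t(2)) (use t \<delta> in auto)
        then show False using \<delta> t by auto
      qed
    qed
  qed
  then show ?thesis using s[of z] by (simp add: sums_iff)
qed

section \<open>Unique continuation for the fractional Laplacian\<close>

lemma frac_laplacian_schwartz_nlap:
  assumes \<phi>: "\<phi> \<in> schwartz" and a: "a > 0"
  shows "frac_laplacian_schwartz a ((nlap ^^ k) \<phi>) = inv_fourier (\<lambda>\<xi>. of_real (norm \<xi> powr (2 * (a + real k))) * fourier \<phi> \<xi>)"
proof -
  have "norm \<xi> powr (2 * a) * norm \<xi> ^ (2 * k) = norm \<xi> powr (2 * (a + real k))" for \<xi> :: 'a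
  proof (cases "\<xi> = 0")
    case False
    then have "norm \<xi> ^ (2 * k) = norm \<xi> powr real (2 * k)" by (subst powr_realpow) auto
    then show ?thesis by (simp add: powr_add[symmetric] algebra_simps)
  qed simp
  then have "of_real (norm \<xi> powr (2 * a)) * (of_real (norm \<xi> ^ (2 * k)) * fourier \<phi> \<xi>) = of_real (norm \<xi> powr (2 * (a + real k))) * fourier \<phi> \<xi>" for \<xi>
    by (metis mult.assoc of_real_mult)
  then show ?thesis unfolding frac_laplacian_schwartz_def fourier_nlap_power(2)[OF \<phi>] by (simp only:)
qed

lemma frac_laplacian_schwartz_Lp:
  fixes \<phi> :: "'a::euclidean_space \<Rightarrow> complex"
  assumes p: "1 < p" and \<phi>: "\<phi> \<in> schwartz" and a: "a > 0"
  shows "frac_laplacian_schwartz a \<phi> \<in> borel_measurable borel" "integrable lborel (\<lambda>x. norm (frac_laplacian_schwartz a \<phi> x) powr p)"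
proof -
  interpret conjugate_exponents p "p / (p - 1)" by (rule conjugate_exponentsI[OF p])
  have e: "frac_laplacian_schwartz a \<phi> = frac_op a (bessel_pot (2 * a) \<phi>)"
    using frac_laplacian_schwartz_eq[OF \<phi>, of "2 * a"] a by simp
  note S = bessel_pot_schwartz[OF \<phi>, of "2 * a"]
  show "frac_laplacian_schwartz a \<phi> \<in> borel_measurable borel"
    unfolding e by (rule frac_op_measurable[OF a schwartz_measurable[OF S]])
  show "integrable lborel (\<lambda>x. norm (frac_laplacian_schwartz a \<phi> x) powr p)"
    unfolding e using p by (intro frac_op_integrable[OF a schwartz_measurable[OF S]] schwartz_powr_integrable[OF S]) simp
qed

text \<open>The exponent \<open>b\<close> will be negative, yet the exponential is flat at 0. The
  value at s = 0 is 0 since \<open>0 powr b = 0\<close>, so the formula is continuous up to the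
  endpoint, which corresponds to infinite distance.\<close>

lemma continuous_on_powr_exp:
  fixes b \<tau> :: real assumes \<tau>: "\<tau> > 0"
  shows "continuous_on {0..R} (\<lambda>s. s powr b * exp (- (\<tau> / s)))"
proof (rule continuous_on_eq_continuous_within[THEN iffD2], rule ballI)
  fix s :: real assume s: "s \<in> {0..R}"
  show "continuous (at s within {0..R}) (\<lambda>s. s powr b * exp (- (\<tau> / s)))"
  proof (cases "s = 0")
    case True
    have "((\<lambda>s. s powr b * exp (- (\<tau> / s))) \<longlongrightarrow> 0) (at_right 0)" using \<tau> by real_asymp
    then have "((\<lambda>s. s powr b * exp (- (\<tau> / s))) \<longlongrightarrow> 0) (at 0 within {0..R})"
    proof (rule tendsto_mono[rotated])
      show "at 0 within {0..R} \<le> at_right 0"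
        unfolding at_within_def by (intro inf_mono order_refl) auto
    qed
    then show ?thesis using True by (simp add: continuous_within)
  next
    case False
    then have "isCont (\<lambda>s. s powr b * exp (- (\<tau> / s))) s" using s by (intro continuous_intros) auto
    then show ?thesis by (rule continuous_at_imp_continuous_within)
  qed
qed

lemma ex_nat_between:
  fixes a :: real assumes "a > 0" "\<And>k::nat. a \<noteq> real k"
  obtains M :: nat where "real M < a" "a < real (Suc M)"
proof -
  have "real (nat \<lfloor>a\<rfloor>) \<le> a" "a < real (Suc (nat \<lfloor>a\<rfloor>))" using assms(1) by linarith+
  then show ?thesis using that[of "nat \<lfloor>a\<rfloor>"] assms(2)[of "nat \<lfloor>a\<rfloor>"] by auto
qed

text \<open>The potentials of \<open>v\<close> with kernels \<open>|x - y|\<^bsup>-n-2a-2k\<^esup>\<close> vanish for every \<open>k\<close>. These are the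
  moments in \<open>\<rho> = |x - y|\<^sup>-\<^sup>2\<close> of a finite measure living on a bounded range of \<open>\<rho>\<close>, so
  Weierstrass approximation replaces the powers of \<open>\<rho>\<close> by a Gaussian.\<close>

lemma gaussian_average_eq_zero:
  fixes v \<phi> :: "'a::euclidean_space \<Rightarrow> real"
  assumes ce: "conjugate_exponents p q" and a: "a > 0" "\<And>k::nat. a \<noteq> real k"
    and vm [measurable]: "v \<in> borel_measurable borel" and v: "integrable lborel (\<lambda>x. norm (v x) powr q)"
    and r: "r > 0" and v0: "\<And>x. norm (x - c) \<le> 2 * r \<Longrightarrow> v x = 0"
    and \<phi>: "\<phi> \<in> smooth_cball c r" and nn: "\<And>y. \<phi> y \<ge> 0"
    and H: "\<And>k. (LINT x|lborel. of_real (v x) * frac_laplacian_schwartz a (\<lambda>x. of_real ((nlap ^^ k) \<phi> x)) x) = 0"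
    and \<tau>: "\<tau> > 0"
  shows "integrable (lborel \<Otimes>\<^sub>M lborel) (\<lambda>(x, y). v x * \<phi> y * exp (- (\<tau> * (norm (x - y))\<^sup>2)))"
    and "(LINT z|(lborel \<Otimes>\<^sub>M lborel). (case z of (x, y) \<Rightarrow> v x * \<phi> y * exp (- (\<tau> * (norm (x - y))\<^sup>2)))) = 0"
proof -
  interpret conjugate_exponents p q by (rule ce)
  define \<Phi> where "\<Phi> x = complex_of_real (\<phi> x)" for x
  have \<Phi>: "\<Phi> \<in> smooth_cball c r" unfolding \<Phi>_def by (rule smooth_cball_linear[OF bounded_linear_of_real \<phi>])
  note \<Phi>S = smooth_cball_schwartz[OF \<Phi>]
  have \<phi>m [measurable]: "\<phi> \<in> borel_measurable borel"
    using \<phi> smooth_continuous_on unfolding smooth_cball_def by (intro borel_measurable_continuous_onI) blast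
  obtain M where M: "real M < a" "a < real (Suc M)" using ex_nat_between[OF a] .
  define d where "d k = - (real DIM('a) + 2 * (a + real k))" for k :: nat
  define P where "P k x = (LINT y|lborel. \<phi> y * norm (x - y) powr d k)" for k x
  have step: "integrable lborel (\<lambda>x. v x * P k x) \<and> (LINT x|lborel. v x * P k x) = 0 \<and>
      (\<forall>x. 2 * r \<le> norm (x - c) \<longrightarrow> integrable lborel (\<lambda>y. \<phi> y * norm (x - y) powr d k))" for k
  proof -
    \<comment> \<open>Adding k keeps the exponent strictly between consecutive integers, so
      \<open>frac_potential\<close> applies for every k.\<close>
    have \<gamma>: "real (M + k) < a + real k" "a + real k < real (Suc (M + k))" using M by auto
    obtain \<kappa> :: real where \<kappa>: "\<kappa> \<noteq> 0" and pot: "\<And>(\<phi> :: 'a \<Rightarrow> complex) c r x. \<phi> \<in> smooth_cball c r \<Longrightarrow> 0 < r \<Longrightarrow> 2 * r \<le> norm (x - c) \<Longrightarrow>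
      integrable lborel (\<lambda>y. \<phi> y * of_real (norm (x - y) powr d k)) \<and>
      inv_fourier (\<lambda>\<xi>. of_real (norm \<xi> powr (2 * (a + real k))) * fourier \<phi> \<xi>) x =
        of_real \<kappa> * (LINT y|lborel. \<phi> y * of_real (norm (x - y) powr d k))"
      using frac_potential[OF \<gamma>, where 'a = 'a] unfolding d_def by blast
    have i: "integrable lborel (\<lambda>y. \<phi> y * norm (x - y) powr d k)"
      and val: "inv_fourier (\<lambda>\<xi>. of_real (norm \<xi> powr (2 * (a + real k))) * fourier \<Phi> \<xi>) x = of_real (\<kappa> * P k x)" if x: "2 * r \<le> norm (x - c)" for x
    proof -
      have "integrable lborel (\<lambda>y. complex_of_real (\<phi> y * norm (x - y) powr d k))"
        using pot[OF \<Phi> r x] by (simp add: \<Phi>_def)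
      then show "integrable lborel (\<lambda>y. \<phi> y * norm (x - y) powr d k)" by (simp only: complex_of_real_integrable_eq)
      have "(LINT y|lborel. \<Phi> y * of_real (norm (x - y) powr d k)) = of_real (P k x)"
        unfolding P_def integral_complex_of_real[symmetric] by (simp add: \<Phi>_def)
      then show "inv_fourier (\<lambda>\<xi>. of_real (norm \<xi> powr (2 * (a + real k))) * fourier \<Phi> \<xi>) x = of_real (\<kappa> * P k x)"
        using pot[OF \<Phi> r x] by simp
    qed
    define F where "F = frac_laplacian_schwartz a ((nlap ^^ k) \<Phi>)"
    have e: "(\<lambda>x. of_real ((nlap ^^ k) \<phi> x)) = (nlap ^^ k) \<Phi>"
      unfolding \<Phi>_def[abs_def] by (rule nlap_power_of_real[OF \<phi>, symmetric])
    have vF: "of_real (v x) * F x = complex_of_real (\<kappa> * (v x * P k x))" for x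
    proof (cases "norm (x - c) \<le> 2 * r")
      case False
      then show ?thesis unfolding F_def frac_laplacian_schwartz_nlap[OF \<Phi>S a(1)] by (subst val) auto
    qed (simp add: v0)
    note S = fourier_nlap_power(1)[OF \<Phi>S, of k]
    note Fm [measurable] = frac_laplacian_schwartz_Lp(1)[OF p1 S a(1), folded F_def]
    have "integrable lborel (\<lambda>x. of_real (v x) * F x)"
      by (rule holder_integrable[OF _ _ _ frac_laplacian_schwartz_Lp(2)[OF p1 S a(1), folded F_def] v])
         (auto simp: norm_mult mult.commute)
    then have "integrable lborel (\<lambda>x. \<kappa> * (v x * P k x))" unfolding vF complex_of_real_integrable_eq .
    then have "integrable lborel (\<lambda>x. v x * P k x)" using \<kappa> by simp
    moreover have "(LINT x|lborel. v x * P k x) = 0"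
      using H[of k] \<kappa> unfolding e F_def[symmetric] vF integral_complex_of_real by simp
    ultimately show ?thesis using i by blast
  qed
  define E where "E k z = (case z of (x, y) \<Rightarrow> v x * (\<phi> y * norm (x - y) powr d k))" for k z
  have [measurable]: "E k \<in> borel_measurable (lborel \<Otimes>\<^sub>M lborel)" for k unfolding E_def[abs_def] by measurable
  define \<rho> where "\<rho> z = (case z of (x, y) \<Rightarrow> 1 / (norm (x - y))\<^sup>2)" for z :: "'a \<times> 'a"
  have [measurable]: "\<rho> \<in> borel_measurable (lborel \<Otimes>\<^sub>M lborel)" unfolding \<rho>_def[abs_def] by measurable
  \<comment> \<open>\<open>v\<close> vanishes within distance 2r of c and \<phi> beyond distance r,
    so the singularity of the kernel on the diagonal is never met.\<close>
  have supp: "r \<le> norm (x - y)" if "v x \<noteq> 0" "\<phi> y \<noteq> 0" for x y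
    using smooth_cball_distance[OF \<phi> _ that(2)] v0[of x] that(1) by fastforce
  \<comment> \<open>Since \<phi> \<ge> 0, the y-integral of the absolute value is |v x * P k x|,
    whose integrability comes from the pairing of L^q with L^p. A \<phi> of changing sign would not
    allow this identification.\<close>
  have Ei: "integrable (lborel \<Otimes>\<^sub>M lborel) (E k)" for k
  proof (rule lborel_pair.Fubini_integrable)
    show "AE x in lborel. integrable lborel (\<lambda>y. E k (x, y))"
    proof (rule AE_I2)
      fix x show "integrable lborel (\<lambda>y. E k (x, y))"
        using step[of k] v0[of x] unfolding E_def by (cases "norm (x - c) \<le> 2 * r") auto
    qed
    have "(LINT y|lborel. norm (E k (x, y))) = \<bar>v x * P k x\<bar>" for x
    proof -
      have "0 \<le> P k x" unfolding P_def using nn by (intro Bochner_Integration.integral_nonneg) auto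
      moreover have "(LINT y|lborel. norm (E k (x, y))) = \<bar>v x\<bar> * P k x"
        unfolding E_def P_def by (simp add: abs_mult nn)
      ultimately show ?thesis by (simp add: abs_mult)
    qed
    then show "integrable lborel (\<lambda>x. LINT y|lborel. norm (E k (x, y)))" using step[of k] by simp
  qed measurable
  have E0: "(LINT z|(lborel \<Otimes>\<^sub>M lborel). E k z) = 0" for k
    unfolding lborel_pair.integral_fst'[OF Ei, symmetric] using step[of k] by (simp add: E_def P_def)
  have Epow: "E 0 z * \<rho> z ^ k = E k z" for k z
  proof (cases z)
    case (Pair x y)
    show ?thesis
    proof (cases "v x = 0 \<or> \<phi> y = 0")
      case False
      then have n: "norm (x - y) > 0" using supp[of x y] r by linarith
      have "(1 / (norm (x - y))\<^sup>2) ^ k = 1 / norm (x - y) ^ (2 * k)" by (simp only: power_one_over power_mult)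
      also have "\<dots> = norm (x - y) powr - real (2 * k)" unfolding powr_minus_divide powr_realpow[OF n] ..
      also have "\<dots> = norm (x - y) powr (- 2 * real k)" by simp
      finally have "(1 / (norm (x - y))\<^sup>2) ^ k = norm (x - y) powr (- 2 * real k)" .
      then have "norm (x - y) powr d 0 * (1 / (norm (x - y))\<^sup>2) ^ k = norm (x - y) powr d k"
        by (simp add: powr_add[symmetric] d_def algebra_simps)
      then show ?thesis by (simp add: Pair E_def \<rho>_def mult.assoc)
    qed (auto simp: Pair E_def)
  qed
  have \<rho>: "\<rho> z \<in> {0..1 / r\<^sup>2}" if "E 0 z \<noteq> 0" for z
  proof (cases z)
    case (Pair x y)
    have "r \<le> norm (x - y)" using that supp[of x y] by (auto simp: Pair E_def)
    then have "r\<^sup>2 \<le> (norm (x - y))\<^sup>2" using r by (intro power_mono) auto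
    then show ?thesis using r by (simp add: Pair \<rho>_def frac_le)
  qed
  \<comment> \<open>At \<rho> = |x - y|^(-2) the power factor equals |x - y|^(-d 0) and cancels the
    kernel in \<open>E 0\<close>; what remains is the Gaussian.\<close>
  define G where "G s = s powr (d 0 / 2) * exp (- (\<tau> / s))" for s :: real
  have [measurable]: "G \<in> borel_measurable borel" unfolding G_def[abs_def] by measurable
  have Gc: "continuous_on {0..1 / r\<^sup>2} G" unfolding G_def[abs_def] by (rule continuous_on_powr_exp[OF \<tau>])
  have EG: "E 0 z * G (\<rho> z) = (case z of (x, y) \<Rightarrow> v x * \<phi> y * exp (- (\<tau> * (norm (x - y))\<^sup>2)))" for z
  proof (cases z)
    case (Pair x y)
    show ?thesis
    proof (cases "v x = 0 \<or> \<phi> y = 0")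
      case False
      then have n: "norm (x - y) > 0" using supp[of x y] r by linarith
      have "1 / (norm (x - y))\<^sup>2 = norm (x - y) powr (- 2)" using n by (simp add: powr_minus_divide powr_numeral)
      then have "(1 / (norm (x - y))\<^sup>2) powr (d 0 / 2) = norm (x - y) powr (- d 0)" by (simp add: powr_powr)
      then have "norm (x - y) powr d 0 * (1 / (norm (x - y))\<^sup>2) powr (d 0 / 2) = 1"
        using n by (simp add: powr_add[symmetric])
      then have "norm (x - y) powr d 0 * G (1 / (norm (x - y))\<^sup>2) = exp (- (\<tau> * (norm (x - y))\<^sup>2))"
        unfolding G_def by (metis (no_types, lifting) divide_divide_eq_right div_by_1 mult.assoc mult_1)
      then show ?thesis by (simp add: Pair E_def \<rho>_def mult.assoc)
    qed (auto simp: Pair E_def)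
  qed
  have "bounded (G ` {0..1 / r\<^sup>2})" by (intro compact_imp_bounded compact_continuous_image Gc) simp
  then obtain B where B: "\<forall>y\<in>G ` {0..1 / r\<^sup>2}. norm y \<le> B" unfolding bounded_iff by blast
  have EGi: "integrable (lborel \<Otimes>\<^sub>M lborel) (\<lambda>z. E 0 z * G (\<rho> z))"
  proof (rule integrable_le[OF integrable_mult_left[OF integrable_norm[OF Ei[of 0]], of B]])
    show "norm (E 0 z * G (\<rho> z)) \<le> norm (E 0 z) * B" for z
      using \<rho>[of z] B by (cases "E 0 z = 0") (auto simp: abs_mult intro!: mult_left_mono)
  qed measurable
  then show "integrable (lborel \<Otimes>\<^sub>M lborel) (\<lambda>(x, y). v x * \<phi> y * exp (- (\<tau> * (norm (x - y))\<^sup>2)))"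
    unfolding EG by (simp add: split_beta')
  have le: "norm (LINT z|(lborel \<Otimes>\<^sub>M lborel). E 0 z * G (\<rho> z)) \<le> e * (LINT z|(lborel \<Otimes>\<^sub>M lborel). norm (E 0 z))" if e: "e > 0" for e
  proof -
    obtain g where g: "real_polynomial_function g" "\<And>s. s \<in> {0..1 / r\<^sup>2} \<Longrightarrow> \<bar>G s - g s\<bar> < e"
      using Stone_Weierstrass_real_polynomial_function[OF _ Gc e] by auto
    obtain b N where gb: "g = (\<lambda>s. \<Sum>i\<le>N. b i * s ^ i)" using g(1) real_polynomial_function_iff_sum by blast
    have Eg: "E 0 z * g (\<rho> z) = (\<Sum>i\<le>N. b i * E i z)" for z
      unfolding gb sum_distrib_left by (intro sum.cong refl) (subst mult.left_commute, simp only: Epow)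
    have gi: "integrable (lborel \<Otimes>\<^sub>M lborel) (\<lambda>z. E 0 z * g (\<rho> z))" unfolding Eg using Ei by auto
    have g0: "(LINT z|(lborel \<Otimes>\<^sub>M lborel). E 0 z * g (\<rho> z)) = 0"
      unfolding Eg using Ei E0 by (subst Bochner_Integration.integral_sum) auto
    have bd: "norm (E 0 z * G (\<rho> z) - E 0 z * g (\<rho> z)) \<le> e * norm (E 0 z)" for z
    proof (cases "E 0 z = 0")
      case False
      then have "\<bar>G (\<rho> z) - g (\<rho> z)\<bar> \<le> e" using g(2)[OF \<rho>] by (simp add: less_imp_le)
      then show ?thesis unfolding right_diff_distrib[symmetric] norm_mult
        by (subst mult.commute) (auto intro!: mult_right_mono)
    qed simp
    have "(LINT z|(lborel \<Otimes>\<^sub>M lborel). E 0 z * G (\<rho> z)) = (LINT z|(lborel \<Otimes>\<^sub>M lborel). E 0 z * G (\<rho> z) - E 0 z * g (\<rho> z))"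
      using EGi gi g0 by simp
    also have "norm \<dots> \<le> (LINT z|(lborel \<Otimes>\<^sub>M lborel). e * norm (E 0 z))"
      by (rule order_trans[OF integral_norm_bound integral_mono[OF _ _ bd]])
         (intro integrable_norm Bochner_Integration.integrable_diff EGi gi integrable_mult_right Ei)+
    also have "\<dots> = e * (LINT z|(lborel \<Otimes>\<^sub>M lborel). norm (E 0 z))" by simp
    finally show ?thesis .
  qed
  define I where "I = (LINT z|(lborel \<Otimes>\<^sub>M lborel). norm (E 0 z))"
  have "((\<lambda>e. e * I) \<longlongrightarrow> 0 * I) (at_right 0)" by (intro tendsto_intros)
  then have "norm (LINT z|(lborel \<Otimes>\<^sub>M lborel). E 0 z * G (\<rho> z)) \<le> 0 * I"
    by (rule tendsto_lowerbound) (use le I_def in \<open>auto simp: eventually_at_filter\<close>)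
  then show "(LINT z|(lborel \<Otimes>\<^sub>M lborel). (case z of (x, y) \<Rightarrow> v x * \<phi> y * exp (- (\<tau> * (norm (x - y))\<^sup>2)))) = 0"
    unfolding EG by simp
qed

lemma (in conjugate_exponents) gaussian_mult_integrable:
  fixes v :: "'a::euclidean_space \<Rightarrow> real"
  assumes vm [measurable]: "v \<in> borel_measurable borel" and v: "integrable lborel (\<lambda>x. norm (v x) powr q)" and \<tau>: "\<tau> > 0"
  shows "integrable lborel (\<lambda>x. v x * exp (- (\<tau> * (norm (x - y))\<^sup>2)))"
proof -
  have "integrable lborel (\<lambda>x::'a. norm (complex_of_real (exp (- (\<tau> * (norm x)\<^sup>2)))) powr p)"
    using p1 by (intro schwartz_powr_integrable schwartz_gaussian \<tau>) simp
  from lborel_integrable_shift[OF this, of "- y"]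
  have g: "integrable lborel (\<lambda>x::'a. norm (exp (- (\<tau> * (norm (x - y))\<^sup>2))) powr p)" by simp
  show ?thesis by (rule holder_integrable[OF _ _ _ g v]) (auto simp: abs_mult)
qed

lemma exp_partial_sum_le:
  fixes t :: real
  assumes "finite I" "t \<ge> 0" shows "(\<Sum>i\<in>I. t ^ i /\<^sub>R fact i) \<le> exp t"
  unfolding exp_def using assms by (intro sum_le_suminf summable_exp_generic) auto

theorem frac_laplacian_unique_continuation:
  fixes v :: "'a::euclidean_space \<Rightarrow> real"
  assumes ce: "conjugate_exponents p q" and a: "a > 0" "\<And>k::nat. a \<noteq> real k"
    and vm [measurable]: "v \<in> borel_measurable borel" and v: "integrable lborel (\<lambda>x. norm (v x) powr q)"
    and U: "open U" "U \<noteq> {}" and v0: "\<And>x. x \<in> U \<Longrightarrow> v x = 0"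
    and H: "\<And>c r \<phi>. 0 < r \<Longrightarrow> cball c r \<subseteq> U \<Longrightarrow> \<phi> \<in> smooth_cball c r \<Longrightarrow>
      (LINT x|lborel. of_real (v x) * frac_laplacian_schwartz a (\<lambda>x. of_real (\<phi> x)) x) = 0"
  shows "AE x in lborel. v x = 0"
proof -
  interpret conjugate_exponents p q by (rule ce)
  \<comment> \<open>Up to a constant factor this is the heat evolution of \<open>v\<close> at time 1
    / (4\<tau>).\<close>
  define Y where "Y \<tau> y = (LINT x|lborel. v x * exp (- (\<tau> * (norm (x - y))\<^sup>2)))" for \<tau> y
  have Yc: "continuous_on UNIV (Y \<tau>)" if \<tau>: "\<tau> > 0" for \<tau>
    unfolding continuous_on_sequentially
  proof (intro allI ballI impI)
    fix y and u :: "nat \<Rightarrow> 'a" assume "(\<forall>n. u n \<in> UNIV) \<and> u \<longlonglongrightarrow> y"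
    then have u: "u \<longlonglongrightarrow> y" by simp
    then have "Bseq u" by (intro convergent_imp_Bseq convergentI)
    then obtain B where B: "\<And>n. norm (u n) \<le> B" unfolding Bseq_def by blast
    show "(Y \<tau> \<circ> u) \<longlonglongrightarrow> Y \<tau> y"
      unfolding Y_def comp_def
    proof (rule integral_dominated_convergence[where w = "\<lambda>x. exp (\<tau> * B\<^sup>2) * (norm (v x * exp (- ((\<tau> / 2) * (norm (x - 0))\<^sup>2))))"])
      show "integrable lborel (\<lambda>x. exp (\<tau> * B\<^sup>2) * (norm (v x * exp (- ((\<tau> / 2) * (norm (x - 0))\<^sup>2)))))"
        using \<tau> by (intro integrable_mult_right integrable_norm gaussian_mult_integrable vm v) simp
      show "AE x in lborel. (\<lambda>n. v x * exp (- (\<tau> * (norm (x - u n))\<^sup>2))) \<longlonglongrightarrow> v x * exp (- (\<tau> * (norm (x - y))\<^sup>2))"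
        by (intro AE_I2 tendsto_intros u)
      \<comment> \<open>From |x|^2 / 2 \<le> |x - u n|^2 + B^2, one Gaussian of half the rate
        dominates all translates along the bounded sequence.\<close>
      show "AE x in lborel. norm (v x * exp (- (\<tau> * (norm (x - u n))\<^sup>2))) \<le> exp (\<tau> * B\<^sup>2) * (norm (v x * exp (- ((\<tau> / 2) * (norm (x - 0))\<^sup>2))))" for n
      proof (rule AE_I2)
        fix x
        have "norm x \<le> norm (x - u n) + norm (u n)" using norm_triangle_ineq[of "x - u n" "u n"] by simp
        then have "(norm x)\<^sup>2 \<le> (norm (x - u n) + norm (u n))\<^sup>2" by (rule power_mono) simp
        also have "\<dots> \<le> 2 * (norm (x - u n))\<^sup>2 + 2 * (norm (u n))\<^sup>2"
          using zero_le_power2[of "norm (x - u n) - norm (u n)"] by (simp add: power2_sum power2_diff)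
        also have "(norm (u n))\<^sup>2 \<le> B\<^sup>2" using B by (intro power_mono) auto
        finally have "(norm x)\<^sup>2 / 2 \<le> (norm (x - u n))\<^sup>2 + B\<^sup>2" by simp
        from mult_left_mono[OF this, of \<tau>] \<tau>
        have "exp (- (\<tau> * (norm (x - u n))\<^sup>2)) \<le> exp (\<tau> * B\<^sup>2 + - ((\<tau> / 2) * (norm x)\<^sup>2))" by (simp add: algebra_simps)
        from mult_left_mono[OF this, of "\<bar>v x\<bar>"]
        show "norm (v x * exp (- (\<tau> * (norm (x - u n))\<^sup>2))) \<le> exp (\<tau> * B\<^sup>2) * (norm (v x * exp (- ((\<tau> / 2) * (norm (x - 0))\<^sup>2))))"
          unfolding exp_add by (simp add: abs_mult mult_ac)
      qed
    qed measurable
  qed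
  have YU: "Y \<tau> c = 0" if \<tau>: "\<tau> > 0" and c: "c \<in> U" for \<tau> c
  proof (rule ccontr)
    assume nz: "Y \<tau> c \<noteq> 0"
    obtain \<epsilon> where \<epsilon>: "\<epsilon> > 0" "cball c \<epsilon> \<subseteq> U" using U(1) c open_contains_cball by blast
    have "open {y. 0 < Y \<tau> y * Y \<tau> c}" by (intro open_Collect_less continuous_intros Yc[OF \<tau>])
    moreover have "c \<in> {y. 0 < Y \<tau> y * Y \<tau> c}" using nz by (simp add: zero_less_mult_iff) linarith
    ultimately obtain \<delta> where \<delta>: "\<delta> > 0" "cball c \<delta> \<subseteq> {y. 0 < Y \<tau> y * Y \<tau> c}" using open_contains_cball by blast
    \<comment> \<open>\<open>v\<close> has to vanish on the ball of radius 2r, while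
      \<open>Y \<tau>\<close> has to keep its sign on the ball of radius r.\<close>
    define r where "r = min (\<epsilon> / 2) \<delta>"
    have r: "r > 0" "2 * r \<le> \<epsilon>" "r \<le> \<delta>" using \<epsilon> \<delta> by (auto simp: r_def)
    obtain \<phi> :: "'a \<Rightarrow> real" where \<phi>: "\<phi> \<in> smooth_cball c r" "\<And>x. \<phi> x \<ge> 0" "\<And>x. norm (x - c) < r \<Longrightarrow> \<phi> x > 0"
      using ex_bump[OF r(1)] by blast
    have \<phi>m [measurable]: "\<phi> \<in> borel_measurable borel"
      using \<phi> smooth_continuous_on unfolding smooth_cball_def by (intro borel_measurable_continuous_onI) blast
    have vc: "v x = 0" if "norm (x - c) \<le> 2 * r" for x
      using that r \<epsilon> by (intro v0) (auto simp: dist_norm norm_minus_commute)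
    have Hk: "(LINT x|lborel. of_real (v x) * frac_laplacian_schwartz a (\<lambda>x. of_real ((nlap ^^ k) \<phi> x)) x) = 0" for k
    proof (rule H[OF r(1) _ smooth_cball_nlap_power[OF \<phi>(1)]])
      show "cball c r \<subseteq> U" using \<epsilon>(2) r by (intro subset_trans[OF _ \<epsilon>(2)]) (auto simp: subset_cball)
    qed
    note g = gaussian_average_eq_zero[OF ce a vm v r(1) vc \<phi>(1,2) Hk \<tau>]
    have i: "integrable lborel (\<lambda>y. \<phi> y * Y \<tau> y)" and z: "(LINT y|lborel. \<phi> y * Y \<tau> y) = 0"
    proof -
      have e: "(LINT x|lborel. v x * \<phi> y * exp (- (\<tau> * (norm (x - y))\<^sup>2))) = \<phi> y * Y \<tau> y" for y
        unfolding Y_def integral_mult_right_zero[symmetric] by (simp add: mult_ac)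
      show "integrable lborel (\<lambda>y. \<phi> y * Y \<tau> y)" using lborel_pair.integrable_snd[OF g(1)] unfolding e .
      show "(LINT y|lborel. \<phi> y * Y \<tau> y) = 0" using lborel_pair.integral_snd[OF g(1)] g(2) unfolding e by simp
    qed
    \<comment> \<open>The constant factor \<open>Y \<tau> c\<close> normalises the sign: f is
      nonnegative and positive on the open ball, although its integral is zero.\<close>
    define f where "f y = \<phi> y * Y \<tau> y * Y \<tau> c" for y
    have fn: "f y \<ge> 0" for y
    proof (cases "norm (y - c) \<le> r")
      case True
      then have "y \<in> cball c \<delta>" using r(3) by (simp add: dist_norm norm_minus_commute)
      then have "0 < Y \<tau> y * Y \<tau> c" using \<delta>(2) by blast
      then show ?thesis using \<phi>(2)[of y] unfolding f_def by (simp add: mult.assoc)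
    next
      case False
      then have "\<phi> y = 0" using \<phi>(1) by (simp add: smooth_cball_def)
      then show ?thesis by (simp add: f_def)
    qed
    have fp: "f y > 0" if "y \<in> ball c r" for y
    proof -
      have "norm (y - c) < r" using that by (simp add: dist_norm norm_minus_commute)
      moreover have "y \<in> cball c \<delta>" using r(3) that by simp
      then have "0 < Y \<tau> y * Y \<tau> c" using \<delta>(2) by blast
      ultimately show ?thesis using \<phi>(3)[of y] unfolding f_def by (simp add: mult.assoc)
    qed
    have "integrable lborel f" "integral\<^sup>L lborel f = 0" unfolding f_def[abs_def] using i z by auto
    then have "AE y in lborel. f y = 0" using fn by (subst (asm) integral_nonneg_eq_0_iff_AE) auto
    then have "AE y in lborel. y \<notin> ball c r" by eventually_elim (use fp in force)
    then have "ball c r \<in> null_sets lborel" by (subst AE_iff_null_sets) auto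
    then have "ball c r \<in> null_sets lebesgue" by (rule null_sets_completionI)
    then have "negligible (ball c r)" by (simp add: negligible_iff_null_sets)
    then show False using open_not_negligible[of "ball c r"] r by auto
  qed
  obtain c where c: "c \<in> U" using U(2) by blast
  obtain \<epsilon> where \<epsilon>: "\<epsilon> > 0" "ball c \<epsilon> \<subseteq> U" using U(1) c open_contains_ball by blast
  have Y0: "Y \<tau> y = 0" if \<tau>: "\<tau> > 0" for \<tau> y
  proof -
    define h where "h = y - c"
    \<comment> \<open>The average along the line c + z h. Completing the square leaves z in an
      exponential that is linear in x - c, so that E has an everywhere convergent power series in
      z.\<close>
    define E where "E z = (LINT x|lborel. v x * exp (- (\<tau> * (norm (x - c))\<^sup>2)) * exp (z * (2 * \<tau> * ((x - c) \<bullet> h))))" for z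
    have EY: "E z = exp (\<tau> * z\<^sup>2 * (norm h)\<^sup>2) * Y \<tau> (c + z *\<^sub>R h)" for z
    proof -
      have "exp (- (\<tau> * (norm (x - c))\<^sup>2)) * exp (z * (2 * \<tau> * ((x - c) \<bullet> h))) = exp (\<tau> * z\<^sup>2 * (norm h)\<^sup>2) * exp (- (\<tau> * (norm (x - (c + z *\<^sub>R h)))\<^sup>2))" for x
      proof -
        have n: "(norm (x - (c + z *\<^sub>R h)))\<^sup>2 = (norm (x - c))\<^sup>2 - 2 * z * ((x - c) \<bullet> h) + z\<^sup>2 * (norm h)\<^sup>2"
          unfolding power2_norm_eq_inner by (simp add: inner_diff_left inner_diff_right inner_add_left inner_add_right inner_commute power2_eq_square algebra_simps)
        have "- (\<tau> * (norm (x - c))\<^sup>2) + z * (2 * \<tau> * ((x - c) \<bullet> h)) = \<tau> * z\<^sup>2 * (norm h)\<^sup>2 + - (\<tau> * (norm (x - (c + z *\<^sub>R h)))\<^sup>2)"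
          unfolding n by (simp add: algebra_simps)
        then show ?thesis unfolding mult_exp_exp by (simp only:)
      qed
      then show ?thesis unfolding E_def Y_def integral_mult_right_zero[symmetric] by (simp add: mult_ac)
    qed
    define cf where "cf j = (LINT x|lborel. v x * exp (- (\<tau> * (norm (x - c))\<^sup>2)) * ((2 * \<tau> * ((x - c) \<bullet> h)) ^ j / fact j))" for j :: nat
    \<comment> \<open>Half of the Gaussian absorbs the exponential of linear growth: (s - 2b)^2
      \<ge> 0 gives 2 s b \<le> s^2 / 2 + 2 b^2.\<close>
    have dom: "integrable lborel (\<lambda>x. \<bar>v x\<bar> * exp (- (\<tau> * (norm (x - c))\<^sup>2)) * exp (\<bar>z\<bar> * (2 * \<tau> * (norm (x - c) * norm h))))" for z
    proof (rule integrable_le)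
      show "integrable lborel (\<lambda>x. exp (2 * \<tau> * (\<bar>z\<bar> * norm h)\<^sup>2) * \<bar>v x * exp (- ((\<tau> / 2) * (norm (x - c))\<^sup>2))\<bar>)"
        using \<tau> by (intro integrable_mult_right integrable_abs gaussian_mult_integrable vm v) simp
      show "norm (\<bar>v x\<bar> * exp (- (\<tau> * (norm (x - c))\<^sup>2)) * exp (\<bar>z\<bar> * (2 * \<tau> * (norm (x - c) * norm h)))) \<le> exp (2 * \<tau> * (\<bar>z\<bar> * norm h)\<^sup>2) * \<bar>v x * exp (- ((\<tau> / 2) * (norm (x - c))\<^sup>2))\<bar>" for x
      proof -
        define s b where "s = norm (x - c)" and "b = \<bar>z\<bar> * norm h"
        have "0 \<le> \<tau> * (s - 2 * b)\<^sup>2" using \<tau> by simp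
        then have "- (\<tau> * s\<^sup>2) + 2 * \<tau> * (s * b) \<le> 2 * \<tau> * b\<^sup>2 + - ((\<tau> / 2) * s\<^sup>2)"
          by (simp add: power2_diff power_mult_distrib algebra_simps)
        then have "exp (- (\<tau> * s\<^sup>2)) * exp (\<bar>z\<bar> * (2 * \<tau> * (s * norm h))) \<le> exp (2 * \<tau> * b\<^sup>2) * exp (- ((\<tau> / 2) * s\<^sup>2))"
          unfolding mult_exp_exp by (simp add: b_def mult_ac)
        from mult_left_mono[OF this, of "\<bar>v x\<bar>"] show ?thesis unfolding s_def b_def by (simp add: abs_mult mult_ac)
      qed
    qed measurable
    have b1: "\<bar>z * (2 * \<tau> * ((x - c) \<bullet> h))\<bar> \<le> \<bar>z\<bar> * (2 * \<tau> * (norm (x - c) * norm h))" for z x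
    proof -
      have "\<bar>z * (2 * \<tau> * ((x - c) \<bullet> h))\<bar> = \<bar>z\<bar> * (2 * \<tau> * \<bar>(x - c) \<bullet> h\<bar>)" using \<tau> by (simp add: abs_mult)
      also have "\<dots> \<le> \<bar>z\<bar> * (2 * \<tau> * (norm (x - c) * norm h))"
        using \<tau> by (intro mult_left_mono Cauchy_Schwarz_ineq2) auto
      finally show ?thesis .
    qed
    define S where "S N t = (\<Sum>j<N. t ^ j / fact j)" for N and t :: real
    have Sconv: "(\<lambda>N. S N t) \<longlonglongrightarrow> exp t" for t
      using exp_converges[of t] unfolding S_def sums_def by (simp add: divide_inverse mult.commute)
    have Sle: "\<bar>S N t\<bar> \<le> exp \<bar>t\<bar>" for N t
    proof -
      have "\<bar>S N t\<bar> \<le> (\<Sum>j<N. \<bar>t\<bar> ^ j /\<^sub>R fact j)"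
        unfolding S_def by (rule order_trans[OF sum_abs]) (simp add: abs_mult power_abs divide_inverse mult.commute)
      also have "\<dots> \<le> exp \<bar>t\<bar>"
        by (rule exp_partial_sum_le) auto
      finally show ?thesis .
    qed
    have ij: "integrable lborel (\<lambda>x. v x * exp (- (\<tau> * (norm (x - c))\<^sup>2)) * ((2 * \<tau> * ((x - c) \<bullet> h)) ^ j / fact j))" for j
    proof (rule integrable_le[OF dom[of 1]])
      show "norm (v x * exp (- (\<tau> * (norm (x - c))\<^sup>2)) * ((2 * \<tau> * ((x - c) \<bullet> h)) ^ j / fact j)) \<le> \<bar>v x\<bar> * exp (- (\<tau> * (norm (x - c))\<^sup>2)) * exp (\<bar>1\<bar> * (2 * \<tau> * (norm (x - c) * norm h)))" for x
      proof -
        define t where "t = 2 * \<tau> * ((x - c) \<bullet> h)"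
        have "\<bar>t ^ j / fact j\<bar> = (\<Sum>i\<in>{j}. \<bar>t\<bar> ^ i /\<^sub>R fact i)" by (simp add: abs_mult power_abs divide_inverse mult.commute)
        also have "\<dots> \<le> exp \<bar>t\<bar>"
          by (rule exp_partial_sum_le) auto
        also have "\<dots> \<le> exp (\<bar>1\<bar> * (2 * \<tau> * (norm (x - c) * norm h)))" using b1[of 1 x] by (simp add: t_def)
        finally have "\<bar>t ^ j / fact j\<bar> \<le> exp (\<bar>1\<bar> * (2 * \<tau> * (norm (x - c) * norm h)))" .
        then show ?thesis unfolding t_def[symmetric] real_norm_def abs_mult abs_exp_cancel by (intro mult_left_mono) auto
      qed
    qed measurable
    have sums: "(\<lambda>j. cf j * z ^ j) sums E z" for z
    proof -
      have "(\<lambda>N. LINT x|lborel. v x * exp (- (\<tau> * (norm (x - c))\<^sup>2)) * S N (z * (2 * \<tau> * ((x - c) \<bullet> h)))) \<longlonglongrightarrow> E z"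
        unfolding E_def
      proof (rule integral_dominated_convergence[OF _ _ dom[of z]])
        show "AE x in lborel. (\<lambda>N. v x * exp (- (\<tau> * (norm (x - c))\<^sup>2)) * S N (z * (2 * \<tau> * ((x - c) \<bullet> h)))) \<longlonglongrightarrow> v x * exp (- (\<tau> * (norm (x - c))\<^sup>2)) * exp (z * (2 * \<tau> * ((x - c) \<bullet> h)))"
          by (intro AE_I2 tendsto_intros Sconv)
        show "AE x in lborel. norm (v x * exp (- (\<tau> * (norm (x - c))\<^sup>2)) * S N (z * (2 * \<tau> * ((x - c) \<bullet> h)))) \<le> \<bar>v x\<bar> * exp (- (\<tau> * (norm (x - c))\<^sup>2)) * exp (\<bar>z\<bar> * (2 * \<tau> * (norm (x - c) * norm h)))" for N
        proof (rule AE_I2)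
          fix x
          have "\<bar>S N (z * (2 * \<tau> * ((x - c) \<bullet> h)))\<bar> \<le> exp (\<bar>z\<bar> * (2 * \<tau> * (norm (x - c) * norm h)))"
            by (rule order_trans[OF Sle]) (use b1[of z x] in simp)
          then show "norm (v x * exp (- (\<tau> * (norm (x - c))\<^sup>2)) * S N (z * (2 * \<tau> * ((x - c) \<bullet> h)))) \<le> \<bar>v x\<bar> * exp (- (\<tau> * (norm (x - c))\<^sup>2)) * exp (\<bar>z\<bar> * (2 * \<tau> * (norm (x - c) * norm h)))"
            unfolding real_norm_def abs_mult abs_exp_cancel by (intro mult_left_mono) auto
        qed
      qed (auto simp: S_def)
      moreover have "(LINT x|lborel. v x * exp (- (\<tau> * (norm (x - c))\<^sup>2)) * S N (z * (2 * \<tau> * ((x - c) \<bullet> h)))) = (\<Sum>j<N. cf j * z ^ j)" for N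
      proof -
        have "v x * exp (- (\<tau> * (norm (x - c))\<^sup>2)) * S N (z * (2 * \<tau> * ((x - c) \<bullet> h))) = (\<Sum>j<N. (v x * exp (- (\<tau> * (norm (x - c))\<^sup>2)) * ((2 * \<tau> * ((x - c) \<bullet> h)) ^ j / fact j)) * z ^ j)" for x
          unfolding S_def sum_distrib_left power_mult_distrib by (intro sum.cong refl) simp
        then show ?thesis
          unfolding cf_def using ij by (simp only: integral_mult_left_zero Bochner_Integration.integral_sum integrable_mult_left)
      qed
      ultimately show ?thesis unfolding sums_def by simp
    qed
    \<comment> \<open>The value z = 1 is the point y itself. For small z the point c + z h lies in
      U, where the average is already known to vanish; the summand 1 in the radius covers h =
      0.\<close>
    have "E 1 = 0"
    proof (rule powser_eq_zero[OF sums])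
      show "0 < \<epsilon> / (norm h + 1)" using \<epsilon> by (simp add: add_nonneg_pos)
      fix z assume z: "\<bar>z\<bar> < \<epsilon> / (norm h + 1)"
      have n: "norm h + 1 > 0" by (simp add: add_nonneg_pos)
      have "\<bar>z\<bar> * norm h \<le> \<bar>z\<bar> * (norm h + 1)" by (intro mult_left_mono) auto
      also have "\<dots> < \<epsilon>" using z n by (simp add: pos_less_divide_eq)
      finally have "c + z *\<^sub>R h \<in> U" using \<epsilon>(2) by (auto simp: dist_norm)
      then show "E z = 0" unfolding EY by (simp add: YU[OF \<tau>])
    qed
    then show ?thesis unfolding EY by (simp add: h_def)
  qed
  define vc where "vc x = complex_of_real (v x)" for x
  have vcm [measurable]: "vc \<in> borel_measurable borel" unfolding vc_def[abs_def] by measurable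
  have vci: "integrable lborel (\<lambda>x. norm (vc x) powr q)" using v by (simp add: vc_def)
  have swap: "conjugate_exponents q p" by (rule conjugate_exponents_swap[OF ce])
  have "AE x in lborel. vc x = 0"
  proof (rule conjugate_exponents.Lp_eq_zeroI[OF swap vcm vci])
    fix h :: "'a \<Rightarrow> complex" and R t :: real assume h: "continuous_on UNIV h" "\<And>x. R < norm x \<Longrightarrow> h x = 0" and t: "t > 0"
    have hm [measurable]: "h \<in> borel_measurable borel" by (rule borel_measurable_continuous_onI[OF h(1)])
    obtain B where B: "\<And>x. norm (h x) \<le> B" using continuous_bounded_support[OF h] by blast
    have hp: "integrable lborel (\<lambda>x. norm (h x) powr p)"
    proof (rule integrable_le)
      have "bounded (cball 0 R :: 'a set)" by simp
      show "integrable lborel (\<lambda>x::'a. B powr p * indicat_real (cball 0 R) x)"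
        by (intro integrable_mult_right integrable_real_indicator) (auto simp: emeasure_bounded_finite[OF bounded_cball, simplified])
      show "norm (norm (h x) powr p) \<le> B powr p * indicat_real (cball 0 R) x" for x
        using h(2)[of x] B[of x] p0 by (cases "norm x \<le> R") (auto intro!: powr_mono2)
    qed measurable
    have K: "integrable lborel (heat t :: 'a \<Rightarrow> real)" by (rule heat_integrable[OF t])
    have e: "(LINT y|lborel. of_real (heat t (x - y)) * h y) = conv (heat t) h x" for x
      unfolding conv_def using lborel_integral_reflect[of "\<lambda>y. of_real (heat t (x - y)) * h y" x] by simp
    \<comment> \<open>The heat kernel is moved by \<open>conv_duality\<close> from the test function
      to \<open>v\<close>, where smoothing at time t gives a multiple of \<open>Y\<close> at \<tau>
      = 1 / (4t).\<close>
    have "conv (heat t) vc y = 0" for y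
    proof -
      have "conv (heat t) vc y = (LINT x|lborel. of_real (heat t (y - x)) * vc x)"
        unfolding conv_def using lborel_integral_reflect[of "\<lambda>x. of_real (heat t (y - x)) * vc x" y] by simp
      also have "\<dots> = (LINT x|lborel. complex_of_real (1 / sqrt (4 * pi * t) ^ DIM('a) * (v x * exp (- (1 / (4 * t) * (norm (x - y))\<^sup>2)))))"
        by (intro Bochner_Integration.integral_cong refl) (simp add: vc_def heat_def norm_minus_commute)
      also have "\<dots> = of_real (1 / sqrt (4 * pi * t) ^ DIM('a) * Y (1 / (4 * t)) y)"
        unfolding integral_complex_of_real integral_mult_right_zero Y_def ..
      finally show ?thesis using Y0[of "1 / (4 * t)" y] t by simp
    qed
    then have "(LINT x|lborel. conv (heat t) h x * vc x) = 0"
      using conv_duality[OF ce K heat_minus hm vcm hp vci] by simp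
    then show "(LINT x|lborel. vc x * (LINT y|lborel. of_real (heat t (x - y)) * h y)) = 0"
      unfolding e by (simp add: mult.commute)
  qed
  then show ?thesis by eventually_elim (simp add: vc_def)
qed

section \<open>Flux densities and the unique continuation theorem\<close>

lemma norm_powr_le_sum:
  fixes w :: "real ^ 'm"
  assumes p: "1 < p" and le: "\<And>i. \<bar>w $ i\<bar> \<le> g i"
  shows "norm w powr p \<le> real CARD('m) powr p * (\<Sum>i\<in>UNIV. g i powr p)"
proof -
  obtain j where j: "\<And>i. g i \<le> g j"
  proof -
    have "Max (range g) \<in> range g" by (rule Max_in) auto
    then obtain j where "g j = Max (range g)" by force
    then show ?thesis using that[of j] by simp
  qed
  have g0: "0 \<le> g i" for i using le[of i] by linarith
  have "norm w \<le> (\<Sum>i\<in>UNIV. \<bar>w $ i\<bar>)" by (rule norm_le_l1_cart)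
  also have "\<dots> \<le> (\<Sum>i\<in>(UNIV :: 'm set). g j)" by (intro sum_mono order_trans[OF le j])
  also have "\<dots> = real CARD('m) * g j" by simp
  finally have "norm w powr p \<le> (real CARD('m) * g j) powr p" using p by (intro powr_mono2) auto
  also have "\<dots> = real CARD('m) powr p * g j powr p" using g0 by (simp add: powr_mult)
  also have "g j powr p \<le> (\<Sum>i\<in>UNIV. g i powr p)" by (rule member_le_sum) auto
  finally show ?thesis by (simp add: mult_left_mono)
qed

section \<open>Borel representatives of the fractional Laplacian and of the flux\<close>

lemma borel_measurable_matrix_vector_mult [measurable (raw)]:
  fixes A :: "'a \<Rightarrow> real ^ 'n ^ 'm"
  assumes "A \<in> borel_measurable M" "w \<in> borel_measurable M"
  shows "(\<lambda>x. A x *v w x) \<in> borel_measurable M"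
  using assms by (rule borel_measurable_continuous_Pair) (unfold matrix_vector_mult_def, intro continuous_intros)

lemma borel_measurable_vec_nth [measurable (raw)]:
  fixes f :: "'a \<Rightarrow> real ^ 'n"
  assumes "f \<in> borel_measurable M" shows "(\<lambda>x. f x $ i) \<in> borel_measurable M"
  using borel_measurable_inner[OF assms borel_measurable_const[of "axis i 1"]] by (simp add: inner_axis)

lemma borel_measurable_vec_lambda:
  fixes f :: "'n::finite \<Rightarrow> 'a \<Rightarrow> real"
  assumes "\<And>i. f i \<in> borel_measurable M" shows "(\<lambda>x. \<chi> i. f i x) \<in> borel_measurable M"
  by (subst borel_measurable_euclidean_space) (auto simp: Basis_vec_def inner_axis assms)

text \<open>\<open>frac_laplacian\<close> returns a chosen representative. It is replaced by the
  Borel function computed from \<open>frac_op\<close>, componentwise and with the real part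
  taken.\<close>

lemma frac_laplacian_borel:
  fixes u :: "'a::euclidean_space functional ^ 'm"
  assumes p: "1 < p" and s: "0 < s" and u: "u \<in> bessel_space_vec s p" and f: "\<And>i. bessel_rep s p (u $ i) (f i)"
  obtains w where "w \<in> borel_measurable borel" "AE x in lebesgue. frac_laplacian (s / 2) p u x = w x"
    "\<And>i. AE x in lebesgue. of_real (w x $ i) = frac_op (s / 2) (f i) x"
    "integrable lborel (\<lambda>x. norm (w x) powr p)"
proof -
  define w where "w x = (\<chi> i. Re (frac_op (s / 2) (f i) x))" for x
  note f' = f[unfolded bessel_rep_def]
  have s2: "s / 2 > 0" using s by simp
  have fm [measurable]: "frac_op (s / 2) (f i) \<in> borel_measurable borel" for i
    using f' by (intro frac_op_measurable[OF s2]) blast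
  interpret conjugate_exponents p "p / (p - 1)" by (rule conjugate_exponentsI[OF p])
  note ae = frac_laplacian_AE(1)[OF p s u f]
  have wm [measurable]: "w \<in> borel_measurable borel"
    unfolding w_def[abs_def] by (rule borel_measurable_vec_lambda) measurable
  moreover have fl: "AE x in lebesgue. \<forall>i. of_real (frac_laplacian (s / 2) p u x $ i) = frac_op (s / 2) (f i) x"
    using ae by (subst AE_all_countable) auto
  then have "AE x in lebesgue. frac_laplacian (s / 2) p u x = w x"
    by eventually_elim (simp add: w_def vec_eq_iff, metis Re_complex_of_real)
  moreover have "AE x in lebesgue. of_real (w x $ i) = frac_op (s / 2) (f i) x" for i
    using ae[of i] by eventually_elim (metis Re_complex_of_real vec_lambda_beta w_def)
  moreover have "integrable lborel (\<lambda>x. norm (w x) powr p)"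
  proof (rule integrable_le)
    show "integrable lborel (\<lambda>x. real CARD('m) powr p * (\<Sum>i\<in>UNIV. norm (frac_op (s / 2) (f i) x) powr p))"
      using f' by (intro integrable_mult_right Bochner_Integration.integrable_sum frac_op_integrable[OF s2]) auto
    show "norm (norm (w x) powr p) \<le> real CARD('m) powr p * (\<Sum>i\<in>UNIV. norm (frac_op (s / 2) (f i) x) powr p)" for x
      using norm_powr_le_sum[OF p, of "w x" "\<lambda>i. norm (frac_op (s / 2) (f i) x)"] by (simp add: w_def abs_Re_le_cmod)
  qed measurable
  ultimately show ?thesis using that by blast
qed

text \<open>Writing |A^(1/2) w| as the square root of (A w) \<bullet> w makes the flux Borel in x
  without measurability of the matrix square root. Its norm is at most L^p |w|^(p-1), and raising to
  the power p / (p - 1) gives a multiple of |w|^p.\<close>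

lemma p_flux_borel:
  fixes A :: "'a::euclidean_space \<Rightarrow> real ^ 'm ^ 'm"
  assumes p: "1 < p" and A: "A \<in> S_plus" and w [measurable]: "w \<in> borel_measurable borel"
    and ae: "AE x in lebesgue. frac_laplacian (s / 2) p u x = w x"
    and i: "integrable lborel (\<lambda>x. norm (w x) powr p)"
  obtains V where "V \<in> borel_measurable borel" "AE x in lebesgue. p_flux s p A u x = V x"
    "integrable lborel (\<lambda>x. norm (V x) powr (p / (p - 1)))"
proof -
  obtain l L where l: "0 < l" "l < L" and b: "AE x in lebesgue. \<forall>v. l\<^sup>2 * (norm v)\<^sup>2 \<le> (A x *v v) \<bullet> v \<and> (A x *v v) \<bullet> v \<le> L\<^sup>2 * (norm v)\<^sup>2"
    and spd: "AE x in lebesgue. sym_pos_def (A x)" and Am: "A \<in> borel_measurable lebesgue"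
    using A unfolding S_plus_def by blast
  obtain A0 where A0 [measurable]: "A0 \<in> borel_measurable borel" and A0e: "AE x in lebesgue. A x = A0 x"
    using lebesgue_ex_borel[OF Am] .
  define V where "V x = sqrt ((A0 x *v w x) \<bullet> w x) powr (p - 2) *\<^sub>R (A0 x *v w x)" for x
  have Vm [measurable]: "V \<in> borel_measurable borel" unfolding V_def[abs_def] by measurable
  moreover have e: "AE x in lebesgue. p_flux s p A u x = V x \<and> norm (V x) \<le> L powr p * norm (w x) powr (p - 1)"
    using ae b spd A0e
  proof eventually_elim
    case (elim x)
    have sym: "transpose (A x) = A x" and b1: "\<And>v. l\<^sup>2 * (norm v)\<^sup>2 \<le> (A x *v v) \<bullet> v" and b2: "\<And>v. (A x *v v) \<bullet> v \<le> L\<^sup>2 * (norm v)\<^sup>2"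
      using elim unfolding sym_pos_def_def by auto
    note M = norm_matrix_sqrt[OF sym l b1 b2] flux_norm_le[OF sym l b1 b2 p]
    have "p_flux s p A u x = flux p (A x) (w x)" unfolding p_flux_def flux_def Let_def elim(1) ..
    moreover have "flux p (A x) (w x) = V x" unfolding flux_def V_def M(1) by (simp add: elim(4))
    ultimately show ?case using M(2)[of "w x"] by simp
  qed
  moreover have "integrable lborel (\<lambda>x. norm (V x) powr (p / (p - 1)))"
  proof -
    have "AE x in lborel. norm (V x) \<le> L powr p * norm (w x) powr (p - 1)"
      by (rule AE_completion_iff[THEN iffD1]) (use e in auto)
    then have "AE x in lborel. norm (norm (V x) powr (p / (p - 1))) \<le> norm ((L powr p) powr (p / (p - 1)) * norm (w x) powr p)"
    proof eventually_elim
      case (elim x)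
      then have "norm (V x) powr (p / (p - 1)) \<le> (L powr p * norm (w x) powr (p - 1)) powr (p / (p - 1))"
        using p by (intro powr_mono2) auto
      also have "\<dots> = (L powr p) powr (p / (p - 1)) * norm (w x) powr p" using p by (simp add: powr_mult powr_powr)
      finally show ?case by simp
    qed
    then show ?thesis by (intro Bochner_Integration.integrable_bound[OF integrable_mult_right[OF i]]) measurable
  qed
  moreover have "AE x in lebesgue. p_flux s p A u x = V x" using e by eventually_elim simp
  ultimately show ?thesis using that by blast
qed

text \<open>A scalar test function placed in one coordinate direction: its fractional Laplacian
  points in that direction, so the pairing with a flux sees one component only. Reality of G is read
  off from the real-valued representative.\<close>

lemma frac_laplacian_test_function:
  fixes \<phi> :: "'a::euclidean_space \<Rightarrow> real" and i :: "'m::finite"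
  assumes p: "1 < p" and s: "0 < s" and \<phi>: "\<phi> \<in> smooth_cball c r"
  defines "G \<equiv> frac_laplacian_schwartz (s / 2) (\<lambda>x. of_real (\<phi> x))"
  shows "AE x in lebesgue. frac_laplacian (s / 2) p (distr_of_vec (\<lambda>x. \<phi> x *\<^sub>R axis i 1)) x = Re (G x) *\<^sub>R (axis i 1 :: real ^ 'm)"
    and "AE x in lebesgue. G x = of_real (Re (G x))"
proof -
  define \<Phi> where "\<Phi> k x = complex_of_real ((\<phi> x *\<^sub>R (axis i 1 :: real ^ 'm)) $ k)" for k x
  have "bounded_linear (\<lambda>t. complex_of_real ((t *\<^sub>R (axis i 1 :: real ^ 'm)) $ k))" for k
    by (intro bounded_linear_of_real[THEN bounded_linear_compose] bounded_linear_vec_nth[THEN bounded_linear_compose] bounded_linear_scaleR_left)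
  then have S: "\<Phi> k \<in> schwartz" for k
    unfolding \<Phi>_def[abs_def] by (rule smooth_cball_schwartz[OF smooth_cball_linear[OF _ \<phi>]])
  define u :: "'a functional ^ 'm" where "u = distr_of_vec (\<lambda>x. \<phi> x *\<^sub>R axis i 1)"
  have uk: "u $ k = distr_of (\<Phi> k)" for k by (simp add: u_def distr_of_vec_def \<Phi>_def[abs_def])
  have rep: "bessel_rep s p (u $ k) (bessel_pot s (\<Phi> k))" for k unfolding uk by (rule bessel_rep_distr_of[OF p S])
  have "Defs.real_distribution (u $ k)" for k
    unfolding uk Defs.real_distribution_def distr_of_def
    by (auto simp: schwartz_cnj \<Phi>_def simp del: Bochner_Integration.integral_cnj simp flip: Bochner_Integration.integral_cnj)
  then have u: "u \<in> bessel_space_vec s p" using rep bessel_space_iff_rep unfolding bessel_space_vec_def by blast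
  have op: "frac_op (s / 2) (bessel_pot s (\<Phi> k)) = (if k = i then G else (\<lambda>x. 0))" for k
  proof (cases "k = i")
    case True
    then have "\<Phi> k = (\<lambda>x. of_real (\<phi> x))" by (simp add: \<Phi>_def fun_eq_iff)
    then show ?thesis using frac_laplacian_schwartz_eq[OF S[of k] s] True by (simp add: G_def)
  next
    case False
    then have "\<Phi> k = (\<lambda>x. 0)" by (simp add: \<Phi>_def fun_eq_iff axis_def)
    then show ?thesis
      using frac_laplacian_schwartz_eq[OF S[of k] s] False
      by (simp add: frac_laplacian_schwartz_def fourier_def inv_fourier_def[abs_def])
  qed
  have ae: "AE x in lebesgue. \<forall>k. complex_of_real (frac_laplacian (s / 2) p u x $ k) = (if k = i then G x else 0)"
  proof (subst AE_all_countable, rule allI)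
    fix k
    show "AE x in lebesgue. complex_of_real (frac_laplacian (s / 2) p u x $ k) = (if k = i then G x else 0)"
      using frac_laplacian_AE(1)[OF p s u rep, of k] unfolding op by (cases "k = i") auto
  qed
  then show "AE x in lebesgue. frac_laplacian (s / 2) p (distr_of_vec (\<lambda>x. \<phi> x *\<^sub>R axis i 1)) x = Re (G x) *\<^sub>R (axis i 1 :: real ^ 'm)"
    unfolding u_def[symmetric]
  proof eventually_elim
    case (elim x)
    have "frac_laplacian (s / 2) p u x $ k = Re (if k = i then G x else 0)" for k
      using elim[rule_format, of k] by (metis Re_complex_of_real)
    then show ?case by (simp add: vec_eq_iff axis_def)
  qed
  show "AE x in lebesgue. G x = of_real (Re (G x))"
    using ae
  proof eventually_elim
    case (elim x)
    have "G x = complex_of_real (frac_laplacian (s / 2) p u x $ i)" using elim[rule_format, of i] by simp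
    then show ?case by simp
  qed
qed

theorem theorem2p3:
  fixes p s :: real
    and A :: "real ^ 'n \<Rightarrow> real ^ 'm ^ 'm"
    and \<Omega> :: "(real ^ 'n) set"
    and u1 u2 :: "(real ^ 'n) functional ^ 'm"
    and v1 v2 :: "real ^ 'n \<Rightarrow> real ^ 'm"
  assumes "1 < p"
    and "0 < s" and "\<nexists>k::nat. s = 2 * real k"
    and "A \<in> S_plus"
    and "open \<Omega>" and "\<Omega> \<noteq> {}"
    and "u1 \<in> bessel_space_vec s p" and "u2 \<in> bessel_space_vec s p"
    and "v1 = p_flux s p A u1" and "v2 = p_flux s p A u2"
    and "\<And>\<phi>. \<phi> \<in> test_functions \<Omega> \<Longrightarrow>
           p_biharmonic s p A u1 (distr_of_vec \<phi>) = p_biharmonic s p A u2 (distr_of_vec \<phi>)"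
    and "AE x in lebesgue. x \<in> \<Omega> \<longrightarrow> v1 x = v2 x"
  shows "u1 = u2"
proof -
  note p = \<open>1 < p\<close> and s = \<open>0 < s\<close> and A = \<open>A \<in> S_plus\<close>
  define a q where "a = s / 2" and "q = p / (p - 1)"
  \<comment> \<open>The assumption that s is not an even natural number says that s / 2 is not a
    natural number.\<close>
  have a: "a > 0" "\<And>k::nat. a \<noteq> real k" using assms(2,3) by (auto simp: a_def field_simps)
  have ce: "conjugate_exponents p q" unfolding q_def by (rule conjugate_exponentsI[OF p])
  interpret conjugate_exponents p q by (rule ce)
  have "\<exists>f. \<forall>i. bessel_rep s p (u $ i) (f i)" if "u \<in> bessel_space_vec s p" for u :: "(real ^ 'n) functional ^ 'm"
    using that unfolding bessel_space_vec_def bessel_space_iff_rep by (auto intro: choice)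
  then obtain f1 f2 where f1: "\<And>i. bessel_rep s p (u1 $ i) (f1 i)" and f2: "\<And>i. bessel_rep s p (u2 $ i) (f2 i)"
    using assms(7,8) by meson
  obtain w1 where w1: "w1 \<in> borel_measurable borel" "AE x in lebesgue. frac_laplacian (s / 2) p u1 x = w1 x"
    "\<And>i. AE x in lebesgue. of_real (w1 x $ i) = frac_op (s / 2) (f1 i) x" "integrable lborel (\<lambda>x. norm (w1 x) powr p)"
    by (rule frac_laplacian_borel[OF p s assms(7) f1]) blast
  obtain w2 where w2: "w2 \<in> borel_measurable borel" "AE x in lebesgue. frac_laplacian (s / 2) p u2 x = w2 x"
    "\<And>i. AE x in lebesgue. of_real (w2 x $ i) = frac_op (s / 2) (f2 i) x" "integrable lborel (\<lambda>x. norm (w2 x) powr p)"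
    by (rule frac_laplacian_borel[OF p s assms(8) f2]) blast
  obtain V1 where V1 [measurable]: "V1 \<in> borel_measurable borel" and V1e: "AE x in lebesgue. p_flux s p A u1 x = V1 x"
    and V1i: "integrable lborel (\<lambda>x. norm (V1 x) powr q)"
    using p_flux_borel[OF p A w1(1,2,4)] unfolding q_def .
  obtain V2 where V2 [measurable]: "V2 \<in> borel_measurable borel" and V2e: "AE x in lebesgue. p_flux s p A u2 x = V2 x"
    and V2i: "integrable lborel (\<lambda>x. norm (V2 x) powr q)"
    using p_flux_borel[OF p A w2(1,2,4)] unfolding q_def .
  have [measurable]: "\<Omega> \<in> sets borel" using assms(5) by simp
  have V0: "AE x in lborel. x \<in> \<Omega> \<longrightarrow> V1 x - V2 x = 0"
  proof (rule AE_completion_iff[THEN iffD1])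
    show "AE x in lebesgue. x \<in> \<Omega> \<longrightarrow> V1 x - V2 x = 0"
      using assms(12) V1e V2e unfolding assms(9,10) by eventually_elim auto
  qed
  have Vi: "AE x in lborel. V1 x $ i - V2 x $ i = 0" for i
  proof -
    \<comment> \<open>The fluxes agree only almost everywhere on \<Omega>; the difference is set to
      0 there because unique continuation is stated for a function vanishing at every point of the
      open set.\<close>
    define v where "v x = (if x \<in> \<Omega> then 0 else (V1 x - V2 x) $ i)" for x
    have vm [measurable]: "v \<in> borel_measurable borel" unfolding v_def[abs_def] by measurable
    have ve: "AE x in lborel. v x = V1 x $ i - V2 x $ i" using V0 by eventually_elim (auto simp: v_def)
    have d: "integrable lborel (\<lambda>x. norm (V1 x - V2 x) powr q)"
      using conjugate_exponents_swap[OF ce] V1i V2i by (intro integrable_powr_diff) (auto dest: conjugate_exponents.p1)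
    have vi: "integrable lborel (\<lambda>x. norm (v x) powr q)"
    proof (rule integrable_le[OF d])
      have "\<bar>v x\<bar> \<le> norm (V1 x - V2 x)" for x
        using component_le_norm_cart[of "V1 x - V2 x" i] by (auto simp: v_def)
      then show "norm (norm (v x) powr q) \<le> norm (V1 x - V2 x) powr q" for x
        using q0 by (auto intro!: powr_mono2)
    qed measurable
    have "AE x in lborel. v x = 0"
    proof (rule frac_laplacian_unique_continuation[OF ce a vm vi assms(5,6)])
      fix c r and \<phi> :: "real ^ 'n \<Rightarrow> real" assume r: "0 < r" "cball c r \<subseteq> \<Omega>" and \<phi>: "\<phi> \<in> smooth_cball c r"
      define G where "G = frac_laplacian_schwartz a (\<lambda>x. of_real (\<phi> x))"
      define g where "g x = Re (G x)" for x
      have \<Phi>S: "(\<lambda>x. complex_of_real (\<phi> x)) \<in> schwartz"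
        by (rule smooth_cball_schwartz[OF smooth_cball_linear[OF bounded_linear_of_real \<phi>]])
      note GL = frac_laplacian_schwartz_Lp[OF p \<Phi>S a(1), folded G_def]
      have [measurable]: "G \<in> borel_measurable borel" by (rule GL)
      have [measurable]: "g \<in> borel_measurable borel" unfolding g_def[abs_def] by measurable
      have gi: "integrable lborel (\<lambda>x. norm (g x) powr p)"
        by (rule integrable_le[OF GL(2)]) (use p in \<open>auto simp: g_def abs_Re_le_cmod intro!: powr_mono2\<close>)
      define \<psi> where "\<psi> = distr_of_vec (\<lambda>x. \<phi> x *\<^sub>R (axis i 1 :: real ^ 'm))"
      note fl = frac_laplacian_test_function(1)[OF p s \<phi>, of i, folded a_def, folded G_def g_def \<psi>_def]
        frac_laplacian_test_function(2)[OF p s \<phi>, folded a_def, folded G_def g_def]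
      \<comment> \<open>Testing in the i-th coordinate direction isolates the i-th component of the
        difference of the fluxes.\<close>
      have "(\<lambda>x. \<phi> x *\<^sub>R (axis i 1 :: real ^ 'm)) \<in> test_functions \<Omega>"
        by (intro smooth_cball_test_function[OF _ r(2)] smooth_cball_linear[OF _ \<phi>] bounded_linear_scaleR_left)
      from assms(11)[OF this]
      have bi: "p_biharmonic s p A u1 \<psi> = p_biharmonic s p A u2 \<psi>" by (simp add: \<psi>_def)
      have pb: "p_biharmonic s p A u \<psi> = (LINT x|lborel. V x $ i * g x)"
        if [measurable]: "V \<in> borel_measurable borel" and V: "AE x in lebesgue. p_flux s p A u x = V x" for u V
      proof -
        have e: "AE x in lebesgue. p_flux s p A u x \<bullet> frac_laplacian (s / 2) p \<psi> x = V x $ i * g x"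
          using V fl(1) by eventually_elim (simp add: a_def inner_axis mult.commute)
        have m: "(\<lambda>x. V x $ i * g x) \<in> borel_measurable borel" by measurable
        \<comment> \<open>The integrand involves values of the choice operator. It equals a Borel
          function almost everywhere, and this implies measurability because the measure is
          complete.\<close>
        have "(\<lambda>x. p_flux s p A u x \<bullet> frac_laplacian (s / 2) p \<psi> x) \<in> borel_measurable lebesgue"
          by (rule borel_measurable_AE[OF borel_imp_lebesgue_measurable[OF m]]) (use e in \<open>eventually_elim, simp\<close>)
        from lebesgue_integral_AE_eq[OF this m e, of "\<lambda>x. x"] show ?thesis unfolding p_biharmonic_def by simp
      qed
      have ii: "integrable lborel (\<lambda>x. V x $ i * g x)"
        if [measurable]: "V \<in> borel_measurable borel" and V: "integrable lborel (\<lambda>x. norm (V x) powr q)" for V :: "real ^ 'n \<Rightarrow> real ^ 'm"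
        by (rule holder_integrable[OF _ _ _ gi V])
           (auto simp: abs_mult mult.commute[of "\<bar>g _\<bar>"] component_le_norm_cart intro!: mult_right_mono)
      have "(LINT x|lborel. v x * g x) = (LINT x|lborel. V1 x $ i * g x - V2 x $ i * g x)"
      proof (rule integral_cong_AE)
        show "AE x in lborel. v x * g x = V1 x $ i * g x - V2 x $ i * g x"
          using ve by eventually_elim (simp add: left_diff_distrib)
      qed measurable
      also have "\<dots> = 0" using bi pb[OF V1 V1e] pb[OF V2 V2e] ii[OF V1 V1i] ii[OF V2 V2i] by simp
      finally have z: "(LINT x|lborel. v x * g x) = 0" .
      have "AE x in lborel. G x = of_real (g x)"
        by (rule AE_completion_iff[THEN iffD1]) (use fl(2) in auto)
      then have "(LINT x|lborel. of_real (v x) * G x) = (LINT x|lborel. complex_of_real (v x * g x))"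
        by (intro integral_cong_AE) auto
      then show "(LINT x|lborel. of_real (v x) * frac_laplacian_schwartz a (\<lambda>x. of_real (\<phi> x)) x) = 0"
        unfolding G_def[symmetric] integral_complex_of_real z by simp
    qed (simp add: v_def)
    then show ?thesis using ve by eventually_elim simp
  qed
  have "AE x in lborel. \<forall>i. V1 x $ i - V2 x $ i = 0" using Vi by (subst AE_all_countable) auto
  then have Ve: "AE x in lebesgue. V1 x = V2 x" by (intro AE_completion) (auto simp: vec_eq_iff)
  obtain l L where l: "0 < l" "l < L" and b: "AE x in lebesgue. \<forall>v. l\<^sup>2 * (norm v)\<^sup>2 \<le> (A x *v v) \<bullet> v \<and> (A x *v v) \<bullet> v \<le> L\<^sup>2 * (norm v)\<^sup>2"
    and spd: "AE x in lebesgue. sym_pos_def (A x)"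
    using A unfolding S_plus_def by blast
  have We: "AE x in lebesgue. w1 x = w2 x"
    using w1(2) w2(2) V1e V2e Ve b spd
  proof eventually_elim
    case (elim x)
    have sym: "transpose (A x) = A x" and b1: "\<And>v. l\<^sup>2 * (norm v)\<^sup>2 \<le> (A x *v v) \<bullet> v" and b2: "\<And>v. (A x *v v) \<bullet> v \<le> L\<^sup>2 * (norm v)\<^sup>2"
      using elim unfolding sym_pos_def_def by auto
    have "flux p (A x) (w1 x) = flux p (A x) (w2 x)"
      using elim(3,4,5) unfolding p_flux_def Let_def elim(1,2) flux_def by simp
    then show ?case by (rule flux_inj[OF sym l b1 b2 p])
  qed
  have "u1 $ i = u2 $ i" for i
  proof -
    note F = f1[of i, unfolded bessel_rep_def] f2[of i, unfolded bessel_rep_def]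
    have [measurable]: "f1 i \<in> borel_measurable borel" "f2 i \<in> borel_measurable borel" using F by auto
    have [measurable]: "frac_op a (f1 i) \<in> borel_measurable borel" "frac_op a (f2 i) \<in> borel_measurable borel"
      by (rule frac_op_measurable[OF a(1)], measurable)+
    have "AE x in lborel. frac_op a (f1 i) x = frac_op a (f2 i) x"
    proof (rule AE_completion_iff[THEN iffD1])
      show "AE x in lebesgue. frac_op a (f1 i) x = frac_op a (f2 i) x"
        using We w1(3)[of i] w2(3)[of i] by eventually_elim (simp add: a_def)
    qed
    moreover have "AE x in lborel. frac_op a (\<lambda>x. f1 i x - f2 i x) x = frac_op a (f1 i) x - frac_op a (f2 i) x"
      using F by (intro frac_op_diff[OF a(1)]) auto
    ultimately have z: "AE x in lborel. frac_op a (\<lambda>x. f1 i x - f2 i x) x = 0" by eventually_elim simp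
    have "integrable lborel (\<lambda>x. norm (f1 i x - f2 i x) powr p)" using F p by (intro integrable_powr_diff) auto
    from frac_op_eq_zero[OF a(1) _ this z] have "AE x in lborel. f1 i x - f2 i x = 0" by simp
    then have "AE x in lebesgue. f1 i x = f2 i x" by (intro AE_completion) auto
    then have "distr_of (f1 i) = distr_of (f2 i)" by (intro distr_of_cong_AE borel_imp_lebesgue_measurable) auto
    then have "bessel_operator s (u1 $ i) = bessel_operator s (u2 $ i)" using F by simp
    from bessel_operator_inj[OF _ _ this] show ?thesis using F by simp
  qed
  then show ?thesis by (simp add: vec_eq_iff)
qed

end
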